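(* Let $n$ be a positive integer. The following diagrams of categories and functors commute (up to natural isomorphism): (a) $j_*\circ c_*\cong t_*$ as functors ${}_{\mathfrak{S}_n}\mathscr{V}\to\mathscr{C}_n$; (b) $j_!\circ c_!\cong t_!$ as functors ${}_{\mathfrak{S}_n}\mathscr{V}\to\mathscr{C}_n$; (c) $c^*\circ j^*\cong t^*$ as functors $\mathscr{C}_n\to{}_{\mathfrak{S}_n}\mathscr{V}$; moreover $\mathscr{C}_n^{\mathsf Y}$ is contained in $\mathscr{C}_n^0$, compatibly with the inclusions $i_*:\mathscr{C}_n^{\mathsf Y}\to\mathscr{C}_n$ and $r_*:\mathscr{C}_n^0\to\mathscr{C}_n$, and $j^*$ restricts to a functor $\mathscr{C}_n^0\to\mathscr{P}_n^0$ compatible with the inclusions $r_*$ and $d_*:\mathscr{P}_n^0\to\mathscr{P}_n$.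
   Context: $\mathbb{K}$ is a field of positive characteristic; $\mathscr{V}$ is the category of finite-dimensional $\mathbb{K}$-vector spaces, $W^\vee$ the dual of $W$; ${}_{\mathfrak{S}_n}\mathscr{V}$ is the category of finite-dimensional representations of the symmetric group $\mathfrak{S}_n$. For $M\in{}_{\mathfrak{S}_n}\mathscr{V}$, $\mathbf h_M=\mathrm{Hom}_{\mathfrak{S}_n}(M,-)$ and $\mathbf t_M=M\otimes_{\mathfrak{S}_n}(-)$ (coinvariants of the tensor product). A $\mathbb{K}$-linear functor $\mathbf f:{}_{\mathfrak{S}_n}\mathscr{V}\to\mathscr{V}$ is coherent if there is an exact sequence $\mathbf h_N\to\mathbf h_M\to\mathbf f\to0$; $\mathscr{C}_n$ is the abelian category of coherent functors. Functors between $\mathscr{C}_n$ and ${}_{\mathfrak{S}_n}\mathscr{V}$: $t^*(\mathbf f)=\mathbf f(\mathbb{K}[\mathfrak{S}_n])$ (with $\mathfrak{S}_n$ acting through automorphisms of the module $\mathbb{K}[\mathfrak{S}_n]$), $t_*(M)=\mathbf h_{M^\vee}$, $t_!(M)=\mathbf t_M$. $\mathscr{C}_n^0$ is the full subcategory of $\mathscr{C}_n$ of the $\mathbf f$ with $t^*(\mathbf f)=0$, with inclusion $r_*$. $\mathscr{C}_n^{\mathsf Y}$ is the full subcategory of the $\mathbf f\in\mathscr{C}_n$ with $\mathbf f(\mathbb{K}[\mathfrak{S}_n/\mathfrak{S}_\lambda])=0$ for all partitions $\lambda$ of $n$ ($\mathfrak{S}_\lambda$ the Young subgroup), with inclusion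 $i_*$. $\Gamma^n\mathscr{V}$ is the category with the same objects as $\mathscr{V}$ and $\mathrm{Hom}_{\Gamma^n\mathscr{V}}(V,W)=(\mathrm{Hom}(V,W)^{\otimes n})^{\mathfrak{S}_n}\cong\mathrm{Hom}_{\mathfrak{S}_n}(V^{\otimes n},W^{\otimes n})$; $\mathscr{P}_n$ is the category of $\mathbb{K}$-linear functors $\Gamma^n\mathscr{V}\to\mathscr{V}$; $T^n\in\mathscr{P}_n$ is $V\mapsto V^{\otimes n}$. Functors between $\mathscr{P}_n$ and ${}_{\mathfrak{S}_n}\mathscr{V}$: $c^*(F)=\mathrm{Hom}_{\mathscr{P}_n}(T^n,F)$ with the $\mathfrak{S}_n$-action induced by permuting the factors of $T^n$, with left adjoint $c_!(M)(V)=(M\otimes V^{\otimes n})_{\mathfrak{S}_n}$ and right adjoint $c_*(M)(V)=(M\otimes V^{\otimes n})^{\mathfrak{S}_n}$. $\mathscr{P}_n^0$ is the full subcategory of the $F$ with $c^*(F)=0$, with inclusion $d_*$. Functors between $\mathscr{C}_n$ and $\mathscr{P}_n$: $j^*(\mathbf f)(V)=\mathbf f(V^{\otimes n})$, with left adjoint $j_!$ and right adjoint $j_*:\mathscr{P}_n\to\mathscr{C}_n$. *)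

theory Defs
  imports "HOL-Algebra.Sym_Groups" "HOL-Algebra.Left_Coset" "HOL-Algebra.AbelCoset"
    "Jordan_Normal_Form.Missing_VectorSpace"
begin

section \<open>Linear categories, functors, natural isomorphisms, adjunctions\<close>

text \<open>
  Morphisms do not carry their source and target, so composition and the action of a functor on
  morphisms take the objects as arguments. The field \<open>Mor\<close> gives the hom-set together with its
  vector space structure; \<open>Cmp C X Y Z g f\<close> is the composite of \<open>f : X \<rightarrow> Y\<close> and \<open>g : Y \<rightarrow> Z\<close>.
\<close>

record ('k, 'o, 'm) lincat =
  Ob :: "'o set"
  Mor :: "'o \<Rightarrow> 'o \<Rightarrow> ('k, 'm) module"
  Id :: "'o \<Rightarrow> 'm"
  Cmp :: "'o \<Rightarrow> 'o \<Rightarrow> 'o \<Rightarrow> 'm \<Rightarrow> 'm \<Rightarrow> 'm"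

abbreviation arr :: "('k, 'o, 'm) lincat \<Rightarrow> 'o \<Rightarrow> 'o \<Rightarrow> 'm set" where
  "arr C X Y \<equiv> carrier (Mor C X Y)"

locale lincategory =
  fixes K :: "('k, 'z) ring_scheme" and C :: "('k, 'o, 'm) lincat"
  assumes Mor_vs: "\<lbrakk>X \<in> Ob C; Y \<in> Ob C\<rbrakk> \<Longrightarrow> vectorspace K (Mor C X Y)"
    and Id_arr: "X \<in> Ob C \<Longrightarrow> Id C X \<in> arr C X X"
    and Cmp_linear_left: "\<lbrakk>X \<in> Ob C; Y \<in> Ob C; Z \<in> Ob C; g \<in> arr C Y Z\<rbrakk> \<Longrightarrow>
      (\<lambda>f. Cmp C X Y Z g f) \<in> module_hom K (Mor C X Y) (Mor C X Z)"
    and Cmp_linear_right: "\<lbrakk>X \<in> Ob C; Y \<in> Ob C; Z \<in> Ob C; f \<in> arr C X Y\<rbrakk> \<Longrightarrow>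
      (\<lambda>g. Cmp C X Y Z g f) \<in> module_hom K (Mor C Y Z) (Mor C X Z)"
    and Cmp_assoc: "\<lbrakk>W \<in> Ob C; X \<in> Ob C; Y \<in> Ob C; Z \<in> Ob C;
      f \<in> arr C W X; g \<in> arr C X Y; h \<in> arr C Y Z\<rbrakk> \<Longrightarrow>
      Cmp C W Y Z h (Cmp C W X Y g f) = Cmp C W X Z (Cmp C X Y Z h g) f"
    and Id_left: "\<lbrakk>X \<in> Ob C; Y \<in> Ob C; f \<in> arr C X Y\<rbrakk> \<Longrightarrow> Cmp C X Y Y (Id C Y) f = f"
    and Id_right: "\<lbrakk>X \<in> Ob C; Y \<in> Ob C; f \<in> arr C X Y\<rbrakk> \<Longrightarrow> Cmp C X X Y f (Id C X) = f"

record ('o, 'm, 'p, 'q) fctr =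
  omap :: "'o \<Rightarrow> 'p"
  mmap :: "'o \<Rightarrow> 'o \<Rightarrow> 'm \<Rightarrow> 'q"

locale is_functor = source: lincategory K C + target: lincategory K D
  for K :: "('k, 'z) ring_scheme" and C :: "('k, 'o, 'm) lincat"
    and D :: "('k, 'p, 'q) lincat" +
  fixes F :: "('o, 'm, 'p, 'q) fctr"
  assumes omap_Ob: "X \<in> Ob C \<Longrightarrow> omap F X \<in> Ob D"
    and mmap_arr: "\<lbrakk>X \<in> Ob C; Y \<in> Ob C; f \<in> arr C X Y\<rbrakk> \<Longrightarrow>
      mmap F X Y f \<in> arr D (omap F X) (omap F Y)"
    and mmap_Id: "X \<in> Ob C \<Longrightarrow> mmap F X X (Id C X) = Id D (omap F X)"
    and mmap_Cmp: "\<lbrakk>X \<in> Ob C; Y \<in> Ob C; Z \<in> Ob C; f \<in> arr C X Y; g \<in> arr C Y Z\<rbrakk> \<Longrightarrow>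
      mmap F X Z (Cmp C X Y Z g f) =
        Cmp D (omap F X) (omap F Y) (omap F Z) (mmap F Y Z g) (mmap F X Y f)"

locale is_linear_functor = is_functor +
  assumes mmap_linear: "\<lbrakk>X \<in> Ob C; Y \<in> Ob C\<rbrakk> \<Longrightarrow>
    mmap F X Y \<in> module_hom K (Mor C X Y) (Mor D (omap F X) (omap F Y))"

definition incl :: "('o, 'm, 'o, 'm) fctr" where
  "incl = \<lparr>omap = (\<lambda>X. X), mmap = (\<lambda>X Y f. f)\<rparr>"

definition cmp_fctr ::
  "('p, 'q, 'r, 's) fctr \<Rightarrow> ('o, 'm, 'p, 'q) fctr \<Rightarrow> ('o, 'm, 'r, 's) fctr" where
  "cmp_fctr G F = \<lparr>omap = (\<lambda>X. omap G (omap F X)),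
     mmap = (\<lambda>X Y f. mmap G (omap F X) (omap F Y) (mmap F X Y f))\<rparr>"

definition full_subcat :: "('k, 'o, 'm) lincat \<Rightarrow> ('o \<Rightarrow> bool) \<Rightarrow> ('k, 'o, 'm) lincat" where
  "full_subcat C P = C\<lparr>Ob := {X \<in> Ob C. P X}\<rparr>"

definition nat_trans :: "('k, 'o, 'm) lincat \<Rightarrow> ('k, 'p, 'q) lincat \<Rightarrow>
    ('o, 'm, 'p, 'q) fctr \<Rightarrow> ('o, 'm, 'p, 'q) fctr \<Rightarrow> ('o \<Rightarrow> 'q) set" where
  "nat_trans C D F G = {\<eta> \<in> (\<Pi>\<^sub>E X\<in>Ob C. arr D (omap F X) (omap G X)).
     \<forall>X\<in>Ob C. \<forall>Y\<in>Ob C. \<forall>f\<in>arr C X Y.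
       Cmp D (omap F X) (omap F Y) (omap G Y) (\<eta> Y) (mmap F X Y f) =
       Cmp D (omap F X) (omap G X) (omap G Y) (mmap G X Y f) (\<eta> X)}"

definition is_iso :: "('k, 'o, 'm) lincat \<Rightarrow> 'o \<Rightarrow> 'o \<Rightarrow> 'm \<Rightarrow> bool" where
  "is_iso C X Y f \<longleftrightarrow> f \<in> arr C X Y \<and>
     (\<exists>g\<in>arr C Y X. Cmp C X Y X g f = Id C X \<and> Cmp C Y X Y f g = Id C Y)"

definition naturally_isomorphic :: "('k, 'z) ring_scheme \<Rightarrow> ('k, 'o, 'm) lincat \<Rightarrow>
    ('k, 'p, 'q) lincat \<Rightarrow> ('o, 'm, 'p, 'q) fctr \<Rightarrow> ('o, 'm, 'p, 'q) fctr \<Rightarrow> bool" where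
  "naturally_isomorphic K C D F G \<longleftrightarrow> is_functor K C D F \<and> is_functor K C D G \<and>
     (\<exists>\<eta>\<in>nat_trans C D F G. \<forall>X\<in>Ob C. is_iso D (omap F X) (omap G X) (\<eta> X))"

text \<open>The triangle formed by \<open>F : A \<rightarrow> B\<close>, \<open>G : B \<rightarrow> C\<close>, \<open>H : A \<rightarrow> C\<close> commutes up to isomorphism.\<close>

definition triangle_commutes where
  "triangle_commutes K A B C F G H \<longleftrightarrow>
     is_functor K A B F \<and> is_functor K B C G \<and> naturally_isomorphic K A C (cmp_fctr G F) H"

text \<open>\<open>L : C \<rightarrow> D\<close> is left adjoint to \<open>R : D \<rightarrow> C\<close>.\<close>

definition adjoint_functors :: "('k, 'z) ring_scheme \<Rightarrow> ('k, 'o, 'm) lincat \<Rightarrow>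
    ('k, 'p, 'q) lincat \<Rightarrow> ('o, 'm, 'p, 'q) fctr \<Rightarrow> ('p, 'q, 'o, 'm) fctr \<Rightarrow> bool" where
  "adjoint_functors K C D L R \<longleftrightarrow> is_functor K C D L \<and> is_functor K D C R \<and>
     (\<exists>\<Phi>.
       (\<forall>X\<in>Ob C. \<forall>Y\<in>Ob D.
          bij_betw (\<Phi> X Y) (arr D (omap L X) Y) (arr C X (omap R Y))) \<and>
       (\<forall>X'\<in>Ob C. \<forall>X\<in>Ob C. \<forall>Y\<in>Ob D. \<forall>Y'\<in>Ob D.
        \<forall>f\<in>arr C X' X. \<forall>u\<in>arr D (omap L X) Y. \<forall>g\<in>arr D Y Y'.
          \<Phi> X' Y' (Cmp D (omap L X') Y Y' g (Cmp D (omap L X') (omap L X) Y u (mmap L X' X f))) =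
          Cmp C X' (omap R Y) (omap R Y') (mmap R Y Y' g) (Cmp C X' X (omap R Y) (\<Phi> X Y u) f)))"

definition functor_cat :: "('k, 'z) ring_scheme \<Rightarrow> ('k, 'o, 'm) lincat \<Rightarrow> ('k, 'p, 'q) lincat \<Rightarrow>
    ('k, ('o, 'm, 'p, 'q) fctr, 'o \<Rightarrow> 'q) lincat" where
  "functor_cat K C D = \<lparr>
     Ob = {F. is_linear_functor K C D F},
     Mor = (\<lambda>F G. \<lparr>carrier = nat_trans C D F G, mult = undefined, one = undefined,
        zero = (\<lambda>X\<in>Ob C. \<zero>\<^bsub>Mor D (omap F X) (omap G X)\<^esub>),
        add = (\<lambda>\<alpha> \<beta>. \<lambda>X\<in>Ob C. \<alpha> X \<oplus>\<^bsub>Mor D (omap F X) (omap G X)\<^esub> \<beta> X),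
        smult = (\<lambda>c \<alpha>. \<lambda>X\<in>Ob C. c \<odot>\<^bsub>Mor D (omap F X) (omap G X)\<^esub> \<alpha> X)\<rparr>),
     Id = (\<lambda>F. \<lambda>X\<in>Ob C. Id D (omap F X)),
     Cmp = (\<lambda>F G H \<beta> \<alpha>. \<lambda>X\<in>Ob C. Cmp D (omap F X) (omap G X) (omap H X) (\<beta> X) (\<alpha> X))\<rparr>"


section \<open>Vector spaces\<close>

text \<open>
  Linear maps are extensional functions on the carrier. The fields \<open>mult\<close> and \<open>one\<close>, which the
  record type \<open>module\<close> inherits from \<open>ring\<close>, have no meaning for vector spaces.
\<close>

definition fdvs :: "('k, 'z) ring_scheme \<Rightarrow> ('k, 'x, 'y) module_scheme \<Rightarrow> bool" where
  "fdvs K V \<longleftrightarrow> vectorspace K V \<and> vectorspace.fin_dim K V"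

definition hom_space :: "('k, 'z) ring_scheme \<Rightarrow> ('k, 'x, 'y) module_scheme \<Rightarrow>
    ('k, 'x', 'y') module_scheme \<Rightarrow> ('k, 'x \<Rightarrow> 'x') module" where
  "hom_space K V W = \<lparr>carrier = module_hom K V W \<inter> extensional (carrier V),
     mult = undefined, one = undefined,
     zero = (\<lambda>x\<in>carrier V. \<zero>\<^bsub>W\<^esub>),
     add = (\<lambda>f g. \<lambda>x\<in>carrier V. f x \<oplus>\<^bsub>W\<^esub> g x),
     smult = (\<lambda>c f. \<lambda>x\<in>carrier V. c \<odot>\<^bsub>W\<^esub> f x)\<rparr>"

definition Vect :: "('k, 'z) ring_scheme \<Rightarrow> ('k, ('k, 'v) module, 'v \<Rightarrow> 'v) lincat" where
  "Vect K = \<lparr>Ob = {V. fdvs K V}, Mor = hom_space K, Id = (\<lambda>V. \<lambda>x\<in>carrier V. x),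
     Cmp = (\<lambda>U V W g f. compose (carrier U) g f)\<rparr>"

definition scalars :: "('k, 'z) ring_scheme \<Rightarrow> ('k, 'k) module" where
  "scalars K = \<lparr>carrier = carrier K, mult = mult K, one = one K, zero = zero K, add = add K,
     smult = mult K\<rparr>"

definition quot_space :: "('k, 'x, 'y) module_scheme \<Rightarrow> 'x set \<Rightarrow> ('k, 'x set) module" where
  "quot_space V W = \<lparr>carrier = a_rcosets\<^bsub>V\<^esub> W, mult = undefined, one = undefined,
     zero = W, add = set_add V,
     smult = (\<lambda>c A. W <+>\<^bsub>V\<^esub> ((\<lambda>x. c \<odot>\<^bsub>V\<^esub> x) ` A))\<rparr>"

subsection \<open>Tensor products\<close>

text \<open>
  For a set \<open>B\<close> of \<open>K\<close>-valued multilinear forms on \<open>P\<close>, the pure tensor of \<open>p \<in> P\<close> is the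
  evaluation \<open>b \<mapsto> b p\<close>, and the tensor product is the span of the pure tensors in the space of all
  functions \<open>B \<rightarrow> K\<close>. As multilinear forms separate the points of the usual tensor product, this is
  a model of it, together with its universal property.
\<close>

definition pure :: "('p \<Rightarrow> 'k) set \<Rightarrow> 'p \<Rightarrow> ('p \<Rightarrow> 'k) \<Rightarrow> 'k" where
  "pure B p = (\<lambda>b\<in>B. b p)"

definition pure_span :: "('k, 'z) ring_scheme \<Rightarrow> ('p \<Rightarrow> 'k) set \<Rightarrow> 'p set \<Rightarrow>
    ('k, ('p \<Rightarrow> 'k) \<Rightarrow> 'k) module" where
  "pure_span K B P = (ring.func_space K B)
     \<lparr>carrier := LinearCombinations.module.span K (ring.func_space K B) (pure B ` P)\<rparr>"

definition bilinear_forms :: "('k, 'z) ring_scheme \<Rightarrow> ('k, 'x, 'y) module_scheme \<Rightarrow>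
    ('k, 'x', 'y') module_scheme \<Rightarrow> ('x \<times> 'x' \<Rightarrow> 'k) set" where
  "bilinear_forms K M N = {b \<in> extensional (carrier M \<times> carrier N).
     (\<forall>x\<in>carrier M. (\<lambda>y. b (x, y)) \<in> module_hom K N (scalars K)) \<and>
     (\<forall>y\<in>carrier N. (\<lambda>x. b (x, y)) \<in> module_hom K M (scalars K))}"

definition tensor :: "('k, 'z) ring_scheme \<Rightarrow> ('k, 'x, 'y) module_scheme \<Rightarrow>
    ('k, 'x', 'y') module_scheme \<Rightarrow> ('k, ('x \<times> 'x' \<Rightarrow> 'k) \<Rightarrow> 'k) module" where
  "tensor K M N = pure_span K (bilinear_forms K M N) (carrier M \<times> carrier N)"

text \<open>\<open>f \<otimes> g : M \<otimes> N \<rightarrow> M' \<otimes> N'\<close> maps the pure tensor of \<open>(x, y)\<close> to that of \<open>(f x, g y)\<close>.\<close>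

definition tensor_map where
  "tensor_map K M N M' N' f g t =
     (\<lambda>b\<in>bilinear_forms K M' N'. t (\<lambda>(x, y)\<in>carrier M \<times> carrier N. b (f x, g y)))"

definition multilinear_forms :: "nat \<Rightarrow> ('k, 'z) ring_scheme \<Rightarrow> ('k, 'x, 'y) module_scheme \<Rightarrow>
    ((nat \<Rightarrow> 'x) \<Rightarrow> 'k) set" where
  "multilinear_forms n K V = {b \<in> extensional ({1..n} \<rightarrow>\<^sub>E carrier V).
     \<forall>v\<in>{1..n} \<rightarrow>\<^sub>E carrier V. \<forall>i\<in>{1..n}. (\<lambda>x. b (v(i := x))) \<in> module_hom K V (scalars K)}"


section \<open>Representations of symmetric groups\<close>

record ('k, 'x) rep = "('k, 'x) module" +
  act :: "(nat \<Rightarrow> nat) \<Rightarrow> 'x \<Rightarrow> 'x"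

definition mk_rep :: "('k, 'x) module \<Rightarrow> ((nat \<Rightarrow> nat) \<Rightarrow> 'x \<Rightarrow> 'x) \<Rightarrow> ('k, 'x) rep" where
  "mk_rep V a = module.extend V (rep.fields a)"

locale representation =
  fixes n :: nat and K :: "('k, 'z) ring_scheme" and M :: "('k, 'x) rep"
  assumes fdvs: "fdvs K M"
    and act_linear: "g \<in> carrier (sym_group n) \<Longrightarrow> act M g \<in> module_hom K M M"
    and act_one: "x \<in> carrier M \<Longrightarrow> act M \<one>\<^bsub>sym_group n\<^esub> x = x"
    and act_mult: "\<lbrakk>g \<in> carrier (sym_group n); h \<in> carrier (sym_group n); x \<in> carrier M\<rbrakk> \<Longrightarrow>
      act M (g \<otimes>\<^bsub>sym_group n\<^esub> h) x = act M g (act M h x)"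

definition rep_hom :: "nat \<Rightarrow> ('k, 'z) ring_scheme \<Rightarrow> ('k, 'x) rep \<Rightarrow> ('k, 'x') rep \<Rightarrow>
    ('k, 'x \<Rightarrow> 'x') module" where
  "rep_hom n K M N = (hom_space K M N)
     \<lparr>carrier := {f \<in> carrier (hom_space K M N).
        \<forall>g\<in>carrier (sym_group n). \<forall>x\<in>carrier M. f (act M g x) = act N g (f x)}\<rparr>"

definition Rep :: "nat \<Rightarrow> ('k, 'z) ring_scheme \<Rightarrow> ('k, ('k, 'v) rep, 'v \<Rightarrow> 'v) lincat" where
  "Rep n K = \<lparr>Ob = {M. representation n K M}, Mor = rep_hom n K,
     Id = (\<lambda>M. \<lambda>x\<in>carrier M. x), Cmp = (\<lambda>L M N g f. compose (carrier L) g f)\<rparr>"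

definition dual_rep :: "nat \<Rightarrow> ('k, 'z) ring_scheme \<Rightarrow> ('k, 'x) rep \<Rightarrow> ('k, 'x \<Rightarrow> 'k) rep" where
  "dual_rep n K M = mk_rep (hom_space K M (scalars K))
     (\<lambda>g \<phi>. \<lambda>x\<in>carrier M. \<phi> (act M (inv\<^bsub>sym_group n\<^esub> g) x))"

definition tensor_rep :: "('k, 'z) ring_scheme \<Rightarrow> ('k, 'x) rep \<Rightarrow> ('k, 'x') rep \<Rightarrow>
    ('k, ('x \<times> 'x' \<Rightarrow> 'k) \<Rightarrow> 'k) rep" where
  "tensor_rep K M N = mk_rep (tensor K M N) (\<lambda>g. tensor_map K M N M N (act M g) (act N g))"

text \<open>The place permutation action: \<open>g\<close> maps \<open>v\<^sub>1 \<otimes> \<dots> \<otimes> v\<^sub>n\<close> to the pure tensor whose factor at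
  place \<open>g i\<close> is \<open>v\<^sub>i\<close>.\<close>

definition tensor_power_rep :: "nat \<Rightarrow> ('k, 'z) ring_scheme \<Rightarrow> ('k, 'x) module \<Rightarrow>
    ('k, ((nat \<Rightarrow> 'x) \<Rightarrow> 'k) \<Rightarrow> 'k) rep" where
  "tensor_power_rep n K V =
     mk_rep (pure_span K (multilinear_forms n K V) ({1..n} \<rightarrow>\<^sub>E carrier V))
       (\<lambda>g t. \<lambda>b\<in>multilinear_forms n K V.
          t (\<lambda>v\<in>{1..n} \<rightarrow>\<^sub>E carrier V. b (v \<circ> inv\<^bsub>sym_group n\<^esub> g)))"

definition invariants :: "nat \<Rightarrow> ('k, 'x) rep \<Rightarrow> ('k, 'x) module" where
  "invariants n M = (module.truncate M)
     \<lparr>carrier := {x \<in> carrier M. \<forall>g\<in>carrier (sym_group n). act M g x = x}\<rparr>"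

definition coinv_relations :: "nat \<Rightarrow> ('k, 'z) ring_scheme \<Rightarrow> ('k, 'x) rep \<Rightarrow> 'x set" where
  "coinv_relations n K M = LinearCombinations.module.span K M
     {act M g x \<ominus>\<^bsub>M\<^esub> x | g x. g \<in> carrier (sym_group n) \<and> x \<in> carrier M}"

definition coinvariants :: "nat \<Rightarrow> ('k, 'z) ring_scheme \<Rightarrow> ('k, 'x) rep \<Rightarrow> ('k, 'x set) module" where
  "coinvariants n K M = quot_space M (coinv_relations n K M)"

text \<open>The map on coinvariants induced by an equivariant map \<open>f\<close> with target \<open>N\<close>.\<close>

definition coinv_map :: "nat \<Rightarrow> ('k, 'z) ring_scheme \<Rightarrow> ('k, 'x') rep \<Rightarrow> ('x \<Rightarrow> 'x') \<Rightarrow>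
    'x set \<Rightarrow> 'x' set" where
  "coinv_map n K N f A = coinv_relations n K N <+>\<^bsub>N\<^esub> (f ` A)"

text \<open>The permutation module \<open>K[X]\<close> of a finite set \<open>X\<close> with left action \<open>a\<close>: a function on \<open>X\<close> is
  the formal linear combination with these coefficients.\<close>

definition perm_rep :: "nat \<Rightarrow> ('k, 'z) ring_scheme \<Rightarrow> 'x set \<Rightarrow> ((nat \<Rightarrow> nat) \<Rightarrow> 'x \<Rightarrow> 'x) \<Rightarrow>
    ('k, 'x \<Rightarrow> 'k) rep" where
  "perm_rep n K X a = mk_rep (ring.func_space K X)
     (\<lambda>g \<phi>. \<lambda>x\<in>X. \<phi> (a (inv\<^bsub>sym_group n\<^esub> g) x))"

definition is_partition :: "nat \<Rightarrow> nat list \<Rightarrow> bool" where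
  "is_partition n \<mu> \<longleftrightarrow> sorted_wrt (\<ge>) \<mu> \<and> 0 \<notin> set \<mu> \<and> sum_list \<mu> = n"

definition young_subgroup :: "nat \<Rightarrow> nat list \<Rightarrow> (nat \<Rightarrow> nat) set" where
  "young_subgroup n \<mu> = {p \<in> carrier (sym_group n). \<forall>i<length \<mu>.
     p ` {sum_list (take i \<mu>)<..sum_list (take (Suc i) \<mu>)} =
       {sum_list (take i \<mu>)<..sum_list (take (Suc i) \<mu>)}}"


section \<open>Isomorphic copies inside a fixed universe\<close>

text \<open>
  The objects of \<open>Vect\<close> and \<open>Rep\<close> are the finite-dimensional spaces whose underlying set lies in a
  fixed type \<open>'v\<close>. Hom spaces, duals, tensor products and so on have carriers in other types; they
  are turned into objects of these categories by transporting their structure along a chosen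
  injection of the carrier into \<open>'v\<close>. Such an injection exists for every finite-dimensional space
  as soon as the type \<open>'k list\<close> embeds into \<open>'v\<close>.
\<close>

definition enc :: "'x set \<Rightarrow> 'x \<Rightarrow> 'v" where
  "enc A = (SOME \<phi>. inj_on \<phi> A)"

definition dec :: "'x set \<Rightarrow> 'v \<Rightarrow> 'x" where
  "dec A = inv_into A (enc A)"

definition copy_vs :: "('k, 'x, 'y) module_scheme \<Rightarrow> ('k, 'v) module" where
  "copy_vs X = (let A = carrier X in \<lparr>carrier = enc A ` A, mult = undefined, one = undefined,
     zero = enc A \<zero>\<^bsub>X\<^esub>,
     add = (\<lambda>a b. enc A (dec A a \<oplus>\<^bsub>X\<^esub> dec A b)),
     smult = (\<lambda>c a. enc A (c \<odot>\<^bsub>X\<^esub> dec A a))\<rparr>)"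

definition copy_rep :: "('k, 'x) rep \<Rightarrow> ('k, 'v) rep" where
  "copy_rep M = mk_rep (copy_vs M) (\<lambda>g a. enc (carrier M) (act M g (dec (carrier M) a)))"

definition copy_map :: "('k, 'x, 'y) module_scheme \<Rightarrow> ('k, 'x', 'y') module_scheme \<Rightarrow>
    ('x \<Rightarrow> 'x') \<Rightarrow> 'v \<Rightarrow> 'v" where
  "copy_map X Y f = (\<lambda>a\<in>carrier (copy_vs X). enc (carrier Y) (f (dec (carrier X) a)))"

definition dual :: "nat \<Rightarrow> ('k, 'z) ring_scheme \<Rightarrow> ('k, 'v) rep \<Rightarrow> ('k, 'v) rep" where
  "dual n K M = copy_rep (dual_rep n K M)"

definition dual_map :: "nat \<Rightarrow> ('k, 'z) ring_scheme \<Rightarrow> ('k, 'v) rep \<Rightarrow> ('k, 'v) rep \<Rightarrow>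
    ('v \<Rightarrow> 'v) \<Rightarrow> 'v \<Rightarrow> 'v" where
  "dual_map n K M N f =
     copy_map (dual_rep n K N) (dual_rep n K M) (\<lambda>\<phi>. compose (carrier M) \<phi> f)"

definition tensor_power :: "nat \<Rightarrow> ('k, 'z) ring_scheme \<Rightarrow> ('k, 'v) module \<Rightarrow> ('k, 'v) rep" where
  "tensor_power n K V = copy_rep (tensor_power_rep n K V)"

text \<open>The group algebra as left regular representation, and the automorphism \<open>x \<mapsto> x g\<^sup>-\<^sup>1\<close> of it,
  through which the group acts from the left.\<close>

definition regular_rep :: "nat \<Rightarrow> ('k, 'z) ring_scheme \<Rightarrow> ('k, (nat \<Rightarrow> nat) \<Rightarrow> 'k) rep" where
  "regular_rep n K = perm_rep n K (carrier (sym_group n)) (mult (sym_group n))"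

definition group_alg :: "nat \<Rightarrow> ('k, 'z) ring_scheme \<Rightarrow> ('k, 'v) rep" where
  "group_alg n K = copy_rep (regular_rep n K)"

definition group_alg_aut :: "nat \<Rightarrow> ('k, 'z) ring_scheme \<Rightarrow> (nat \<Rightarrow> nat) \<Rightarrow> 'v \<Rightarrow> 'v" where
  "group_alg_aut n K g = copy_map (regular_rep n K) (regular_rep n K)
     (\<lambda>\<phi>. \<lambda>x\<in>carrier (sym_group n). \<phi> (x \<otimes>\<^bsub>sym_group n\<^esub> g))"

definition young_rep :: "nat \<Rightarrow> ('k, 'z) ring_scheme \<Rightarrow> nat list \<Rightarrow> ('k, 'v) rep" where
  "young_rep n K \<mu> = copy_rep (perm_rep n K
     (lcosets\<^bsub>sym_group n\<^esub> (young_subgroup n \<mu>)) (\<lambda>g A. g <#\<^bsub>sym_group n\<^esub> A))"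


section \<open>The category of coherent functors\<close>

type_synonym ('k, 'v) rep_functor = "(('k, 'v) rep, 'v \<Rightarrow> 'v, ('k, 'v) module, 'v \<Rightarrow> 'v) fctr"
type_synonym ('k, 'v) rep_nat = "('k, 'v) rep \<Rightarrow> 'v \<Rightarrow> 'v"

definition h_functor :: "nat \<Rightarrow> ('k, 'z) ring_scheme \<Rightarrow> ('k, 'v) rep \<Rightarrow> ('k, 'v) rep_functor" where
  "h_functor n K M = \<lparr>omap = (\<lambda>N. copy_vs (rep_hom n K M N)),
     mmap = (\<lambda>N N' f. copy_map (rep_hom n K M N) (rep_hom n K M N')
        (\<lambda>u. compose (carrier M) f u))\<rparr>"

text \<open>The transformation \<open>h\<^sub>M \<rightarrow> h\<^sub>M\<^sub>'\<close> given by precomposition with \<open>f : M' \<rightarrow> M\<close>.\<close>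

definition h_trans :: "nat \<Rightarrow> ('k, 'z) ring_scheme \<Rightarrow> ('k, 'v) rep \<Rightarrow> ('k, 'v) rep \<Rightarrow>
    ('v \<Rightarrow> 'v) \<Rightarrow> ('k, 'v) rep_nat" where
  "h_trans n K M M' f = (\<lambda>N\<in>Ob (Rep n K).
     copy_map (rep_hom n K M N) (rep_hom n K M' N) (\<lambda>u. compose (carrier M') u f))"

definition t_functor :: "nat \<Rightarrow> ('k, 'z) ring_scheme \<Rightarrow> ('k, 'v) rep \<Rightarrow> ('k, 'v) rep_functor" where
  "t_functor n K M = \<lparr>omap = (\<lambda>N. copy_vs (coinvariants n K (tensor_rep K M N))),
     mmap = (\<lambda>N N' f.
       copy_map (coinvariants n K (tensor_rep K M N)) (coinvariants n K (tensor_rep K M N'))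
         (coinv_map n K (tensor_rep K M N') (tensor_map K M N M N' (\<lambda>x. x) f)))\<rparr>"

definition t_trans :: "nat \<Rightarrow> ('k, 'z) ring_scheme \<Rightarrow> ('k, 'v) rep \<Rightarrow> ('k, 'v) rep \<Rightarrow>
    ('v \<Rightarrow> 'v) \<Rightarrow> ('k, 'v) rep_nat" where
  "t_trans n K M M' f = (\<lambda>N\<in>Ob (Rep n K).
     copy_map (coinvariants n K (tensor_rep K M N)) (coinvariants n K (tensor_rep K M' N))
       (coinv_map n K (tensor_rep K M' N) (tensor_map K M N M' N f (\<lambda>x. x))))"

definition coherent :: "nat \<Rightarrow> ('k, 'z) ring_scheme \<Rightarrow> ('k, 'v) rep_functor \<Rightarrow> bool" where
  "coherent n K f \<longleftrightarrow> is_linear_functor K (Rep n K) (Vect K) f \<and>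
     (\<exists>M\<in>Ob (Rep n K). \<exists>N\<in>Ob (Rep n K).
      \<exists>\<alpha>\<in>nat_trans (Rep n K) (Vect K) (h_functor n K N) (h_functor n K M).
      \<exists>\<beta>\<in>nat_trans (Rep n K) (Vect K) (h_functor n K M) f.
        \<forall>X\<in>Ob (Rep n K).
          \<alpha> X ` carrier (omap (h_functor n K N) X) =
            {a \<in> carrier (omap (h_functor n K M) X). \<beta> X a = \<zero>\<^bsub>omap f X\<^esub>} \<and>
          \<beta> X ` carrier (omap (h_functor n K M) X) = carrier (omap f X))"

definition Coh :: "nat \<Rightarrow> ('k, 'z) ring_scheme \<Rightarrow>
    ('k, ('k, 'v) rep_functor, ('k, 'v) rep_nat) lincat" where
  "Coh n K = full_subcat (functor_cat K (Rep n K) (Vect K)) (coherent n K)"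

definition t_upper_star :: "nat \<Rightarrow> ('k, 'z) ring_scheme \<Rightarrow>
    (('k, 'v) rep_functor, ('k, 'v) rep_nat, ('k, 'v) rep, 'v \<Rightarrow> 'v) fctr" where
  "t_upper_star n K = \<lparr>
     omap = (\<lambda>f. mk_rep (omap f (group_alg n K))
       (\<lambda>g. mmap f (group_alg n K) (group_alg n K) (group_alg_aut n K g))),
     mmap = (\<lambda>f f' \<alpha>. \<alpha> (group_alg n K))\<rparr>"

definition t_lower_star :: "nat \<Rightarrow> ('k, 'z) ring_scheme \<Rightarrow>
    (('k, 'v) rep, 'v \<Rightarrow> 'v, ('k, 'v) rep_functor, ('k, 'v) rep_nat) fctr" where
  "t_lower_star n K = \<lparr>omap = (\<lambda>M. h_functor n K (dual n K M)),
     mmap = (\<lambda>M N f. h_trans n K (dual n K M) (dual n K N) (dual_map n K M N f))\<rparr>"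

definition t_lower_shriek :: "nat \<Rightarrow> ('k, 'z) ring_scheme \<Rightarrow>
    (('k, 'v) rep, 'v \<Rightarrow> 'v, ('k, 'v) rep_functor, ('k, 'v) rep_nat) fctr" where
  "t_lower_shriek n K = \<lparr>omap = t_functor n K, mmap = t_trans n K\<rparr>"

definition Coh0 :: "nat \<Rightarrow> ('k, 'z) ring_scheme \<Rightarrow>
    ('k, ('k, 'v) rep_functor, ('k, 'v) rep_nat) lincat" where
  "Coh0 n K = full_subcat (Coh n K)
     (\<lambda>f. carrier (omap (t_upper_star n K) f) = {\<zero>\<^bsub>omap (t_upper_star n K) f\<^esub>})"

definition CohY :: "nat \<Rightarrow> ('k, 'z) ring_scheme \<Rightarrow>
    ('k, ('k, 'v) rep_functor, ('k, 'v) rep_nat) lincat" where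
  "CohY n K = full_subcat (Coh n K) (\<lambda>f. \<forall>\<mu>. is_partition n \<mu> \<longrightarrow>
     carrier (omap f (young_rep n K \<mu>)) = {\<zero>\<^bsub>omap f (young_rep n K \<mu>)\<^esub>})"


section \<open>Strict polynomial functors\<close>

type_synonym ('k, 'v) poly_functor =
  "(('k, 'v) module, 'v \<Rightarrow> 'v, ('k, 'v) module, 'v \<Rightarrow> 'v) fctr"
type_synonym ('k, 'v) poly_nat = "('k, 'v) module \<Rightarrow> 'v \<Rightarrow> 'v"

text \<open>
  The invariants of \<open>Hom(V, W)\<^sup>\<otimes>\<^sup>n\<close> are identified with the equivariant maps \<open>V\<^sup>\<otimes>\<^sup>n \<rightarrow> W\<^sup>\<otimes>\<^sup>n\<close>;
  composition is then composition of maps.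
\<close>

definition Gamma :: "nat \<Rightarrow> ('k, 'z) ring_scheme \<Rightarrow> ('k, ('k, 'v) module, 'v \<Rightarrow> 'v) lincat" where
  "Gamma n K = \<lparr>Ob = {V. fdvs K V},
     Mor = (\<lambda>V W. rep_hom n K (tensor_power n K V) (tensor_power n K W)),
     Id = (\<lambda>V. \<lambda>x\<in>carrier (tensor_power n K V). x),
     Cmp = (\<lambda>U V W g f. compose (carrier (tensor_power n K U)) g f)\<rparr>"

definition Pol :: "nat \<Rightarrow> ('k, 'z) ring_scheme \<Rightarrow>
    ('k, ('k, 'v) poly_functor, ('k, 'v) poly_nat) lincat" where
  "Pol n K = functor_cat K (Gamma n K) (Vect K)"

definition T_functor :: "nat \<Rightarrow> ('k, 'z) ring_scheme \<Rightarrow> ('k, 'v) poly_functor" where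
  "T_functor n K = \<lparr>omap = (\<lambda>V. module.truncate (tensor_power n K V)), mmap = (\<lambda>V W f. f)\<rparr>"

text \<open>\<open>Hom(T\<^sup>n, F)\<close>, where \<open>g\<close> acts by precomposition with the place permutation \<open>g\<^sup>-\<^sup>1\<close>.\<close>

definition hom_T_rep :: "nat \<Rightarrow> ('k, 'z) ring_scheme \<Rightarrow> ('k, 'v) poly_functor \<Rightarrow>
    ('k, ('k, 'v) poly_nat) rep" where
  "hom_T_rep n K F = mk_rep (Mor (Pol n K) (T_functor n K) F)
     (\<lambda>g \<alpha>. \<lambda>V\<in>Ob (Gamma n K). compose (carrier (tensor_power n K V)) (\<alpha> V)
        (act (tensor_power n K V) (inv\<^bsub>sym_group n\<^esub> g)))"

definition c_upper_star :: "nat \<Rightarrow> ('k, 'z) ring_scheme \<Rightarrow>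
    (('k, 'v) poly_functor, ('k, 'v) poly_nat, ('k, 'v) rep, 'v \<Rightarrow> 'v) fctr" where
  "c_upper_star n K = \<lparr>omap = (\<lambda>F. copy_rep (hom_T_rep n K F)),
     mmap = (\<lambda>F G \<beta>. copy_map (hom_T_rep n K F) (hom_T_rep n K G)
        (\<lambda>\<alpha>. Cmp (Pol n K) (T_functor n K) F G \<beta> \<alpha>))\<rparr>"

definition c_lower_shriek :: "nat \<Rightarrow> ('k, 'z) ring_scheme \<Rightarrow>
    (('k, 'v) rep, 'v \<Rightarrow> 'v, ('k, 'v) poly_functor, ('k, 'v) poly_nat) fctr" where
  "c_lower_shriek n K = \<lparr>
     omap = (\<lambda>M. \<lparr>
       omap = (\<lambda>V. copy_vs (coinvariants n K (tensor_rep K M (tensor_power n K V)))),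
       mmap = (\<lambda>V W f. copy_map
         (coinvariants n K (tensor_rep K M (tensor_power n K V)))
         (coinvariants n K (tensor_rep K M (tensor_power n K W)))
         (coinv_map n K (tensor_rep K M (tensor_power n K W))
           (tensor_map K M (tensor_power n K V) M (tensor_power n K W) (\<lambda>x. x) f)))\<rparr>),
     mmap = (\<lambda>M N f. \<lambda>V\<in>Ob (Gamma n K). copy_map
       (coinvariants n K (tensor_rep K M (tensor_power n K V)))
       (coinvariants n K (tensor_rep K N (tensor_power n K V)))
       (coinv_map n K (tensor_rep K N (tensor_power n K V))
         (tensor_map K M (tensor_power n K V) N (tensor_power n K V) f (\<lambda>x. x))))\<rparr>"

definition c_lower_star :: "nat \<Rightarrow> ('k, 'z) ring_scheme \<Rightarrow>
    (('k, 'v) rep, 'v \<Rightarrow> 'v, ('k, 'v) poly_functor, ('k, 'v) poly_nat) fctr" where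
  "c_lower_star n K = \<lparr>
     omap = (\<lambda>M. \<lparr>
       omap = (\<lambda>V. copy_vs (invariants n (tensor_rep K M (tensor_power n K V)))),
       mmap = (\<lambda>V W f. copy_map
         (invariants n (tensor_rep K M (tensor_power n K V)))
         (invariants n (tensor_rep K M (tensor_power n K W)))
         (tensor_map K M (tensor_power n K V) M (tensor_power n K W) (\<lambda>x. x) f))\<rparr>),
     mmap = (\<lambda>M N f. \<lambda>V\<in>Ob (Gamma n K). copy_map
       (invariants n (tensor_rep K M (tensor_power n K V)))
       (invariants n (tensor_rep K N (tensor_power n K V)))
       (tensor_map K M (tensor_power n K V) N (tensor_power n K V) f (\<lambda>x. x)))\<rparr>"

definition Pol0 :: "nat \<Rightarrow> ('k, 'z) ring_scheme \<Rightarrow>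
    ('k, ('k, 'v) poly_functor, ('k, 'v) poly_nat) lincat" where
  "Pol0 n K = full_subcat (Pol n K)
     (\<lambda>F. carrier (omap (c_upper_star n K) F) = {\<zero>\<^bsub>omap (c_upper_star n K) F\<^esub>})"

definition j_upper_star :: "nat \<Rightarrow> ('k, 'z) ring_scheme \<Rightarrow>
    (('k, 'v) rep_functor, ('k, 'v) rep_nat, ('k, 'v) poly_functor, ('k, 'v) poly_nat) fctr" where
  "j_upper_star n K = \<lparr>
     omap = (\<lambda>f. \<lparr>omap = (\<lambda>V. omap f (tensor_power n K V)),
       mmap = (\<lambda>V W u. mmap f (tensor_power n K V) (tensor_power n K W) u)\<rparr>),
     mmap = (\<lambda>f f' \<alpha>. \<lambda>V\<in>Ob (Gamma n K). \<alpha> (tensor_power n K V))\<rparr>"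

end

theory Submission
  imports Defs
begin

text \<open>
  For \<open>E = K\<^sup>n\<close> the place permutations move \<open>\<tau> = e\<^sub>1 \<otimes> \<dots> \<otimes> e\<^sub>n\<close> freely, and the coordinate
  function \<open>w\<close> at \<open>\<tau>\<close> satisfies \<open>w(g \<tau>) = \<delta>\<^sub>g\<^sub>1\<close>. Averaging over the group therefore yields, for every
  representation \<open>N\<close> and \<open>x \<in> N\<close>, an equivariant map \<open>E\<^sup>\<otimes>\<^sup>n \<rightarrow> N\<close> with \<open>\<tau> \<mapsto> x\<close> and, for every
  functional \<open>\<phi>\<close> on \<open>N\<close>, an equivariant map \<open>N \<rightarrow> E\<^sup>\<otimes>\<^sup>n\<close> whose composite with \<open>w\<close> is \<open>\<phi>\<close>. By the
  former, transformations out of \<open>t\<^sub>M\<close> can be recovered from their values on tensor powers; by the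
  latter, so can transformations into \<open>h\<^sub>B\<close>. In other words, \<open>j\<^sup>*\<close> induces bijections on
  \<open>Hom(t\<^sub>M, f)\<close> and on \<open>Hom(f, h\<^sub>B)\<close>. Since \<open>j\<^sup>* t\<^sub>* \<cong> c\<^sub>*\<close> by contraction,
  \<open>M \<otimes> N \<cong> Hom(M\<^sup>\<or>, N)\<close>, and \<open>j\<^sup>* t\<^sub>! = c\<^sub>!\<close>, the Yoneda lemma turns these bijections into the first
  two triangles.

  For the third one, \<open>y \<in> f(K[\<S>\<^sub>n])\<close> is sent to the transformation \<open>T\<^sup>n \<rightarrow> j\<^sup>* f\<close> which maps \<open>x\<close> to
  the image of \<open>y\<close> under \<open>f(K[\<S>\<^sub>n] \<rightarrow> V\<^sup>\<otimes>\<^sup>n, 1 \<mapsto> x)\<close>; this is invertible because \<open>K[\<S>\<^sub>n]\<close> is a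
  retract of \<open>E\<^sup>\<otimes>\<^sup>n\<close>. It is also a retract of the permutation module of the partition
  \<open>(1, \<dots>, 1)\<close>, whence the inclusion of subcategories.
\<close>

section \<open>Linear algebra\<close>

text \<open>The sums over the group are never divided by n!, which may be zero in K. What replaces
  division is the freeness of the orbit of \<tau>: as \<open>w\<close> is the delta function on it,
  exactly one summand survives in \<open>avg_at\<close> and in \<open>functional_avg\<close>.
  Morphisms of \<open>Gamma n K\<close> are by definition all equivariant maps between tensor
  powers, so j^* is restriction to a full family of representations. Averaged maps between tensor
  powers are again morphisms there, and a transformation given only on tensor powers is natural
  along them. The adjoints of j^* are known only through their hom bijections; no formula for them
  enters. The triangles are therefore deduced from j^* alone, and for t_! this requires that t_M be
  coherent, hence an explicit presentation by representable functors. All objects live in one type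
  'v. Each constructed space is replaced by a code chosen with \<open>enc\<close>, whose injectivity
  is derived from finite dimension; hence finite dimension is established for every space on the
  way, including Hom(T^n, F).\<close>

lemma module_homI:
  assumes "\<And>x. x \<in> carrier M \<Longrightarrow> f x \<in> carrier N"
    and "\<And>x y. \<lbrakk>x \<in> carrier M; y \<in> carrier M\<rbrakk> \<Longrightarrow> f (x \<oplus>\<^bsub>M\<^esub> y) = f x \<oplus>\<^bsub>N\<^esub> f y"
    and "\<And>c x. \<lbrakk>c \<in> carrier K; x \<in> carrier M\<rbrakk> \<Longrightarrow> f (c \<odot>\<^bsub>M\<^esub> x) = c \<odot>\<^bsub>N\<^esub> f x"
  shows "f \<in> module_hom K M N"
  using assms by (auto simp: module_hom_def)

lemma module_hom_in: "\<lbrakk>f \<in> module_hom K M N; x \<in> carrier M\<rbrakk> \<Longrightarrow> f x \<in> carrier N"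
  by (auto simp: module_hom_def)

lemma module_hom_comp:
  "\<lbrakk>f \<in> module_hom K M N; g \<in> module_hom K N P\<rbrakk> \<Longrightarrow> (\<lambda>x. g (f x)) \<in> module_hom K M P"
  by (auto simp: module_hom_def Pi_iff)

lemma module_hom_zero:
  "\<lbrakk>module K M; module K N; f \<in> module_hom K M N\<rbrakk> \<Longrightarrow> f \<zero>\<^bsub>M\<^esub> = \<zero>\<^bsub>N\<^esub>"
  by (rule mod_hom.f0_is_0[where R = K]) (simp add: mod_hom_def mod_hom_axioms_def)

lemma module_hom_minus:
  "\<lbrakk>module K M; module K N; f \<in> module_hom K M N; x \<in> carrier M; y \<in> carrier M\<rbrakk> \<Longrightarrow>
    f (x \<ominus>\<^bsub>M\<^esub> y) = f x \<ominus>\<^bsub>N\<^esub> f y"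
  by (rule mod_hom.f_minus[where R = K]) (simp_all add: mod_hom_def mod_hom_axioms_def)

lemma module_hom_finsum:
  assumes "module K M" "module K N" "f \<in> module_hom K M N" "g \<in> A \<rightarrow> carrier M"
  shows "f (finsum M g A) = finsum N (\<lambda>a. f (g a)) A"
proof -
  interpret M: module K M by fact
  interpret N: module K N by fact
  show ?thesis using assms(4)
  proof (induct A rule: infinite_finite_induct)
    case (insert a A)
    have "f (finsum M g (insert a A)) = f (g a \<oplus>\<^bsub>M\<^esub> finsum M g A)"
      using insert by (subst M.finsum_insert) auto
    also have "\<dots> = f (g a) \<oplus>\<^bsub>N\<^esub> f (finsum M g A)"
      using insert assms(3) by (intro module_hom_add) auto
    also have "\<dots> = finsum N (\<lambda>a. f (g a)) (insert a A)"
      using insert assms(3) by (subst N.finsum_insert) (auto intro!: module_hom_in[OF assms(3)])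
    finally show ?case .
  qed (use module_hom_zero[OF assms(1-3)] in auto)
qed

lemma id_hom: "(\<lambda>x. x) \<in> module_hom K M M"
  by (rule module_homI) auto

lemma submodule_finsum:
  assumes "submodule K U M" "h \<in> A \<rightarrow> U"
  shows "finsum M h A \<in> U"
proof -
  interpret U: submodule K U M by fact
  interpret M: module K M by (rule U.module)
  show ?thesis using assms(2)
  proof (induct A rule: infinite_finite_induct)
    case (insert a A)
    then have "h \<in> A \<rightarrow> carrier M" "h a \<in> carrier M" using U.subset by auto
    with insert show ?case by (subst M.finsum_insert) auto
  qed simp_all
qed

section \<open>Vector space structures on images and on families\<close>

lemma vectorspace_module [dest]: "vectorspace K V \<Longrightarrow> module K V"
  by (rule vectorspace.axioms(1))

text \<open>The axioms pass to any surjective image on which the operations are induced. The map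
  \<open>p\<close> may identify points, so the same lemma serves coded copies, where
  \<open>p\<close> is injective, and quotients, where it sends a vector to its coset.\<close>

lemma vectorspace_image:
  assumes "vectorspace K V" and car: "carrier W = p ` carrier V" and zero: "\<zero>\<^bsub>W\<^esub> = p \<zero>\<^bsub>V\<^esub>"
    and add: "\<And>x y. \<lbrakk>x \<in> carrier V; y \<in> carrier V\<rbrakk> \<Longrightarrow> p x \<oplus>\<^bsub>W\<^esub> p y = p (x \<oplus>\<^bsub>V\<^esub> y)"
    and smult: "\<And>c x. \<lbrakk>c \<in> carrier K; x \<in> carrier V\<rbrakk> \<Longrightarrow> c \<odot>\<^bsub>W\<^esub> p x = p (c \<odot>\<^bsub>V\<^esub> x)"
  shows "vectorspace K W" and "p \<in> module_hom K V W"
proof -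
  interpret V: vectorspace K V by fact
  have neg: "\<exists>y\<in>carrier V. x \<oplus>\<^bsub>V\<^esub> y = \<zero>\<^bsub>V\<^esub>" if "x \<in> carrier V" for x
    using that by (metis V.M.r_neg V.M.add.inv_closed)
  show "vectorspace K W"
  proof (rule vs_criteria, goal_cases)
    case 1 show ?case by (rule V.field_axioms)
  next
    case 4
    show ?case
    proof
      fix v assume "v \<in> carrier W"
      then obtain x where x: "x \<in> carrier V" "v = p x" by (auto simp: car)
      with neg obtain y where "y \<in> carrier V" "x \<oplus>\<^bsub>V\<^esub> y = \<zero>\<^bsub>V\<^esub>" by blast
      with x show "\<exists>u\<in>carrier W. v \<oplus>\<^bsub>W\<^esub> u = \<zero>\<^bsub>W\<^esub>"
        by (intro bexI[of _ "p y"]) (auto simp: car add zero)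
    qed
  qed (auto simp: car zero add smult V.M.a_ac V.smult_assoc1 V.smult_l_distr V.smult_r_distr
      intro!: imageI)
  show "p \<in> module_hom K V W"
    by (rule module_homI) (auto simp: car add smult)
qed

lemma vectorspace_cong:
  assumes "vectorspace K V" "carrier W = carrier V" "\<zero>\<^bsub>W\<^esub> = \<zero>\<^bsub>V\<^esub>" "add W = add V" "smult W = smult V"
  shows "vectorspace K W"
  by (rule vectorspace_image(1)[OF assms(1), of _ "\<lambda>x. x"]) (simp_all add: assms)

text \<open>Hom spaces, spaces of equivariant maps and spaces of natural transformations are all
  sets of extensional families with componentwise operations. The target \<open>W i\<close> may vary
  with \<open>i\<close> because the components of a transformation lie in different hom
  spaces.\<close>

lemma pointwise_vectorspace:
  fixes V :: "('k, 'i \<Rightarrow> 'x, 'y) module_scheme" and W :: "'i \<Rightarrow> ('k, 'x, 'u) module_scheme"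
  assumes K: "field K" and W: "\<And>i. i \<in> I \<Longrightarrow> vectorspace K (W i)"
    and car: "\<And>f i. \<lbrakk>f \<in> carrier V; i \<in> I\<rbrakk> \<Longrightarrow> f i \<in> carrier (W i)"
    and ext: "\<And>f. f \<in> carrier V \<Longrightarrow> f \<in> extensional I"
    and zero: "\<zero>\<^bsub>V\<^esub> = (\<lambda>i\<in>I. \<zero>\<^bsub>W i\<^esub>)"
    and add: "\<And>f g. f \<oplus>\<^bsub>V\<^esub> g = (\<lambda>i\<in>I. f i \<oplus>\<^bsub>W i\<^esub> g i)"
    and smult: "\<And>c f. c \<odot>\<^bsub>V\<^esub> f = (\<lambda>i\<in>I. c \<odot>\<^bsub>W i\<^esub> f i)"
    and closed: "\<zero>\<^bsub>V\<^esub> \<in> carrier V"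
      "\<And>f g. \<lbrakk>f \<in> carrier V; g \<in> carrier V\<rbrakk> \<Longrightarrow> f \<oplus>\<^bsub>V\<^esub> g \<in> carrier V"
      "\<And>c f. \<lbrakk>c \<in> carrier K; f \<in> carrier V\<rbrakk> \<Longrightarrow> c \<odot>\<^bsub>V\<^esub> f \<in> carrier V"
  shows "vectorspace K V"
proof -
  interpret K: field K by fact
  have eqI: "f = g" if "f \<in> extensional I" "g \<in> extensional I" "\<And>i. i \<in> I \<Longrightarrow> f i = g i" for f g :: "'i \<Rightarrow> 'x"
    using that by (rule extensionalityI) auto
  note defs = add smult zero
  have W': "\<And>i. i \<in> I \<Longrightarrow> module K (W i)" using W by blast
  have W'': "\<And>i. i \<in> I \<Longrightarrow> abelian_group (W i)" using W' module.axioms(2) by blast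
  have W3: "\<And>i. i \<in> I \<Longrightarrow> abelian_monoid (W i)" using W'' abelian_group.axioms(1) by blast
  show ?thesis
  proof (rule vs_criteria, goal_cases)
    case 4
    show ?case
    proof
      \<comment> \<open>The closure conditions speak of sums and multiples only; the negative of
        \<open>f\<close> is taken as its multiple by -1.\<close>
      fix f assume f: "f \<in> carrier V"
      have "f \<oplus>\<^bsub>V\<^esub> ((\<ominus>\<^bsub>K\<^esub> \<one>\<^bsub>K\<^esub>) \<odot>\<^bsub>V\<^esub> f) = \<zero>\<^bsub>V\<^esub>"
        using f by (intro eqI) (auto simp: defs car abelian_group.r_neg[OF W''] module.smult_l_minus[OF W'] module.smult_one[OF W'])
      with f show "\<exists>g\<in>carrier V. f \<oplus>\<^bsub>V\<^esub> g = \<zero>\<^bsub>V\<^esub>"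
        using closed(3)[of "\<ominus>\<^bsub>K\<^esub> \<one>\<^bsub>K\<^esub>" f] by auto
    qed
  qed (use closed in \<open>auto simp: K defs car ext abelian_monoid.a_comm[OF W3] abelian_monoid.a_assoc[OF W3] abelian_monoid.a_lcomm[OF W3]
      abelian_monoid.r_zero[OF W3] module.smult_assoc1[OF W'] module.smult_l_distr[OF W']
      module.smult_r_distr[OF W'] module.smult_one[OF W'] abelian_monoid.a_closed[OF W3] module.smult_closed[OF W']
      intro!: eqI restrict_ext\<close>)
qed

section \<open>Finite dimension, functionals and dual bases\<close>

definition functionals :: "('k, 'z) ring_scheme \<Rightarrow> ('k, 'x, 'y) module_scheme \<Rightarrow> ('x \<Rightarrow> 'k) set" where
  "functionals K V = module_hom K V (scalars K)"

lemma scalars_simps [simp]: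
  "carrier (scalars K) = carrier K" "\<zero>\<^bsub>scalars K\<^esub> = \<zero>\<^bsub>K\<^esub>" "add (scalars K) = add K"
  "smult (scalars K) = mult K"
  by (simp_all add: scalars_def)

lemma finsum_scalars [simp]: "finsum (scalars K) f A = finsum K f A"
  by (simp add: finsum_def finprod_def scalars_def)

lemma (in field) scalars_vectorspace: "vectorspace R (scalars R)"
  by (rule vs_criteria) (auto simp: field_axioms a_ac m_assoc l_distr r_distr intro: r_neg)

lemma functionals_in: "\<lbrakk>f \<in> functionals K V; x \<in> carrier V\<rbrakk> \<Longrightarrow> f x \<in> carrier K"
  by (auto simp: functionals_def module_hom_def)

text \<open>The working form of finite dimension: an indexed basis \<open>z\<close> with coordinate
  functionals \<open>w\<close>. Elements of \<open>functionals\<close> are unconstrained off the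
  carrier, unlike those of \<open>hom_space K V (scalars K)\<close>, so that composites such as
  \<phi> after u remain functionals as they stand.\<close>

definition dual_basis :: "('k, 'z) ring_scheme \<Rightarrow> ('k, 'x, 'y) module_scheme \<Rightarrow> nat \<Rightarrow>
    (nat \<Rightarrow> 'x) \<Rightarrow> (nat \<Rightarrow> 'x \<Rightarrow> 'k) \<Rightarrow> bool" where
  "dual_basis K V d z w \<longleftrightarrow> (\<forall>i<d. z i \<in> carrier V \<and> w i \<in> functionals K V) \<and>
     (\<forall>x\<in>carrier V. (\<Oplus>\<^bsub>V\<^esub>i\<in>{..<d}. w i x \<odot>\<^bsub>V\<^esub> z i) = x) \<and>
     (\<forall>i<d. \<forall>j<d. w i (z j) = (if i = j then \<one>\<^bsub>K\<^esub> else \<zero>\<^bsub>K\<^esub>))"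

lemma fdvs_vs: "fdvs K V \<Longrightarrow> vectorspace K V"
  by (simp add: fdvs_def)

lemma fdvs_image:
  assumes "fdvs K V" "vectorspace K W" "p \<in> module_hom K V W" "p ` carrier V = carrier W"
  shows "fdvs K W"
proof -
  interpret linear_map K V W p
    using assms by (simp add: linear_map_def mod_hom_def mod_hom_axioms_def fdvs_def vectorspace_module)
  show ?thesis
    using surj_fin_dim assms by (simp add: fdvs_def)
qed

lemma fdvs_span:
  assumes "vectorspace K V" "finite S" "S \<subseteq> carrier V" "carrier V \<subseteq> LinearCombinations.module.span K V S"
  shows "fdvs K V"
proof -
  interpret vectorspace K V by fact
  show ?thesis
    using assms span_is_subset2[OF assms(3)] by (auto simp: fdvs_def fin_dim_def)
qed

lemma span_induct [consumes 3]:
  assumes "module K V" "S \<subseteq> carrier V" "x \<in> LinearCombinations.module.span K V S"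
    and "P \<zero>\<^bsub>V\<^esub>" and "\<And>s. s \<in> S \<Longrightarrow> P s"
    and "\<And>x y. \<lbrakk>x \<in> carrier V; y \<in> carrier V; P x; P y\<rbrakk> \<Longrightarrow> P (x \<oplus>\<^bsub>V\<^esub> y)"
    and "\<And>c x. \<lbrakk>c \<in> carrier K; x \<in> carrier V; P x\<rbrakk> \<Longrightarrow> P (c \<odot>\<^bsub>V\<^esub> x)"
  shows "P x"
proof -
  interpret module K V by fact
  have "submodule K {x \<in> carrier V. P x} V"
    by unfold_locales (use assms in auto)
  then have "span S \<subseteq> {x \<in> carrier V. P x}"
    using assms by (intro span_is_subset) auto
  with assms show ?thesis by auto
qed

text \<open>The \<open>f j\<close> embed V into a finite power of K. The spanning set is found by
  treating the functionals one at a time: the kernel of \<open>f i\<close> in a subspace has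
  codimension at most one, so one further vector suffices. The induction runs over subspaces U
  because it has to pass to such kernels.\<close>

lemma fdvs_of_functionals:
  assumes V: "vectorspace K V" and "finite J" and f: "\<And>j. j \<in> J \<Longrightarrow> f j \<in> functionals K V"
    and inj: "\<And>x. \<lbrakk>x \<in> carrier V; \<And>j. j \<in> J \<Longrightarrow> f j x = \<zero>\<^bsub>K\<^esub>\<rbrakk> \<Longrightarrow> x = \<zero>\<^bsub>V\<^esub>"
  shows "fdvs K V"
proof -
  interpret vectorspace K V by fact
  have fK: "f j x \<in> carrier K" if "j \<in> J" "x \<in> carrier V" for j x
    using f[of j] that by (auto simp: functionals_def module_hom_def)
  have f_add: "f j (x \<oplus>\<^bsub>V\<^esub> y) = f j x \<oplus>\<^bsub>K\<^esub> f j y" if "j \<in> J" "x \<in> carrier V" "y \<in> carrier V" for j x y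
    using f[of j] that by (auto simp: functionals_def module_hom_def)
  have f_smult: "f j (c \<odot>\<^bsub>V\<^esub> x) = c \<otimes>\<^bsub>K\<^esub> f j x" if "j \<in> J" "x \<in> carrier V" "c \<in> carrier K" for j x c
    using f[of j] that by (auto simp: functionals_def module_hom_def)
  have f0: "f j \<zero>\<^bsub>V\<^esub> = \<zero>\<^bsub>K\<^esub>" if "j \<in> J" for j
    using module_hom_zero[OF module_axioms scalars_vectorspace[THEN vectorspace_module]] f[OF that]
    by (auto simp: functionals_def)
  have "\<exists>B. finite B \<and> B \<subseteq> U \<and> U \<subseteq> span B"
    if "finite I" "I \<subseteq> J" "submodule K U V" "\<And>x. \<lbrakk>x \<in> U; \<And>j. j \<in> I \<Longrightarrow> f j x = \<zero>\<^bsub>K\<^esub>\<rbrakk> \<Longrightarrow> x = \<zero>\<^bsub>V\<^esub>" for I U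
    using that
  proof (induct I arbitrary: U rule: finite_induct)
    case empty
    then have "U \<subseteq> {\<zero>\<^bsub>V\<^esub>}" by auto
    moreover have "{\<zero>\<^bsub>V\<^esub>} \<subseteq> span {\<zero>\<^bsub>V\<^esub>}"
      by (rule in_own_span) simp
    moreover have "{\<zero>\<^bsub>V\<^esub>} \<subseteq> U"
      using submodule.zero_closed[OF empty(2)] by simp
    ultimately show ?case
      by (intro exI[of _ "{\<zero>\<^bsub>V\<^esub>}"]) (meson finite.emptyI finite.insertI order_trans)
  next
    case (insert i I)
    interpret U: submodule K U V by fact
    have i: "i \<in> J" and I: "I \<subseteq> J" using insert by auto
    let ?U = "{x \<in> U. f i x = \<zero>\<^bsub>K\<^esub>}"
    have UV: "x \<in> carrier V" if "x \<in> U" for x using U.subset that by auto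
    have sub: "submodule K ?U V"
      by unfold_locales (auto simp: f_add f_smult f0 UV i)
    obtain B where B: "finite B" "B \<subseteq> ?U" "?U \<subseteq> span B"
      using insert(3)[OF I sub] insert.prems(3) by auto
    show ?case
    proof (cases "\<forall>x\<in>U. f i x = \<zero>\<^bsub>K\<^esub>")
      case True
      with B show ?thesis by (intro exI[of _ B]) auto
    next
      case False
      then obtain y where y: "y \<in> U" "f i y \<noteq> \<zero>\<^bsub>K\<^esub>" by auto
      have yV: "y \<in> carrier V" using y UV by auto
      have fy: "f i y \<in> carrier K" "inv\<^bsub>K\<^esub> f i y \<in> carrier K" "inv\<^bsub>K\<^esub> f i y \<otimes>\<^bsub>K\<^esub> f i y = \<one>\<^bsub>K\<^esub>"
        using y yV i fK[OF i yV] by (auto simp: field_Units Units_inv_closed Units_l_inv)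
      have BV: "insert y B \<subseteq> carrier V" using B UV y by auto
      interpret S: submodule K "span (insert y B)" V
        using BV by (rule span_is_submodule)
      have "x \<in> span (insert y B)" if x: "x \<in> U" for x
      proof -
        have xV: "x \<in> carrier V" using x UV by auto
        have fx: "f i x \<in> carrier K" using fK[OF i xV] .
        \<comment> \<open>The multiple of \<open>y\<close> that has to be subtracted from
          \<open>x\<close> to reach the kernel of \<open>f i\<close>.\<close>
        define c where "c = f i x \<otimes>\<^bsub>K\<^esub> inv\<^bsub>K\<^esub> f i y"
        have c: "c \<in> carrier K" using fx fy by (simp add: c_def)
        have cy: "c \<odot>\<^bsub>V\<^esub> y \<in> U" using c y by auto
        have "x \<oplus>\<^bsub>V\<^esub> (\<ominus>\<^bsub>K\<^esub> c) \<odot>\<^bsub>V\<^esub> y \<in> U"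
          using c y x by auto
        moreover have "f i (x \<oplus>\<^bsub>V\<^esub> (\<ominus>\<^bsub>K\<^esub> c) \<odot>\<^bsub>V\<^esub> y) = \<zero>\<^bsub>K\<^esub>"
          using c yV xV i fy fx by (simp add: f_add f_smult c_def m_assoc l_minus R.r_neg)
        ultimately have 1: "x \<oplus>\<^bsub>V\<^esub> (\<ominus>\<^bsub>K\<^esub> c) \<odot>\<^bsub>V\<^esub> y \<in> span (insert y B)"
          using B span_is_monotone[of B "insert y B"] by auto
        have 2: "c \<odot>\<^bsub>V\<^esub> y \<in> span (insert y B)"
          using in_own_span[OF BV] c by auto
        have "x = (x \<oplus>\<^bsub>V\<^esub> (\<ominus>\<^bsub>K\<^esub> c) \<odot>\<^bsub>V\<^esub> y) \<oplus>\<^bsub>V\<^esub> c \<odot>\<^bsub>V\<^esub> y"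
          using xV yV c by (simp add: M.a_assoc smult_l_minus M.l_neg)
        with 1 2 show ?thesis by (metis S.m_closed)
      qed
      with B y show ?thesis by (intro exI[of _ "insert y B"]) auto
    qed
  qed
  from this[OF \<open>finite J\<close> subset_refl, of "carrier V"] inj obtain B
    where "finite B" "B \<subseteq> carrier V" "carrier V \<subseteq> span B"
    using module_axioms by (auto simp: submodule_def)
  with V show ?thesis by (blast intro: fdvs_span)
qed

text \<open>Coefficients with respect to a finite basis are unique once they are taken as
  extensional functions on it. Each identity for the coordinate map \<open>co\<close> thus becomes,
  through \<open>coI\<close>, the computation of a linear combination.\<close>

lemma fdvs_dual_basis:
  assumes "fdvs K V"
  obtains d z w where "dual_basis K V d z w"
proof -
  interpret vectorspace K V using assms by (rule fdvs_vs)
  obtain B where B: "finite B" "basis B"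
    using assms finite_basis_exists by (auto simp: fdvs_def)
  then have BV: "B \<subseteq> carrier V" by (simp add: basis_def)
  obtain h where h: "bij_betw h {..<card B} B"
    using ex_bij_betw_nat_finite[OF B(1)] by (auto simp: atLeast0LessThan)
  have ex1: "\<exists>!a. a \<in> B \<rightarrow>\<^sub>E carrier K \<and> lincomb a B = v" if "v \<in> carrier V" for v
    using basis_criterion[OF B(1) BV] B(2) that by blast
  define co where "co v = (THE a. a \<in> B \<rightarrow>\<^sub>E carrier K \<and> lincomb a B = v)" for v
  have co: "co v \<in> B \<rightarrow>\<^sub>E carrier K" "lincomb (co v) B = v" if "v \<in> carrier V" for v
    using theI'[OF ex1[OF that]] unfolding co_def by auto
  have coI: "co v = a" if "a \<in> B \<rightarrow>\<^sub>E carrier K" "lincomb a B = v" for v a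
  proof -
    have "v \<in> carrier V" using that BV by auto
    with ex1[OF this] that show ?thesis unfolding co_def by (intro the1_equality) auto
  qed
  have coK: "co v b \<in> carrier K" if "v \<in> carrier V" "b \<in> B" for v b
    using co(1)[OF that(1)] that(2) by auto
  have add: "co (u \<oplus>\<^bsub>V\<^esub> v) = (\<lambda>b\<in>B. co u b \<oplus>\<^bsub>K\<^esub> co v b)" if "u \<in> carrier V" "v \<in> carrier V" for u v
  proof (rule coI)
    have "lincomb (\<lambda>b\<in>B. co u b \<oplus>\<^bsub>K\<^esub> co v b) B = (\<Oplus>\<^bsub>V\<^esub>b\<in>B. co u b \<odot>\<^bsub>V\<^esub> b \<oplus>\<^bsub>V\<^esub> co v b \<odot>\<^bsub>V\<^esub> b)"
      unfolding lincomb_def using that BV coK by (intro M.finsum_cong') (auto simp: smult_l_distr)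
    also have "\<dots> = lincomb (co u) B \<oplus>\<^bsub>V\<^esub> lincomb (co v) B"
      unfolding lincomb_def using that BV coK by (intro M.finsum_addf) auto
    finally show "lincomb (\<lambda>b\<in>B. co u b \<oplus>\<^bsub>K\<^esub> co v b) B = u \<oplus>\<^bsub>V\<^esub> v"
      by (simp add: co that)
  qed (use that coK in auto)
  have smult: "co (c \<odot>\<^bsub>V\<^esub> v) = (\<lambda>b\<in>B. c \<otimes>\<^bsub>K\<^esub> co v b)" if "c \<in> carrier K" "v \<in> carrier V" for c v
  proof (rule coI)
    have "lincomb (\<lambda>b\<in>B. c \<otimes>\<^bsub>K\<^esub> co v b) B = (\<Oplus>\<^bsub>V\<^esub>b\<in>B. c \<odot>\<^bsub>V\<^esub> (co v b \<odot>\<^bsub>V\<^esub> b))"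
      unfolding lincomb_def using that BV coK by (intro M.finsum_cong') (auto simp: smult_assoc1)
    also have "\<dots> = c \<odot>\<^bsub>V\<^esub> lincomb (co v) B"
      unfolding lincomb_def using that BV coK by (intro finsum_smult[symmetric]) auto
    finally show "lincomb (\<lambda>b\<in>B. c \<otimes>\<^bsub>K\<^esub> co v b) B = c \<odot>\<^bsub>V\<^esub> v"
      by (simp add: co that)
  qed (use that coK in auto)
  have unit: "co b = (\<lambda>b'\<in>B. if b' = b then \<one>\<^bsub>K\<^esub> else \<zero>\<^bsub>K\<^esub>)" if b: "b \<in> B" for b
  proof (rule coI)
    have "lincomb (\<lambda>b'\<in>B. if b' = b then \<one>\<^bsub>K\<^esub> else \<zero>\<^bsub>K\<^esub>) B = (\<Oplus>\<^bsub>V\<^esub>b'\<in>B. if b = b' then b' else \<zero>\<^bsub>V\<^esub>)"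
      unfolding lincomb_def using that BV by (intro M.finsum_cong') auto
    also have "\<dots> = b"
      using M.finsum_singleton[OF b B(1), of "\<lambda>x. x"] BV by (auto simp: Pi_iff)
    finally show "lincomb (\<lambda>b'\<in>B. if b' = b then \<one>\<^bsub>K\<^esub> else \<zero>\<^bsub>K\<^esub>) B = b" .
  qed (use that in auto)
  have hB: "h i \<in> B" if "i < card B" for i
    using h that by (auto simp: bij_betw_def)
  have "dual_basis K V (card B) h (\<lambda>i x. co x (h i))"
    unfolding dual_basis_def
  proof (intro conjI allI impI ballI)
    fix i assume i: "i < card B"
    show "h i \<in> carrier V" using hB[OF i] BV by auto
    show "(\<lambda>x. co x (h i)) \<in> functionals K V"
      unfolding functionals_def by (rule module_homI) (auto simp: coK hB i add smult)
  next
    fix x assume x: "x \<in> carrier V"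
    have "(\<Oplus>\<^bsub>V\<^esub>i\<in>{..<card B}. co x (h i) \<odot>\<^bsub>V\<^esub> h i) = (\<Oplus>\<^bsub>V\<^esub>b\<in>h ` {..<card B}. co x b \<odot>\<^bsub>V\<^esub> b)"
      using h BV coK[OF x] hB by (intro M.finsum_reindex[symmetric]) (auto simp: bij_betw_def)
    also have "\<dots> = lincomb (co x) B" using h by (simp add: lincomb_def bij_betw_def)
    finally show "(\<Oplus>\<^bsub>V\<^esub>i\<in>{..<card B}. co x (h i) \<odot>\<^bsub>V\<^esub> h i) = x" by (simp add: co x)
  next
    fix i j assume ij: "i < card B" "j < card B"
    then have "h i = h j \<longleftrightarrow> i = j" using h by (auto simp: bij_betw_def inj_on_def)
    with ij show "co (h j) (h i) = (if i = j then \<one>\<^bsub>K\<^esub> else \<zero>\<^bsub>K\<^esub>)"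
      by (simp add: unit hB)
  qed
  then show thesis by (rule that)
qed

lemma fdvs_separating:
  assumes V: "fdvs K V" and "x \<in> carrier V" "y \<in> carrier V"
    and "\<And>f. f \<in> functionals K V \<Longrightarrow> f x = f y"
  shows "x = y"
proof -
  obtain d z w where dw: "dual_basis K V d z w" using V by (rule fdvs_dual_basis)
  interpret vectorspace K V using V by (rule fdvs_vs)
  have wxy: "w i x = w i y" if "i < d" for i using dw that assms(4) by (simp add: dual_basis_def)
  have "x = (\<Oplus>\<^bsub>V\<^esub>i\<in>{..<d}. w i x \<odot>\<^bsub>V\<^esub> z i)" using dw assms by (simp add: dual_basis_def)
  also have "\<dots> = (\<Oplus>\<^bsub>V\<^esub>i\<in>{..<d}. w i y \<odot>\<^bsub>V\<^esub> z i)"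
    using dw assms by (intro M.finsum_cong') (auto simp: dual_basis_def functionals_in wxy)
  also have "\<dots> = y" using dw assms by (simp add: dual_basis_def)
  finally show ?thesis .
qed

lemma fdvs_of_injection:
  assumes V: "vectorspace K V" and W: "fdvs K W" and f: "f \<in> module_hom K V W" and inj: "inj_on f (carrier V)"
  shows "fdvs K V"
proof -
  obtain d z w where dw: "dual_basis K W d z w" using W by (rule fdvs_dual_basis)
  interpret V: vectorspace K V by fact
  interpret W: vectorspace K W using W by (rule fdvs_vs)
  show ?thesis
  proof (rule fdvs_of_functionals[OF V, of "{..<d}" "\<lambda>i x. w i (f x)"])
    fix i assume "i \<in> {..<d}"
    then show "(\<lambda>x. w i (f x)) \<in> functionals K V"
      using dw module_hom_comp[OF f] by (auto simp: dual_basis_def functionals_def)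
  next
    fix x assume x: "x \<in> carrier V" and 0: "\<And>i. i \<in> {..<d} \<Longrightarrow> w i (f x) = \<zero>\<^bsub>K\<^esub>"
    have "f x = (\<Oplus>\<^bsub>W\<^esub>i\<in>{..<d}. w i (f x) \<odot>\<^bsub>W\<^esub> z i)"
      using dw module_hom_in[OF f x] by (simp add: dual_basis_def)
    also have "\<dots> = (\<Oplus>\<^bsub>W\<^esub>i\<in>{..<d}. \<zero>\<^bsub>W\<^esub>)"
      using dw by (intro W.M.finsum_cong') (auto simp: dual_basis_def 0)
    also have "\<dots> = f \<zero>\<^bsub>V\<^esub>" using module_hom_zero[OF V.module_axioms W.module_axioms f] by simp
    finally show "x = \<zero>\<^bsub>V\<^esub>" using inj x by (auto simp: inj_on_def)
  qed simp
qed

section \<open>Spaces of linear maps and of equivariant maps\<close>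

lemma mk_rep_simps [simp]:
  "carrier (mk_rep V a) = carrier V" "zero (mk_rep V a) = zero V" "add (mk_rep V a) = add V"
  "smult (mk_rep V a) = smult V" "act (mk_rep V a) = a"
  by (simp_all add: mk_rep_def module.defs rep.defs)

lemma module_truncate_simps [simp]:
  "carrier (module.truncate V) = carrier V" "zero (module.truncate V) = zero V"
  "add (module.truncate V) = add V" "smult (module.truncate V) = smult V"
  by (simp_all add: module.defs)

lemma finsum_cong_structure:
  "\<lbrakk>carrier V = carrier W; zero V = zero W; add V = add W\<rbrakk> \<Longrightarrow> finsum V f A = finsum W f A"
  by (simp add: finsum_def finprod_def)

lemma module_hom_cong:
  assumes "module K M" "\<And>x. x \<in> carrier M \<Longrightarrow> f x = g x" "g \<in> module_hom K M N"
  shows "f \<in> module_hom K M N"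
proof -
  interpret module K M by fact
  show ?thesis using assms(2,3) by (auto simp: module_hom_def)
qed

lemma fdvs_cong:
  assumes "fdvs K V" "carrier W = carrier V" "\<zero>\<^bsub>W\<^esub> = \<zero>\<^bsub>V\<^esub>" "add W = add V" "smult W = smult V"
  shows "fdvs K W"
  by (rule fdvs_image[OF assms(1) vectorspace_cong[OF fdvs_vs[OF assms(1)] assms(2-)], of "\<lambda>x. x"])
    (simp_all add: module_hom_def assms)

lemma fdvs_mk_rep [simp]: "fdvs K (mk_rep V a) \<longleftrightarrow> fdvs K V"
  by (auto elim: fdvs_cong)

lemma hom_space_simps [simp]:
  "\<zero>\<^bsub>hom_space K V W\<^esub> = (\<lambda>x\<in>carrier V. \<zero>\<^bsub>W\<^esub>)"
  "f \<oplus>\<^bsub>hom_space K V W\<^esub> g = (\<lambda>x\<in>carrier V. f x \<oplus>\<^bsub>W\<^esub> g x)"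
  "c \<odot>\<^bsub>hom_space K V W\<^esub> f = (\<lambda>x\<in>carrier V. c \<odot>\<^bsub>W\<^esub> f x)"
  by (simp_all add: hom_space_def)

lemma hom_space_carrier:
  "f \<in> carrier (hom_space K V W) \<longleftrightarrow> f \<in> module_hom K V W \<and> f \<in> extensional (carrier V)"
  by (simp add: hom_space_def)

lemma rep_hom_simps [simp]:
  "\<zero>\<^bsub>rep_hom n K V W\<^esub> = (\<lambda>x\<in>carrier V. \<zero>\<^bsub>W\<^esub>)"
  "f \<oplus>\<^bsub>rep_hom n K V W\<^esub> g = (\<lambda>x\<in>carrier V. f x \<oplus>\<^bsub>W\<^esub> g x)"
  "c \<odot>\<^bsub>rep_hom n K V W\<^esub> f = (\<lambda>x\<in>carrier V. c \<odot>\<^bsub>W\<^esub> f x)"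
  by (simp_all add: rep_hom_def)

lemma rep_hom_carrier:
  "f \<in> carrier (rep_hom n K V W) \<longleftrightarrow> f \<in> module_hom K V W \<and> f \<in> extensional (carrier V) \<and>
    (\<forall>g\<in>carrier (sym_group n). \<forall>x\<in>carrier V. f (act V g x) = act W g (f x))"
  by (auto simp: rep_hom_def hom_space_carrier)

lemma module_hom_restrict:
  assumes "module K V" "f \<in> module_hom K V W"
  shows "(\<lambda>x\<in>carrier V. f x) \<in> carrier (hom_space K V W)"
  using module_hom_cong[OF assms(1) _ assms(2), of "\<lambda>x\<in>carrier V. f x"] by (simp add: hom_space_carrier)

lemma module_hom_pointwise:
  assumes "vectorspace K V" "vectorspace K W"
  shows "(\<lambda>x\<in>carrier V. \<zero>\<^bsub>W\<^esub>) \<in> module_hom K V W"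
    and "\<lbrakk>f \<in> module_hom K V W; g \<in> module_hom K V W\<rbrakk> \<Longrightarrow> (\<lambda>x\<in>carrier V. f x \<oplus>\<^bsub>W\<^esub> g x) \<in> module_hom K V W"
    and "\<lbrakk>c \<in> carrier K; f \<in> module_hom K V W\<rbrakk> \<Longrightarrow> (\<lambda>x\<in>carrier V. c \<odot>\<^bsub>W\<^esub> f x) \<in> module_hom K V W"
proof -
  interpret V: vectorspace K V by fact
  interpret W: vectorspace K W by fact
  show "(\<lambda>x\<in>carrier V. \<zero>\<^bsub>W\<^esub>) \<in> module_hom K V W"
    by (rule module_homI) auto
  show "(\<lambda>x\<in>carrier V. f x \<oplus>\<^bsub>W\<^esub> g x) \<in> module_hom K V W"
    if "f \<in> module_hom K V W" "g \<in> module_hom K V W"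
    using that by (intro module_homI)
      (auto simp: module_hom_in module_hom_add module_hom_smult W.smult_r_distr W.M.a_ac)
  show "(\<lambda>x\<in>carrier V. c \<odot>\<^bsub>W\<^esub> f x) \<in> module_hom K V W"
    if "c \<in> carrier K" "f \<in> module_hom K V W"
    using that by (intro module_homI)
      (auto simp: module_hom_in module_hom_add module_hom_smult W.smult_r_distr W.smult_assoc1[symmetric] V.R.m_comm)
qed

lemma hom_space_vectorspace:
  assumes "vectorspace K V" "vectorspace K W"
  shows "vectorspace K (hom_space K V W)"
proof (rule pointwise_vectorspace[where I = "carrier V" and W = "\<lambda>_. W"])
  show "field K" using assms(1) by (simp add: vectorspace_def)
qed (use assms module_hom_pointwise[OF assms] in \<open>auto simp: hom_space_carrier module_hom_in\<close>)

context representation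
begin

lemma vectorspace: "vectorspace K M" using fdvs by (rule fdvs_vs)

lemma module: "module K M" using vectorspace by blast

lemma act_closed [simp]: "\<lbrakk>g \<in> carrier (sym_group n); x \<in> carrier M\<rbrakk> \<Longrightarrow> act M g x \<in> carrier M"
  using act_linear by (rule module_hom_in)

lemma act_zero: "g \<in> carrier (sym_group n) \<Longrightarrow> act M g \<zero>\<^bsub>M\<^esub> = \<zero>\<^bsub>M\<^esub>"
  using module_hom_zero[OF module module act_linear] .

lemma act_add: "\<lbrakk>g \<in> carrier (sym_group n); x \<in> carrier M; y \<in> carrier M\<rbrakk> \<Longrightarrow>
    act M g (x \<oplus>\<^bsub>M\<^esub> y) = act M g x \<oplus>\<^bsub>M\<^esub> act M g y"
  using module_hom_add[OF act_linear] .

lemma act_smult: "\<lbrakk>g \<in> carrier (sym_group n); c \<in> carrier K; x \<in> carrier M\<rbrakk> \<Longrightarrow>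
    act M g (c \<odot>\<^bsub>M\<^esub> x) = c \<odot>\<^bsub>M\<^esub> act M g x"
  using module_hom_smult[OF act_linear] .

end

lemma rep_hom_vectorspace:
  assumes "representation n K M" "representation n K N"
  shows "vectorspace K (rep_hom n K M N)"
proof -
  interpret M: representation n K M by fact
  interpret N: representation n K N by fact
  note MN = M.vectorspace N.vectorspace
  interpret MM: vectorspace K M by (rule MN)
  interpret NN: vectorspace K N by (rule MN)
  show ?thesis
  proof (rule pointwise_vectorspace[where I = "carrier M" and W = "\<lambda>_. N"])
    show "field K" by (rule MM.field_axioms)
  qed (use MN module_hom_pointwise[OF MN] in
      \<open>auto simp: rep_hom_carrier module_hom_in N.act_zero N.act_add N.act_smult\<close>)
qed

section \<open>The linear categories of spaces, representations and functors\<close>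

lemma lincategory_Vect: "field K \<Longrightarrow> lincategory K (Vect K)"
proof (rule lincategory.intro, goal_cases)
  case (1 X Y)
  then show ?case by (simp add: Vect_def hom_space_vectorspace fdvs_vs)
next
  case (2 X)
  then interpret vectorspace K X by (simp add: Vect_def fdvs_vs)
  show ?case by (auto simp: Vect_def hom_space_carrier intro!: module_homI)
next
  case (3 X Y Z g)
  then interpret X: vectorspace K X by (simp add: Vect_def fdvs_vs)
  show ?case using 3 by (intro module_homI)
    (auto simp: Vect_def hom_space_carrier compose_def module_hom_add module_hom_smult module_hom_in
      intro!: module_homI)
next
  case (4 X Y Z f)
  then interpret X: vectorspace K X by (simp add: Vect_def fdvs_vs)
  show ?case using 4 by (intro module_homI)
    (auto simp: Vect_def hom_space_carrier compose_def module_hom_add module_hom_smult module_hom_in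
      intro!: module_homI)
next
  case (5 W X Y Z f g h)
  then show ?case by (auto simp: Vect_def compose_def hom_space_carrier module_hom_in)
next
  case (6 X Y f)
  then show ?case by (auto simp: Vect_def compose_def hom_space_carrier module_hom_in extensional_def)
next
  case (7 X Y f)
  then show ?case by (auto simp: Vect_def compose_def hom_space_carrier module_hom_in extensional_def)
qed

lemma lincategory_Rep: "field K \<Longrightarrow> lincategory K (Rep n K)"
proof (rule lincategory.intro, goal_cases)
  case (1 X Y)
  then show ?case by (simp add: Rep_def rep_hom_vectorspace)
next
  case (2 X)
  then interpret representation n K X by (simp add: Rep_def)
  interpret vectorspace K X by (rule vectorspace)
  show ?case by (auto simp: Rep_def rep_hom_carrier intro!: module_homI)
next
  case (3 X Y Z g)
  then interpret rX: representation n K X by (simp add: Rep_def)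
  interpret X: vectorspace K X by (rule rX.vectorspace)
  show ?case using 3 by (intro module_homI)
    (auto simp: Rep_def rep_hom_carrier compose_def module_hom_add module_hom_smult module_hom_in
      intro!: module_homI)
next
  case (4 X Y Z f)
  then interpret rX: representation n K X by (simp add: Rep_def)
  interpret X: vectorspace K X by (rule rX.vectorspace)
  show ?case using 4 by (intro module_homI)
    (auto simp: Rep_def rep_hom_carrier compose_def module_hom_add module_hom_smult module_hom_in
      intro!: module_homI)
next
  case (5 W X Y Z f g h)
  then show ?case by (auto simp: Rep_def compose_def rep_hom_carrier module_hom_in)
next
  case (6 X Y f)
  then show ?case by (auto simp: Rep_def compose_def rep_hom_carrier module_hom_in extensional_def)
next
  case (7 X Y f)
  then show ?case by (auto simp: Rep_def compose_def rep_hom_carrier module_hom_in extensional_def)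
qed

lemma (in lincategory) Cmp_arr:
  "\<lbrakk>X \<in> Ob C; Y \<in> Ob C; Z \<in> Ob C; f \<in> arr C X Y; g \<in> arr C Y Z\<rbrakk> \<Longrightarrow> Cmp C X Y Z g f \<in> arr C X Z"
  using Cmp_linear_left by (rule module_hom_in)

text \<open>Meant for \<open>Gamma n K\<close>, whose hom spaces and composition are those of
  \<open>Rep n K\<close> read along the tensor power, with spaces as objects. All axioms are
  inherited through the map \<open>T\<close> on objects.\<close>

lemma lincategory_pullback:
  assumes "lincategory K C" and "\<And>X. X \<in> Ob D \<Longrightarrow> T X \<in> Ob C"
    and "\<And>X Y. \<lbrakk>X \<in> Ob D; Y \<in> Ob D\<rbrakk> \<Longrightarrow> Mor D X Y = Mor C (T X) (T Y)"
    and "\<And>X. X \<in> Ob D \<Longrightarrow> Id D X = Id C (T X)"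
    and "\<And>X Y Z f g. \<lbrakk>X \<in> Ob D; Y \<in> Ob D; Z \<in> Ob D; f \<in> arr D X Y; g \<in> arr D Y Z\<rbrakk> \<Longrightarrow>
      Cmp D X Y Z g f = Cmp C (T X) (T Y) (T Z) g f"
  shows "lincategory K D"
proof -
  interpret C: lincategory K C by fact
  note A = assms(2-)
  show ?thesis
  proof (rule lincategory.intro, goal_cases)
    case (3 X Y Z g)
    interpret module K "Mor C (T X) (T Y)" using C.Mor_vs 3 A by blast
    show ?case
      by (rule module_hom_cong[where g = "\<lambda>f. Cmp C (T X) (T Y) (T Z) g f"])
        (use 3 in \<open>auto simp: A module_axioms C.Cmp_linear_left\<close>)
  next
    case (4 X Y Z f)
    interpret module K "Mor C (T Y) (T Z)" using C.Mor_vs 4 A by blast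
    show ?case
      by (rule module_hom_cong[where g = "\<lambda>g. Cmp C (T X) (T Y) (T Z) g f"])
        (use 4 in \<open>auto simp: A module_axioms C.Cmp_linear_right\<close>)
  next
    case (5 W X Y Z f g h)
    then show ?case using C.Cmp_assoc[of "T W" "T X" "T Y" "T Z"] by (simp add: A C.Cmp_arr)
  qed (auto simp: A C.Mor_vs C.Id_arr C.Id_left C.Id_right)
qed

lemma lincategory_full_subcat: "lincategory K C \<Longrightarrow> lincategory K (full_subcat C P)"
  by (auto simp: lincategory_def full_subcat_def)

lemma full_subcat_simps [simp]:
  "Ob (full_subcat C P) = {X \<in> Ob C. P X}" "Mor (full_subcat C P) = Mor C"
  "Id (full_subcat C P) = Id C" "Cmp (full_subcat C P) = Cmp C"
  by (simp_all add: full_subcat_def)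

lemma full_subcat_functor:
  assumes F: "is_functor K C D F" and PQ: "\<And>X. \<lbrakk>X \<in> Ob C; P X\<rbrakk> \<Longrightarrow> Q (omap F X)"
  shows "is_functor K (full_subcat C P) (full_subcat D Q) F"
proof -
  interpret F: is_functor K C D F by (rule F)
  show ?thesis
    by (intro is_functor.intro is_functor_axioms.intro lincategory_full_subcat F.source.lincategory_axioms F.target.lincategory_axioms)
      (auto simp: PQ F.omap_Ob F.mmap_arr F.mmap_Id F.mmap_Cmp)
qed

lemma full_subcat_True [simp]: "full_subcat C (\<lambda>_. True) = C"
  by (simp add: full_subcat_def)

lemma nat_transI:
  assumes "\<And>X. X \<in> Ob C \<Longrightarrow> a X \<in> arr D (omap F X) (omap G X)" "a \<in> extensional (Ob C)"
    and "\<And>X Y f. \<lbrakk>X \<in> Ob C; Y \<in> Ob C; f \<in> arr C X Y\<rbrakk> \<Longrightarrow>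
       Cmp D (omap F X) (omap F Y) (omap G Y) (a Y) (mmap F X Y f) =
       Cmp D (omap F X) (omap G X) (omap G Y) (mmap G X Y f) (a X)"
  shows "a \<in> nat_trans C D F G"
  using assms by (auto simp: nat_trans_def PiE_def)

lemma nat_transD:
  assumes "a \<in> nat_trans C D F G"
  shows "X \<in> Ob C \<Longrightarrow> a X \<in> arr D (omap F X) (omap G X)" "a \<in> extensional (Ob C)"
    and "\<lbrakk>X \<in> Ob C; Y \<in> Ob C; f \<in> arr C X Y\<rbrakk> \<Longrightarrow>
       Cmp D (omap F X) (omap F Y) (omap G Y) (a Y) (mmap F X Y f) =
       Cmp D (omap F X) (omap G X) (omap G Y) (mmap G X Y f) (a X)"
  using assms by (auto simp: nat_trans_def PiE_def)

lemma functor_cat_simps: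
  "Ob (functor_cat K C D) = {F. is_linear_functor K C D F}"
  "arr (functor_cat K C D) F G = nat_trans C D F G"
  "Id (functor_cat K C D) F = (\<lambda>X\<in>Ob C. Id D (omap F X))"
  "Cmp (functor_cat K C D) F G H b a = (\<lambda>X\<in>Ob C. Cmp D (omap F X) (omap G X) (omap H X) (b X) (a X))"
  "\<zero>\<^bsub>Mor (functor_cat K C D) F G\<^esub> = (\<lambda>X\<in>Ob C. \<zero>\<^bsub>Mor D (omap F X) (omap G X)\<^esub>)"
  "a \<oplus>\<^bsub>Mor (functor_cat K C D) F G\<^esub> b = (\<lambda>X\<in>Ob C. a X \<oplus>\<^bsub>Mor D (omap F X) (omap G X)\<^esub> b X)"
  "c \<odot>\<^bsub>Mor (functor_cat K C D) F G\<^esub> a = (\<lambda>X\<in>Ob C. c \<odot>\<^bsub>Mor D (omap F X) (omap G X)\<^esub> a X)"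
  by (simp_all add: functor_cat_def)

lemma is_linear_functor_functor: "is_linear_functor K C D F \<Longrightarrow> is_functor K C D F"
  by (simp add: is_linear_functor_def)

text \<open>Vertical composites are natural by pasting two squares; everything else, including
  bilinearity of composition, holds componentwise in D.\<close>

lemma lincategory_functor_cat:
  assumes "lincategory K C" "lincategory K D" "field K"
  shows "lincategory K (functor_cat K C D)"
proof -
  interpret C: lincategory K C by fact
  interpret D: lincategory K D by fact
  have fD: "omap F X \<in> Ob D" if "is_linear_functor K C D F" "X \<in> Ob C" for F X
    using is_functor.omap_Ob[OF is_linear_functor_functor] that .
  have mD: "mmap F X Y f \<in> arr D (omap F X) (omap F Y)"
    if "is_linear_functor K C D F" "X \<in> Ob C" "Y \<in> Ob C" "f \<in> arr C X Y" for F X Y f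
    using is_functor.mmap_arr[OF is_linear_functor_functor] that .
  have vs: "module K (Mor D (omap F X) (omap G Y))"
    if "is_linear_functor K C D F" "is_linear_functor K C D G" "X \<in> Ob C" "Y \<in> Ob C" for F G X Y
    using D.Mor_vs fD that by blast
  note addL = module_hom_add[OF D.Cmp_linear_left] and addR = module_hom_add[OF D.Cmp_linear_right]
    and smL = module_hom_smult[OF D.Cmp_linear_left] and smR = module_hom_smult[OF D.Cmp_linear_right]
  have cmp: "(\<lambda>X\<in>Ob C. Cmp D (omap F X) (omap G X) (omap H X) (b X) (a X)) \<in> nat_trans C D F H"
    if F: "is_linear_functor K C D F" and G: "is_linear_functor K C D G" and H: "is_linear_functor K C D H"
      and a: "a \<in> nat_trans C D F G" and b: "b \<in> nat_trans C D G H" for F G H a b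
  proof (rule nat_transI, goal_cases)
    case (3 X Y f)
    have "Cmp D (omap F X) (omap F Y) (omap H Y) (Cmp D (omap F Y) (omap G Y) (omap H Y) (b Y) (a Y)) (mmap F X Y f) =
      Cmp D (omap F X) (omap G Y) (omap H Y) (b Y) (Cmp D (omap F X) (omap F Y) (omap G Y) (a Y) (mmap F X Y f))"
      using 3 nat_transD(1)[OF a] nat_transD(1)[OF b] by (simp add: D.Cmp_assoc fD F G H mD F)
    also have "\<dots> = Cmp D (omap F X) (omap G Y) (omap H Y) (b Y) (Cmp D (omap F X) (omap G X) (omap G Y) (mmap G X Y f) (a X))"
      using 3 nat_transD(3)[OF a] by simp
    also have "\<dots> = Cmp D (omap F X) (omap G X) (omap H Y) (Cmp D (omap G X) (omap G Y) (omap H Y) (b Y) (mmap G X Y f)) (a X)"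
      using 3 nat_transD(1)[OF a] nat_transD(1)[OF b] by (simp add: D.Cmp_assoc fD F G H mD G)
    also have "\<dots> = Cmp D (omap F X) (omap G X) (omap H Y) (Cmp D (omap G X) (omap H X) (omap H Y) (mmap H X Y f) (b X)) (a X)"
      using 3 nat_transD(3)[OF b] by simp
    also have "\<dots> = Cmp D (omap F X) (omap H X) (omap H Y) (mmap H X Y f) (Cmp D (omap F X) (omap G X) (omap H X) (b X) (a X))"
      using 3 nat_transD(1)[OF a] nat_transD(1)[OF b] by (simp add: D.Cmp_assoc fD F G H mD H)
    finally show ?case using 3 by simp
  qed (use nat_transD(1)[OF a] nat_transD(1)[OF b] in \<open>auto simp: D.Cmp_arr fD F G H\<close>)
  show ?thesis
  proof (rule lincategory.intro, goal_cases)
    case (1 F G)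
    then have F: "is_linear_functor K C D F" and G: "is_linear_functor K C D G"
      by (simp_all add: functor_cat_simps)
    show ?case
    proof (rule pointwise_vectorspace[where I = "Ob C" and W = "\<lambda>X. Mor D (omap F X) (omap G X)"], goal_cases)
      case 8
      show ?case unfolding functor_cat_simps
      proof (rule nat_transI, goal_cases)
        case (1 X)
        then interpret module K "Mor D (omap F X) (omap G X)" by (simp add: vs F G)
        show ?case using 1 by simp
      next
        case (3 X Y f)
        have "Cmp D (omap F X) (omap F Y) (omap G Y) \<zero>\<^bsub>Mor D (omap F Y) (omap G Y)\<^esub> (mmap F X Y f) = \<zero>\<^bsub>Mor D (omap F X) (omap G Y)\<^esub>"
          using 3 by (intro module_hom_zero[OF vs vs D.Cmp_linear_right] F G fD mD)
        moreover have "Cmp D (omap F X) (omap G X) (omap G Y) (mmap G X Y f) \<zero>\<^bsub>Mor D (omap F X) (omap G X)\<^esub> = \<zero>\<^bsub>Mor D (omap F X) (omap G Y)\<^esub>"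
          using 3 by (intro module_hom_zero[OF vs vs D.Cmp_linear_left] F G fD mD)
        ultimately show ?case using 3 by simp
      qed simp
    next
      case (9 a b)
      then have ab: "a \<in> nat_trans C D F G" "b \<in> nat_trans C D F G" by (simp_all add: functor_cat_simps)
      note D = nat_transD[OF ab(1)] nat_transD[OF ab(2)]
      show ?case unfolding functor_cat_simps
      proof (rule nat_transI, goal_cases)
        case (1 X)
        then interpret module K "Mor D (omap F X) (omap G X)" by (simp add: vs F G)
        show ?case using 1 D by simp
      next
        case (3 X Y f)
        then show ?case using D by (simp add: addL addR fD mD F G)
      qed simp
    next
      case (10 c a)
      then have ab: "a \<in> nat_trans C D F G" by (simp_all add: functor_cat_simps)
      note D = nat_transD[OF ab(1)]
      show ?case unfolding functor_cat_simps
      proof (rule nat_transI, goal_cases)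
        case (1 X)
        then interpret module K "Mor D (omap F X) (omap G X)" by (simp add: vs F G)
        show ?case using 1 D 10(1) by simp
      next
        case (3 X Y f)
        then show ?case using D 10(1) by (simp add: smL smR fD mD F G)
      qed simp
    qed (auto simp: functor_cat_simps assms D.Mor_vs fD F G dest: nat_transD)
  next
    case (2 F)
    then have F: "is_linear_functor K C D F" by (simp_all add: functor_cat_simps)
    show ?case unfolding functor_cat_simps
      by (rule nat_transI) (auto simp: D.Id_arr fD F mD D.Id_left D.Id_right)
  next
    case (3 F G H b)
    then have F: "is_linear_functor K C D F" and G: "is_linear_functor K C D G" and H: "is_linear_functor K C D H"
      and b: "b \<in> nat_trans C D G H"
      by (simp_all add: functor_cat_simps)
    note fD' = fD[OF F] fD[OF G] fD[OF H]
    show ?case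
    proof (rule module_homI, goal_cases)
      case (1 a)
      then have a: "a \<in> nat_trans C D F G" by (simp add: functor_cat_simps)
      show ?case unfolding functor_cat_simps by (rule cmp[OF F G H a b])
    next
      case (2 a a')
      then have a: "a \<in> nat_trans C D F G" "a' \<in> nat_trans C D F G" by (simp_all add: functor_cat_simps)
      show ?case unfolding functor_cat_simps
        using nat_transD(1)[OF a(1)] nat_transD(1)[OF a(2)] nat_transD(1)[OF b]
        by (intro restrict_ext) (simp add: addL fD')
    next
      case (3 c a)
      then have a: "a \<in> nat_trans C D F G" by (simp_all add: functor_cat_simps)
      show ?case unfolding functor_cat_simps
        using nat_transD(1)[OF a(1)] nat_transD(1)[OF b] 3(1)
        by (intro restrict_ext) (simp add: smL fD')
    qed
  next
    case (4 F G H a)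
    then have F: "is_linear_functor K C D F" and G: "is_linear_functor K C D G" and H: "is_linear_functor K C D H"
      and a: "a \<in> nat_trans C D F G"
      by (simp_all add: functor_cat_simps)
    note fD' = fD[OF F] fD[OF G] fD[OF H]
    show ?case
    proof (rule module_homI, goal_cases)
      case (1 b)
      then have b: "b \<in> nat_trans C D G H" by (simp add: functor_cat_simps)
      show ?case unfolding functor_cat_simps by (rule cmp[OF F G H a b])
    next
      case (2 b b')
      then have b: "b \<in> nat_trans C D G H" "b' \<in> nat_trans C D G H" by (simp_all add: functor_cat_simps)
      show ?case unfolding functor_cat_simps
        using nat_transD(1)[OF b(1)] nat_transD(1)[OF b(2)] nat_transD(1)[OF a]
        by (intro restrict_ext) (simp add: addR fD')
    next
      case (3 c b)
      then have b: "b \<in> nat_trans C D G H" by (simp_all add: functor_cat_simps)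
      show ?case unfolding functor_cat_simps
        using nat_transD(1)[OF b(1)] nat_transD(1)[OF a] 3(1)
        by (intro restrict_ext) (simp add: smR fD')
    qed
  next
    case (5 F G H I a b c)
    then show ?case by (auto simp: functor_cat_simps nat_transD(1) D.Cmp_assoc fD intro!: restrict_ext)
  next
    case (6 F G a)
    then show ?case
      by (auto simp: functor_cat_simps fD nat_transD(1) D.Id_left intro!: extensionalityI[OF _ nat_transD(2)])
  next
    case (7 F G a)
    then show ?case
      by (auto simp: functor_cat_simps fD nat_transD(1) D.Id_right intro!: extensionalityI[OF _ nat_transD(2)])
  qed
qed

lemma copy_vs_simps:
  "carrier (copy_vs X) = enc (carrier X) ` carrier X"
  "\<zero>\<^bsub>copy_vs X\<^esub> = enc (carrier X) \<zero>\<^bsub>X\<^esub>"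
  "a \<oplus>\<^bsub>copy_vs X\<^esub> b = enc (carrier X) (dec (carrier X) a \<oplus>\<^bsub>X\<^esub> dec (carrier X) b)"
  "c \<odot>\<^bsub>copy_vs X\<^esub> a = enc (carrier X) (c \<odot>\<^bsub>X\<^esub> dec (carrier X) a)"
  by (simp_all add: copy_vs_def Let_def)

lemma copy_rep_simps [simp]:
  "carrier (copy_rep M) = carrier (copy_vs M)" "\<zero>\<^bsub>copy_rep M\<^esub> = \<zero>\<^bsub>copy_vs M\<^esub>"
  "add (copy_rep M) = add (copy_vs M)" "smult (copy_rep M) = smult (copy_vs M)"
  "act (copy_rep M) = (\<lambda>g a. enc (carrier M) (act M g (dec (carrier M) a)))"
  by (simp_all add: copy_rep_def)

section \<open>Isomorphisms\<close>

lemma is_iso_full_subcat [simp]: "is_iso (full_subcat C P) = is_iso C"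
  by (simp add: is_iso_def full_subcat_def fun_eq_iff)

lemma bij_inv_module_hom:
  assumes "module K V" "f \<in> module_hom K V W" "bij_betw f (carrier V) (carrier W)"
  shows "inv_into (carrier V) f \<in> module_hom K W V"
proof -
  interpret module K V by fact
  have i: "inv_into (carrier V) f y \<in> carrier V" "f (inv_into (carrier V) f y) = y" if "y \<in> carrier W" for y
    using assms(3) that by (auto simp: bij_betw_def inv_into_into f_inv_into_f)
  have j: "inv_into (carrier V) f (f x) = x" if "x \<in> carrier V" for x
    using assms(3) that by (auto simp: bij_betw_def)
  show ?thesis
  proof (rule module_homI)
    fix x y assume "x \<in> carrier W" "y \<in> carrier W"
    then show "inv_into (carrier V) f (x \<oplus>\<^bsub>W\<^esub> y) = inv_into (carrier V) f x \<oplus>\<^bsub>V\<^esub> inv_into (carrier V) f y"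
      using j[of "inv_into (carrier V) f x \<oplus>\<^bsub>V\<^esub> inv_into (carrier V) f y"] i
      by (simp add: module_hom_add[OF assms(2)])
  next
    fix c x assume "c \<in> carrier K" "x \<in> carrier W"
    then show "inv_into (carrier V) f (c \<odot>\<^bsub>W\<^esub> x) = c \<odot>\<^bsub>V\<^esub> inv_into (carrier V) f x"
      using j[of "c \<odot>\<^bsub>V\<^esub> inv_into (carrier V) f x"] i
      by (simp add: module_hom_smult[OF assms(2)])
  qed (simp add: i)
qed

lemma Vect_simps:
  "Ob (Vect K) = {V. fdvs K V}" "Mor (Vect K) = hom_space K"
  "Id (Vect K) V = (\<lambda>x\<in>carrier V. x)" "Cmp (Vect K) U V W g f = compose (carrier U) g f"
  by (simp_all add: Vect_def)

lemma Rep_simps: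
  "Ob (Rep n K) = {M. representation n K M}" "Mor (Rep n K) = rep_hom n K"
  "Id (Rep n K) M = (\<lambda>x\<in>carrier M. x)" "Cmp (Rep n K) L M N g f = compose (carrier L) g f"
  by (simp_all add: Rep_def)

lemma Vect_isoI:
  assumes "fdvs K V" "fdvs K W" "f \<in> carrier (hom_space K V W)" "bij_betw f (carrier V) (carrier W)"
  shows "is_iso (Vect K) V W f"
proof -
  interpret V: vectorspace K V using assms(1) by (rule fdvs_vs)
  interpret W: vectorspace K W using assms(2) by (rule fdvs_vs)
  have f: "f \<in> module_hom K V W" using assms by (simp add: hom_space_carrier)
  have i: "inv_into (carrier V) f y \<in> carrier V" "f (inv_into (carrier V) f y) = y" if "y \<in> carrier W" for y
    using assms(4) that by (auto simp: bij_betw_def inv_into_into f_inv_into_f)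
  have j: "inv_into (carrier V) f (f x) = x" if "x \<in> carrier V" for x
    using assms(4) that by (auto simp: bij_betw_def)
  show ?thesis
    unfolding is_iso_def Vect_simps
    by (intro conjI assms(3) bexI[OF _ module_hom_restrict[OF W.module_axioms bij_inv_module_hom[OF V.module_axioms f assms(4)]]])
      (auto simp: compose_def i j module_hom_in[OF f] intro!: restrict_ext)
qed

lemma Rep_isoI:
  assumes "representation n K V" "representation n K W" "f \<in> carrier (rep_hom n K V W)"
    "bij_betw f (carrier V) (carrier W)"
  shows "is_iso (Rep n K) V W f"
proof -
  interpret rV: representation n K V by fact
  interpret rW: representation n K W by fact
  interpret V: vectorspace K V by (rule rV.vectorspace)
  interpret W: vectorspace K W by (rule rW.vectorspace)
  have f: "f \<in> module_hom K V W" using assms by (simp add: rep_hom_carrier)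
  have i: "inv_into (carrier V) f y \<in> carrier V" "f (inv_into (carrier V) f y) = y" if "y \<in> carrier W" for y
    using assms(4) that by (auto simp: bij_betw_def inv_into_into f_inv_into_f)
  have j: "inv_into (carrier V) f (f x) = x" if "x \<in> carrier V" for x
    using assms(4) that by (auto simp: bij_betw_def)
  have "inv_into (carrier V) f (act W g y) = act V g (inv_into (carrier V) f y)"
    if "g \<in> carrier (sym_group n)" "y \<in> carrier W" for g y
    using j[of "act V g (inv_into (carrier V) f y)"] i that assms(3) by (simp add: rep_hom_carrier)
  then have r: "restrict (inv_into (carrier V) f) (carrier W) \<in> carrier (rep_hom n K W V)"
    using module_hom_restrict[OF W.module_axioms bij_inv_module_hom[OF V.module_axioms f assms(4)]]
    by (simp add: rep_hom_carrier hom_space_carrier)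
  show ?thesis
    unfolding is_iso_def Rep_simps
    by (intro conjI assms(3) bexI[OF _ r])
      (auto simp: compose_def i j module_hom_in[OF f] intro!: restrict_ext)
qed

text \<open>Pointwise inverses are automatically natural: insert the identity as \<open>a X\<close>
  after \<open>b X\<close>, use the naturality of \<open>a\<close>, and cancel \<open>b Y\<close>
  against \<open>a Y\<close>. The chosen family is restricted to the objects because transformations
  are extensional.\<close>

lemma inverse_nat_trans:
  assumes F: "is_functor K C D F" and G: "is_functor K C D G" and a: "a \<in> nat_trans C D F G"
    and iso: "\<And>X. X \<in> Ob C \<Longrightarrow> is_iso D (omap F X) (omap G X) (a X)"
  shows "\<exists>b\<in>nat_trans C D G F. \<forall>X\<in>Ob C. Cmp D (omap F X) (omap G X) (omap F X) (b X) (a X) = Id D (omap F X) \<and>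
    Cmp D (omap G X) (omap F X) (omap G X) (a X) (b X) = Id D (omap G X)"
proof -
  interpret F: is_functor K C D F by fact
  interpret G: is_functor K C D G by fact
  have "\<forall>X\<in>Ob C. \<exists>b. b \<in> arr D (omap G X) (omap F X) \<and>
      Cmp D (omap F X) (omap G X) (omap F X) b (a X) = Id D (omap F X) \<and>
      Cmp D (omap G X) (omap F X) (omap G X) (a X) b = Id D (omap G X)"
    using iso by (auto simp: is_iso_def)
  then obtain b' where b': "\<forall>X\<in>Ob C. b' X \<in> arr D (omap G X) (omap F X) \<and>
      Cmp D (omap F X) (omap G X) (omap F X) (b' X) (a X) = Id D (omap F X) \<and>
      Cmp D (omap G X) (omap F X) (omap G X) (a X) (b' X) = Id D (omap G X)"
    by (auto dest!: bchoice)
  define b where "b = restrict b' (Ob C)"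
  have b: "b X \<in> arr D (omap G X) (omap F X)"
    "Cmp D (omap F X) (omap G X) (omap F X) (b X) (a X) = Id D (omap F X)"
    "Cmp D (omap G X) (omap F X) (omap G X) (a X) (b X) = Id D (omap G X)" if "X \<in> Ob C" for X
    using b' that by (simp_all add: b_def)
  note Fo = F.omap_Ob G.omap_Ob F.mmap_arr G.mmap_arr and aD = nat_transD[OF a]
  note T = F.target.Cmp_assoc F.target.Cmp_arr F.target.Id_left F.target.Id_right
  have "b \<in> nat_trans C D G F"
  proof (rule nat_transI, goal_cases)
    case (3 X Y f)
    let ?Fx = "omap F X" and ?Fy = "omap F Y" and ?Gx = "omap G X" and ?Gy = "omap G Y"
    have "Cmp D ?Gx ?Gy ?Fy (b Y) (mmap G X Y f) =
       Cmp D ?Gx ?Gy ?Fy (b Y) (Cmp D ?Gx ?Gx ?Gy (mmap G X Y f) (Cmp D ?Gx ?Fx ?Gx (a X) (b X)))"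
      using 3 by (simp add: b T Fo)
    also have "\<dots> = Cmp D ?Gx ?Gy ?Fy (b Y) (Cmp D ?Gx ?Fx ?Gy (Cmp D ?Fx ?Gx ?Gy (mmap G X Y f) (a X)) (b X))"
      using 3 by (simp add: T(1)[symmetric] Fo b aD(1))
    also have "\<dots> = Cmp D ?Gx ?Gy ?Fy (b Y) (Cmp D ?Gx ?Fx ?Gy (Cmp D ?Fx ?Fy ?Gy (a Y) (mmap F X Y f)) (b X))"
      using 3 by (simp add: aD(3))
    also have "\<dots> = Cmp D ?Gx ?Fy ?Fy (Cmp D ?Fy ?Gy ?Fy (b Y) (a Y)) (Cmp D ?Gx ?Fx ?Fy (mmap F X Y f) (b X))"
      using 3 by (simp add: T(1)[symmetric] T(2) Fo b(1) aD(1))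
    also have "\<dots> = Cmp D ?Gx ?Fx ?Fy (mmap F X Y f) (b X)"
      using 3 by (simp add: T b Fo)
    finally show ?case .
  qed (auto simp: b(1), simp add: b_def)
  then show ?thesis using b(2,3) by blast
qed

lemma functor_cat_isoI:
  assumes F: "is_functor K C D F" and G: "is_functor K C D G"
    and a: "a \<in> nat_trans C D F G" and iso: "\<And>X. X \<in> Ob C \<Longrightarrow> is_iso D (omap F X) (omap G X) (a X)"
  shows "is_iso (functor_cat K C D) F G a"
proof -
  obtain b where "b \<in> nat_trans C D G F"
    and inv: "\<forall>X\<in>Ob C. Cmp D (omap F X) (omap G X) (omap F X) (b X) (a X) = Id D (omap F X) \<and>
      Cmp D (omap G X) (omap F X) (omap G X) (a X) (b X) = Id D (omap G X)"
    using inverse_nat_trans[OF assms] by (rule bexE)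
  then show ?thesis
    unfolding is_iso_def functor_cat_simps
    using a inv by (intro conjI bexI[of _ b]) (auto intro!: restrict_ext)
qed

section \<open>Functors and transformations with values in vector spaces, element by element\<close>

lemma Vect_functor:
  assumes F: "is_linear_functor K C (Vect K) F"
  shows "X \<in> Ob C \<Longrightarrow> fdvs K (omap F X)"
    and "\<lbrakk>X \<in> Ob C; Y \<in> Ob C; u \<in> arr C X Y\<rbrakk> \<Longrightarrow> mmap F X Y u \<in> module_hom K (omap F X) (omap F Y)"
    and "\<lbrakk>X \<in> Ob C; Y \<in> Ob C; u \<in> arr C X Y\<rbrakk> \<Longrightarrow> mmap F X Y u \<in> extensional (carrier (omap F X))"
    and "\<lbrakk>X \<in> Ob C; x \<in> carrier (omap F X)\<rbrakk> \<Longrightarrow> mmap F X X (Id C X) x = x"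
    and "\<lbrakk>X \<in> Ob C; Y \<in> Ob C; Z \<in> Ob C; u \<in> arr C X Y; v \<in> arr C Y Z; x \<in> carrier (omap F X)\<rbrakk> \<Longrightarrow>
      mmap F X Z (Cmp C X Y Z v u) x = mmap F Y Z v (mmap F X Y u x)"
    and "\<lbrakk>X \<in> Ob C; Y \<in> Ob C; u \<in> arr C X Y; v \<in> arr C X Y; x \<in> carrier (omap F X)\<rbrakk> \<Longrightarrow>
      mmap F X Y (u \<oplus>\<^bsub>Mor C X Y\<^esub> v) x = mmap F X Y u x \<oplus>\<^bsub>omap F Y\<^esub> mmap F X Y v x"
    and "\<lbrakk>X \<in> Ob C; Y \<in> Ob C; u \<in> arr C X Y; c \<in> carrier K; x \<in> carrier (omap F X)\<rbrakk> \<Longrightarrow>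
      mmap F X Y (c \<odot>\<^bsub>Mor C X Y\<^esub> u) x = c \<odot>\<^bsub>omap F Y\<^esub> mmap F X Y u x"
proof -
  interpret is_linear_functor K C "Vect K" F by fact
  show "X \<in> Ob C \<Longrightarrow> fdvs K (omap F X)" using omap_Ob by (simp add: Vect_simps)
  show "\<lbrakk>X \<in> Ob C; Y \<in> Ob C; u \<in> arr C X Y\<rbrakk> \<Longrightarrow> mmap F X Y u \<in> module_hom K (omap F X) (omap F Y)"
    "\<lbrakk>X \<in> Ob C; Y \<in> Ob C; u \<in> arr C X Y\<rbrakk> \<Longrightarrow> mmap F X Y u \<in> extensional (carrier (omap F X))"
    using mmap_arr by (simp_all add: Vect_simps hom_space_carrier)
  show "\<lbrakk>X \<in> Ob C; x \<in> carrier (omap F X)\<rbrakk> \<Longrightarrow> mmap F X X (Id C X) x = x"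
    by (simp add: mmap_Id Vect_simps)
  show "\<lbrakk>X \<in> Ob C; Y \<in> Ob C; Z \<in> Ob C; u \<in> arr C X Y; v \<in> arr C Y Z; x \<in> carrier (omap F X)\<rbrakk> \<Longrightarrow>
      mmap F X Z (Cmp C X Y Z v u) x = mmap F Y Z v (mmap F X Y u x)"
    by (simp add: mmap_Cmp Vect_simps compose_def)
  show "\<lbrakk>X \<in> Ob C; Y \<in> Ob C; u \<in> arr C X Y; v \<in> arr C X Y; x \<in> carrier (omap F X)\<rbrakk> \<Longrightarrow>
      mmap F X Y (u \<oplus>\<^bsub>Mor C X Y\<^esub> v) x = mmap F X Y u x \<oplus>\<^bsub>omap F Y\<^esub> mmap F X Y v x"
    using module_hom_add[OF mmap_linear] by (simp add: Vect_simps)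
  show "\<lbrakk>X \<in> Ob C; Y \<in> Ob C; u \<in> arr C X Y; c \<in> carrier K; x \<in> carrier (omap F X)\<rbrakk> \<Longrightarrow>
      mmap F X Y (c \<odot>\<^bsub>Mor C X Y\<^esub> u) x = c \<odot>\<^bsub>omap F Y\<^esub> mmap F X Y u x"
    using module_hom_smult[OF mmap_linear] by (simp add: Vect_simps)
qed

lemma Vect_functorI:
  assumes C: "lincategory K C" and K: "field K"
    and "\<And>X. X \<in> Ob C \<Longrightarrow> fdvs K (omap F X)"
    and hom: "\<And>X Y u. \<lbrakk>X \<in> Ob C; Y \<in> Ob C; u \<in> arr C X Y\<rbrakk> \<Longrightarrow> mmap F X Y u \<in> module_hom K (omap F X) (omap F Y)"
    and ext: "\<And>X Y u. \<lbrakk>X \<in> Ob C; Y \<in> Ob C; u \<in> arr C X Y\<rbrakk> \<Longrightarrow> mmap F X Y u \<in> extensional (carrier (omap F X))"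
    and "\<And>X x. \<lbrakk>X \<in> Ob C; x \<in> carrier (omap F X)\<rbrakk> \<Longrightarrow> mmap F X X (Id C X) x = x"
    and "\<And>X Y Z u v x. \<lbrakk>X \<in> Ob C; Y \<in> Ob C; Z \<in> Ob C; u \<in> arr C X Y; v \<in> arr C Y Z; x \<in> carrier (omap F X)\<rbrakk> \<Longrightarrow>
      mmap F X Z (Cmp C X Y Z v u) x = mmap F Y Z v (mmap F X Y u x)"
    and "\<And>X Y u v x. \<lbrakk>X \<in> Ob C; Y \<in> Ob C; u \<in> arr C X Y; v \<in> arr C X Y; x \<in> carrier (omap F X)\<rbrakk> \<Longrightarrow>
      mmap F X Y (u \<oplus>\<^bsub>Mor C X Y\<^esub> v) x = mmap F X Y u x \<oplus>\<^bsub>omap F Y\<^esub> mmap F X Y v x"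
    and "\<And>X Y u c x. \<lbrakk>X \<in> Ob C; Y \<in> Ob C; u \<in> arr C X Y; c \<in> carrier K; x \<in> carrier (omap F X)\<rbrakk> \<Longrightarrow>
      mmap F X Y (c \<odot>\<^bsub>Mor C X Y\<^esub> u) x = c \<odot>\<^bsub>omap F Y\<^esub> mmap F X Y u x"
  shows "is_linear_functor K C (Vect K) F"
proof -
  interpret C: lincategory K C by fact
  have sm: "c \<odot>\<^bsub>Mor C X Y\<^esub> u \<in> arr C X Y" if "X \<in> Ob C" "Y \<in> Ob C" "u \<in> arr C X Y" "c \<in> carrier K" for X Y u c
  proof -
    interpret vectorspace K "Mor C X Y" using C.Mor_vs that by blast
    show ?thesis using that by simp
  qed
  have ad: "u \<oplus>\<^bsub>Mor C X Y\<^esub> v \<in> arr C X Y" if "X \<in> Ob C" "Y \<in> Ob C" "u \<in> arr C X Y" "v \<in> arr C X Y" for X Y u v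
  proof -
    interpret vectorspace K "Mor C X Y" using C.Mor_vs that by blast
    show ?thesis using that by simp
  qed
  note A = assms(3-)
  show ?thesis
  proof (intro is_linear_functor.intro is_functor.intro is_functor_axioms.intro is_linear_functor_axioms.intro
      C lincategory_Vect K, goal_cases)
    case (3 X)
    then show ?case
      by (intro extensionalityI[OF ext]) (auto simp: A C.Id_arr Vect_simps)
  next
    case (4 X Y Z f g)
    then show ?case
      by (intro extensionalityI[OF ext]) (auto simp: A C.Cmp_arr Vect_simps compose_def)
  next
    case (5 X Y)
    show ?case
    proof (rule module_homI, goal_cases)
      case (2 u v)
      with 5 show ?case by (intro extensionalityI[OF ext]) (auto simp: A ad Vect_simps)
    next
      case (3 c u)
      with 5 show ?case by (intro extensionalityI[OF ext]) (auto simp: A sm Vect_simps)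
    qed (use 5 in \<open>simp add: Vect_simps hom_space_carrier hom ext\<close>)
  qed (simp_all add: Vect_simps A hom_space_carrier)
qed

lemma Vect_nat:
  assumes "a \<in> nat_trans C (Vect K) F G"
  shows "X \<in> Ob C \<Longrightarrow> a X \<in> module_hom K (omap F X) (omap G X)"
    and "X \<in> Ob C \<Longrightarrow> a X \<in> extensional (carrier (omap F X))"
    and "\<lbrakk>X \<in> Ob C; Y \<in> Ob C; u \<in> arr C X Y; x \<in> carrier (omap F X)\<rbrakk> \<Longrightarrow>
      a Y (mmap F X Y u x) = mmap G X Y u (a X x)"
proof -
  show "X \<in> Ob C \<Longrightarrow> a X \<in> module_hom K (omap F X) (omap G X)"
    "X \<in> Ob C \<Longrightarrow> a X \<in> extensional (carrier (omap F X))"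
    using nat_transD(1)[OF assms] by (simp_all add: Vect_simps hom_space_carrier)
  show "\<lbrakk>X \<in> Ob C; Y \<in> Ob C; u \<in> arr C X Y; x \<in> carrier (omap F X)\<rbrakk> \<Longrightarrow>
      a Y (mmap F X Y u x) = mmap G X Y u (a X x)"
    using fun_cong[OF nat_transD(3)[OF assms], of X Y u x] by (simp add: Vect_simps compose_def)
qed

lemma Vect_natI:
  assumes "\<And>X. X \<in> Ob C \<Longrightarrow> a X \<in> module_hom K (omap F X) (omap G X)"
    and "\<And>X. X \<in> Ob C \<Longrightarrow> a X \<in> extensional (carrier (omap F X))" "a \<in> extensional (Ob C)"
    and "\<And>X Y u x. \<lbrakk>X \<in> Ob C; Y \<in> Ob C; u \<in> arr C X Y; x \<in> carrier (omap F X)\<rbrakk> \<Longrightarrow>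
      a Y (mmap F X Y u x) = mmap G X Y u (a X x)"
  shows "a \<in> nat_trans C (Vect K) F G"
  by (rule nat_transI) (use assms in \<open>auto simp: Vect_simps hom_space_carrier compose_def intro!: restrict_ext\<close>)

lemma Vect_nat_eqI:
  assumes "a \<in> nat_trans C (Vect K) F G" "b \<in> nat_trans C (Vect K) F G"
    and "\<And>X x. \<lbrakk>X \<in> Ob C; x \<in> carrier (omap F X)\<rbrakk> \<Longrightarrow> a X x = b X x"
  shows "a = b"
  using assms by (intro extensionalityI[OF nat_transD(2) nat_transD(2)] extensionalityI[OF Vect_nat(2) Vect_nat(2)]) auto

section \<open>Coded copies inside the universe\<close>

locale universe = field K for K :: "('k, 'z) ring_scheme" +
  fixes e :: "'k list \<Rightarrow> 'v"
  assumes inj_e: "inj e"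
begin

text \<open>\<open>enc\<close> is a choice, so it is injective as soon as some injection of the
  carrier into 'v exists. One is obtained by listing the coordinates with respect to a basis and
  applying \<open>e\<close> to the list.\<close>

lemma inj_enc:
  assumes "fdvs K X"
  shows "inj_on (enc (carrier X) :: 'x \<Rightarrow> 'v) (carrier (X :: ('k, 'x, 'y) module_scheme))"
proof -
  obtain d z w where dw: "dual_basis K X d z w" using assms by (rule fdvs_dual_basis)
  interpret vectorspace K X using assms by (rule fdvs_vs)
  have "inj_on (\<lambda>x. e (map (\<lambda>i. w i x) [0..<d])) (carrier X)"
  proof (rule inj_onI)
    fix x y assume x: "x \<in> carrier X" and y: "y \<in> carrier X"
      and "e (map (\<lambda>i. w i x) [0..<d]) = e (map (\<lambda>i. w i y) [0..<d])"
    then have w: "w i x = w i y" if "i < d" for i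
      using that by (auto dest: injD[OF inj_e])
    have "x = (\<Oplus>\<^bsub>X\<^esub>i\<in>{..<d}. w i x \<odot>\<^bsub>X\<^esub> z i)" using dw x by (simp add: dual_basis_def)
    also have "\<dots> = (\<Oplus>\<^bsub>X\<^esub>i\<in>{..<d}. w i y \<odot>\<^bsub>X\<^esub> z i)"
      using dw y by (intro M.finsum_cong') (auto simp: dual_basis_def functionals_in w)
    also have "\<dots> = y" using dw y by (simp add: dual_basis_def)
    finally show "x = y" .
  qed
  then show ?thesis unfolding enc_def by (rule someI[of "\<lambda>\<phi>. inj_on \<phi> (carrier X)"])
qed

lemma dec_enc [simp]:
  "\<lbrakk>fdvs K X; x \<in> carrier X\<rbrakk> \<Longrightarrow> dec (carrier X) (enc (carrier X) x :: 'v) = x"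
  by (simp add: dec_def inv_into_f_f[OF inj_enc])

lemma copy_vs_fdvs: "fdvs K X \<Longrightarrow> fdvs K (copy_vs X :: ('k, 'v) module)"
  and enc_hom: "fdvs K X \<Longrightarrow> enc (carrier X) \<in> module_hom K X (copy_vs X :: ('k, 'v) module)"
proof -
  assume X: "fdvs K X"
  note v = vectorspace_image[OF fdvs_vs[OF X], of "copy_vs X :: ('k, 'v) module" "enc (carrier X)"]
  have 1: "vectorspace K (copy_vs X :: ('k, 'v) module)"
    by (rule v) (auto simp: copy_vs_simps X)
  show 2: "enc (carrier X) \<in> module_hom K X (copy_vs X :: ('k, 'v) module)"
    by (rule v) (auto simp: copy_vs_simps X)
  show "fdvs K (copy_vs X :: ('k, 'v) module)"
    by (rule fdvs_image[OF X 1 2]) (auto simp: copy_vs_simps)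
qed

lemma enc_in [simp]: "x \<in> carrier X \<Longrightarrow> enc (carrier X) x \<in> carrier (copy_vs X :: ('k, 'v) module)"
  by (simp add: copy_vs_simps)

lemma copy_carrierE:
  assumes "a \<in> carrier (copy_vs X :: ('k, 'v) module)"
  obtains x where "x \<in> carrier X" "a = enc (carrier X) x"
  using assms by (auto simp: copy_vs_simps)

lemma dec_in [simp]: "\<lbrakk>fdvs K X; a \<in> carrier (copy_vs X :: ('k, 'v) module)\<rbrakk> \<Longrightarrow> dec (carrier X) a \<in> carrier X"
  by (auto elim!: copy_carrierE)

lemma enc_dec [simp]: "\<lbrakk>fdvs K X; a \<in> carrier (copy_vs X :: ('k, 'v) module)\<rbrakk> \<Longrightarrow> enc (carrier X) (dec (carrier X) a) = a"
  by (auto elim!: copy_carrierE)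

lemma enc_eq_iff: "\<lbrakk>fdvs K X; x \<in> carrier X; y \<in> carrier X\<rbrakk> \<Longrightarrow> (enc (carrier X) x :: 'v) = enc (carrier X) y \<longleftrightarrow> x = y"
  using inj_enc by (auto simp: inj_on_def)

lemma enc_bij: "fdvs K X \<Longrightarrow> bij_betw (enc (carrier X)) (carrier X) (carrier (copy_vs X :: ('k, 'v) module))"
  by (simp add: bij_betw_def inj_enc copy_vs_simps)

lemma dec_hom: "fdvs K X \<Longrightarrow> dec (carrier X) \<in> module_hom K (copy_vs X :: ('k, 'v) module) X"
  using bij_inv_module_hom[OF _ enc_hom enc_bij] fdvs_vs by (auto simp: dec_def)

lemma enc_add: "\<lbrakk>fdvs K X; x \<in> carrier X; y \<in> carrier X\<rbrakk> \<Longrightarrow>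
    (enc (carrier X) (x \<oplus>\<^bsub>X\<^esub> y) :: 'v) = enc (carrier X) x \<oplus>\<^bsub>copy_vs X\<^esub> enc (carrier X) y"
  using module_hom_add[OF enc_hom] .

lemma enc_smult: "\<lbrakk>fdvs K X; c \<in> carrier K; x \<in> carrier X\<rbrakk> \<Longrightarrow>
    (enc (carrier X) (c \<odot>\<^bsub>X\<^esub> x) :: 'v) = c \<odot>\<^bsub>copy_vs X\<^esub> enc (carrier X) x"
  using module_hom_smult[OF enc_hom] .

lemma copy_map_enc [simp]: "\<lbrakk>fdvs K X; x \<in> carrier X\<rbrakk> \<Longrightarrow>
    copy_map X Y f (enc (carrier X) x :: 'v) = (enc (carrier Y) (f x) :: 'v)"
  by (simp add: copy_map_def)

lemma copy_map_ext [simp]: "copy_map X Y f \<in> extensional (carrier (copy_vs X))"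
  by (simp add: copy_map_def)

lemma copy_map_hom:
  assumes "fdvs K X" "fdvs K Y" "f \<in> module_hom K X Y"
  shows "copy_map X Y f \<in> module_hom K (copy_vs X :: ('k, 'v) module) (copy_vs Y :: ('k, 'v) module)"
proof -
  interpret module K "copy_vs X :: ('k, 'v) module" using copy_vs_fdvs[OF assms(1)] fdvs_vs by blast
  show ?thesis
    by (rule module_hom_cong[OF _ _ module_hom_comp[OF dec_hom module_hom_comp[OF assms(3) enc_hom]]])
      (auto simp: assms copy_map_def module_axioms)
qed

lemma copy_map_bij:
  assumes "fdvs K X" "fdvs K Y" "bij_betw f (carrier X) (carrier Y)"
  shows "bij_betw (copy_map X Y f) (carrier (copy_vs X :: ('k, 'v) module)) (carrier (copy_vs Y :: ('k, 'v) module))"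
proof -
  have "bij_betw (dec (carrier X)) (carrier (copy_vs X :: ('k, 'v) module)) (carrier X)"
    unfolding dec_def using enc_bij[OF assms(1)] by (rule bij_betw_inv_into)
  from bij_betw_trans[OF this bij_betw_trans[OF assms(3) enc_bij[OF assms(2)]]]
  show ?thesis by (simp add: copy_map_def bij_betw_restrict_eq comp_def)
qed

text \<open>The functors h_M and t_M and the values of c_* all consist of coded spaces with coded
  maps. With an arbitrary family of spaces \<open>S\<close> and maps \<open>s\<close>, functoriality
  and naturality can be checked before coding.\<close>

definition copy_fctr :: "('o \<Rightarrow> ('k, 'x, 'y) module_scheme) \<Rightarrow> ('o \<Rightarrow> 'o \<Rightarrow> 'm \<Rightarrow> 'x \<Rightarrow> 'x) \<Rightarrow>
    ('o, 'm, ('k, 'v) module, 'v \<Rightarrow> 'v) fctr" where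
  "copy_fctr S s = \<lparr>omap = \<lambda>X. copy_vs (S X), mmap = \<lambda>X Y f. copy_map (S X) (S Y) (s X Y f)\<rparr>"

lemma copy_fctr_simps [simp]:
  "omap (copy_fctr S s) X = copy_vs (S X)" "mmap (copy_fctr S s) X Y f = copy_map (S X) (S Y) (s X Y f)"
  by (simp_all add: copy_fctr_def)

lemma copy_fctr_linear:
  assumes C: "lincategory K C" and S: "\<And>X. X \<in> Ob C \<Longrightarrow> fdvs K (S X)"
    and s: "\<And>X Y u. \<lbrakk>X \<in> Ob C; Y \<in> Ob C; u \<in> arr C X Y\<rbrakk> \<Longrightarrow> s X Y u \<in> module_hom K (S X) (S Y)"
    and Id: "\<And>X x. \<lbrakk>X \<in> Ob C; x \<in> carrier (S X)\<rbrakk> \<Longrightarrow> s X X (Id C X) x = x"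
    and Cmp: "\<And>X Y Z u v x. \<lbrakk>X \<in> Ob C; Y \<in> Ob C; Z \<in> Ob C; u \<in> arr C X Y; v \<in> arr C Y Z; x \<in> carrier (S X)\<rbrakk> \<Longrightarrow>
      s X Z (Cmp C X Y Z v u) x = s Y Z v (s X Y u x)"
    and add: "\<And>X Y u v x. \<lbrakk>X \<in> Ob C; Y \<in> Ob C; u \<in> arr C X Y; v \<in> arr C X Y; x \<in> carrier (S X)\<rbrakk> \<Longrightarrow>
      s X Y (u \<oplus>\<^bsub>Mor C X Y\<^esub> v) x = s X Y u x \<oplus>\<^bsub>S Y\<^esub> s X Y v x"
    and smult: "\<And>X Y u c x. \<lbrakk>X \<in> Ob C; Y \<in> Ob C; u \<in> arr C X Y; c \<in> carrier K; x \<in> carrier (S X)\<rbrakk> \<Longrightarrow>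
      s X Y (c \<odot>\<^bsub>Mor C X Y\<^esub> u) x = c \<odot>\<^bsub>S Y\<^esub> s X Y u x"
  shows "is_linear_functor K C (Vect K) (copy_fctr S s)"
proof (rule Vect_functorI[OF C field_axioms])
  have in': "s X Y u x \<in> carrier (S Y)" if "X \<in> Ob C" "Y \<in> Ob C" "u \<in> arr C X Y" "x \<in> carrier (S X)" for X Y u x
    using module_hom_in[OF s] that by blast
  show "\<And>X Y Z u v a. \<lbrakk>X \<in> Ob C; Y \<in> Ob C; Z \<in> Ob C; u \<in> arr C X Y; v \<in> arr C Y Z; a \<in> carrier (omap (copy_fctr S s) X)\<rbrakk> \<Longrightarrow>
      mmap (copy_fctr S s) X Z (Cmp C X Y Z v u) a = mmap (copy_fctr S s) Y Z v (mmap (copy_fctr S s) X Y u a)"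
    by (auto simp: S Cmp in' elim!: copy_carrierE)
  show "\<And>X Y u v a. \<lbrakk>X \<in> Ob C; Y \<in> Ob C; u \<in> arr C X Y; v \<in> arr C X Y; a \<in> carrier (omap (copy_fctr S s) X)\<rbrakk> \<Longrightarrow>
      mmap (copy_fctr S s) X Y (u \<oplus>\<^bsub>Mor C X Y\<^esub> v) a = mmap (copy_fctr S s) X Y u a \<oplus>\<^bsub>omap (copy_fctr S s) Y\<^esub> mmap (copy_fctr S s) X Y v a"
    by (auto simp: S add in' enc_add elim!: copy_carrierE)
  show "\<And>X Y u c a. \<lbrakk>X \<in> Ob C; Y \<in> Ob C; u \<in> arr C X Y; c \<in> carrier K; a \<in> carrier (omap (copy_fctr S s) X)\<rbrakk> \<Longrightarrow>
      mmap (copy_fctr S s) X Y (c \<odot>\<^bsub>Mor C X Y\<^esub> u) a = c \<odot>\<^bsub>omap (copy_fctr S s) Y\<^esub> mmap (copy_fctr S s) X Y u a"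
    by (auto simp: S smult in' enc_smult elim!: copy_carrierE)
qed (auto simp: S s Id copy_vs_fdvs copy_map_hom elim!: copy_carrierE)

lemma copy_nat:
  assumes S: "\<And>X. X \<in> Ob C \<Longrightarrow> fdvs K (S X)" and S': "\<And>X. X \<in> Ob C \<Longrightarrow> fdvs K (S' X)"
    and s: "\<And>X Y u. \<lbrakk>X \<in> Ob C; Y \<in> Ob C; u \<in> arr C X Y\<rbrakk> \<Longrightarrow> s X Y u \<in> module_hom K (S X) (S Y)"
    and a: "\<And>X. X \<in> Ob C \<Longrightarrow> a X \<in> module_hom K (S X) (S' X)"
    and nat: "\<And>X Y u x. \<lbrakk>X \<in> Ob C; Y \<in> Ob C; u \<in> arr C X Y; x \<in> carrier (S X)\<rbrakk> \<Longrightarrow>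
      a Y (s X Y u x) = s' X Y u (a X x)"
  shows "(\<lambda>X\<in>Ob C. copy_map (S X) (S' X) (a X)) \<in> nat_trans C (Vect K) (copy_fctr S s) (copy_fctr S' s')"
proof -
  have "s X Y u x \<in> carrier (S Y)" if "X \<in> Ob C" "Y \<in> Ob C" "u \<in> arr C X Y" "x \<in> carrier (S X)" for X Y u x
    using module_hom_in[OF s] that by blast
  moreover have "a X x \<in> carrier (S' X)" if "X \<in> Ob C" "x \<in> carrier (S X)" for X x
    using module_hom_in[OF a] that by blast
  ultimately show ?thesis
    by (intro Vect_natI) (auto simp: S S' copy_map_hom a nat elim!: copy_carrierE)
qed

end

section \<open>Spans of pure tensors\<close>

lemma module_hom_mk_rep [simp]:
  "module_hom K (mk_rep V a) W = module_hom K V W" "module_hom K W (mk_rep V a) = module_hom K W V"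
  by (simp_all add: module_hom_def)

text \<open>Used with U a span, it proves that tensors of basis vectors span, one factor at a time;
  used with U = 0, it proves that a linear map vanishing on a basis is zero.\<close>

lemma hom_basis_submodule:
  assumes dw: "dual_basis K V d z w" and V: "vectorspace K V" and W: "vectorspace K W" and f: "f \<in> module_hom K V W"
    and U: "submodule K U W" "\<And>i. i < d \<Longrightarrow> f (z i) \<in> U" and x: "x \<in> carrier V"
  shows "f x \<in> U"
proof -
  interpret V: vectorspace K V by fact
  interpret W: vectorspace K W by fact
  interpret U: submodule K U W by fact
  have "f x = f (\<Oplus>\<^bsub>V\<^esub>i\<in>{..<d}. w i x \<odot>\<^bsub>V\<^esub> z i)" using dw x by (simp add: dual_basis_def)
  also have "\<dots> = (\<Oplus>\<^bsub>W\<^esub>i\<in>{..<d}. f (w i x \<odot>\<^bsub>V\<^esub> z i))"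
    using dw x by (intro module_hom_finsum[OF V.module_axioms W.module_axioms f]) (auto simp: dual_basis_def functionals_in)
  also have "\<dots> \<in> U"
    using dw x U by (intro submodule_finsum) (auto simp: dual_basis_def functionals_in module_hom_smult[OF f])
  finally show ?thesis .
qed

lemma func_space_simps [simp]:
  assumes "field K"
  shows "carrier (ring.func_space K B) = B \<rightarrow>\<^sub>E carrier K"
    "\<zero>\<^bsub>ring.func_space K B\<^esub> = (\<lambda>b\<in>B. \<zero>\<^bsub>K\<^esub>)"
    "f \<oplus>\<^bsub>ring.func_space K B\<^esub> g = (\<lambda>b\<in>B. f b \<oplus>\<^bsub>K\<^esub> g b)"
    "c \<odot>\<^bsub>ring.func_space K B\<^esub> f = (\<lambda>b\<in>B. c \<otimes>\<^bsub>K\<^esub> f b)"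
proof -
  interpret field K by fact
  show "carrier (ring.func_space K B) = B \<rightarrow>\<^sub>E carrier K"
    "\<zero>\<^bsub>ring.func_space K B\<^esub> = (\<lambda>b\<in>B. \<zero>\<^bsub>K\<^esub>)"
    "f \<oplus>\<^bsub>ring.func_space K B\<^esub> g = (\<lambda>b\<in>B. f b \<oplus>\<^bsub>K\<^esub> g b)"
    "c \<odot>\<^bsub>ring.func_space K B\<^esub> f = (\<lambda>b\<in>B. c \<otimes>\<^bsub>K\<^esub> f b)"
    by (simp_all add: func_space_def)
qed

lemma func_space_vectorspace: "field K \<Longrightarrow> vectorspace K (ring.func_space K B)"
proof -
  assume "field K"
  then interpret field K .
  interpret V: vectorspace K "scalars K" by (rule scalars_vectorspace)
  show ?thesis by (rule V.func_space_is_vs)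
qed

lemma func_space_fdvs:
  assumes "field K" "finite B"
  shows "fdvs K (ring.func_space K B)"
proof -
  interpret field K by fact
  note [simp] = func_space_simps[OF assms(1)]
  show ?thesis
  proof (rule fdvs_of_functionals[OF func_space_vectorspace[OF assms(1)] assms(2), of "\<lambda>b f. f b"])
    fix f assume "f \<in> carrier (ring.func_space K B)" "\<And>b. b \<in> B \<Longrightarrow> f b = \<zero>\<^bsub>K\<^esub>"
    then show "f = \<zero>\<^bsub>ring.func_space K B\<^esub>" by (auto simp: PiE_def intro!: extensionalityI[of _ B])
  qed (auto simp: functionals_def intro!: module_homI)
qed

text \<open>The part of the tensor construction shared by products of two factors and by powers:
  \<open>P\<close> is the set of tuples, \<open>B\<close> the set of forms on them. Multilinearity
  enters in the two instances; here a form is any K-valued function on tuples.\<close>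

locale pure_forms = field K for K :: "('k, 'z) ring_scheme" +
  fixes B :: "('p \<Rightarrow> 'k) set" and P :: "'p set"
  assumes form_in: "\<lbrakk>b \<in> B; p \<in> P\<rbrakk> \<Longrightarrow> b p \<in> carrier K"
begin

abbreviation "PS \<equiv> pure_span K B P"

lemma pure_carrier: "p \<in> P \<Longrightarrow> pure B p \<in> carrier (ring.func_space K B)"
  by (auto simp: func_space_simps[OF field_axioms] pure_def form_in)

interpretation FS: vectorspace K "ring.func_space K B"
  by (rule func_space_vectorspace) (rule field_axioms)

lemma ops [simp]:
  "\<zero>\<^bsub>PS\<^esub> = (\<lambda>b\<in>B. \<zero>\<^bsub>K\<^esub>)" "s \<oplus>\<^bsub>PS\<^esub> t = (\<lambda>b\<in>B. s b \<oplus>\<^bsub>K\<^esub> t b)" "c \<odot>\<^bsub>PS\<^esub> t = (\<lambda>b\<in>B. c \<otimes>\<^bsub>K\<^esub> t b)"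
  using func_space_simps[OF field_axioms] by (simp_all add: pure_span_def)

lemma pures: "pure B ` P \<subseteq> carrier (ring.func_space K B)"
  using pure_carrier by auto

lemma vs: "vectorspace K PS"
proof -
  have "subspace K (FS.span (pure B ` P)) (ring.func_space K B)"
    by (simp add: subspace_def FS.vectorspace_axioms FS.span_is_submodule pures)
  then show ?thesis
    unfolding pure_span_def by (rule FS.subspace_is_vs)
qed

sublocale PS: vectorspace K PS
  by (rule vs)

lemma pure_in: "p \<in> P \<Longrightarrow> pure B p \<in> carrier PS"
  using FS.in_own_span[OF pures] by (auto simp: pure_span_def)

lemma pure_apply [simp]: "b \<in> B \<Longrightarrow> pure B p b = b p"
  by (simp add: pure_def)

lemma PS_subset: "carrier PS \<subseteq> B \<rightarrow>\<^sub>E carrier K"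
  using FS.span_is_subset2[OF pures] func_space_simps(1)[OF field_axioms, of B] by (simp add: pure_span_def)

lemma PS_in: "\<lbrakk>t \<in> carrier PS; b \<in> B\<rbrakk> \<Longrightarrow> t b \<in> carrier K"
  using PS_subset by (auto simp: PiE_def)

lemma induct [consumes 1, case_names zero pure add smult]:
  assumes "t \<in> carrier PS" "Q \<zero>\<^bsub>PS\<^esub>" "\<And>p. p \<in> P \<Longrightarrow> Q (pure B p)"
    "\<And>s t. \<lbrakk>s \<in> carrier PS; t \<in> carrier PS; Q s; Q t\<rbrakk> \<Longrightarrow> Q (s \<oplus>\<^bsub>PS\<^esub> t)"
    "\<And>c t. \<lbrakk>c \<in> carrier K; t \<in> carrier PS; Q t\<rbrakk> \<Longrightarrow> Q (c \<odot>\<^bsub>PS\<^esub> t)"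
  shows "Q t"
proof -
  have op: "\<zero>\<^bsub>PS\<^esub> = \<zero>\<^bsub>ring.func_space K B\<^esub>" "add PS = add (ring.func_space K B)"
    "smult PS = smult (ring.func_space K B)" "carrier PS = FS.span (pure B ` P)"
    by (simp_all add: pure_span_def)
  have "t \<in> carrier PS \<and> Q t"
  proof (rule span_induct[where P = "\<lambda>t. t \<in> carrier PS \<and> Q t", OF FS.module_axioms pures])
    show "t \<in> FS.span (pure B ` P)" using assms(1) op by simp
    show "\<zero>\<^bsub>func_space B\<^esub> \<in> carrier PS \<and> Q \<zero>\<^bsub>func_space B\<^esub>"
      using assms(2) PS.M.zero_closed unfolding op by blast
    show "s \<in> carrier PS \<and> Q s" if "s \<in> pure B ` P" for s
      using that assms(3) pure_in by auto
    show "s \<oplus>\<^bsub>func_space B\<^esub> t \<in> carrier PS \<and> Q (s \<oplus>\<^bsub>func_space B\<^esub> t)"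
      if "s \<in> carrier PS \<and> Q s" "t \<in> carrier PS \<and> Q t" for s t
      using that assms(4)[of s t] PS.M.a_closed[of s t] unfolding op by blast
    show "c \<odot>\<^bsub>func_space B\<^esub> t \<in> carrier PS \<and> Q (c \<odot>\<^bsub>func_space B\<^esub> t)"
      if "c \<in> carrier K" "t \<in> carrier PS \<and> Q t" for c t
      using that assms(5)[of c t] PS.smult_closed[of c t] unfolding op by blast
  qed
  then show ?thesis by simp
qed

lemma hom_eq:
  assumes "f \<in> module_hom K PS W" "g \<in> module_hom K PS W" "module K W"
    "\<And>p. p \<in> P \<Longrightarrow> f (pure B p) = g (pure B p)" "t \<in> carrier PS"
  shows "f t = g t"
  using assms(5)
proof (induct rule: induct)
  case zero
  show ?case using module_hom_zero[OF PS.module_axioms assms(3)] assms(1,2) by metis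
qed (simp_all add: assms(4) module_hom_add[OF assms(1)] module_hom_add[OF assms(2)]
    module_hom_smult[OF assms(1)] module_hom_smult[OF assms(2)] del: ops)

lemma eval_functional: "b \<in> B \<Longrightarrow> (\<lambda>t. t b) \<in> functionals K PS"
  unfolding functionals_def by (rule module_homI) (auto simp: PS_in)

text \<open>Universal property, obtained from a relation instead of a quotient: \<open>Q t y\<close>
  says that every functional w takes on y the value of t at the form w after f. Such a y exists for
  pure tensors and hence on their span; it is unique because functionals separate the points of a
  finite-dimensional W.\<close>

lemma lift:
  assumes W: "fdvs K W" and f: "\<And>p. p \<in> P \<Longrightarrow> f p \<in> carrier W"
    and forms: "\<And>w. w \<in> functionals K W \<Longrightarrow> \<exists>b\<in>B. \<forall>p\<in>P. b p = w (f p)"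
  obtains h where "h \<in> module_hom K PS W" "\<And>p. p \<in> P \<Longrightarrow> h (pure B p) = f p"
proof -
  interpret W: vectorspace K W using W by (rule fdvs_vs)
  have "\<forall>w\<in>functionals K W. \<exists>b. b \<in> B \<and> (\<forall>p\<in>P. b p = w (f p))"
    using forms by blast
  then obtain b where b': "\<forall>w\<in>functionals K W. b w \<in> B \<and> (\<forall>p\<in>P. b w p = w (f p))"
    by (auto dest!: bchoice)
  then have b: "b w \<in> B" "\<And>p. p \<in> P \<Longrightarrow> b w p = w (f p)" if "w \<in> functionals K W" for w
    using that by auto
  define Q where "Q t y \<longleftrightarrow> y \<in> carrier W \<and> (\<forall>w\<in>functionals K W. w y = t (b w))" for t y
  have fun0: "w \<zero>\<^bsub>W\<^esub> = \<zero>\<^bsub>K\<^esub>" if "w \<in> functionals K W" for w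
    using module_hom_zero[OF W.module_axioms _, of "scalars K" w] that scalars_vectorspace
    by (auto simp: functionals_def)
  have Q0: "Q \<zero>\<^bsub>PS\<^esub> \<zero>\<^bsub>W\<^esub>" by (auto simp: Q_def fun0 b)
  have Qp: "Q (pure B p) (f p)" if "p \<in> P" for p using that f by (auto simp: Q_def b)
  have Qa: "Q (s \<oplus>\<^bsub>PS\<^esub> t) (x \<oplus>\<^bsub>W\<^esub> y)" if "Q s x" "Q t y" for s t x y
    using that by (auto simp: Q_def b functionals_def module_hom_add)
  have Qs: "Q (c \<odot>\<^bsub>PS\<^esub> t) (c \<odot>\<^bsub>W\<^esub> y)" if "c \<in> carrier K" "Q t y" for c t y
    using that by (auto simp: Q_def b functionals_def module_hom_smult)
  have Qu: "x = y" if "Q t x" "Q t y" for t x y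
    using that by (intro fdvs_separating[OF W]) (auto simp: Q_def)
  have ex: "\<exists>y. Q t y" if "t \<in> carrier PS" for t
    using that by (induct rule: induct) (use Q0 Qp Qa Qs in blast)+
  define h where "h t = (THE y. Q t y)" for t
  have h: "h t = y" if "Q t y" for t y
    unfolding h_def using that Qu by blast
  have Qh: "Q t (h t)" if "t \<in> carrier PS" for t
    using ex[OF that] h by auto
  show thesis
  proof (rule that)
    show "h \<in> module_hom K PS W"
    proof (rule module_homI)
      show "h t \<in> carrier W" if "t \<in> carrier PS" for t using Qh[OF that] by (simp add: Q_def)
      show "h (s \<oplus>\<^bsub>PS\<^esub> t) = h s \<oplus>\<^bsub>W\<^esub> h t" if "s \<in> carrier PS" "t \<in> carrier PS" for s t
        using that by (intro h Qa Qh)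
      show "h (c \<odot>\<^bsub>PS\<^esub> t) = c \<odot>\<^bsub>W\<^esub> h t" if "c \<in> carrier K" "t \<in> carrier PS" for c t
        using that by (intro h Qs Qh)
    qed
    show "h (pure B p) = f p" if "p \<in> P" for p using Qp[OF that] by (rule h)
  qed
qed

text \<open>A map \<open>q\<close> of forms that is transposed to a map \<open>r\<close> of tuples
  induces a linear map in the direction of \<open>r\<close>. Both \<open>tensor_map\<close> and the
  place permutations have this shape.\<close>

lemma pullback_hom:
  assumes "pure_forms K B' P'" and q: "\<And>b. b \<in> B' \<Longrightarrow> q b \<in> B" and r: "\<And>p. p \<in> P \<Longrightarrow> r p \<in> P'"
    and qr: "\<And>b p. \<lbrakk>b \<in> B'; p \<in> P\<rbrakk> \<Longrightarrow> q b p = b (r p)"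
  shows "(\<lambda>t. \<lambda>b\<in>B'. t (q b)) \<in> module_hom K PS (pure_span K B' P')"
    and "p \<in> P \<Longrightarrow> (\<lambda>b\<in>B'. pure B p (q b)) = pure B' (r p)"
proof -
  interpret B': pure_forms K B' P' by fact
  show *: "(\<lambda>b\<in>B'. pure B p (q b)) = pure B' (r p)" if "p \<in> P" for p
    using that q qr by (auto simp: pure_def fun_eq_iff)
  show "(\<lambda>t. \<lambda>b\<in>B'. t (q b)) \<in> module_hom K PS (pure_span K B' P')"
  proof (rule module_homI)
    fix t assume "t \<in> carrier PS"
    then show "(\<lambda>b\<in>B'. t (q b)) \<in> carrier (pure_span K B' P')"
    proof (induct rule: induct)
      case zero
      have "(\<lambda>b\<in>B'. \<zero>\<^bsub>PS\<^esub> (q b)) = \<zero>\<^bsub>pure_span K B' P'\<^esub>" using q by auto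
      then show ?case using B'.PS.M.zero_closed by (simp only:)
    next
      case (pure p)
      then show ?case using * B'.pure_in r by simp
    next
      case (add s t)
      have "(\<lambda>b\<in>B'. (s \<oplus>\<^bsub>PS\<^esub> t) (q b)) = (\<lambda>b\<in>B'. s (q b)) \<oplus>\<^bsub>pure_span K B' P'\<^esub> (\<lambda>b\<in>B'. t (q b))" using q by auto
      then show ?case using B'.PS.M.a_closed[OF add(3,4)] by (simp only:)
    next
      case (smult c t)
      have "(\<lambda>b\<in>B'. (c \<odot>\<^bsub>PS\<^esub> t) (q b)) = c \<odot>\<^bsub>pure_span K B' P'\<^esub> (\<lambda>b\<in>B'. t (q b))" using q by auto
      then show ?case using B'.PS.smult_closed[OF smult(1,3)] by (simp only:)
    qed
  qed (use q in auto)
qed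

lemma fdvsI:
  assumes "finite S" "S \<subseteq> carrier PS" "\<And>p. p \<in> P \<Longrightarrow> pure B p \<in> LinearCombinations.module.span K PS S"
  shows "fdvs K PS"
proof (rule fdvs_span[OF vs assms(1,2)])
  interpret S: submodule K "PS.span S" PS using assms(2) by (rule PS.span_is_submodule)
  show "carrier PS \<subseteq> PS.span S"
  proof
    fix t assume "t \<in> carrier PS"
    then show "t \<in> PS.span S"
      by (induct rule: induct) (use assms(3) S.m_closed S.smult_closed S.zero_closed in \<open>auto simp del: ops\<close>)
  qed
qed

end

subsection \<open>Tensor products\<close>

definition tens :: "('k, 'z) ring_scheme \<Rightarrow> ('k, 'x, 'y) module_scheme \<Rightarrow> ('k, 'x', 'y') module_scheme \<Rightarrow>
    'x \<Rightarrow> 'x' \<Rightarrow> ('x \<times> 'x' \<Rightarrow> 'k) \<Rightarrow> 'k" where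
  "tens K M N x y = pure (bilinear_forms K M N) (x, y)"

locale two_spaces = field K for K :: "('k, 'z) ring_scheme" +
  fixes M :: "('k, 'x, 'y) module_scheme" and N :: "('k, 'x', 'y') module_scheme"
  assumes M: "fdvs K M" and N: "fdvs K N"
begin

sublocale M: vectorspace K M using M by (rule fdvs_vs)
sublocale N: vectorspace K N using N by (rule fdvs_vs)

lemma bilinear_formD:
  assumes "b \<in> bilinear_forms K M N"
  shows "\<lbrakk>x \<in> carrier M; y \<in> carrier N\<rbrakk> \<Longrightarrow> b (x, y) \<in> carrier K"
    and "\<lbrakk>x \<in> carrier M; x' \<in> carrier M; y \<in> carrier N\<rbrakk> \<Longrightarrow> b (x \<oplus>\<^bsub>M\<^esub> x', y) = b (x, y) \<oplus>\<^bsub>K\<^esub> b (x', y)"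
    and "\<lbrakk>x \<in> carrier M; y \<in> carrier N; y' \<in> carrier N\<rbrakk> \<Longrightarrow> b (x, y \<oplus>\<^bsub>N\<^esub> y') = b (x, y) \<oplus>\<^bsub>K\<^esub> b (x, y')"
    and "\<lbrakk>c \<in> carrier K; x \<in> carrier M; y \<in> carrier N\<rbrakk> \<Longrightarrow> b (c \<odot>\<^bsub>M\<^esub> x, y) = c \<otimes>\<^bsub>K\<^esub> b (x, y)"
    and "\<lbrakk>c \<in> carrier K; x \<in> carrier M; y \<in> carrier N\<rbrakk> \<Longrightarrow> b (x, c \<odot>\<^bsub>N\<^esub> y) = c \<otimes>\<^bsub>K\<^esub> b (x, y)"
  using assms by (auto simp: bilinear_forms_def module_hom_def)

lemma bilinear_formI:
  assumes "\<And>x. x \<in> carrier M \<Longrightarrow> f x \<in> module_hom K N (scalars K)"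
    and "\<And>y. y \<in> carrier N \<Longrightarrow> (\<lambda>x. f x y) \<in> module_hom K M (scalars K)"
  shows "(\<lambda>(x, y)\<in>carrier M \<times> carrier N. f x y) \<in> bilinear_forms K M N"
proof -
  let ?b = "\<lambda>(x, y)\<in>carrier M \<times> carrier N. f x y"
  have "(\<lambda>y. ?b (x, y)) \<in> module_hom K N (scalars K)" if "x \<in> carrier M" for x
    by (rule module_hom_cong[OF N.module_axioms _ assms(1)[OF that]]) (simp add: that)
  moreover have "(\<lambda>x. ?b (x, y)) \<in> module_hom K M (scalars K)" if "y \<in> carrier N" for y
    by (rule module_hom_cong[OF M.module_axioms _ assms(2)[OF that]]) (simp add: that)
  ultimately show ?thesis by (simp add: bilinear_forms_def)
qed

sublocale T: pure_forms K "bilinear_forms K M N" "carrier M \<times> carrier N"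
  by unfold_locales (auto simp: bilinear_formD)

lemma tensor_eq: "tensor K M N = T.PS"
  by (simp add: tensor_def)

lemma tens_in [simp]: "\<lbrakk>x \<in> carrier M; y \<in> carrier N\<rbrakk> \<Longrightarrow> tens K M N x y \<in> carrier (tensor K M N)"
  by (simp add: tens_def tensor_eq T.pure_in)

lemma tensor_vs: "vectorspace K (tensor K M N)"
  unfolding tensor_eq by (rule T.vs)

lemma tens_hom_right: "x \<in> carrier M \<Longrightarrow> tens K M N x \<in> module_hom K N (tensor K M N)"
  by (rule module_homI, simp) (auto simp: tens_def tensor_eq pure_def bilinear_formD)

lemma tens_hom_left: "y \<in> carrier N \<Longrightarrow> (\<lambda>x. tens K M N x y) \<in> module_hom K M (tensor K M N)"
  by (rule module_homI, simp) (auto simp: tens_def tensor_eq pure_def bilinear_formD)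

lemma tensor_induct [consumes 1, case_names zero tens add smult]:
  assumes "t \<in> carrier (tensor K M N)" "Q \<zero>\<^bsub>tensor K M N\<^esub>"
    "\<And>x y. \<lbrakk>x \<in> carrier M; y \<in> carrier N\<rbrakk> \<Longrightarrow> Q (tens K M N x y)"
    "\<And>s t. \<lbrakk>s \<in> carrier (tensor K M N); t \<in> carrier (tensor K M N); Q s; Q t\<rbrakk> \<Longrightarrow> Q (s \<oplus>\<^bsub>tensor K M N\<^esub> t)"
    "\<And>c t. \<lbrakk>c \<in> carrier K; t \<in> carrier (tensor K M N); Q t\<rbrakk> \<Longrightarrow> Q (c \<odot>\<^bsub>tensor K M N\<^esub> t)"
  shows "Q t"
proof -
  note a = assms[unfolded tensor_eq tens_def]
  have "Q (pure (bilinear_forms K M N) p)" if "p \<in> carrier M \<times> carrier N" for p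
    using a(3)[of "fst p" "snd p"] that by auto
  note a = a(1,2) this a(4,5)
  show ?thesis
    by (intro T.induct[where Q = Q and t = t]) (fact a)+
qed

lemma tensor_hom_eq:
  assumes "f \<in> module_hom K (tensor K M N) W" "g \<in> module_hom K (tensor K M N) W" "module K W"
    "\<And>x y. \<lbrakk>x \<in> carrier M; y \<in> carrier N\<rbrakk> \<Longrightarrow> f (tens K M N x y) = g (tens K M N x y)"
    "t \<in> carrier (tensor K M N)"
  shows "f t = g t"
  by (rule T.hom_eq[of f W g, folded tensor_eq]) (use assms in \<open>auto simp: tens_def\<close>)

lemma tensor_lift:
  assumes W: "fdvs K W" and f: "\<And>x. x \<in> carrier M \<Longrightarrow> f x \<in> module_hom K N W"
    "\<And>y. y \<in> carrier N \<Longrightarrow> (\<lambda>x. f x y) \<in> module_hom K M W"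
  obtains h where "h \<in> module_hom K (tensor K M N) W"
    "\<And>x y. \<lbrakk>x \<in> carrier M; y \<in> carrier N\<rbrakk> \<Longrightarrow> h (tens K M N x y) = f x y"
proof -
  have "\<exists>b\<in>bilinear_forms K M N. \<forall>p\<in>carrier M \<times> carrier N. b p = w (case p of (x, y) \<Rightarrow> f x y)"
    if w: "w \<in> functionals K W" for w
    using w by (intro bexI[OF _ bilinear_formI[of "\<lambda>x y. w (f x y)"]])
      (auto simp: functionals_def intro: module_hom_comp[OF f(1)] module_hom_comp[OF f(2)])
  moreover have "(case p of (x, y) \<Rightarrow> f x y) \<in> carrier W" if "p \<in> carrier M \<times> carrier N" for p
    using that f(1) by (auto intro: module_hom_in)
  ultimately have "\<exists>h. h \<in> module_hom K T.PS W \<and> (\<forall>p\<in>carrier M \<times> carrier N.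
      h (pure (bilinear_forms K M N) p) = (case p of (x, y) \<Rightarrow> f x y))"
    using T.lift[OF W, of "\<lambda>p. case p of (x, y) \<Rightarrow> f x y"] by metis
  then obtain h where "h \<in> module_hom K T.PS W"
    "\<And>p. p \<in> carrier M \<times> carrier N \<Longrightarrow> h (pure (bilinear_forms K M N) p) = (case p of (x, y) \<Rightarrow> f x y)"
    by blast
  then show thesis by (intro that[of h]) (auto simp: tensor_eq tens_def)
qed

text \<open>Tensors of basis vectors span: the second factor is expanded with a basis vector fixed
  in the first, and then the first factor is expanded too.\<close>

lemma tensor_fdvs: "fdvs K (tensor K M N)"
proof -
  obtain d z w where dw: "dual_basis K M d z w" using M by (rule fdvs_dual_basis)
  obtain d' z' w' where dw': "dual_basis K N d' z' w'" using N by (rule fdvs_dual_basis)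
  let ?S = "(\<lambda>(i, j). tens K M N (z i) (z' j)) ` ({..<d} \<times> {..<d'})"
  have S: "?S \<subseteq> carrier (tensor K M N)" using dw dw' by (auto simp: dual_basis_def)
  interpret T': vectorspace K "tensor K M N" by (rule tensor_vs)
  have sub: "submodule K (T'.span ?S) (tensor K M N)" using S by (rule T'.span_is_submodule)
  have zz: "tens K M N (z i) (z' j) \<in> T'.span ?S" if "i < d" "j < d'" for i j
    using that T'.in_own_span[OF S] by auto
  have zM: "z i \<in> carrier M" if "i < d" for i using that dw by (simp add: dual_basis_def)
  have 1: "tens K M N (z i) y \<in> T'.span ?S" if "i < d" "y \<in> carrier N" for i y
    by (rule hom_basis_submodule[OF dw' N.vectorspace_axioms T'.vectorspace_axioms
        tens_hom_right[OF zM[OF that(1)]] sub zz[OF that(1)] that(2)])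
  have "tens K M N x y \<in> T'.span ?S" if "x \<in> carrier M" "y \<in> carrier N" for x y
    by (rule hom_basis_submodule[OF dw M.vectorspace_axioms T'.vectorspace_axioms
        tens_hom_left[OF that(2)] sub 1[OF _ that(2)] that(1)])
  then show ?thesis unfolding tensor_eq
    by (intro T.fdvsI[of ?S]) (use S in \<open>auto simp: tensor_eq tens_def\<close>)
qed

end

lemma two_spacesI: "\<lbrakk>fdvs K M; fdvs K N\<rbrakk> \<Longrightarrow> two_spaces K M N"
  by (simp add: two_spaces_def two_spaces_axioms_def fdvs_def vectorspace_def)

lemma tensor_map_hom:
  assumes "two_spaces K M N" "two_spaces K M' N'" and f: "f \<in> module_hom K M M'" and g: "g \<in> module_hom K N N'"
  shows "tensor_map K M N M' N' f g \<in> module_hom K (tensor K M N) (tensor K M' N')"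
    and "\<lbrakk>x \<in> carrier M; y \<in> carrier N\<rbrakk> \<Longrightarrow>
      tensor_map K M N M' N' f g (tens K M N x y) = tens K M' N' (f x) (g y)"
proof -
  interpret A: two_spaces K M N by fact
  interpret B: two_spaces K M' N' by fact
  have 1: "(\<lambda>(x, y)\<in>carrier M \<times> carrier N. b (f x, g y)) \<in> bilinear_forms K M N"
    if "b \<in> bilinear_forms K M' N'" for b
    using that f g by (intro A.bilinear_formI module_homI)
      (auto simp: B.bilinear_formD module_hom_in module_hom_add module_hom_smult)
  have 2: "map_prod f g p \<in> carrier M' \<times> carrier N'" if "p \<in> carrier M \<times> carrier N" for p
    using that f g by (auto simp: module_hom_in)
  have eq: "tensor_map K M N M' N' f g = (\<lambda>t. \<lambda>b\<in>bilinear_forms K M' N'. t ((\<lambda>b. \<lambda>(x, y)\<in>carrier M \<times> carrier N. b (f x, g y)) b))"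
    by (simp add: tensor_map_def fun_eq_iff)
  note pb = A.T.pullback_hom[OF B.T.pure_forms_axioms, of "\<lambda>b. \<lambda>(x, y)\<in>carrier M \<times> carrier N. b (f x, g y)" "map_prod f g"]
  show "tensor_map K M N M' N' f g \<in> module_hom K (tensor K M N) (tensor K M' N')"
    unfolding eq A.tensor_eq B.tensor_eq by (rule pb) (use 1 2 in auto)
  show "tensor_map K M N M' N' f g (tens K M N x y) = tens K M' N' (f x) (g y)"
    if "x \<in> carrier M" "y \<in> carrier N"
    using pb(2)[of "(x, y)"] that 1 2 unfolding eq tens_def by auto
qed

lemma representation_mk_repI:
  assumes "fdvs K V" "\<And>g. g \<in> carrier (sym_group n) \<Longrightarrow> a g \<in> module_hom K V V"
    and "\<And>x. x \<in> carrier V \<Longrightarrow> a \<one>\<^bsub>sym_group n\<^esub> x = x"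
    and "\<And>g h x. \<lbrakk>g \<in> carrier (sym_group n); h \<in> carrier (sym_group n); x \<in> carrier V\<rbrakk> \<Longrightarrow>
      a (g \<otimes>\<^bsub>sym_group n\<^esub> h) x = a g (a h x)"
  shows "representation n K (mk_rep V a)"
  by unfold_locales (use assms in auto)

lemma tensor_rep_simps [simp]:
  "carrier (tensor_rep K M N) = carrier (tensor K M N)" "zero (tensor_rep K M N) = zero (tensor K M N)"
  "add (tensor_rep K M N) = add (tensor K M N)" "smult (tensor_rep K M N) = smult (tensor K M N)"
  "act (tensor_rep K M N) g = tensor_map K M N M N (act M g) (act N g)"
  "fdvs K (tensor_rep K M N) = fdvs K (tensor K M N)"
  by (simp_all add: tensor_rep_def)

lemma module_hom_tensor_rep [simp]:
  "module_hom L (tensor_rep K M N) W = module_hom L (tensor K M N) W"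
  "module_hom L W (tensor_rep K M N) = module_hom L W (tensor K M N)"
  by (simp_all add: tensor_rep_def)

lemma tensor_rep_representation:
  assumes "representation n K M" "representation n K N"
  shows "representation n K (tensor_rep K M N)"
proof -
  interpret rM: representation n K M by fact
  interpret rN: representation n K N by fact
  have MN: "two_spaces K M N" by (rule two_spacesI rM.fdvs rN.fdvs)+
  interpret two_spaces K M N by (rule MN)
  interpret T': vectorspace K "tensor K M N" by (rule tensor_vs)
  interpret G: group "sym_group n" by (rule sym_group_is_group)
  note tm = tensor_map_hom[OF MN MN]
  show ?thesis unfolding tensor_rep_def
  proof (rule representation_mk_repI[OF tensor_fdvs])
    show "tensor_map K M N M N (act M g) (act N g) \<in> module_hom K (tensor K M N) (tensor K M N)"
      if "g \<in> carrier (sym_group n)" for g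
      by (rule tm rM.act_linear rN.act_linear that)+
    note tm' = tm(1)[OF rM.act_linear rN.act_linear] tm(2)[OF rM.act_linear rN.act_linear]
    show "tensor_map K M N M N (act M \<one>\<^bsub>sym_group n\<^esub>) (act N \<one>\<^bsub>sym_group n\<^esub>) t = t"
      if "t \<in> carrier (tensor K M N)" for t
      by (rule tensor_hom_eq[where g = "\<lambda>t. t", OF tm'(1) _ T'.module_axioms _ that])
        (auto simp: tm' rM.act_one rN.act_one intro!: module_homI)
    show "tensor_map K M N M N (act M (g \<otimes>\<^bsub>sym_group n\<^esub> h)) (act N (g \<otimes>\<^bsub>sym_group n\<^esub> h)) t =
        tensor_map K M N M N (act M g) (act N g) (tensor_map K M N M N (act M h) (act N h) t)"
      if "g \<in> carrier (sym_group n)" "h \<in> carrier (sym_group n)" "t \<in> carrier (tensor K M N)" for g h t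
      by (rule tensor_hom_eq[OF tm'(1) module_hom_comp[OF tm'(1) tm'(1)] T'.module_axioms _ that(3)])
        (use that in \<open>auto simp: tm' rM.act_mult rN.act_mult\<close>)
  qed
qed

lemma tensor_map_act:
  assumes "representation n K M" "representation n K M'" "representation n K N" "representation n K N'"
    and f: "f \<in> module_hom K M M'" "\<And>g x. \<lbrakk>g \<in> carrier (sym_group n); x \<in> carrier M\<rbrakk> \<Longrightarrow> f (act M g x) = act M' g (f x)"
    and u: "u \<in> module_hom K N N'" "\<And>g x. \<lbrakk>g \<in> carrier (sym_group n); x \<in> carrier N\<rbrakk> \<Longrightarrow> u (act N g x) = act N' g (u x)"
    and g: "g \<in> carrier (sym_group n)" and t: "t \<in> carrier (tensor K M N)"
  shows "tensor_map K M N M' N' f u (act (tensor_rep K M N) g t) = act (tensor_rep K M' N') g (tensor_map K M N M' N' f u t)"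
proof -
  interpret M: representation n K M by fact
  interpret N: representation n K N by fact
  interpret M': representation n K M' by fact
  interpret N': representation n K N' by fact
  have ts: "two_spaces K M N" and ts': "two_spaces K M' N'"
    by (rule two_spacesI M.fdvs N.fdvs M'.fdvs N'.fdvs)+
  note tm = tensor_map_hom[OF ts ts' f(1) u(1)]
  note a = tensor_map_hom[OF ts ts M.act_linear[OF g] N.act_linear[OF g]]
  note b = tensor_map_hom[OF ts' ts' M'.act_linear[OF g] N'.act_linear[OF g]]
  have "tensor_map K M N M' N' f u (tensor_map K M N M N (act M g) (act N g) t) =
    tensor_map K M' N' M' N' (act M' g) (act N' g) (tensor_map K M N M' N' f u t)"
    by (rule two_spaces.tensor_hom_eq[OF ts module_hom_comp[OF a(1) tm(1)] module_hom_comp[OF tm(1) b(1)]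
          vectorspace_module[OF two_spaces.tensor_vs[OF ts']]])
      (use g t in \<open>auto simp: a(2) b(2) tm(2) f(2) u(2) module_hom_in[OF f(1)] module_hom_in[OF u(1)]\<close>)
  then show ?thesis by simp
qed

subsection \<open>Tensor powers\<close>

declare One_nat_def [simp del]

lemma sym_group_finite: "finite (carrier (sym_group n))"
  by (simp add: sym_group_def finite_permutations)

lemma perm_comp_inv_PiE:
  assumes "g permutes {1..n}" "v \<in> {1..n} \<rightarrow>\<^sub>E A"
  shows "v \<circ> inv' g \<in> {1..n} \<rightarrow>\<^sub>E A"
proof (rule PiE_I)
  fix i assume "i \<in> {1..n}"
  then have "inv' g i \<in> {1..n}" using permutes_in_image[OF permutes_inv[OF assms(1)]] by simp
  then show "(v \<circ> inv' g) i \<in> A" using assms(2) by auto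
next
  fix i assume "i \<notin> {1..n}"
  then have "inv' g i = i" using permutes_not_in[OF permutes_inv[OF assms(1)]] by simp
  then show "(v \<circ> inv' g) i = undefined" using assms(2) \<open>i \<notin> {1..n}\<close> by (auto simp: PiE_def extensional_def)
qed

lemma perm_comp_inv_upd:
  assumes "g permutes {1..n}"
  shows "v(i := x) \<circ> inv' g = (v \<circ> inv' g)(g i := x)"
  using permutes_inverses[OF assms] by (auto simp: fun_eq_iff)

locale power_space = field K for K :: "('k, 'z) ring_scheme" +
  fixes n :: nat and V :: "('k, 'x) module"
  assumes n: "n > 0" and V: "fdvs K V"
begin

sublocale V: vectorspace K V using V by (rule fdvs_vs)

abbreviation "MF \<equiv> multilinear_forms n K V"
abbreviation "P \<equiv> {1..n} \<rightarrow>\<^sub>E carrier V"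

lemma multilinear_form_hom:
  "\<lbrakk>b \<in> MF; v \<in> P; i \<in> {1..n}\<rbrakk> \<Longrightarrow> (\<lambda>x. b (v(i := x))) \<in> module_hom K V (scalars K)"
  by (simp add: multilinear_forms_def)

lemma upd_in: "\<lbrakk>v \<in> P; i \<in> {1..n}; x \<in> carrier V\<rbrakk> \<Longrightarrow> v(i := x) \<in> P"
  by (auto simp: PiE_def extensional_def)

sublocale T: pure_forms K MF P
proof unfold_locales
  fix b v assume "b \<in> MF" "v \<in> P"
  \<comment> \<open>A form is K-valued because it is linear in some place, so there has to be a
    place: this uses n > 0.\<close>
  moreover have "1 \<in> {1..n}" using n by simp
  ultimately have "b (v(1 := v 1)) \<in> carrier K"
    using module_hom_in[OF multilinear_form_hom, of b v 1 "v 1"] PiE_mem[of v "{1..n}" "\<lambda>_. carrier V" 1]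
    by simp
  then show "b v \<in> carrier K" by simp
qed

lemma pure_upd_hom: "\<lbrakk>v \<in> P; i \<in> {1..n}\<rbrakk> \<Longrightarrow> (\<lambda>x. pure MF (v(i := x))) \<in> module_hom K V T.PS"
proof (rule module_homI, goal_cases)
  case (1 x) then show ?case by (intro T.pure_in upd_in)
next
  case (2 x y) then show ?case
    by (auto simp: pure_def module_hom_add[OF multilinear_form_hom] intro!: restrict_ext)
next
  case (3 c x) then show ?case
    by (auto simp: pure_def module_hom_smult[OF multilinear_form_hom] intro!: restrict_ext)
qed

lemma tensor_power_rep_simps [simp]:
  "carrier (tensor_power_rep n K V) = carrier T.PS" "\<zero>\<^bsub>tensor_power_rep n K V\<^esub> = \<zero>\<^bsub>T.PS\<^esub>"
  "add (tensor_power_rep n K V) = add T.PS" "smult (tensor_power_rep n K V) = smult T.PS"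
  by (simp_all add: tensor_power_rep_def)

end

text \<open>The entries are expanded in the basis place by place. In the induction \<open>k\<close>
  bounds the places whose entries are still arbitrary; entries at places beyond \<open>k\<close> are
  already basis vectors, and at k = 0 all of them are.\<close>

lemma (in power_space) power_fdvs: "fdvs K T.PS"
proof -
  obtain d z w where dw: "dual_basis K V d z w" using V by (rule fdvs_dual_basis)
  let ?S = "pure MF ` ({1..n} \<rightarrow>\<^sub>E z ` {..<d})"
  have z: "z i \<in> carrier V" if "i < d" for i using dw that by (simp add: dual_basis_def)
  have SP: "({1..n} \<rightarrow>\<^sub>E z ` {..<d}) \<subseteq> P" using z by (intro PiE_mono) auto
  have S: "?S \<subseteq> carrier T.PS" using SP T.pure_in by blast
  interpret S: submodule K "T.PS.span ?S" T.PS using S by (rule T.PS.span_is_submodule)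
  have "pure MF v \<in> T.PS.span ?S"
    if "k \<le> n" "v \<in> P" "\<And>i. \<lbrakk>i \<in> {1..n}; k < i\<rbrakk> \<Longrightarrow> v i \<in> z ` {..<d}" for k v
    using that
  proof (induct k arbitrary: v)
    case 0
    then have "v \<in> {1..n} \<rightarrow>\<^sub>E z ` {..<d}" by (auto simp: PiE_def Pi_def)
    then show ?case using T.PS.in_own_span[OF S] by auto
  next
    case (Suc k)
    have k: "Suc k \<in> {1..n}" using Suc by auto
    have "pure MF (v(Suc k := z i)) \<in> T.PS.span ?S" if "i < d" for i
      using Suc that k by (intro Suc.hyps upd_in z) auto
    moreover have "v (Suc k) \<in> carrier V" using Suc k by auto
    ultimately have "pure MF (v(Suc k := v (Suc k))) \<in> T.PS.span ?S"
      by (rule hom_basis_submodule[OF dw V.vectorspace_axioms T.PS.vectorspace_axioms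
            pure_upd_hom[OF Suc.prems(2) k] S.submodule_axioms])
    then show ?case by simp
  qed
  from this[of n] show ?thesis
    by (intro T.fdvsI[of ?S] S finite_imageI finite_PiE) auto
qed

context power_space
begin

text \<open>Changing \<open>v\<close> in place \<open>i\<close> changes the permuted tuple in place
  \<open>g i\<close> (\<open>perm_comp_inv_upd\<close>), so linearity of \<open>b\<close> in place
  \<open>g i\<close> gives linearity of the permuted form in place \<open>i\<close>.\<close>

lemma permuted_form:
  assumes g: "g permutes {1..n}" and b: "b \<in> MF"
  shows "(\<lambda>v\<in>P. b (v \<circ> inv' g)) \<in> MF"
  unfolding multilinear_forms_def
proof (intro CollectI conjI ballI)
  fix v i assume v: "v \<in> P" and i: "i \<in> {1..n}"
  show "(\<lambda>x. (\<lambda>v\<in>P. b (v \<circ> inv' g)) (v(i := x))) \<in> module_hom K V (scalars K)"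
  proof (rule module_hom_cong[OF V.module_axioms])
    show "(\<lambda>x. b ((v \<circ> inv' g)(g i := x))) \<in> module_hom K V (scalars K)"
      using permutes_in_image[OF g] i by (intro multilinear_form_hom[OF b] perm_comp_inv_PiE[OF g v]) auto
  qed (use upd_in[OF v i] in \<open>simp add: perm_comp_inv_upd[OF g]\<close>)
qed simp

lemma tensor_power_act:
  assumes "g \<in> carrier (sym_group n)"
  shows "act (tensor_power_rep n K V) g \<in> module_hom K T.PS T.PS"
    and "v \<in> P \<Longrightarrow> act (tensor_power_rep n K V) g (pure MF v) = pure MF (v \<circ> inv' g)"
proof -
  have g: "g permutes {1..n}" using assms by (simp add: sym_group_carrier)
  note pb = T.pullback_hom[OF T.pure_forms_axioms, of "\<lambda>b. \<lambda>v\<in>P. b (v \<circ> inv' g)" "\<lambda>v. v \<circ> inv' g"]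
  have a: "act (tensor_power_rep n K V) g = (\<lambda>t. \<lambda>b\<in>MF. t (\<lambda>v\<in>P. b (v \<circ> inv' g)))"
    using assms by (simp add: tensor_power_rep_def)
  show "act (tensor_power_rep n K V) g \<in> module_hom K T.PS T.PS"
    unfolding a by (rule pb(1)) (simp_all add: permuted_form[OF g] perm_comp_inv_PiE[OF g])
  show "act (tensor_power_rep n K V) g (pure MF v) = pure MF (v \<circ> inv' g)" if v: "v \<in> P"
    unfolding a by (rule pb(2)) (simp_all add: permuted_form[OF g] perm_comp_inv_PiE[OF g] v)
qed

lemma tensor_power_representation: "representation n K (tensor_power_rep n K V)"
proof
  interpret G: group "sym_group n" by (rule sym_group_is_group)
  have hom: "act (tensor_power_rep n K V) g \<in> module_hom K T.PS T.PS" if "g \<in> carrier (sym_group n)" for g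
    using tensor_power_act(1)[OF that] .
  show "fdvs K (tensor_power_rep n K V)"
    using power_fdvs by (simp add: tensor_power_rep_def)
  show "act (tensor_power_rep n K V) g \<in> module_hom K (tensor_power_rep n K V) (tensor_power_rep n K V)"
    if "g \<in> carrier (sym_group n)" for g
    using hom[OF that] by (simp add: tensor_power_rep_def)
  show "act (tensor_power_rep n K V) \<one>\<^bsub>sym_group n\<^esub> t = t" if "t \<in> carrier (tensor_power_rep n K V)" for t
  proof (rule T.hom_eq[where g = "\<lambda>t. t", OF hom[OF G.one_closed] _ T.PS.module_axioms])
    show "(\<lambda>t. t) \<in> module_hom K T.PS T.PS" by (rule module_homI) (auto simp del: T.ops)
    show "act (tensor_power_rep n K V) \<one>\<^bsub>sym_group n\<^esub> (pure MF v) = pure MF v" if "v \<in> P" for v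
      using tensor_power_act(2)[OF G.one_closed that] by (simp add: sym_group_one)
  qed (use that in simp)
  show "act (tensor_power_rep n K V) (g \<otimes>\<^bsub>sym_group n\<^esub> h) t =
      act (tensor_power_rep n K V) g (act (tensor_power_rep n K V) h t)"
    if gh: "g \<in> carrier (sym_group n)" "h \<in> carrier (sym_group n)" and t: "t \<in> carrier (tensor_power_rep n K V)" for g h t
  proof (rule T.hom_eq[OF hom module_hom_comp[OF hom hom] T.PS.module_axioms, of _ h g])
    fix v assume v: "v \<in> P"
    have p: "g permutes {1..n}" "h permutes {1..n}" using gh by (simp_all add: sym_group_carrier)
    \<comment> \<open>Inversion reverses the order, and so does precomposition; together they give a
      left action.\<close>
    have "inv' (g \<circ> h) = inv' h \<circ> inv' g"
      using p by (intro o_inv_distrib) (auto simp: permutes_bij)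
    then show "act (tensor_power_rep n K V) (g \<otimes>\<^bsub>sym_group n\<^esub> h) (pure MF v) =
      act (tensor_power_rep n K V) g (act (tensor_power_rep n K V) h (pure MF v))"
      using tensor_power_act(2)[OF G.m_closed[OF gh] v] tensor_power_act(2)[OF gh(2) v]
        tensor_power_act(2)[OF gh(1) perm_comp_inv_PiE[OF p(2) v]]
      by (simp add: sym_group_mult comp_assoc)
  qed (use gh t in auto)
qed

end

subsection \<open>Coinvariants and invariants\<close>

text \<open>The image of a coset of U is only part of a coset of W; adding W completes it, and the
  image of U is absorbed because it lies in W. With f a scaling this is scalar multiplication in
  \<open>quot_space\<close>, with f equivariant it is \<open>coinv_map\<close>.\<close>

lemma set_add_image_coset:
  assumes M: "module K M" and N: "module K N" and f: "f \<in> module_hom K M N"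
    and U: "submodule K U M" and W: "submodule K W N" and fU: "f ` U \<subseteq> W" and x: "x \<in> carrier M"
  shows "W <+>\<^bsub>N\<^esub> (f ` (U +>\<^bsub>M\<^esub> x)) = W +>\<^bsub>N\<^esub> f x"
proof -
  interpret M: module K M by fact
  interpret N: module K N by fact
  interpret U: submodule K U M by fact
  interpret W: submodule K W N by fact
  have fx: "f x \<in> carrier N" using f x by (rule module_hom_in)
  have c: "W +>\<^bsub>N\<^esub> y = {w \<oplus>\<^bsub>N\<^esub> y | w. w \<in> W}" for y by (auto simp: a_r_coset_def')
  have "f (u \<oplus>\<^bsub>M\<^esub> x) = f u \<oplus>\<^bsub>N\<^esub> f x" if "u \<in> U" for u
    using that x U.subset by (intro module_hom_add[OF f]) auto
  then have eq: "f ` (U +>\<^bsub>M\<^esub> x) = {f u \<oplus>\<^bsub>N\<^esub> f x | u. u \<in> U}"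
    by (force simp: a_r_coset_def')
  show ?thesis
  proof (intro equalityI subsetI)
    fix y assume "y \<in> W <+>\<^bsub>N\<^esub> (f ` (U +>\<^bsub>M\<^esub> x))"
    then obtain w u where wu: "w \<in> W" "u \<in> U" and y: "y = w \<oplus>\<^bsub>N\<^esub> (f u \<oplus>\<^bsub>N\<^esub> f x)"
      by (auto simp: eq set_add_def')
    have "f u \<in> W" using wu fU by auto
    moreover have "w \<in> carrier N" "f u \<in> carrier N" using wu calculation W.subset by auto
    ultimately have "y = (w \<oplus>\<^bsub>N\<^esub> f u) \<oplus>\<^bsub>N\<^esub> f x" "w \<oplus>\<^bsub>N\<^esub> f u \<in> W"
      using y wu fx by (simp_all add: N.M.a_assoc W.m_closed)
    then show "y \<in> W +>\<^bsub>N\<^esub> f x" by (auto simp: c)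
  next
    fix y assume "y \<in> W +>\<^bsub>N\<^esub> f x"
    then obtain w where w: "w \<in> W" and y: "y = w \<oplus>\<^bsub>N\<^esub> f x" by (auto simp: c)
    have "f \<zero>\<^bsub>M\<^esub> = \<zero>\<^bsub>N\<^esub>" by (rule module_hom_zero[OF M N f])
    then have "y = w \<oplus>\<^bsub>N\<^esub> (f \<zero>\<^bsub>M\<^esub> \<oplus>\<^bsub>N\<^esub> f x)" using y fx by simp
    then show "y \<in> W <+>\<^bsub>N\<^esub> (f ` (U +>\<^bsub>M\<^esub> x))"
      unfolding eq set_add_def' using w U.zero_closed by blast
  qed
qed

text \<open>The set operations of \<open>quot_space\<close> turn out to be those induced along the
  map from a vector to its coset, so \<open>vectorspace_image\<close> supplies the axioms.\<close>

lemma quot_space_vectorspace: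
  assumes V: "vectorspace K V" and U: "submodule K U V"
  shows "vectorspace K (quot_space V U)"
    and "(\<lambda>x. U +>\<^bsub>V\<^esub> x) \<in> module_hom K V (quot_space V U)"
    and "carrier (quot_space V U) = (\<lambda>x. U +>\<^bsub>V\<^esub> x) ` carrier V"
    and "\<lbrakk>x \<in> carrier V; y \<in> carrier V\<rbrakk> \<Longrightarrow> U +>\<^bsub>V\<^esub> x = U +>\<^bsub>V\<^esub> y \<longleftrightarrow> x \<ominus>\<^bsub>V\<^esub> y \<in> U"
    and "x \<in> carrier V \<Longrightarrow> U +>\<^bsub>V\<^esub> x = \<zero>\<^bsub>quot_space V U\<^esub> \<longleftrightarrow> x \<in> U"
proof -
  interpret V: vectorspace K V by fact
  interpret U: submodule K U V by fact
  have neg: "\<ominus>\<^bsub>V\<^esub> u \<in> U" if "u \<in> U" for u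
  proof -
    have "(\<ominus>\<^bsub>K\<^esub> \<one>\<^bsub>K\<^esub>) \<odot>\<^bsub>V\<^esub> u \<in> U" using that by (intro U.smult_closed) auto
    moreover have "u \<in> carrier V" using that U.subset by auto
    ultimately show ?thesis using V.smult_minus_1 by metis
  qed
  have "subgroup U (add_monoid V)"
    by (rule subgroup.intro) (use U.subset neg in \<open>auto simp: a_inv_def[symmetric]\<close>)
  then interpret A: abelian_subgroup U V
    by (intro abelian_subgroupI3) (auto simp: additive_subgroup_def V.M.abelian_group_axioms)
  show car: "carrier (quot_space V U) = (\<lambda>x. U +>\<^bsub>V\<^esub> x) ` carrier V"
    by (auto simp: quot_space_def A_RCOSETS_def')
  have zero: "\<zero>\<^bsub>quot_space V U\<^esub> = U +>\<^bsub>V\<^esub> \<zero>\<^bsub>V\<^esub>"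
    using U.subset by (simp add: quot_space_def V.M.a_coset_add_zero)
  have add: "(U +>\<^bsub>V\<^esub> x) \<oplus>\<^bsub>quot_space V U\<^esub> (U +>\<^bsub>V\<^esub> y) = U +>\<^bsub>V\<^esub> (x \<oplus>\<^bsub>V\<^esub> y)"
    if "x \<in> carrier V" "y \<in> carrier V" for x y
    using that by (simp add: quot_space_def A.a_rcos_sum)
  have sm: "c \<odot>\<^bsub>quot_space V U\<^esub> (U +>\<^bsub>V\<^esub> x) = U +>\<^bsub>V\<^esub> (c \<odot>\<^bsub>V\<^esub> x)" if "c \<in> carrier K" "x \<in> carrier V" for c x
  proof -
    have "(\<lambda>x. c \<odot>\<^bsub>V\<^esub> x) \<in> module_hom K V V"
      using that by (intro module_homI) (auto simp: V.smult_r_distr V.smult_assoc1[symmetric] V.m_comm)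
    then show ?thesis
      using set_add_image_coset[OF V.module_axioms V.module_axioms _ U U, of "\<lambda>x. c \<odot>\<^bsub>V\<^esub> x" x] that
      by (auto simp: quot_space_def)
  qed
  show "vectorspace K (quot_space V U)" "(\<lambda>x. U +>\<^bsub>V\<^esub> x) \<in> module_hom K V (quot_space V U)"
    using vectorspace_image[OF V car zero add sm] by blast+
  show eq: "U +>\<^bsub>V\<^esub> x = U +>\<^bsub>V\<^esub> y \<longleftrightarrow> x \<ominus>\<^bsub>V\<^esub> y \<in> U" if "x \<in> carrier V" "y \<in> carrier V" for x y
  proof
    assume "U +>\<^bsub>V\<^esub> x = U +>\<^bsub>V\<^esub> y"
    then have "x \<in> U +>\<^bsub>V\<^esub> y" using A.a_rcos_self[OF that(1)] by simp
    then show "x \<ominus>\<^bsub>V\<^esub> y \<in> U" using A.a_rcos_module[OF that(2,1)] by (simp add: a_minus_def)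
  next
    assume "x \<ominus>\<^bsub>V\<^esub> y \<in> U"
    then have "x \<in> U +>\<^bsub>V\<^esub> y" using that A.a_rcos_module[OF that(2,1)] by (simp add: a_minus_def)
    then show "U +>\<^bsub>V\<^esub> x = U +>\<^bsub>V\<^esub> y" using A.a_repr_independence'[OF _ that(2)] by simp
  qed
  show "U +>\<^bsub>V\<^esub> x = \<zero>\<^bsub>quot_space V U\<^esub> \<longleftrightarrow> x \<in> U" if "x \<in> carrier V"
  proof -
    have "\<ominus>\<^bsub>V\<^esub> \<zero>\<^bsub>V\<^esub> = \<zero>\<^bsub>V\<^esub>"
      using V.M.r_neg[OF V.M.zero_closed] V.M.l_zero[OF V.M.a_inv_closed[OF V.M.zero_closed]] by simp
    then have "x \<ominus>\<^bsub>V\<^esub> \<zero>\<^bsub>V\<^esub> = x" using that by (metis a_minus_def V.M.r_zero)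
    then show ?thesis using eq[OF that V.M.zero_closed] unfolding zero by (simp only:)
  qed
qed

definition coinv_class :: "nat \<Rightarrow> ('k, 'z) ring_scheme \<Rightarrow> ('k, 'x) rep \<Rightarrow> 'x \<Rightarrow> 'x set" where
  "coinv_class n K M x = coinv_relations n K M +>\<^bsub>M\<^esub> x"

context representation
begin

sublocale vectorspace K M by (rule vectorspace)

lemma relation_in: "\<lbrakk>g \<in> carrier (sym_group n); x \<in> carrier M\<rbrakk> \<Longrightarrow> act M g x \<ominus>\<^bsub>M\<^esub> x \<in> coinv_relations n K M"
  and coinv_relations_submodule: "submodule K (coinv_relations n K M) M"
proof -
  let ?S = "{act M g x \<ominus>\<^bsub>M\<^esub> x | g x. g \<in> carrier (sym_group n) \<and> x \<in> carrier M}"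
  have S: "?S \<subseteq> carrier M" by auto
  show "submodule K (coinv_relations n K M) M"
    unfolding coinv_relations_def using S by (rule span_is_submodule)
  show "act M g x \<ominus>\<^bsub>M\<^esub> x \<in> coinv_relations n K M" if "g \<in> carrier (sym_group n)" "x \<in> carrier M"
    unfolding coinv_relations_def using in_own_span[OF S] that by auto
qed

lemmas quot = quot_space_vectorspace[OF vectorspace coinv_relations_submodule,
    folded coinvariants_def coinv_class_def]

lemma coinv_class_hom: "coinv_class n K M \<in> module_hom K M (coinvariants n K M)"
  using quot(2) .

lemma coinvariants_fdvs: "fdvs K (coinvariants n K M)"
  by (rule fdvs_image[OF fdvs quot(1) coinv_class_hom]) (simp add: quot(3))

lemma coinv_class_act:
  "\<lbrakk>g \<in> carrier (sym_group n); x \<in> carrier M\<rbrakk> \<Longrightarrow> coinv_class n K M (act M g x) = coinv_class n K M x"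
  by (simp add: quot(4) relation_in)

lemma coinvariants_cases:
  assumes "A \<in> carrier (coinvariants n K M)"
  obtains x where "x \<in> carrier M" "A = coinv_class n K M x"
  using assms quot(3) by auto

lemma coinv_lift:
  assumes W: "vectorspace K W" and f: "f \<in> module_hom K M W"
    and inv: "\<And>g x. \<lbrakk>g \<in> carrier (sym_group n); x \<in> carrier M\<rbrakk> \<Longrightarrow> f (act M g x) = f x"
  obtains h where "h \<in> module_hom K (coinvariants n K M) W"
    "\<And>x. x \<in> carrier M \<Longrightarrow> h (coinv_class n K M x) = f x"
proof -
  interpret W: vectorspace K W by fact
  have 0: "f x = \<zero>\<^bsub>W\<^esub>" if "x \<in> coinv_relations n K M" for x
  proof (rule span_induct[where P = "\<lambda>x. f x = \<zero>\<^bsub>W\<^esub>", OF module _ that[unfolded coinv_relations_def]])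
    show "f \<zero>\<^bsub>M\<^esub> = \<zero>\<^bsub>W\<^esub>" by (rule module_hom_zero[OF module W.module_axioms f])
    show "f s = \<zero>\<^bsub>W\<^esub>" if "s \<in> {act M g x \<ominus>\<^bsub>M\<^esub> x |g x. g \<in> carrier (sym_group n) \<and> x \<in> carrier M}" for s
      using that by (auto simp: module_hom_minus[OF module W.module_axioms f] inv module_hom_in[OF f])
  qed (auto simp: module_hom_add[OF f] module_hom_smult[OF f])
  have eq: "f x = f y" if "x \<in> carrier M" "y \<in> carrier M" "coinv_class n K M x = coinv_class n K M y" for x y
  proof -
    have "f x \<ominus>\<^bsub>W\<^esub> f y = \<zero>\<^bsub>W\<^esub>"
      using that 0[of "x \<ominus>\<^bsub>M\<^esub> y"] by (simp add: quot(4) module_hom_minus[OF module W.module_axioms f])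
    then show ?thesis using that by (simp add: module_hom_in[OF f])
  qed
  \<comment> \<open>Any representative will do, by \<open>eq\<close>.\<close>
  define h where "h A = f (SOME x. x \<in> carrier M \<and> coinv_class n K M x = A)" for A
  have h: "h (coinv_class n K M x) = f x" if "x \<in> carrier M" for x
    unfolding h_def
  proof (rule someI2[of _ x])
    show "f y = f x" if "y \<in> carrier M \<and> coinv_class n K M y = coinv_class n K M x" for y
      using eq[of y x] that \<open>x \<in> carrier M\<close> by blast
  qed (use that in simp)
  show thesis
  proof (rule that)
    show "h \<in> module_hom K (coinvariants n K M) W"
    proof (rule module_homI)
      fix A B assume A: "A \<in> carrier (coinvariants n K M)" and B: "B \<in> carrier (coinvariants n K M)"
      from A B obtain x y where "x \<in> carrier M" "A = coinv_class n K M x" "y \<in> carrier M" "B = coinv_class n K M y"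
        by (auto elim!: coinvariants_cases)
      then show "h (A \<oplus>\<^bsub>coinvariants n K M\<^esub> B) = h A \<oplus>\<^bsub>W\<^esub> h B"
        by (simp add: module_hom_add[OF coinv_class_hom, symmetric] h module_hom_add[OF f])
    next
      fix c A assume A: "A \<in> carrier (coinvariants n K M)" and c: "c \<in> carrier K"
      from A obtain x where "x \<in> carrier M" "A = coinv_class n K M x" by (auto elim!: coinvariants_cases)
      then show "h (c \<odot>\<^bsub>coinvariants n K M\<^esub> A) = c \<odot>\<^bsub>W\<^esub> h A"
        using c by (simp add: module_hom_smult[OF coinv_class_hom, symmetric] h module_hom_smult[OF f])
    qed (auto elim!: coinvariants_cases simp: h module_hom_in[OF f])
  qed (rule h)
qed

lemma invariants_fdvs: "fdvs K (invariants n M)"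
proof -
  have "vectorspace K (module.truncate M)"
    by (rule vectorspace_cong[OF vectorspace]) simp_all
  moreover have "submodule K {x \<in> carrier M. \<forall>g\<in>carrier (sym_group n). act M g x = x} (module.truncate M)"
    by (rule submodule.intro) (use calculation in \<open>auto simp: act_zero act_add act_smult\<close>)
  ultimately have "vectorspace K (invariants n M)"
    unfolding invariants_def by (intro vectorspace.subspace_is_vs) (auto simp: subspace_def)
  then show ?thesis
    by (rule fdvs_of_injection[OF _ fdvs, of _ "\<lambda>x. x"]) (auto simp: invariants_def intro!: module_homI)
qed

end

lemma invariants_simps [simp]:
  "carrier (invariants n M) = {x \<in> carrier M. \<forall>g\<in>carrier (sym_group n). act M g x = x}"
  "add (invariants n M) = add M" "smult (invariants n M) = smult M" "zero (invariants n M) = zero M"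
  by (simp_all add: invariants_def)

lemma coinv_map_class:
  assumes M: "representation n K M" and N: "representation n K N" and f: "f \<in> module_hom K M N"
    and eqv: "\<And>g x. \<lbrakk>g \<in> carrier (sym_group n); x \<in> carrier M\<rbrakk> \<Longrightarrow> f (act M g x) = act N g (f x)"
  shows "x \<in> carrier M \<Longrightarrow> coinv_map n K N f (coinv_class n K M x) = coinv_class n K N (f x)"
    and "coinv_map n K N f \<in> module_hom K (coinvariants n K M) (coinvariants n K N)"
proof -
  interpret M: representation n K M by fact
  interpret N: representation n K N by fact
  interpret R: submodule K "coinv_relations n K N" N by (rule N.coinv_relations_submodule)
  have "f x \<in> coinv_relations n K N" if "x \<in> coinv_relations n K M" for x
  proof (rule span_induct[where P = "\<lambda>x. f x \<in> coinv_relations n K N", OF M.module _ that[unfolded coinv_relations_def]])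
    show "f \<zero>\<^bsub>M\<^esub> \<in> coinv_relations n K N" by (simp add: module_hom_zero[OF M.module N.module f])
    show "f s \<in> coinv_relations n K N" if "s \<in> {act M g x \<ominus>\<^bsub>M\<^esub> x |g x. g \<in> carrier (sym_group n) \<and> x \<in> carrier M}" for s
      using that by (auto simp: module_hom_minus[OF M.module N.module f] eqv module_hom_in[OF f] N.relation_in)
  qed (auto simp: module_hom_add[OF f] module_hom_smult[OF f])
  then have *: "coinv_map n K N f (coinv_class n K M x) = coinv_class n K N (f x)" if "x \<in> carrier M" for x
    unfolding coinv_map_def coinv_class_def using that
    by (intro set_add_image_coset[OF M.module N.module f M.coinv_relations_submodule N.coinv_relations_submodule]) auto
  then show "x \<in> carrier M \<Longrightarrow> coinv_map n K N f (coinv_class n K M x) = coinv_class n K N (f x)" .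
  have "coinv_class n K N (f (act M g x)) = coinv_class n K N (f x)"
    if "g \<in> carrier (sym_group n)" "x \<in> carrier M" for g x
    using that module_hom_in[OF f] by (simp add: eqv N.coinv_class_act)
  \<comment> \<open>\<open>coinv_map\<close> is a map on sets of vectors; its linearity is borrowed
    from the linear map induced on the quotient, with which it agrees on every class.\<close>
  then obtain h where h: "h \<in> module_hom K (coinvariants n K M) (coinvariants n K N)"
    "\<And>x. x \<in> carrier M \<Longrightarrow> h (coinv_class n K M x) = coinv_class n K N (f x)"
    using M.coinv_lift[OF N.quot(1) module_hom_comp[OF f N.coinv_class_hom]] by metis
  show "coinv_map n K N f \<in> module_hom K (coinvariants n K M) (coinvariants n K N)"
    using M.quot(1) by (intro module_hom_cong[OF _ _ h(1)]) (auto simp: * h elim!: M.coinvariants_cases)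
qed

subsection \<open>Permutation modules, duals and copies\<close>

lemma rep_hom_in: "\<lbrakk>f \<in> carrier (rep_hom n K M N); x \<in> carrier M\<rbrakk> \<Longrightarrow> f x \<in> carrier N"
  and rep_hom_hom: "f \<in> carrier (rep_hom n K M N) \<Longrightarrow> f \<in> module_hom K M N"
  and rep_hom_ext: "f \<in> carrier (rep_hom n K M N) \<Longrightarrow> f \<in> extensional (carrier M)"
  and rep_hom_act: "\<lbrakk>f \<in> carrier (rep_hom n K M N); g \<in> carrier (sym_group n); x \<in> carrier M\<rbrakk> \<Longrightarrow>
    f (act M g x) = act N g (f x)"
  by (auto simp: rep_hom_carrier module_hom_in)

lemma scalars_fdvs: "field K \<Longrightarrow> fdvs K (scalars K)"
  by (rule fdvs_of_functionals[OF field.scalars_vectorspace, of _ "{()}" "\<lambda>_ x. x"])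
    (auto simp: functionals_def intro!: module_homI)

text \<open>The matrix entries \<open>w' j (f (z i))\<close> are finitely many functionals on the
  hom space whose only common zero is the zero map.\<close>

lemma hom_space_fdvs:
  assumes V: "fdvs K V" and W: "fdvs K W"
  shows "fdvs K (hom_space K V W)"
proof -
  interpret V: vectorspace K V using V by (rule fdvs_vs)
  interpret W: vectorspace K W using W by (rule fdvs_vs)
  obtain d z w where dw: "dual_basis K V d z w" using V by (rule fdvs_dual_basis)
  obtain d' z' w' where dw': "dual_basis K W d' z' w'" using W by (rule fdvs_dual_basis)
  have z: "z i \<in> carrier V" if "i < d" for i using that dw by (simp add: dual_basis_def)
  have w': "w' i \<in> functionals K W" if "i < d'" for i using that dw' by (simp add: dual_basis_def)
  show ?thesis
  proof (rule fdvs_of_functionals[OF hom_space_vectorspace[OF fdvs_vs[OF V] fdvs_vs[OF W]],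
        of "{..<d} \<times> {..<d'}" "\<lambda>(i, j) f. w' j (f (z i))"], goal_cases)
    case (2 p)
    then obtain i j where p: "p = (i, j)" "i < d" "j < d'" by auto
    have "(\<lambda>f. f (z i)) \<in> module_hom K (hom_space K V W) W"
      by (rule module_homI) (use z p in \<open>auto simp: hom_space_carrier module_hom_in\<close>)
    from module_hom_comp[OF this] w'[OF p(3)] show ?case by (simp add: p functionals_def)
  next
    case (3 f)
    then have f: "f \<in> module_hom K V W" "f \<in> extensional (carrier V)" by (simp_all add: hom_space_carrier)
    have 0: "f (z i) = \<zero>\<^bsub>W\<^esub>" if "i < d" for i
    proof -
      have fz: "f (z i) \<in> carrier W" using f z that by (simp add: module_hom_in)
      have "f (z i) = (\<Oplus>\<^bsub>W\<^esub>j\<in>{..<d'}. w' j (f (z i)) \<odot>\<^bsub>W\<^esub> z' j)" using dw' fz by (simp add: dual_basis_def)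
      also have "\<dots> = (\<Oplus>\<^bsub>W\<^esub>j\<in>{..<d'}. \<zero>\<^bsub>W\<^esub>)"
        using dw' 3(2) that by (intro W.M.finsum_cong') (auto simp: dual_basis_def)
      finally show ?thesis by simp
    qed
    have sub: "submodule K {\<zero>\<^bsub>W\<^esub>} W" by unfold_locales auto
    have "f x = \<zero>\<^bsub>W\<^esub>" if "x \<in> carrier V" for x
      using hom_basis_submodule[OF dw V.vectorspace_axioms W.vectorspace_axioms f(1) sub _ that] 0 by auto
    then show ?case using f by (auto intro!: extensionalityI[of _ "carrier V"])
  qed simp
qed

lemma rep_hom_fdvs:
  assumes "representation n K M" "representation n K N"
  shows "fdvs K (rep_hom n K M N)"
proof -
  interpret M: representation n K M by fact
  interpret N: representation n K N by fact
  show ?thesis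
    by (rule fdvs_of_injection[OF rep_hom_vectorspace[OF assms] hom_space_fdvs[OF M.fdvs N.fdvs], of "\<lambda>x. x"])
      (auto simp: hom_space_carrier rep_hom_carrier intro!: module_homI)
qed

lemma dual_rep_simps [simp]:
  "carrier (dual_rep n K M) = carrier (hom_space K M (scalars K))"
  "zero (dual_rep n K M) = zero (hom_space K M (scalars K))"
  "add (dual_rep n K M) = add (hom_space K M (scalars K))"
  "smult (dual_rep n K M) = smult (hom_space K M (scalars K))"
  "act (dual_rep n K M) g \<phi> = (\<lambda>x\<in>carrier M. \<phi> (act M (inv\<^bsub>sym_group n\<^esub> g) x))"
  by (simp_all add: dual_rep_def)

lemma dual_rep_representation:
  assumes "representation n K M"
  shows "representation n K (dual_rep n K M)"
proof -
  interpret M: representation n K M by fact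
  interpret G: group "sym_group n" by (rule sym_group_is_group)
  note inv = G.inv_closed
  have in': "(\<lambda>x\<in>carrier M. \<phi> (act M g x)) \<in> carrier (hom_space K M (scalars K))"
    if "g \<in> carrier (sym_group n)" "\<phi> \<in> carrier (hom_space K M (scalars K))" for g \<phi>
    using that module_hom_comp[OF M.act_linear]
    by (intro module_hom_restrict[OF M.module]) (auto simp: hom_space_carrier)
  show ?thesis unfolding dual_rep_def
  proof (rule representation_mk_repI)
    show "fdvs K (hom_space K M (scalars K))"
      by (rule hom_space_fdvs[OF M.fdvs scalars_fdvs]) (rule M.field_axioms)
    show "(\<lambda>\<phi>. \<lambda>x\<in>carrier M. \<phi> (act M (inv\<^bsub>sym_group n\<^esub> g) x)) \<in> module_hom K (hom_space K M (scalars K)) (hom_space K M (scalars K))"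
      if "g \<in> carrier (sym_group n)" for g
      by (rule module_homI) (use that inv in' in \<open>auto simp del: sym_group_inv_equality intro!: restrict_ext\<close>)
    show "(\<lambda>x\<in>carrier M. \<phi> (act M (inv\<^bsub>sym_group n\<^esub> \<one>\<^bsub>sym_group n\<^esub>) x)) = \<phi>" if "\<phi> \<in> carrier (hom_space K M (scalars K))" for \<phi>
      using that G.inv_one by (auto simp: hom_space_carrier M.act_one simp del: sym_group_inv_equality intro!: extensionalityI[of _ "carrier M"])
    show "(\<lambda>x\<in>carrier M. \<phi> (act M (inv\<^bsub>sym_group n\<^esub> (g \<otimes>\<^bsub>sym_group n\<^esub> h)) x)) =
      (\<lambda>x\<in>carrier M. (\<lambda>x\<in>carrier M. \<phi> (act M (inv\<^bsub>sym_group n\<^esub> h) x)) (act M (inv\<^bsub>sym_group n\<^esub> g) x))"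
      if "g \<in> carrier (sym_group n)" "h \<in> carrier (sym_group n)" for g h \<phi>
      using that by (auto simp: G.inv_mult_group M.act_mult inv simp del: sym_group_inv_equality intro!: restrict_ext)
  qed
qed

lemma perm_rep_simps [simp]:
  assumes "field K"
  shows "carrier (perm_rep n K X a) = X \<rightarrow>\<^sub>E carrier K"
    "zero (perm_rep n K X a) = (\<lambda>x\<in>X. \<zero>\<^bsub>K\<^esub>)"
    "f \<oplus>\<^bsub>perm_rep n K X a\<^esub> f' = (\<lambda>x\<in>X. f x \<oplus>\<^bsub>K\<^esub> f' x)"
    "c \<odot>\<^bsub>perm_rep n K X a\<^esub> f = (\<lambda>x\<in>X. c \<otimes>\<^bsub>K\<^esub> f x)"
    "act (perm_rep n K X a) g f = (\<lambda>x\<in>X. f (a (inv\<^bsub>sym_group n\<^esub> g) x))"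
  by (simp_all add: perm_rep_def assms)

lemma perm_rep_representation:
  assumes K: "field K" and "finite X"
    and X: "\<And>g x. \<lbrakk>g \<in> carrier (sym_group n); x \<in> X\<rbrakk> \<Longrightarrow> a g x \<in> X"
    and one: "\<And>x. x \<in> X \<Longrightarrow> a \<one>\<^bsub>sym_group n\<^esub> x = x"
    and mult: "\<And>g h x. \<lbrakk>g \<in> carrier (sym_group n); h \<in> carrier (sym_group n); x \<in> X\<rbrakk> \<Longrightarrow>
      a (g \<otimes>\<^bsub>sym_group n\<^esub> h) x = a g (a h x)"
  shows "representation n K (perm_rep n K X a)"
proof -
  interpret G: group "sym_group n" by (rule sym_group_is_group)
  note [simp] = func_space_simps[OF K]
  show ?thesis unfolding perm_rep_def
  proof (rule representation_mk_repI)
    show "fdvs K (ring.func_space K X)" by (rule func_space_fdvs) fact+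
    show "(\<lambda>\<phi>. \<lambda>x\<in>X. \<phi> (a (inv\<^bsub>sym_group n\<^esub> g) x)) \<in> module_hom K (ring.func_space K X) (ring.func_space K X)"
      if "g \<in> carrier (sym_group n)" for g
      by (rule module_homI) (use that X G.inv_closed in \<open>auto simp del: sym_group_inv_equality intro!: restrict_ext\<close>)
    show "(\<lambda>x\<in>X. \<phi> (a (inv\<^bsub>sym_group n\<^esub> \<one>\<^bsub>sym_group n\<^esub>) x)) = \<phi>" if "\<phi> \<in> carrier (ring.func_space K X)" for \<phi>
      using that G.inv_one by (auto simp: one PiE_def simp del: sym_group_inv_equality intro!: extensionalityI[of _ X])
    show "(\<lambda>x\<in>X. \<phi> (a (inv\<^bsub>sym_group n\<^esub> (g \<otimes>\<^bsub>sym_group n\<^esub> h)) x)) =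
      (\<lambda>x\<in>X. (\<lambda>x\<in>X. \<phi> (a (inv\<^bsub>sym_group n\<^esub> h) x)) (a (inv\<^bsub>sym_group n\<^esub> g) x))"
      if "g \<in> carrier (sym_group n)" "h \<in> carrier (sym_group n)" for g h \<phi>
      using that by (auto simp: G.inv_mult_group mult X G.inv_closed simp del: sym_group_inv_equality intro!: restrict_ext)
  qed
qed

text \<open>The sum over the group of the conjugates of the linear map \<open>z \<mapsto> \<phi>(z) x\<close>.\<close>

definition avg :: "nat \<Rightarrow> ('k, 'x) rep \<Rightarrow> ('k, 'y) rep \<Rightarrow> ('x \<Rightarrow> 'k) \<Rightarrow> 'y \<Rightarrow> 'x \<Rightarrow> 'y" where
  "avg n M N \<phi> x = (\<lambda>z\<in>carrier M. \<Oplus>\<^bsub>N\<^esub>g\<in>carrier (sym_group n).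
     \<phi> (act M (inv\<^bsub>sym_group n\<^esub> g) z) \<odot>\<^bsub>N\<^esub> act N g x)"

section \<open>Averages over the group\<close>

locale two_reps = M: representation n K M + N: representation n K N
  for n :: nat and K :: "('k, 'z) ring_scheme" and M :: "('k, 'x) rep" and N :: "('k, 'y) rep"
begin

abbreviation "G \<equiv> carrier (sym_group n)"

sublocale G: group "sym_group n" by (rule sym_group_is_group)

declare sym_group_inv_equality [simp del]

lemma avg_term: "\<lbrakk>\<phi> \<in> functionals K M; x \<in> carrier N; z \<in> carrier M; g \<in> G\<rbrakk> \<Longrightarrow>
    \<phi> (act M (inv\<^bsub>sym_group n\<^esub> g) z) \<odot>\<^bsub>N\<^esub> act N g x \<in> carrier N"
  by (intro N.smult_closed functionals_in[of \<phi>]) auto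

lemma avg_arr:
  assumes \<phi>: "\<phi> \<in> functionals K M" and x: "x \<in> carrier N"
  shows "avg n M N \<phi> x \<in> carrier (rep_hom n K M N)"
proof -
  have \<phi>K: "\<phi> z \<in> carrier K" if "z \<in> carrier M" for z using functionals_in[OF \<phi> that] .
  have \<phi>a: "\<phi> (y \<oplus>\<^bsub>M\<^esub> z) = \<phi> y \<oplus>\<^bsub>K\<^esub> \<phi> z" if "y \<in> carrier M" "z \<in> carrier M" for y z
    using \<phi> that by (simp add: functionals_def module_hom_add)
  have \<phi>s: "\<phi> (c \<odot>\<^bsub>M\<^esub> z) = c \<otimes>\<^bsub>K\<^esub> \<phi> z" if "c \<in> carrier K" "z \<in> carrier M" for c z
    using \<phi> that by (simp add: functionals_def module_hom_smult)
  note inv = G.inv_closed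
  have hom: "avg n M N \<phi> x \<in> module_hom K M N"
  proof (rule module_homI, goal_cases)
    case (1 z) then show ?case by (simp add: avg_def avg_term[OF \<phi> x] N.M.finsum_closed Pi_iff)
  next
    case (2 y z)
    have "avg n M N \<phi> x (y \<oplus>\<^bsub>M\<^esub> z) = (\<Oplus>\<^bsub>N\<^esub>g\<in>G. \<phi> (act M (inv\<^bsub>sym_group n\<^esub> g) y) \<odot>\<^bsub>N\<^esub> act N g x \<oplus>\<^bsub>N\<^esub>
      \<phi> (act M (inv\<^bsub>sym_group n\<^esub> g) z) \<odot>\<^bsub>N\<^esub> act N g x)"
      using 2 x by (simp add: avg_def) (rule N.M.finsum_cong', auto simp: \<phi>K \<phi>a M.act_add N.smult_l_distr inv)
    also have "\<dots> = avg n M N \<phi> x y \<oplus>\<^bsub>N\<^esub> avg n M N \<phi> x z"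
      using 2 by (simp add: avg_def) (rule N.M.finsum_addf, auto simp: avg_term[OF \<phi> x])
    finally show ?case .
  next
    case (3 c z)
    have "avg n M N \<phi> x (c \<odot>\<^bsub>M\<^esub> z) = (\<Oplus>\<^bsub>N\<^esub>g\<in>G. c \<odot>\<^bsub>N\<^esub> (\<phi> (act M (inv\<^bsub>sym_group n\<^esub> g) z) \<odot>\<^bsub>N\<^esub> act N g x))"
      using 3 x by (simp add: avg_def) (rule N.M.finsum_cong', auto simp: \<phi>K \<phi>s M.act_smult N.smult_assoc1 inv)
    also have "\<dots> = c \<odot>\<^bsub>N\<^esub> avg n M N \<phi> x z"
      using 3 by (simp add: avg_def) (rule N.finsum_smult[symmetric], auto simp: avg_term[OF \<phi> x])
    finally show ?case .
  qed
  have "avg n M N \<phi> x (act M h z) = act N h (avg n M N \<phi> x z)" if h: "h \<in> G" and z: "z \<in> carrier M" for h z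
  proof -
    \<comment> \<open>Equivariance is reindexing of the sum by left translation with h, since the
      inverse of h k, multiplied by h on the right, is the inverse of k.\<close>
    have bij: "(\<lambda>k. h \<otimes>\<^bsub>sym_group n\<^esub> k) ` G = G" "inj_on (\<lambda>k. h \<otimes>\<^bsub>sym_group n\<^esub> k) G"
      using h by (auto simp: G.surj_const_mult G.inj_on_cmult)
    have "avg n M N \<phi> x (act M h z) = (\<Oplus>\<^bsub>N\<^esub>g\<in>(\<lambda>k. h \<otimes>\<^bsub>sym_group n\<^esub> k) ` G.
        \<phi> (act M (inv\<^bsub>sym_group n\<^esub> g) (act M h z)) \<odot>\<^bsub>N\<^esub> act N g x)"
      using h z bij by (simp add: avg_def)
    also have "\<dots> = (\<Oplus>\<^bsub>N\<^esub>k\<in>G. \<phi> (act M (inv\<^bsub>sym_group n\<^esub> (h \<otimes>\<^bsub>sym_group n\<^esub> k)) (act M h z)) \<odot>\<^bsub>N\<^esub>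
        act N (h \<otimes>\<^bsub>sym_group n\<^esub> k) x)"
      using h z by (intro N.M.finsum_reindex bij) (auto intro!: avg_term \<phi> x)
    also have "\<dots> = (\<Oplus>\<^bsub>N\<^esub>k\<in>G. act N h (\<phi> (act M (inv\<^bsub>sym_group n\<^esub> k) z) \<odot>\<^bsub>N\<^esub> act N k x))"
    proof (rule N.M.finsum_cong')
      fix k assume k: "k \<in> G"
      have "act M (inv\<^bsub>sym_group n\<^esub> (h \<otimes>\<^bsub>sym_group n\<^esub> k)) (act M h z) =
          act M (inv\<^bsub>sym_group n\<^esub> (h \<otimes>\<^bsub>sym_group n\<^esub> k) \<otimes>\<^bsub>sym_group n\<^esub> h) z"
        using h k z by (simp add: M.act_mult inv)
      also have "inv\<^bsub>sym_group n\<^esub> (h \<otimes>\<^bsub>sym_group n\<^esub> k) \<otimes>\<^bsub>sym_group n\<^esub> h = inv\<^bsub>sym_group n\<^esub> k"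
        using h k by (simp add: G.inv_mult_group G.m_assoc inv)
      finally show "\<phi> (act M (inv\<^bsub>sym_group n\<^esub> (h \<otimes>\<^bsub>sym_group n\<^esub> k)) (act M h z)) \<odot>\<^bsub>N\<^esub> act N (h \<otimes>\<^bsub>sym_group n\<^esub> k) x =
          act N h (\<phi> (act M (inv\<^bsub>sym_group n\<^esub> k) z) \<odot>\<^bsub>N\<^esub> act N k x)"
        using h k z x by (simp add: N.act_smult N.act_mult \<phi>K inv)
    qed (use h z in \<open>auto intro!: N.act_closed avg_term \<phi> x\<close>)
    also have "\<dots> = act N h (avg n M N \<phi> x z)"
      using z by (simp add: avg_def) (rule module_hom_finsum[OF N.module N.module N.act_linear[OF h], symmetric],
        auto intro!: avg_term \<phi> x)
    finally show ?thesis .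
  qed
  with hom show ?thesis by (simp add: rep_hom_carrier avg_def)
qed

lemma avg_add:
  assumes "\<phi> \<in> functionals K M" "x \<in> carrier N" "y \<in> carrier N"
  shows "avg n M N \<phi> (x \<oplus>\<^bsub>N\<^esub> y) = avg n M N \<phi> x \<oplus>\<^bsub>rep_hom n K M N\<^esub> avg n M N \<phi> y"
proof -
  have "avg n M N \<phi> (x \<oplus>\<^bsub>N\<^esub> y) z = avg n M N \<phi> x z \<oplus>\<^bsub>N\<^esub> avg n M N \<phi> y z" if z: "z \<in> carrier M" for z
  proof -
    have "avg n M N \<phi> (x \<oplus>\<^bsub>N\<^esub> y) z = (\<Oplus>\<^bsub>N\<^esub>g\<in>G. \<phi> (act M (inv\<^bsub>sym_group n\<^esub> g) z) \<odot>\<^bsub>N\<^esub> act N g x \<oplus>\<^bsub>N\<^esub>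
      \<phi> (act M (inv\<^bsub>sym_group n\<^esub> g) z) \<odot>\<^bsub>N\<^esub> act N g y)"
      using z assms by (simp add: avg_def)
        (rule N.M.finsum_cong', auto simp: N.act_add N.smult_r_distr functionals_in G.inv_closed)
    also have "\<dots> = avg n M N \<phi> x z \<oplus>\<^bsub>N\<^esub> avg n M N \<phi> y z"
      using z assms by (simp add: avg_def) (rule N.M.finsum_addf, auto intro!: avg_term)
    finally show ?thesis .
  qed
  then show ?thesis by (auto simp: avg_def intro!: restrict_ext)
qed

lemma avg_smult:
  assumes "\<phi> \<in> functionals K M" "x \<in> carrier N" "c \<in> carrier K"
  shows "avg n M N \<phi> (c \<odot>\<^bsub>N\<^esub> x) = c \<odot>\<^bsub>rep_hom n K M N\<^esub> avg n M N \<phi> x"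
proof -
  have "avg n M N \<phi> (c \<odot>\<^bsub>N\<^esub> x) z = c \<odot>\<^bsub>N\<^esub> avg n M N \<phi> x z" if z: "z \<in> carrier M" for z
  proof -
    have "avg n M N \<phi> (c \<odot>\<^bsub>N\<^esub> x) z = (\<Oplus>\<^bsub>N\<^esub>g\<in>G. c \<odot>\<^bsub>N\<^esub> (\<phi> (act M (inv\<^bsub>sym_group n\<^esub> g) z) \<odot>\<^bsub>N\<^esub> act N g x))"
      using z assms by (simp add: avg_def)
        (rule N.M.finsum_cong', auto simp: N.act_smult N.smult_assoc1[symmetric] functionals_in G.inv_closed M.m_comm)
    also have "\<dots> = c \<odot>\<^bsub>N\<^esub> avg n M N \<phi> x z"
      using z assms by (simp add: avg_def) (rule N.finsum_smult[symmetric], auto intro!: avg_term)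
    finally show ?thesis .
  qed
  then show ?thesis by (auto simp: avg_def intro!: restrict_ext)
qed

lemma avg_add_left:
  assumes "\<phi> \<in> functionals K M" "\<psi> \<in> functionals K M" "x \<in> carrier N"
  shows "avg n M N (\<lambda>z. \<phi> z \<oplus>\<^bsub>K\<^esub> \<psi> z) x = avg n M N \<phi> x \<oplus>\<^bsub>rep_hom n K M N\<^esub> avg n M N \<psi> x"
proof -
  have "avg n M N (\<lambda>z. \<phi> z \<oplus>\<^bsub>K\<^esub> \<psi> z) x z = avg n M N \<phi> x z \<oplus>\<^bsub>N\<^esub> avg n M N \<psi> x z" if z: "z \<in> carrier M" for z
  proof -
    have "avg n M N (\<lambda>z. \<phi> z \<oplus>\<^bsub>K\<^esub> \<psi> z) x z = (\<Oplus>\<^bsub>N\<^esub>g\<in>G. \<phi> (act M (inv\<^bsub>sym_group n\<^esub> g) z) \<odot>\<^bsub>N\<^esub> act N g x \<oplus>\<^bsub>N\<^esub>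
      \<psi> (act M (inv\<^bsub>sym_group n\<^esub> g) z) \<odot>\<^bsub>N\<^esub> act N g x)"
      using z assms by (simp add: avg_def)
        (rule N.M.finsum_cong', auto simp: N.smult_l_distr functionals_in G.inv_closed)
    also have "\<dots> = avg n M N \<phi> x z \<oplus>\<^bsub>N\<^esub> avg n M N \<psi> x z"
      using z assms by (simp add: avg_def) (rule N.M.finsum_addf, auto intro!: avg_term)
    finally show ?thesis .
  qed
  then show ?thesis by (auto simp: avg_def intro!: restrict_ext)
qed

lemma avg_smult_left:
  assumes "\<phi> \<in> functionals K M" "x \<in> carrier N" "c \<in> carrier K"
  shows "avg n M N (\<lambda>z. c \<otimes>\<^bsub>K\<^esub> \<phi> z) x = c \<odot>\<^bsub>rep_hom n K M N\<^esub> avg n M N \<phi> x"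
proof -
  have "avg n M N (\<lambda>z. c \<otimes>\<^bsub>K\<^esub> \<phi> z) x z = c \<odot>\<^bsub>N\<^esub> avg n M N \<phi> x z" if z: "z \<in> carrier M" for z
  proof -
    have "avg n M N (\<lambda>z. c \<otimes>\<^bsub>K\<^esub> \<phi> z) x z = (\<Oplus>\<^bsub>N\<^esub>g\<in>G. c \<odot>\<^bsub>N\<^esub> (\<phi> (act M (inv\<^bsub>sym_group n\<^esub> g) z) \<odot>\<^bsub>N\<^esub> act N g x))"
      using z assms by (simp add: avg_def)
        (rule N.M.finsum_cong', auto simp: N.smult_assoc1 functionals_in G.inv_closed)
    also have "\<dots> = c \<odot>\<^bsub>N\<^esub> avg n M N \<phi> x z"
      using z assms by (simp add: avg_def) (rule N.finsum_smult[symmetric], auto intro!: avg_term)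
    finally show ?thesis .
  qed
  then show ?thesis by (auto simp: avg_def intro!: restrict_ext)
qed

end

text \<open>Equivariant maps pass through the sum. Together with \<open>avg_pre\<close> this makes
  the averaged maps natural in the vector and in the functional; the naturality of the
  transformations built from them rests on these two facts.\<close>

lemma avg_post:
  assumes "representation n K M" "representation n K N" "representation n K P"
    and \<phi>: "\<phi> \<in> functionals K M" and x: "x \<in> carrier N" and u: "u \<in> carrier (rep_hom n K N P)"
  shows "compose (carrier M) u (avg n M N \<phi> x) = avg n M P \<phi> (u x)"
proof -
  interpret MN: two_reps n K M N by (rule two_reps.intro) fact+
  interpret P: representation n K P by fact
  have "u (avg n M N \<phi> x z) = avg n M P \<phi> (u x) z" if z: "z \<in> carrier M" for z
  proof -
    have "u (avg n M N \<phi> x z) = (\<Oplus>\<^bsub>P\<^esub>g\<in>MN.G. u (\<phi> (act M (inv\<^bsub>sym_group n\<^esub> g) z) \<odot>\<^bsub>N\<^esub> act N g x))"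
      using z by (simp add: avg_def) (rule module_hom_finsum[OF MN.N.module P.module rep_hom_hom[OF u]],
        auto intro!: MN.avg_term \<phi> x)
    also have "\<dots> = avg n M P \<phi> (u x) z"
      using z x by (simp add: avg_def) (rule P.M.finsum_cong', auto simp: module_hom_smult[OF rep_hom_hom[OF u]]
        rep_hom_act[OF u] functionals_in[OF \<phi>] MN.G.inv_closed rep_hom_in[OF u])
    finally show ?thesis .
  qed
  then show ?thesis by (auto simp: compose_def avg_def intro!: restrict_ext)
qed

lemma avg_pre:
  assumes "representation n K L" "representation n K M" "representation n K N"
    and \<phi>: "\<phi> \<in> functionals K M" and x: "x \<in> carrier N" and u: "u \<in> carrier (rep_hom n K L M)"
  shows "compose (carrier L) (avg n M N \<phi> x) u = avg n L N (\<lambda>z. \<phi> (u z)) x"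
proof -
  interpret L: representation n K L by fact
  interpret MN: two_reps n K M N by (rule two_reps.intro) fact+
  have "avg n M N \<phi> x (u z) = avg n L N (\<lambda>z. \<phi> (u z)) x z" if z: "z \<in> carrier L" for z
    using z rep_hom_in[OF u z] by (simp add: avg_def) (rule MN.N.M.finsum_cong', auto simp: rep_hom_act[OF u] MN.G.inv_closed
      functionals_in[OF \<phi>] rep_hom_in[OF u] x)
  then show ?thesis by (auto simp: compose_def avg_def intro!: restrict_ext)
qed

text \<open>The hypothesis makes \<phi> the delta function on the orbit of \<open>z\<close>. At
  \<open>z\<close> the summand of g carries the coefficient \<phi>(g^-1 z), so only g = 1
  contributes, with value \<open>x\<close>.\<close>

lemma (in two_reps) avg_at:
  assumes \<phi>: "\<phi> \<in> functionals K M" and x: "x \<in> carrier N" and z: "z \<in> carrier M"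
    and dual: "\<And>g. g \<in> G \<Longrightarrow> \<phi> (act M g z) = (if g = \<one>\<^bsub>sym_group n\<^esub> then \<one>\<^bsub>K\<^esub> else \<zero>\<^bsub>K\<^esub>)"
  shows "avg n M N \<phi> x z = x"
proof -
  have "avg n M N \<phi> x z = (\<Oplus>\<^bsub>N\<^esub>g\<in>G. if \<one>\<^bsub>sym_group n\<^esub> = g then act N g x else \<zero>\<^bsub>N\<^esub>)"
    using z x by (simp add: avg_def)
      (rule N.M.finsum_cong', auto simp: dual G.inv_closed G.inv_eq_1_iff)
  also have "\<dots> = x"
    using x N.M.finsum_singleton[OF G.one_closed sym_group_finite, of "\<lambda>g. act N g x"]
    by (auto simp: N.act_one)
  finally show ?thesis .
qed

text \<open>Transpose of \<open>avg_at\<close>: here \<psi> is the delta function on the orbit of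
  \<open>x\<close>, and applying it to the sum keeps just the coefficient at g = 1, which is
  \<phi>(z).\<close>

lemma (in two_reps) functional_avg:
  assumes \<phi>: "\<phi> \<in> functionals K M" and x: "x \<in> carrier N" and z: "z \<in> carrier M" and \<psi>: "\<psi> \<in> functionals K N"
    and dual: "\<And>g. g \<in> G \<Longrightarrow> \<psi> (act N g x) = (if g = \<one>\<^bsub>sym_group n\<^esub> then \<one>\<^bsub>K\<^esub> else \<zero>\<^bsub>K\<^esub>)"
  shows "\<psi> (avg n M N \<phi> x z) = \<phi> z"
proof -
  interpret S: vectorspace K "scalars K" by (rule M.scalars_vectorspace)
  have "\<psi> (avg n M N \<phi> x z) = (\<Oplus>\<^bsub>scalars K\<^esub>g\<in>G. \<psi> (\<phi> (act M (inv\<^bsub>sym_group n\<^esub> g) z) \<odot>\<^bsub>N\<^esub> act N g x))"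
    using z \<psi> unfolding avg_def functionals_def
    by simp (rule module_hom_finsum[OF N.module S.module_axioms, simplified], auto intro!: avg_term \<phi> x)
  also have "\<dots> = (\<Oplus>\<^bsub>scalars K\<^esub>g\<in>G. if \<one>\<^bsub>sym_group n\<^esub> = g then \<phi> (act M (inv\<^bsub>sym_group n\<^esub> g) z) else \<zero>\<^bsub>scalars K\<^esub>)"
  proof (rule S.M.finsum_cong')
    fix g assume g: "g \<in> G"
    have "\<phi> (act M (inv\<^bsub>sym_group n\<^esub> g) z) \<in> carrier K" using g z by (intro functionals_in[OF \<phi>]) (simp add: G.inv_closed)
    then show "\<psi> (\<phi> (act M (inv\<^bsub>sym_group n\<^esub> g) z) \<odot>\<^bsub>N\<^esub> act N g x) =
        (if \<one>\<^bsub>sym_group n\<^esub> = g then \<phi> (act M (inv\<^bsub>sym_group n\<^esub> g) z) else \<zero>\<^bsub>scalars K\<^esub>)"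
      using \<psi> g x by (auto simp: functionals_def module_hom_smult dual)
  qed (use z in \<open>auto intro!: functionals_in[OF \<phi>] simp: G.inv_closed\<close>)
  also have "\<dots> = \<phi> z"
    using z S.M.finsum_singleton[OF G.one_closed sym_group_finite, of "\<lambda>g. \<phi> (act M (inv\<^bsub>sym_group n\<^esub> g) z)"]
      functionals_in[OF \<phi>] by (simp add: M.act_one Pi_iff G.inv_closed)
  finally show ?thesis .
qed

lemma (in two_reps) avg_cong:
  assumes "x \<in> carrier N" "\<psi> \<in> functionals K M" "\<And>z. z \<in> carrier M \<Longrightarrow> \<phi> z = \<psi> z"
  shows "avg n M N \<phi> x = avg n M N \<psi> x"
  unfolding avg_def
  by (rule restrict_ext, rule N.M.finsum_cong') (use assms in \<open>auto simp: G.inv_closed functionals_in\<close>)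

section \<open>Dual bases, composition of tensor maps, reflexivity\<close>

lemma dual_expansion:
  assumes V: "fdvs K V" and dw: "dual_basis K V d z w" and \<phi>: "\<phi> \<in> carrier (hom_space K V (scalars K))"
  shows "(\<Oplus>\<^bsub>hom_space K V (scalars K)\<^esub>i\<in>{..<d}. \<phi> (z i) \<odot>\<^bsub>hom_space K V (scalars K)\<^esub> restrict (w i) (carrier V)) = \<phi>"
    (is "?s = \<phi>")
proof (rule extensionalityI[of _ "carrier V"])
  interpret V: vectorspace K V using V by (rule fdvs_vs)
  interpret S: vectorspace K "scalars K" by (rule V.scalars_vectorspace)
  let ?D = "hom_space K V (scalars K)"
  interpret D: vectorspace K ?D by (rule hom_space_vectorspace) (rule V.vectorspace_axioms S.vectorspace_axioms)+
  have z: "z i \<in> carrier V" and w: "w i \<in> module_hom K V (scalars K)" if "i < d" for i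
    using that dw by (auto simp: dual_basis_def functionals_def)
  have w': "restrict (w i) (carrier V) \<in> carrier ?D" if "i < d" for i
    using module_hom_restrict[OF V.module_axioms w[OF that]] .
  have \<phi>h: "\<phi> \<in> module_hom K V (scalars K)" using \<phi> by (simp add: hom_space_carrier)
  have \<phi>z: "\<phi> (z i) \<in> carrier K" if "i < d" for i using module_hom_in[OF \<phi>h z[OF that]] by simp
  have sD: "?s \<in> carrier ?D" using \<phi>z w' by (intro D.M.finsum_closed) (auto simp del: hom_space_simps)
  then show "?s \<in> extensional (carrier V)" by (simp add: hom_space_carrier)
  show "\<phi> \<in> extensional (carrier V)" using \<phi> by (simp add: hom_space_carrier)
  fix y assume y: "y \<in> carrier V"
  have ev: "(\<lambda>f. f y) \<in> module_hom K ?D (scalars K)"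
    by (rule module_homI) (use y in \<open>auto simp: hom_space_carrier module_hom_def\<close>)
  have "?s y = (\<Oplus>\<^bsub>scalars K\<^esub>i\<in>{..<d}. (\<phi> (z i) \<odot>\<^bsub>?D\<^esub> restrict (w i) (carrier V)) y)"
    using \<phi>z w' by (intro module_hom_finsum[OF D.module_axioms S.module_axioms ev]) (auto simp del: hom_space_simps)
  also have "\<dots> = (\<Oplus>\<^bsub>scalars K\<^esub>i\<in>{..<d}. \<phi> (w i y \<odot>\<^bsub>V\<^esub> z i))"
    using y \<phi>z z module_hom_in[OF w y]
    by (intro S.M.finsum_cong') (auto simp: module_hom_smult[OF \<phi>h] V.m_comm)
  also have "\<dots> = \<phi> (\<Oplus>\<^bsub>V\<^esub>i\<in>{..<d}. w i y \<odot>\<^bsub>V\<^esub> z i)"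
    using z module_hom_in[OF w y] by (intro module_hom_finsum[OF V.module_axioms S.module_axioms \<phi>h, symmetric]) auto
  also have "\<dots> = \<phi> y" using dw y by (simp add: dual_basis_def)
  finally show "?s y = \<phi> y" .
qed

lemma tensor_map_ident:
  assumes ts: "two_spaces K M N" and f: "f \<in> module_hom K M M" "\<And>x. x \<in> carrier M \<Longrightarrow> f x = x"
    and u: "u \<in> module_hom K N N" "\<And>x. x \<in> carrier N \<Longrightarrow> u x = x" and t: "t \<in> carrier (tensor K M N)"
  shows "tensor_map K M N M N f u t = t"
  by (rule two_spaces.tensor_hom_eq[where g = "\<lambda>t. t", OF ts tensor_map_hom(1)[OF ts ts f(1) u(1)] _
        vectorspace_module[OF two_spaces.tensor_vs[OF ts]] _ t])
    (simp_all add: tensor_map_hom(2)[OF ts ts f(1) u(1)] f u module_homI)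

lemma tensor_map_comp:
  assumes ts: "two_spaces K M N" "two_spaces K M' N'" "two_spaces K M'' N''"
    and f: "f \<in> module_hom K M M'" "f' \<in> module_hom K M' M''" "h \<in> module_hom K M M''" "\<And>x. x \<in> carrier M \<Longrightarrow> h x = f' (f x)"
    and u: "u \<in> module_hom K N N'" "u' \<in> module_hom K N' N''" "k \<in> module_hom K N N''" "\<And>x. x \<in> carrier N \<Longrightarrow> k x = u' (u x)"
    and t: "t \<in> carrier (tensor K M N)"
  shows "tensor_map K M N M'' N'' h k t = tensor_map K M' N' M'' N'' f' u' (tensor_map K M N M' N' f u t)"
proof -
  note a = tensor_map_hom[OF ts(1,2) f(1) u(1)] and b = tensor_map_hom[OF ts(2,3) f(2) u(2)]
    and c = tensor_map_hom[OF ts(1,3) f(3) u(3)]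
  show ?thesis
    by (rule two_spaces.tensor_hom_eq[OF ts(1) c(1) module_hom_comp[OF a(1) b(1)] vectorspace_module[OF two_spaces.tensor_vs[OF ts(3)]] _ t])
      (simp add: a(2) b(2) c(2) f(4) u(4) module_hom_in[OF f(1)] module_hom_in[OF u(1)])
qed

text \<open>The preimage of \<open>L\<close> in V is the sum of the \<open>L (w' i)\<close> times
  \<open>z i\<close>. This is how a vector is later produced from prescribed values of all
  functionals on it.\<close>

lemma fdvs_reflexive:
  assumes V: "fdvs K V" and L: "L \<in> functionals K (hom_space K V (scalars K))"
  shows "\<exists>x\<in>carrier V. \<forall>\<phi>\<in>carrier (hom_space K V (scalars K)). \<phi> x = L \<phi>"
proof -
  obtain d z w where dw: "dual_basis K V d z w" using V by (rule fdvs_dual_basis)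
  interpret V: vectorspace K V using V by (rule fdvs_vs)
  interpret S: vectorspace K "scalars K" by (rule V.scalars_vectorspace)
  let ?D = "hom_space K V (scalars K)"
  interpret D: vectorspace K ?D by (rule hom_space_vectorspace) (rule V.vectorspace_axioms S.vectorspace_axioms)+
  have z: "z i \<in> carrier V" and w: "w i \<in> module_hom K V (scalars K)" if "i < d" for i
    using that dw by (auto simp: dual_basis_def functionals_def)
  define w' where "w' i = restrict (w i) (carrier V)" for i
  have w': "w' i \<in> carrier ?D" if "i < d" for i
    unfolding w'_def using module_hom_restrict[OF V.module_axioms w[OF that]] .
  let ?x = "\<Oplus>\<^bsub>V\<^esub>i\<in>{..<d}. L (w' i) \<odot>\<^bsub>V\<^esub> z i"
  have LK: "L \<phi> \<in> carrier K" if "\<phi> \<in> carrier ?D" for \<phi> using functionals_in[OF L that] .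
  have x: "?x \<in> carrier V" using z w' LK by (intro V.M.finsum_closed) auto
  have "\<phi> ?x = L \<phi>" if \<phi>: "\<phi> \<in> carrier ?D" for \<phi>
  proof -
    have \<phi>h: "\<phi> \<in> module_hom K V (scalars K)" using \<phi> by (simp add: hom_space_carrier)
    have \<phi>z: "\<phi> (z i) \<in> carrier K" if "i < d" for i using module_hom_in[OF \<phi>h z[OF that]] by simp
    have sum: "(\<Oplus>\<^bsub>?D\<^esub>i\<in>{..<d}. \<phi> (z i) \<odot>\<^bsub>?D\<^esub> w' i) = \<phi>" (is "?s = \<phi>")
      unfolding w'_def by (rule dual_expansion[OF V dw \<phi>])
    have "\<phi> ?x = (\<Oplus>\<^bsub>scalars K\<^esub>i\<in>{..<d}. \<phi> (L (w' i) \<odot>\<^bsub>V\<^esub> z i))"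
      using z w' LK by (intro module_hom_finsum[OF V.module_axioms S.module_axioms \<phi>h]) auto
    also have "\<dots> = (\<Oplus>\<^bsub>scalars K\<^esub>i\<in>{..<d}. L (\<phi> (z i) \<odot>\<^bsub>?D\<^esub> w' i))"
      using z w' LK \<phi>z L by (intro S.M.finsum_cong')
        (auto simp: module_hom_smult[OF \<phi>h] module_hom_smult[of L K ?D] functionals_def V.m_comm simp del: hom_space_simps)
    also have "\<dots> = L ?s"
      using w' \<phi>z L by (intro module_hom_finsum[OF D.module_axioms S.module_axioms, symmetric])
        (auto simp: functionals_def simp del: hom_space_simps)
    finally show ?thesis by (simp only: sum)
  qed
  with x show ?thesis by blast
qed

lemma module_hom_copy_rep [simp]:
  "module_hom L (copy_rep M) W = module_hom L (copy_vs M) W" "module_hom L W (copy_rep M) = module_hom L W (copy_vs M)"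
  by (simp_all add: copy_rep_def)

lemma fdvs_copy_rep [simp]: "fdvs K (copy_rep M :: ('k, 'v) rep) = fdvs K (copy_vs M :: ('k, 'v) module)"
  by (simp add: copy_rep_def)

lemma functionals_copy_rep [simp]: "functionals K (copy_rep M) = functionals K (copy_vs M)"
  by (simp add: functionals_def)

lemma rep_hom_compose:
  assumes "representation n K M" "u \<in> carrier (rep_hom n K M N)" "v \<in> carrier (rep_hom n K N P)"
  shows "compose (carrier M) v u \<in> carrier (rep_hom n K M P)"
proof -
  interpret M: representation n K M by fact
  show ?thesis
    using assms(2,3) module_hom_cong[OF M.module _ module_hom_comp[OF rep_hom_hom[OF assms(2)] rep_hom_hom[OF assms(3)]]]
    by (auto simp: rep_hom_carrier compose_def module_hom_in)
qed

section \<open>Representations in the universe and the category of tensor powers\<close>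

locale coherent_setup = universe K e for K :: "('k, 'z) ring_scheme" and e :: "'k list \<Rightarrow> 'v" +
  fixes n :: nat
  assumes n_pos: "n > 0"
begin

abbreviation "G \<equiv> carrier (sym_group n)"

abbreviation one_G ("\<one>\<^sub>G") where "\<one>\<^sub>G \<equiv> \<one>\<^bsub>sym_group n\<^esub>"

abbreviation mult_G (infixl "\<cdot>" 70) where "g \<cdot> h \<equiv> g \<otimes>\<^bsub>sym_group n\<^esub> h"

abbreviation iv where "iv g \<equiv> inv\<^bsub>sym_group n\<^esub> g"

abbreviation Hom :: "('k, 'x) rep \<Rightarrow> ('k, 'y) rep \<Rightarrow> ('x \<Rightarrow> 'y) set" where
  "Hom M N \<equiv> carrier (rep_hom n K M N)"

sublocale G: group "sym_group n" by (rule sym_group_is_group)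

abbreviation R :: "('k, 'x) rep \<Rightarrow> bool" where "R \<equiv> representation n K"

lemma copy_rep_representation: "R M \<Longrightarrow> R (copy_rep M :: ('k, 'v) rep)"
proof -
  assume "R M"
  then interpret M: representation n K M .
  have "(\<lambda>a. enc (carrier M) (act M g (dec (carrier M) a))) \<in> module_hom K (copy_vs M :: ('k, 'v) module) (copy_vs M :: ('k, 'v) module)"
    if "g \<in> G" for g
    by (rule module_hom_comp[OF dec_hom[OF M.fdvs] module_hom_comp[OF M.act_linear[OF that] enc_hom[OF M.fdvs]]])
  then show ?thesis
    unfolding copy_rep_def
    by (intro representation_mk_repI copy_vs_fdvs M.fdvs) (auto simp: M.fdvs M.act_one M.act_mult)
qed

lemma enc_act: "\<lbrakk>R M; g \<in> G; x \<in> carrier M\<rbrakk> \<Longrightarrow>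
    act (copy_rep M) g (enc (carrier M) x :: 'v) = enc (carrier M) (act M g x)"
  by (simp add: representation.fdvs)

lemma copy_map_rep_hom:
  assumes M: "R M" and N: "R N" and f: "f \<in> module_hom K M N"
    and eqv: "\<And>g x. \<lbrakk>g \<in> G; x \<in> carrier M\<rbrakk> \<Longrightarrow> f (act M g x) = act N g (f x)"
  shows "copy_map M N f \<in> Hom (copy_rep M :: ('k, 'v) rep) (copy_rep N :: ('k, 'v) rep)"
proof -
  interpret M: representation n K M by fact
  interpret N: representation n K N by fact
  show ?thesis
    using module_hom_in[OF f]
    by (auto simp: rep_hom_carrier copy_map_hom[OF M.fdvs N.fdvs f] M.fdvs N.fdvs eqv elim!: copy_carrierE)
qed

abbreviation tp :: "('k, 'v) module \<Rightarrow> ('k, 'v) rep" where "tp \<equiv> tensor_power n K"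

lemma power_spaceI: "fdvs K V \<Longrightarrow> power_space K n V"
  by (simp add: power_space_def power_space_axioms_def field_axioms n_pos)

lemma tp_rep [simp]: "fdvs K V \<Longrightarrow> R (tp V)"
  unfolding tensor_power_def
  by (intro copy_rep_representation power_space.tensor_power_representation power_spaceI)

lemma Gamma_simps:
  "Ob (Gamma n K) = {V. fdvs K V}" "Mor (Gamma n K) V W = rep_hom n K (tp V) (tp W)"
  "Id (Gamma n K) V = (\<lambda>x\<in>carrier (tp V). x)" "Cmp (Gamma n K) U V W g f = compose (carrier (tp U)) g f"
  by (simp_all add: Gamma_def)

lemma lincategory_Gamma: "lincategory K (Gamma n K :: ('k, ('k, 'v) module, 'v \<Rightarrow> 'v) lincat)"
  by (rule lincategory_pullback[OF lincategory_Rep[OF field_axioms], of _ tp])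
    (auto simp: Gamma_simps Rep_simps)

text \<open>Tensors are functions on multilinear forms, so the coordinate function at \<tau> is
  evaluation at one particular form \<open>b\<close>. The translate of \<tau> by g has at place i
  the basis vector of index g^-1 i, so \<open>b\<close> yields the product of the Kronecker deltas
  of g^-1 i and i.\<close>

lemma special_vector:
  obtains E \<tau> w where "fdvs K (E :: ('k, 'v) module)" "\<tau> \<in> carrier (tp E)" "w \<in> functionals K (tp E)"
    "\<And>g. g \<in> G \<Longrightarrow> w (act (tp E) g \<tau>) = (if g = \<one>\<^sub>G then \<one>\<^bsub>K\<^esub> else \<zero>\<^bsub>K\<^esub>)"
proof -
  define F :: "('k, nat \<Rightarrow> 'k) module" where "F = ring.func_space K {1..n}"
  have F: "fdvs K F" unfolding F_def by (rule func_space_fdvs) (auto simp: field_axioms)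
  note F_simps = func_space_simps[OF field_axioms, of "{1..n}", folded F_def]
  define E where "E = (copy_vs F :: ('k, 'v) module)"
  have E: "fdvs K E" unfolding E_def by (rule copy_vs_fdvs[OF F])
  interpret P: power_space K n E by (rule power_spaceI[OF E])
  let ?T = "tensor_power_rep n K E"
  interpret T: representation n K ?T by (rule P.tensor_power_representation)
  define d where "d i j = (if i = j then \<one>\<^bsub>K\<^esub> else \<zero>\<^bsub>K\<^esub>)" for i j :: nat
  define v where "v = (\<lambda>i\<in>{1..n}. enc (carrier F) (\<lambda>j\<in>{1..n}. d i j) :: 'v)"
  have dF: "(\<lambda>j\<in>{1..n}. d i j) \<in> carrier F" for i by (auto simp: F_simps d_def)
  have v: "v \<in> P.P" using dF by (auto simp: v_def E_def)
  define c where "c i a = dec (carrier F) a i" for i :: nat and a :: 'v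
  have c: "c i \<in> module_hom K E (scalars K)" if "i \<in> {1..n}" for i
  proof -
    have "(\<lambda>f. f i) \<in> module_hom K F (scalars K)"
      by (rule module_homI) (use that in \<open>auto simp: F_simps\<close>)
    from module_hom_comp[OF dec_hom[OF F] this] show ?thesis by (simp add: c_def[abs_def] E_def)
  qed
  have cv: "c i (v j) = d j i" if "i \<in> {1..n}" "j \<in> {1..n}" for i j
    using that dF F by (simp add: c_def v_def)
  have cK: "c i a \<in> carrier K" if "i \<in> {1..n}" "a \<in> carrier E" for i a
    using module_hom_in[OF c[OF that(1)] that(2)] by simp
  \<comment> \<open>On a pure tensor this is its coefficient at \<tau>; it is multilinear because
    each argument occurs in exactly one factor.\<close>
  define b where "b = (\<lambda>v\<in>P.P. \<Otimes>\<^bsub>K\<^esub>i\<in>{1..n}. c i (v i))"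
  have split: "b (v(i := x)) = c i x \<otimes>\<^bsub>K\<^esub> (\<Otimes>\<^bsub>K\<^esub>j\<in>{1..n} - {i}. c j (v j))"
    and prodK: "(\<Otimes>\<^bsub>K\<^esub>j\<in>{1..n} - {i}. c j (v j)) \<in> carrier K"
    if "v \<in> P.P" "i \<in> {1..n}" "x \<in> carrier E" for v i x
  proof -
    have vE: "v j \<in> carrier E" if "j \<in> {1..n}" for j using \<open>v \<in> P.P\<close> that by auto
    show "(\<Otimes>\<^bsub>K\<^esub>j\<in>{1..n} - {i}. c j (v j)) \<in> carrier K"
      using cK vE by (intro finprod_closed) auto
    have "b (v(i := x)) = (\<Otimes>\<^bsub>K\<^esub>j\<in>insert i ({1..n} - {i}). c j ((v(i := x)) j))"
      using that P.upd_in[OF that] by (simp add: b_def insert_absorb)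
    also have "\<dots> = c i x \<otimes>\<^bsub>K\<^esub> (\<Otimes>\<^bsub>K\<^esub>j\<in>{1..n} - {i}. c j ((v(i := x)) j))"
      using that vE cK by (subst finprod_insert) auto
    also have "(\<Otimes>\<^bsub>K\<^esub>j\<in>{1..n} - {i}. c j ((v(i := x)) j)) = (\<Otimes>\<^bsub>K\<^esub>j\<in>{1..n} - {i}. c j (v j))"
      using vE cK by (intro finprod_cong') auto
    finally show "b (v(i := x)) = c i x \<otimes>\<^bsub>K\<^esub> (\<Otimes>\<^bsub>K\<^esub>j\<in>{1..n} - {i}. c j (v j))" .
  qed
  have b: "b \<in> P.MF"
    unfolding multilinear_forms_def
  proof (intro CollectI conjI ballI)
    show "b \<in> extensional P.P" by (simp add: b_def)
    fix v i assume vi: "v \<in> P.P" "i \<in> {1..n}"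
    show "(\<lambda>x. b (v(i := x))) \<in> module_hom K E (scalars K)"
      by (rule module_homI) (use vi in \<open>auto simp: split prodK cK module_hom_add[OF c] module_hom_smult[OF c]
          l_distr m_assoc P.V.smult_closed P.V.M.a_closed\<close>)
  qed
  define t where "t = pure P.MF v"
  have t: "t \<in> carrier ?T" using v by (simp add: t_def P.T.pure_in)
  have val: "act ?T g t b = (if g = \<one>\<^sub>G then \<one>\<^bsub>K\<^esub> else \<zero>\<^bsub>K\<^esub>)" if g: "g \<in> G" for g
  proof -
    have p: "g permutes {1..n}" using g by (simp add: sym_group_carrier)
    have iv: "inv' g i \<in> {1..n}" if "i \<in> {1..n}" for i
      using permutes_in_image[OF permutes_inv[OF p]] that by simp
    have "act ?T g t b = b (v \<circ> inv' g)"
      using P.tensor_power_act(2)[OF g v] b by (simp add: t_def)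
    also have "\<dots> = (\<Otimes>\<^bsub>K\<^esub>i\<in>{1..n}. d (inv' g i) i)"
      using perm_comp_inv_PiE[OF p v] iv by (simp add: b_def) (rule finprod_cong', auto simp: cv d_def)
    also have "\<dots> = (if g = \<one>\<^sub>G then \<one>\<^bsub>K\<^esub> else \<zero>\<^bsub>K\<^esub>)"
    proof (cases "g = \<one>\<^sub>G")
      case True
      then show ?thesis by (simp add: sym_group_one d_def inv_id finprod_one_eqI)
    next
      case False
      \<comment> \<open>A permutation of {1..n} other than the identity moves some place, and the
        delta at that place annihilates the product.\<close>
      have "\<exists>i\<in>{1..n}. inv' g i \<noteq> i"
      proof (rule ccontr)
        assume "\<not> ?thesis"
        then have "inv' g i = i" for i
          using permutes_not_in[OF permutes_inv[OF p], of i] by (cases "i \<in> {1..n}") auto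
        then have "g = id" using permutes_inverses(1)[OF p] by (auto simp: fun_eq_iff)
        with False show False by (simp add: sym_group_one)
      qed
      then obtain i where i: "i \<in> {1..n}" "inv' g i \<noteq> i" by auto
      have "(\<Otimes>\<^bsub>K\<^esub>i\<in>{1..n}. d (inv' g i) i) = (\<Otimes>\<^bsub>K\<^esub>j\<in>insert i ({1..n} - {i}). d (inv' g j) j)"
        using i by (simp add: insert_absorb)
      also have "\<dots> = d (inv' g i) i \<otimes>\<^bsub>K\<^esub> (\<Otimes>\<^bsub>K\<^esub>j\<in>{1..n} - {i}. d (inv' g j) j)"
        by (subst finprod_insert) (auto simp: d_def)
      also have "\<dots> = \<zero>\<^bsub>K\<^esub>"
        using i finprod_closed[of "\<lambda>j. d (inv' g j) j" "{1..n} - {i}"] by (simp add: d_def Pi_iff)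
      finally show ?thesis using False by simp
    qed
    finally show ?thesis .
  qed
  show thesis
  proof (rule that[OF E])
    show "enc (carrier ?T) t \<in> carrier (tp E)"
      using enc_in[OF t] by (simp add: tensor_power_def del: P.tensor_power_rep_simps)
    have "(\<lambda>t. t b) \<in> module_hom K ?T (scalars K)"
      using P.T.eval_functional[OF b] by (simp add: functionals_def tensor_power_rep_def)
    from module_hom_comp[OF dec_hom[OF T.fdvs] this]
    show "(\<lambda>a. dec (carrier ?T) a b) \<in> functionals K (tp E)"
      by (simp add: functionals_def tensor_power_def)
    show "dec (carrier ?T) (act (tp E) g (enc (carrier ?T) t)) b = (if g = \<one>\<^sub>G then \<one>\<^bsub>K\<^esub> else \<zero>\<^bsub>K\<^esub>)"
      if "g \<in> G" for g
      using that t val by (simp only: tensor_power_def enc_act[OF P.tensor_power_representation] T.act_closed dec_enc[OF T.fdvs])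
  qed
qed

section \<open>Representable functors on representations\<close>

abbreviation RepC :: "('k, ('k, 'v) rep, 'v \<Rightarrow> 'v) lincat" where "RepC \<equiv> Rep n K"
abbreviation GamC :: "('k, ('k, 'v) module, 'v \<Rightarrow> 'v) lincat" where "GamC \<equiv> Gamma n K"
abbreviation VecC :: "('k, ('k, 'v) module, 'v \<Rightarrow> 'v) lincat" where "VecC \<equiv> Vect K"
abbreviation hf :: "('k, 'v) rep \<Rightarrow> ('k, 'v) rep_functor" where "hf \<equiv> h_functor n K"
abbreviation tf :: "('k, 'v) rep \<Rightarrow> ('k, 'v) rep_functor" where "tf \<equiv> t_functor n K"
abbreviation lin_fun :: "('k, 'v) rep_functor \<Rightarrow> bool" where "lin_fun \<equiv> is_linear_functor K RepC VecC"
abbreviation ju :: "(('k, 'v) rep_functor, ('k, 'v) rep_nat, ('k, 'v) poly_functor, ('k, 'v) poly_nat) fctr" where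
  "ju \<equiv> j_upper_star n K"
abbreviation jo :: "('k, 'v) rep_functor \<Rightarrow> ('k, 'v) poly_functor" where "jo \<equiv> omap ju"
abbreviation natR :: "('k, 'v) rep_functor \<Rightarrow> ('k, 'v) rep_functor \<Rightarrow> ('k, 'v) rep_nat set" where
  "natR \<equiv> nat_trans RepC VecC"
abbreviation natP :: "('k, 'v) poly_functor \<Rightarrow> ('k, 'v) poly_functor \<Rightarrow> ('k, 'v) poly_nat set" where
  "natP \<equiv> nat_trans GamC VecC"
abbreviation tl :: "(('k, 'v) rep, 'v \<Rightarrow> 'v, ('k, 'v) rep_functor, ('k, 'v) rep_nat) fctr" where
  "tl \<equiv> t_lower_star n K"
abbreviation tsh :: "(('k, 'v) rep, 'v \<Rightarrow> 'v, ('k, 'v) rep_functor, ('k, 'v) rep_nat) fctr" where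
  "tsh \<equiv> t_lower_shriek n K"
abbreviation tu :: "(('k, 'v) rep_functor, ('k, 'v) rep_nat, ('k, 'v) rep, 'v \<Rightarrow> 'v) fctr" where
  "tu \<equiv> t_upper_star n K"

lemma lincategory_RepC: "lincategory K RepC" by (rule lincategory_Rep) (rule field_axioms)

lemma lincategory_VecC: "lincategory K VecC" by (rule lincategory_Vect) (rule field_axioms)

lemma h_functor_eq: "hf M = copy_fctr (rep_hom n K M) (\<lambda>N N' f u. compose (carrier M) f u)"
  by (simp add: h_functor_def copy_fctr_def)

lemma compose_hom: "\<lbrakk>R (M :: ('k, 'x) rep); R (N :: ('k, 'x) rep); R (P :: ('k, 'x) rep); f \<in> Hom N P\<rbrakk> \<Longrightarrow>
    (\<lambda>u. compose (carrier M) f u) \<in> module_hom K (rep_hom n K M N) (rep_hom n K M P)"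
  using lincategory.Cmp_linear_left[OF lincategory_Rep[OF field_axioms], of M n N P f] by (simp add: Rep_simps)

lemma h_functor_linear:
  assumes M: "R M"
  shows "lin_fun (hf M)"
  unfolding h_functor_eq
proof (rule copy_fctr_linear[OF lincategory_RepC])
  show "fdvs K (rep_hom n K M N)" if "N \<in> Ob RepC" for N
    using M that by (simp add: Rep_simps rep_hom_fdvs)
  show "(\<lambda>u. compose (carrier M) f u) \<in> module_hom K (rep_hom n K M X) (rep_hom n K M Y)"
    if "X \<in> Ob RepC" "Y \<in> Ob RepC" "f \<in> arr RepC X Y" for X Y f
    using that M compose_hom by (simp add: Rep_simps)
qed (auto simp: Rep_simps compose_def rep_hom_carrier module_hom_in fun_eq_iff extensional_def)

lemma h_carrier: "omap (hf M) N = copy_vs (rep_hom n K M N)"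
  by (simp add: h_functor_eq)

lemma h_mmap: "\<lbrakk>R M; R N; R N'; u \<in> Hom N N'; a \<in> carrier (omap (hf M) N)\<rbrakk> \<Longrightarrow>
    mmap (hf M) N N' u a = enc (Hom M N') (compose (carrier M) u (dec (Hom M N) a))"
  by (auto simp: h_functor_eq rep_hom_fdvs elim!: copy_carrierE)

subsection \<open>The functor of coinvariants\<close>

text \<open>Elements of t_M(N) are wrapped three times: a tensor, its class modulo the relations,
  the code of this class in 'v. \<open>tcl\<close> names the generators, so that later arguments see
  only m and x.\<close>

definition tcl :: "('k, 'v) rep \<Rightarrow> ('k, 'v) rep \<Rightarrow> 'v \<Rightarrow> 'v \<Rightarrow> 'v" where
  "tcl M N m x = enc (carrier (coinvariants n K (tensor_rep K M N)))
     (coinv_class n K (tensor_rep K M N) (tens K M N m x))"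

lemma t_functor_eq: "tf M = copy_fctr (\<lambda>N. coinvariants n K (tensor_rep K M N))
    (\<lambda>N N' f. coinv_map n K (tensor_rep K M N') (tensor_map K M N M N' (\<lambda>x. x) f))"
  by (simp add: t_functor_def copy_fctr_def)

lemma two_spaces_rep: "\<lbrakk>R M; R N\<rbrakk> \<Longrightarrow> two_spaces K M N"
  by (simp add: two_spacesI representation.fdvs)

lemma tco_fdvs: "\<lbrakk>R M; R N\<rbrakk> \<Longrightarrow> fdvs K (coinvariants n K (tensor_rep K M N))"
  by (rule representation.coinvariants_fdvs) (rule tensor_rep_representation)

lemma t_carrier: "omap (tf M) N = copy_vs (coinvariants n K (tensor_rep K M N))"
  by (simp add: t_functor_eq)

lemma t_fdvs: "\<lbrakk>R M; R N\<rbrakk> \<Longrightarrow> fdvs K (omap (tf M) N)"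
  by (simp add: t_carrier copy_vs_fdvs tco_fdvs)

definition tproj :: "('k, 'v) rep \<Rightarrow> ('k, 'v) rep \<Rightarrow> _ \<Rightarrow> 'v" where
  "tproj M N t = enc (carrier (coinvariants n K (tensor_rep K M N))) (coinv_class n K (tensor_rep K M N) t)"

lemma tcl_tproj: "tcl M N m x = tproj M N (tens K M N m x)"
  by (simp add: tcl_def tproj_def)

text \<open>The third clause describes the kernel of the projection; it is what makes the
  presentation of t_M exact in the middle.\<close>

lemma tproj_hom:
  assumes "R M" "R N"
  shows "tproj M N \<in> module_hom K (tensor K M N) (omap (tf M) N)"
    and "tproj M N ` carrier (tensor K M N) = carrier (omap (tf M) N)"
    and "t \<in> carrier (tensor K M N) \<Longrightarrow> tproj M N t = \<zero>\<^bsub>omap (tf M) N\<^esub> \<longleftrightarrow> t \<in> coinv_relations n K (tensor_rep K M N)"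
proof -
  interpret T: representation n K "tensor_rep K M N" using assms by (rule tensor_rep_representation)
  note fd = tco_fdvs[OF assms]
  show "tproj M N \<in> module_hom K (tensor K M N) (omap (tf M) N)"
    using module_hom_comp[OF T.coinv_class_hom enc_hom[OF fd]]
    by (simp add: tproj_def[abs_def] t_carrier)
  show "tproj M N ` carrier (tensor K M N) = carrier (omap (tf M) N)"
    using T.quot(3) by (simp add: tproj_def[abs_def] t_carrier copy_vs_simps image_image)
  show "tproj M N t = \<zero>\<^bsub>omap (tf M) N\<^esub> \<longleftrightarrow> t \<in> coinv_relations n K (tensor_rep K M N)"
    if "t \<in> carrier (tensor K M N)"
  proof -
    have "\<zero>\<^bsub>coinvariants n K (tensor_rep K M N)\<^esub> \<in> carrier (coinvariants n K (tensor_rep K M N))"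
      using fdvs_vs[OF fd] by (simp add: vectorspace_def module_def abelian_group_def abelian_monoid.zero_closed)
    then show ?thesis
      using that T.quot(5)[of t] module_hom_in[OF T.coinv_class_hom, of t]
      by (simp add: tproj_def t_carrier copy_vs_simps enc_eq_iff[OF fd])
  qed
qed

lemma tcl_in: "\<lbrakk>R M; R N; m \<in> carrier M; x \<in> carrier N\<rbrakk> \<Longrightarrow> tcl M N m x \<in> carrier (omap (tf M) N)"
  unfolding tcl_tproj by (intro module_hom_in[OF tproj_hom(1)] two_spaces.tens_in two_spaces_rep)

lemma tcl_hom_right: "\<lbrakk>R M; R N; m \<in> carrier M\<rbrakk> \<Longrightarrow> tcl M N m \<in> module_hom K N (omap (tf M) N)"
  unfolding tcl_tproj[abs_def]
  using module_hom_comp[OF two_spaces.tens_hom_right[OF two_spaces_rep] tproj_hom(1)] by blast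

lemma tcl_hom_left: "\<lbrakk>R M; R N; x \<in> carrier N\<rbrakk> \<Longrightarrow> (\<lambda>m. tcl M N m x) \<in> module_hom K M (omap (tf M) N)"
  unfolding tcl_tproj[abs_def]
  using module_hom_comp[OF two_spaces.tens_hom_left[OF two_spaces_rep] tproj_hom(1)] by blast

lemma tcl_act:
  assumes "R M" "R N" "m \<in> carrier M" "x \<in> carrier N" "g \<in> G"
  shows "tcl M N (act M g m) (act N g x) = tcl M N m x"
proof -
  interpret T: representation n K "tensor_rep K M N" using assms(1,2) by (rule tensor_rep_representation)
  note ts = two_spaces_rep[OF assms(1,2)]
  have "coinv_class n K (tensor_rep K M N) (act (tensor_rep K M N) g (tens K M N m x)) =
    coinv_class n K (tensor_rep K M N) (tens K M N m x)"
    using assms two_spaces.tens_in[OF ts] by (intro T.coinv_class_act) simp_all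
  then show ?thesis
    using tensor_map_hom(2)[OF ts ts representation.act_linear[OF assms(1,5)] representation.act_linear[OF assms(2,5)] assms(3,4)]
    by (simp add: tcl_def)
qed

lemma tcl_hom_eq:
  assumes MN: "R M" "R N" and f: "f \<in> module_hom K (omap (tf M) N) W" and g: "g \<in> module_hom K (omap (tf M) N) W"
    and W: "module K W" and eq: "\<And>m x. \<lbrakk>m \<in> carrier M; x \<in> carrier N\<rbrakk> \<Longrightarrow> f (tcl M N m x) = g (tcl M N m x)"
    and a: "a \<in> carrier (omap (tf M) N)"
  shows "f a = g a"
proof -
  interpret two_spaces K M N using MN by (rule two_spaces_rep)
  obtain t where t: "t \<in> carrier (tensor K M N)" "a = tproj M N t"
    using a tproj_hom(2)[OF MN] by auto
  show ?thesis unfolding t(2)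
    by (rule tensor_hom_eq[OF module_hom_comp[OF tproj_hom(1)[OF MN] f] module_hom_comp[OF tproj_hom(1)[OF MN] g] W _ t(1)])
      (use eq in \<open>simp add: tcl_tproj\<close>)
qed

text \<open>Invariance under the diagonal action is the balancing condition for the tensor product
  over the group, with M made a right module through inverses. The map is lifted through the tensor
  product, then through the coinvariants, and finally composed with decoding.\<close>

lemma tcl_lift:
  assumes MN: "R M" "R N" and W: "fdvs K W" and f: "\<And>x. x \<in> carrier M \<Longrightarrow> f x \<in> module_hom K N W"
    "\<And>y. y \<in> carrier N \<Longrightarrow> (\<lambda>x. f x y) \<in> module_hom K M W"
    and inv: "\<And>g x y. \<lbrakk>g \<in> G; x \<in> carrier M; y \<in> carrier N\<rbrakk> \<Longrightarrow> f (act M g x) (act N g y) = f x y"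
  obtains h where "h \<in> module_hom K (omap (tf M) N) W"
    "\<And>x y. \<lbrakk>x \<in> carrier M; y \<in> carrier N\<rbrakk> \<Longrightarrow> h (tcl M N x y) = f x y"
proof -
  interpret M: representation n K M by fact
  interpret N: representation n K N by fact
  interpret T: representation n K "tensor_rep K M N" using MN by (rule tensor_rep_representation)
  note ts = two_spaces_rep[OF MN]
  interpret two_spaces K M N by (rule ts)
  note fd = tco_fdvs[OF MN]
  have W': "module K W" using fdvs_vs[OF W] by blast
  obtain h1 where h1: "h1 \<in> module_hom K (tensor K M N) W"
    "\<And>x y. \<lbrakk>x \<in> carrier M; y \<in> carrier N\<rbrakk> \<Longrightarrow> h1 (tens K M N x y) = f x y"
    using tensor_lift[OF W f] by blast
  have "h1 (act (tensor_rep K M N) g t) = h1 t" if g: "g \<in> G" and t: "t \<in> carrier (tensor_rep K M N)" for g t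
  proof -
    note tm = tensor_map_hom[OF ts ts M.act_linear[OF g] N.act_linear[OF g]]
    have "h1 (tensor_map K M N M N (act M g) (act N g) t) = h1 t"
      by (rule tensor_hom_eq[OF module_hom_comp[OF tm(1) h1(1)] h1(1) W'])
        (use g t in \<open>auto simp: tm(2) h1(2) inv\<close>)
    then show ?thesis by simp
  qed
  then obtain h2 where h2: "h2 \<in> module_hom K (coinvariants n K (tensor_rep K M N)) W"
    "\<And>t. t \<in> carrier (tensor K M N) \<Longrightarrow> h2 (coinv_class n K (tensor_rep K M N) t) = h1 t"
    using T.coinv_lift[OF fdvs_vs[OF W], of h1] h1(1) by auto
  show thesis
  proof (rule that)
    show "(\<lambda>a. h2 (dec (carrier (coinvariants n K (tensor_rep K M N))) a)) \<in> module_hom K (omap (tf M) N) W"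
      using module_hom_comp[OF dec_hom[OF fd] h2(1)] by (simp add: t_carrier)
    show "h2 (dec (carrier (coinvariants n K (tensor_rep K M N))) (tcl M N x y)) = f x y"
      if "x \<in> carrier M" "y \<in> carrier N" for x y
      using that module_hom_in[OF T.coinv_class_hom] by (simp add: tcl_def fd h2 h1)
  qed
qed

lemma t_map:
  assumes M: "R M" "R M'" and N: "R N" "R N'" and f: "f \<in> module_hom K M M'"
    "\<And>g x. \<lbrakk>g \<in> G; x \<in> carrier M\<rbrakk> \<Longrightarrow> f (act M g x) = act M' g (f x)"
    and u: "u \<in> module_hom K N N'" "\<And>g x. \<lbrakk>g \<in> G; x \<in> carrier N\<rbrakk> \<Longrightarrow> u (act N g x) = act N' g (u x)"
  defines "r \<equiv> coinv_map n K (tensor_rep K M' N') (tensor_map K M N M' N' f u)"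
  shows "r \<in> module_hom K (coinvariants n K (tensor_rep K M N)) (coinvariants n K (tensor_rep K M' N'))"
    and "\<lbrakk>m \<in> carrier M; x \<in> carrier N\<rbrakk> \<Longrightarrow>
      copy_map (coinvariants n K (tensor_rep K M N)) (coinvariants n K (tensor_rep K M' N')) r (tcl M N m x) = tcl M' N' (f m) (u x)"
proof -
  interpret T: representation n K "tensor_rep K M N" using M(1) N(1) by (rule tensor_rep_representation)
  note ts = two_spaces_rep[OF M(1) N(1)] and ts' = two_spaces_rep[OF M(2) N(2)]
  interpret A: two_spaces K M N by (rule ts)
  note tm = tensor_map_hom[OF ts ts' f(1) u(1)]
  have eqv: "tensor_map K M N M' N' f u (act (tensor_rep K M N) g t) = act (tensor_rep K M' N') g (tensor_map K M N M' N' f u t)"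
    if "g \<in> G" "t \<in> carrier (tensor_rep K M N)" for g t
    using tensor_map_act[OF M N f u that(1)] that(2) by simp
  note cm = coinv_map_class[OF tensor_rep_representation[OF M(1) N(1)] tensor_rep_representation[OF M(2) N(2)],
      of "tensor_map K M N M' N' f u", unfolded module_hom_tensor_rep, OF tm(1) eqv]
  show "r \<in> module_hom K (coinvariants n K (tensor_rep K M N)) (coinvariants n K (tensor_rep K M' N'))"
    unfolding r_def by (rule cm(2))
  show "copy_map (coinvariants n K (tensor_rep K M N)) (coinvariants n K (tensor_rep K M' N')) r (tcl M N m x) = tcl M' N' (f m) (u x)"
    if "m \<in> carrier M" "x \<in> carrier N"
    using that module_hom_in[OF T.coinv_class_hom] tco_fdvs[OF M(1) N(1)] cm(1)[of "tens K M N m x"]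
    by (simp add: tcl_def r_def tm(2))
qed

lemma t_mmap:
  assumes "R M" "R N" "R N'" "u \<in> Hom N N'"
  shows "mmap (tf M) N N' u \<in> module_hom K (omap (tf M) N) (omap (tf M) N')"
    and "\<lbrakk>m \<in> carrier M; x \<in> carrier N\<rbrakk> \<Longrightarrow> mmap (tf M) N N' u (tcl M N m x) = tcl M N' m (u x)"
proof -
  note tm = t_map[OF assms(1,1,2,3) id_hom _ rep_hom_hom[OF assms(4)] rep_hom_act[OF assms(4)]]
  show "mmap (tf M) N N' u \<in> module_hom K (omap (tf M) N) (omap (tf M) N')"
    unfolding t_functor_eq copy_fctr_simps by (intro copy_map_hom tco_fdvs assms tm) auto
  show "\<lbrakk>m \<in> carrier M; x \<in> carrier N\<rbrakk> \<Longrightarrow> mmap (tf M) N N' u (tcl M N m x) = tcl M N' m (u x)"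
    unfolding t_functor_eq copy_fctr_simps by (intro tm) auto
qed

text \<open>Each functor law is an equation between linear maps out of t_M(X), so by
  \<open>tcl_hom_eq\<close> it is enough to see it on the generators, where a morphism simply acts
  on the second argument.\<close>

lemma t_functor_linear:
  assumes M: "R M"
  shows "lin_fun (tf M)"
proof (rule Vect_functorI[OF lincategory_RepC field_axioms])
  have W: "module K (omap (tf M) N)" if "R N" for N
    using fdvs_vs[OF t_fdvs[OF M that]] by blast
  have ts: "N \<in> Ob RepC \<Longrightarrow> R N" for N by (simp add: Rep_simps)
  show "X \<in> Ob RepC \<Longrightarrow> fdvs K (omap (tf M) X)" for X
    by (simp add: Rep_simps t_fdvs M)
  show "mmap (tf M) X Y u \<in> module_hom K (omap (tf M) X) (omap (tf M) Y)"
    if "X \<in> Ob RepC" "Y \<in> Ob RepC" "u \<in> arr RepC X Y" for X Y u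
    using t_mmap(1)[OF M] that by (simp add: Rep_simps)
  show "mmap (tf M) X Y u \<in> extensional (carrier (omap (tf M) X))"
    if "X \<in> Ob RepC" "Y \<in> Ob RepC" "u \<in> arr RepC X Y" for X Y u
    by (simp add: t_functor_eq)
  note in' = lincategory.Cmp_arr[OF lincategory_RepC] and idn = lincategory.Id_arr[OF lincategory_RepC]
  show "mmap (tf M) X X (Id RepC X) a = a" if X: "X \<in> Ob RepC" and a: "a \<in> carrier (omap (tf M) X)" for X a
  proof -
    have RX: "R X" using X by (simp add: Rep_simps)
    have i: "Id RepC X \<in> Hom X X" using idn[OF X] by (simp add: Rep_simps)
    show ?thesis
      by (rule tcl_hom_eq[where g = "\<lambda>a. a", OF M RX t_mmap(1)[OF M RX RX i] id_hom W[OF RX] _ a])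
        (use RX i in \<open>simp add: t_mmap(2)[OF M RX RX i]; simp add: Rep_simps\<close>)
  qed
  show "mmap (tf M) X Z (Cmp RepC X Y Z v u) a = mmap (tf M) Y Z v (mmap (tf M) X Y u a)"
    if XYZ: "X \<in> Ob RepC" "Y \<in> Ob RepC" "Z \<in> Ob RepC" and u: "u \<in> arr RepC X Y" and v: "v \<in> arr RepC Y Z"
      and a: "a \<in> carrier (omap (tf M) X)" for X Y Z u v a
  proof -
    have r: "R X" "R Y" "R Z" using XYZ by (simp_all add: Rep_simps)
    have c: "Cmp RepC X Y Z v u \<in> Hom X Z" using in'[OF XYZ u v] by (simp add: Rep_simps)
    have uv: "u \<in> Hom X Y" "v \<in> Hom Y Z" using u v by (simp_all add: Rep_simps)
    show ?thesis
      by (rule tcl_hom_eq[OF M r(1) t_mmap(1)[OF M r(1,3) c] module_hom_comp[OF t_mmap(1)[OF M r(1,2) uv(1)] t_mmap(1)[OF M r(2,3) uv(2)]] W[OF r(3)] _ a])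
        (simp add: t_mmap(2)[OF M r(1,3) c] t_mmap(2)[OF M r(1,2) uv(1)] t_mmap(2)[OF M r(2,3) uv(2)] rep_hom_in[OF uv(1)],
          simp add: Rep_simps compose_def)
  qed
  show "mmap (tf M) X Y (u \<oplus>\<^bsub>Mor RepC X Y\<^esub> v) a = mmap (tf M) X Y u a \<oplus>\<^bsub>omap (tf M) Y\<^esub> mmap (tf M) X Y v a"
    if XY: "X \<in> Ob RepC" "Y \<in> Ob RepC" and u: "u \<in> arr RepC X Y" and v: "v \<in> arr RepC X Y"
      and a: "a \<in> carrier (omap (tf M) X)" for X Y u v a
  proof -
    have r: "R X" "R Y" using XY by (simp_all add: Rep_simps)
    have uv: "u \<in> Hom X Y" "v \<in> Hom X Y" using u v by (simp_all add: Rep_simps)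
    interpret H: vectorspace K "rep_hom n K X Y" by (rule rep_hom_vectorspace[OF r])
    have c: "u \<oplus>\<^bsub>rep_hom n K X Y\<^esub> v \<in> Hom X Y" using uv by (rule H.M.a_closed)
    have s: "(\<lambda>a\<in>carrier (omap (tf M) X). mmap (tf M) X Y u a \<oplus>\<^bsub>omap (tf M) Y\<^esub> mmap (tf M) X Y v a) \<in> module_hom K (omap (tf M) X) (omap (tf M) Y)"
      by (intro module_hom_pointwise fdvs_vs t_fdvs M r t_mmap uv)
    have "mmap (tf M) X Y (u \<oplus>\<^bsub>rep_hom n K X Y\<^esub> v) a = (\<lambda>a\<in>carrier (omap (tf M) X). mmap (tf M) X Y u a \<oplus>\<^bsub>omap (tf M) Y\<^esub> mmap (tf M) X Y v a) a"
      by (rule tcl_hom_eq[OF M r(1) t_mmap(1)[OF M r c] s W[OF r(2)] _ a])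
        (simp add: t_mmap(2)[OF M r c] t_mmap(2)[OF M r uv(1)] t_mmap(2)[OF M r uv(2)] tcl_in M r rep_hom_in[OF uv(1)] rep_hom_in[OF uv(2)]
          module_hom_add[OF tcl_hom_right] del: rep_hom_simps, simp add: M r rep_hom_in[OF uv(1)] rep_hom_in[OF uv(2)] module_hom_add[OF tcl_hom_right])
    then show ?thesis using a by (simp add: Rep_simps del: rep_hom_simps)
  qed
  show "mmap (tf M) X Y (c \<odot>\<^bsub>Mor RepC X Y\<^esub> u) a = c \<odot>\<^bsub>omap (tf M) Y\<^esub> mmap (tf M) X Y u a"
    if XY: "X \<in> Ob RepC" "Y \<in> Ob RepC" and u: "u \<in> arr RepC X Y" and cK: "c \<in> carrier K"
      and a: "a \<in> carrier (omap (tf M) X)" for X Y u c a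
  proof -
    have r: "R X" "R Y" using XY by (simp_all add: Rep_simps)
    have uv: "u \<in> Hom X Y" using u by (simp_all add: Rep_simps)
    interpret H: vectorspace K "rep_hom n K X Y" by (rule rep_hom_vectorspace[OF r])
    have c: "c \<odot>\<^bsub>rep_hom n K X Y\<^esub> u \<in> Hom X Y" using cK uv by (rule H.smult_closed)
    have s: "(\<lambda>a\<in>carrier (omap (tf M) X). c \<odot>\<^bsub>omap (tf M) Y\<^esub> mmap (tf M) X Y u a) \<in> module_hom K (omap (tf M) X) (omap (tf M) Y)"
      by (intro module_hom_pointwise fdvs_vs t_fdvs M r t_mmap uv cK)
    have "mmap (tf M) X Y (c \<odot>\<^bsub>rep_hom n K X Y\<^esub> u) a = (\<lambda>a\<in>carrier (omap (tf M) X). c \<odot>\<^bsub>omap (tf M) Y\<^esub> mmap (tf M) X Y u a) a"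
      by (rule tcl_hom_eq[OF M r(1) t_mmap(1)[OF M r c] s W[OF r(2)] _ a])
        (simp add: t_mmap(2)[OF M r c] t_mmap(2)[OF M r uv] tcl_in M r del: rep_hom_simps,
          simp add: M r cK rep_hom_in[OF uv] module_hom_smult[OF tcl_hom_right])
    then show ?thesis using a by (simp add: Rep_simps del: rep_hom_simps)
  qed
qed

end

lemma (in coherent_setup) jo_simps [simp]:
  "omap (jo F) V = omap F (tp V)" "mmap (jo F) V W u = mmap F (tp V) (tp W) u"
  by (simp_all add: j_upper_star_def)

lemma (in coherent_setup) jm: "mmap ju F F' \<alpha> = (\<lambda>V\<in>Ob GamC. \<alpha> (tp V))"
  by (simp add: j_upper_star_def)

text \<open>The model is \<open>E = K\<^sup>n\<close> with \<open>\<tau> = e\<^sub>1 \<otimes> \<dots> \<otimes> e\<^sub>n\<close> and \<open>w\<close> the coordinate function at \<open>\<tau>\<close>.\<close>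

locale special = coherent_setup K e n
  for K :: "('k, 'z) ring_scheme" and e :: "'k list \<Rightarrow> 'v" and n :: nat +
  fixes E :: "('k, 'v) module" and \<tau> :: 'v and w :: "'v \<Rightarrow> 'k"
  assumes E: "fdvs K E" and \<tau>: "\<tau> \<in> carrier (tp E)" and w: "w \<in> functionals K (tp E)"
    and w\<tau>: "\<And>g. g \<in> G \<Longrightarrow> w (act (tp E) g \<tau>) = (if g = \<one>\<^sub>G then \<one>\<^bsub>K\<^esub> else \<zero>\<^bsub>K\<^esub>)"
begin

abbreviation T :: "('k, 'v) rep" where "T \<equiv> tp E"

lemma RT: "R T" using E by simp

sublocale T: representation n K T by (rule RT)

text \<open>A point of N as a map out of T; \<open>cop\<close> is the dual notion, a functional on N
  as a map into T. For N a tensor power both are morphisms of \<open>Gamma n K\<close>.\<close>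

definition pt :: "('k, 'x) rep \<Rightarrow> 'x \<Rightarrow> 'v \<Rightarrow> 'x" where "pt N x = avg n T N w x"
definition cop :: "('k, 'x) rep \<Rightarrow> ('x \<Rightarrow> 'k) \<Rightarrow> 'x \<Rightarrow> 'v" where "cop N \<phi> = avg n N T \<phi> \<tau>"

lemma two_repsI: "\<lbrakk>R M; R N\<rbrakk> \<Longrightarrow> two_reps n K M N"
  by (simp add: two_reps_def)

lemma pt_arr: "\<lbrakk>R N; x \<in> carrier N\<rbrakk> \<Longrightarrow> pt N x \<in> Hom T N"
  unfolding pt_def by (rule two_reps.avg_arr[OF two_repsI[OF RT] w])

lemma pt_\<tau>: "\<lbrakk>R N; x \<in> carrier N\<rbrakk> \<Longrightarrow> pt N x \<tau> = x"
  unfolding pt_def by (rule two_reps.avg_at[OF two_repsI[OF RT] w _ \<tau> w\<tau>])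

lemma pt_post: "\<lbrakk>R N; R P; x \<in> carrier N; u \<in> Hom N P\<rbrakk> \<Longrightarrow>
    compose (carrier T) u (pt N x) = pt P (u x)"
  unfolding pt_def by (rule avg_post[OF RT _ _ w])

text \<open>Here \<open>pt T (act T g \<tau>)\<close> is the endomorphism of T that moves \<tau> to
  its translate. The formula converts the action of g on N, which is not a morphism, into a morphism
  between tensor powers, along which transformations are natural.\<close>

lemma pt_act:
  assumes "R N" "x \<in> carrier N" "g \<in> G"
  shows "compose (carrier T) (pt N x) (pt T (act T g \<tau>)) = pt N (act N g x)"
  using pt_post[OF RT assms(1) T.act_closed[OF assms(3) \<tau>] pt_arr[OF assms(1,2)]]
  by (simp add: rep_hom_act[OF pt_arr[OF assms(1,2)] assms(3) \<tau>] pt_\<tau>[OF assms(1,2)])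

lemma pt_add: "\<lbrakk>R N; x \<in> carrier N; y \<in> carrier N\<rbrakk> \<Longrightarrow> pt N (x \<oplus>\<^bsub>N\<^esub> y) = pt N x \<oplus>\<^bsub>rep_hom n K T N\<^esub> pt N y"
  unfolding pt_def by (rule two_reps.avg_add[OF two_repsI[OF RT] w])

lemma pt_smult: "\<lbrakk>R N; x \<in> carrier N; c \<in> carrier K\<rbrakk> \<Longrightarrow> pt N (c \<odot>\<^bsub>N\<^esub> x) = c \<odot>\<^bsub>rep_hom n K T N\<^esub> pt N x"
  unfolding pt_def by (rule two_reps.avg_smult[OF two_repsI[OF RT] w])

lemma cop_arr: "\<lbrakk>R N; \<phi> \<in> functionals K N\<rbrakk> \<Longrightarrow> cop N \<phi> \<in> Hom N T"
  unfolding cop_def by (rule two_reps.avg_arr[OF two_repsI[OF _ RT] _ \<tau>])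

lemma w_cop: "\<lbrakk>R N; \<phi> \<in> functionals K N; z \<in> carrier N\<rbrakk> \<Longrightarrow> w (cop N \<phi> z) = \<phi> z"
  unfolding cop_def by (rule two_reps.functional_avg[OF two_repsI[OF _ RT] _ \<tau> _ w w\<tau>])

lemma cop_pre: "\<lbrakk>R L; R N; \<phi> \<in> functionals K N; u \<in> Hom L N\<rbrakk> \<Longrightarrow>
    compose (carrier L) (cop N \<phi>) u = cop L (\<lambda>z. \<phi> (u z))"
  unfolding cop_def by (rule avg_pre[OF _ _ RT _ \<tau>])

lemma cop_cong: "\<lbrakk>R N; \<psi> \<in> functionals K N; \<And>z. z \<in> carrier N \<Longrightarrow> \<phi> z = \<psi> z\<rbrakk> \<Longrightarrow> cop N \<phi> = cop N \<psi>"
  unfolding cop_def by (rule two_reps.avg_cong[OF two_repsI[OF _ RT] \<tau>])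

lemma cop_add: "\<lbrakk>R N; \<phi> \<in> functionals K N; \<psi> \<in> functionals K N\<rbrakk> \<Longrightarrow>
    cop N (\<lambda>z. \<phi> z \<oplus>\<^bsub>K\<^esub> \<psi> z) = cop N \<phi> \<oplus>\<^bsub>rep_hom n K N T\<^esub> cop N \<psi>"
  unfolding cop_def by (rule two_reps.avg_add_left[OF two_repsI[OF _ RT] _ _ \<tau>])

lemma cop_smult: "\<lbrakk>R N; \<phi> \<in> functionals K N; c \<in> carrier K\<rbrakk> \<Longrightarrow>
    cop N (\<lambda>z. c \<otimes>\<^bsub>K\<^esub> \<phi> z) = c \<odot>\<^bsub>rep_hom n K N T\<^esub> cop N \<phi>"
  unfolding cop_def by (rule two_reps.avg_smult_left[OF two_repsI[OF _ RT] _ \<tau>])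

text \<open>A transformation out of \<open>t\<^sub>M\<close> is determined by its values on the classes of \<open>m \<otimes> \<tau>\<close>, because
  every \<open>x\<close> is the image of \<open>\<tau>\<close> under \<open>pt N x\<close>.\<close>

lemma t_restrict_bij:
  assumes M: "R M" and F: "lin_fun F"
  shows "bij_betw (mmap ju (tf M) F)
    (natR (tf M) F) (natP (jo (tf M)) (jo F))"
proof -
  note Fs = Vect_functor[OF F, unfolded Rep_simps mem_Collect_eq]
  have Fm: "module K (omap F N)" if "R N" for N using fdvs_vs[OF Fs(1)[OF that]] by blast
  have key: "a N (tcl M N m x) = mmap F T N (pt N x) (a T (tcl M T m \<tau>))"
    if a: "a \<in> natR (tf M) F" and N: "R N" and m: "m \<in> carrier M" and x: "x \<in> carrier N" for a N m x
  proof -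
    have "mmap (tf M) T N (pt N x) (tcl M T m \<tau>) = tcl M N m x"
      using t_mmap(2)[OF M RT N pt_arr[OF N x] m \<tau>] by (simp add: pt_\<tau> N x)
    then show ?thesis
      using Vect_nat(3)[OF a, of T N "pt N x" "tcl M T m \<tau>"] RT N pt_arr[OF N x] tcl_in[OF M RT m \<tau>]
      by (simp add: Rep_simps)
  qed
  have into: "mmap ju (tf M) F a \<in> natP (jo (tf M)) (jo F)"
    if a: "a \<in> natR (tf M) F" for a
    unfolding jm by (rule Vect_natI) (use Vect_nat[OF a] in \<open>auto simp: Gamma_simps Rep_simps\<close>)
  have inj: "a = b" if a: "a \<in> natR (tf M) F" and b: "b \<in> natR (tf M) F"
    and eq: "mmap ju (tf M) F a = mmap ju (tf M) F b" for a b
  proof (rule Vect_nat_eqI[OF a b])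
    fix N x assume N: "N \<in> Ob RepC" and x: "x \<in> carrier (omap (tf M) N)"
    then have RN: "R N" by (simp add: Rep_simps)
    have "a T = b T" using fun_cong[OF eq, of E] E by (simp add: jm Gamma_simps)
    then show "a N x = b N x"
      by (intro tcl_hom_eq[OF M RN Vect_nat(1)[OF a N] Vect_nat(1)[OF b N] Fm[OF RN] _ x])
        (simp add: key[OF a RN] key[OF b RN])
  qed
  have surj: "\<exists>a\<in>natR (tf M) F. mmap ju (tf M) F a = b"
    if b: "b \<in> natP (jo (tf M)) (jo F)" for b
  proof -
    have bh: "b V \<in> module_hom K (omap (tf M) (tp V)) (omap F (tp V))" if "fdvs K V" for V
      using Vect_nat(1)[OF b, of V] that by (simp add: Gamma_simps)
    have bn: "b V (mmap (tf M) T (tp V) u y) = mmap F T (tp V) u (b E y)"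
      if "fdvs K V" "u \<in> Hom T (tp V)" "y \<in> carrier (omap (tf M) T)" for V u y
      using Vect_nat(3)[OF b, of E V u y] that E by (simp add: Gamma_simps)
    \<comment> \<open>This is \<open>key\<close> read as a definition: the right-hand side involves
      only the component of \<open>b\<close> at E.\<close>
    define f where "f N m x = mmap F T N (pt N x) (b E (tcl M T m \<tau>))" for N m x
    have bE: "b E (tcl M T m \<tau>) \<in> carrier (omap F T)" if "m \<in> carrier M" for m
      using module_hom_in[OF bh[OF E] tcl_in[OF M RT that \<tau>]] .
    have Fpt: "mmap F T N (pt N x) \<in> module_hom K (omap F T) (omap F N)" if "R N" "x \<in> carrier N" for N x
      using Fs(2)[OF RT that(1) pt_arr[OF that]] .
    have f1: "f N m \<in> module_hom K N (omap F N)" if N: "R N" and m: "m \<in> carrier M" for N m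
      by (rule module_homI) (auto simp del: rep_hom_simps simp: f_def pt_add[OF N] pt_smult[OF N] Fs(6)[OF RT N pt_arr[OF N] pt_arr[OF N] bE[OF m]]
          Fs(7)[OF RT N pt_arr[OF N] _ bE[OF m]] module_hom_in[OF Fpt[OF N] bE[OF m]])
    have f2: "(\<lambda>m. f N m x) \<in> module_hom K M (omap F N)" if N: "R N" and x: "x \<in> carrier N" for N x
      unfolding f_def using module_hom_comp[OF module_hom_comp[OF tcl_hom_left[OF M RT \<tau>] bh[OF E]] Fpt[OF N x]] .
    \<comment> \<open>Balancing. The element g is moved from x into the endomorphism
      \<open>pt T (act T g \<tau>)\<close>; as T is the tensor power of E, \<open>b\<close> is
      natural for it. After that g acts on both entries of the class of m \<otimes> \<tau> and
      disappears.\<close>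
    have f3: "f N (act M g m) (act N g x) = f N m x" if N: "R N" and g: "g \<in> G" and m: "m \<in> carrier M" and x: "x \<in> carrier N" for N g m x
    proof -
      have gt: "act T g \<tau> \<in> carrier T" using g \<tau> by simp
      have gm: "act M g m \<in> carrier M" using representation.act_closed[OF M g m] .
      note p = pt_arr[OF RT gt]
      have "f N (act M g m) (act N g x) = mmap F T N (compose (carrier T) (pt N x) (pt T (act T g \<tau>))) (b E (tcl M T (act M g m) \<tau>))"
        by (simp add: f_def pt_act[OF N x g])
      also have "\<dots> = mmap F T N (pt N x) (mmap F T T (pt T (act T g \<tau>)) (b E (tcl M T (act M g m) \<tau>)))"
        by (rule Fs(5)[OF RT RT N p pt_arr[OF N x] bE[OF gm]])
      also have "mmap F T T (pt T (act T g \<tau>)) (b E (tcl M T (act M g m) \<tau>)) = b E (mmap (tf M) T T (pt T (act T g \<tau>)) (tcl M T (act M g m) \<tau>))"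
        using bn[OF E p tcl_in[OF M RT gm \<tau>]] by simp
      also have "\<dots> = b E (tcl M T (act M g m) (act T g \<tau>))"
        by (simp add: t_mmap(2)[OF M RT RT p gm \<tau>] pt_\<tau>[OF RT gt])
      also have "\<dots> = b E (tcl M T m \<tau>)" by (simp add: tcl_act[OF M RT m \<tau> g])
      finally show ?thesis by (simp add: f_def)
    qed
    have "\<exists>h. h \<in> module_hom K (omap (tf M) N) (omap F N) \<and>
        (\<forall>m\<in>carrier M. \<forall>x\<in>carrier N. h (tcl M N m x) = f N m x)" if N: "R N" for N
      by (rule tcl_lift[OF M N Fs(1)[OF N] f1[OF N] f2[OF N] f3[OF N]]) auto
    then obtain h where h: "\<And>N. R N \<Longrightarrow> h N \<in> module_hom K (omap (tf M) N) (omap F N)"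
        "\<And>N m x. \<lbrakk>R N; m \<in> carrier M; x \<in> carrier N\<rbrakk> \<Longrightarrow> h N (tcl M N m x) = f N m x"
      by metis
    define a where "a = (\<lambda>N\<in>Ob RepC. restrict (h N) (carrier (omap (tf M) N)))"
    have tm: "module K (omap (tf M) N)" if "R N" for N using fdvs_vs[OF t_fdvs[OF M that]] by blast
    have a: "a \<in> natR (tf M) F"
    proof (rule Vect_natI)
      fix N assume "N \<in> Ob RepC"
      then have N: "R N" by (simp add: Rep_simps)
      then show "a N \<in> module_hom K (omap (tf M) N) (omap F N)"
        using module_hom_restrict[OF tm[OF N] h(1)[OF N]] by (simp add: a_def Rep_simps hom_space_carrier)
      show "a N \<in> extensional (carrier (omap (tf M) N))" using N by (simp add: a_def Rep_simps)
    next
      show "a \<in> extensional (Ob RepC)" by (simp add: a_def)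
      fix X Y u y assume "X \<in> Ob RepC" "Y \<in> Ob RepC" "u \<in> arr RepC X Y" and y: "y \<in> carrier (omap (tf M) X)"
      then have X: "R X" and Y: "R Y" and u: "u \<in> Hom X Y" by (simp_all add: Rep_simps)
      note tmm = t_mmap[OF M X Y u]
      have "h Y (mmap (tf M) X Y u y) = mmap F X Y u (h X y)"
      proof (rule tcl_hom_eq[OF M X module_hom_comp[OF tmm(1) h(1)[OF Y]] module_hom_comp[OF h(1)[OF X] Fs(2)[OF X Y u]] Fm[OF Y] _ y])
        fix m x assume m: "m \<in> carrier M" and x: "x \<in> carrier X"
        have "f Y m (u x) = mmap F T Y (compose (carrier T) u (pt X x)) (b E (tcl M T m \<tau>))"
          by (simp add: f_def pt_post[OF X Y x u])
        also have "\<dots> = mmap F X Y u (f X m x)"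
          unfolding f_def by (rule Fs(5)[OF RT X Y pt_arr[OF X x] u bE[OF m]])
        finally show "h Y (mmap (tf M) X Y u (tcl M X m x)) = mmap F X Y u (h X (tcl M X m x))"
          using m x rep_hom_in[OF u x] by (simp add: tmm(2) h(2) X Y)
      qed
      then show "a Y (mmap (tf M) X Y u y) = mmap F X Y u (a X y)"
        using X Y y module_hom_in[OF tmm(1) y] by (simp add: a_def Rep_simps)
    qed
    moreover have "mmap ju (tf M) F a = b"
    proof (rule Vect_nat_eqI[OF into[OF a] b])
      fix V y assume "V \<in> Ob GamC" and y: "y \<in> carrier (omap (jo (tf M)) V)"
      then have V: "fdvs K V" by (simp add: Gamma_simps)
      have y': "y \<in> carrier (omap (tf M) (tp V))" using y by simp
      have "h (tp V) y = b V y"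
      proof (rule tcl_hom_eq[OF M tp_rep[OF V] h(1)[OF tp_rep[OF V]] bh[OF V] Fm[OF tp_rep[OF V]] _ y'])
        fix m x assume m: "m \<in> carrier M" and x: "x \<in> carrier (tp V)"
        note p = pt_arr[OF tp_rep[OF V] x]
        \<comment> \<open>On a tensor power \<open>pt (tp V) x\<close> is a morphism from E to V in
          \<open>Gamma n K\<close>, so the extension agrees with \<open>b\<close> by the naturality
          of \<open>b\<close> itself.\<close>
        have "h (tp V) (tcl M (tp V) m x) = b V (mmap (tf M) T (tp V) (pt (tp V) x) (tcl M T m \<tau>))"
          by (simp add: h(2) V m x f_def bn[OF V p tcl_in[OF M RT m \<tau>]])
        then show "h (tp V) (tcl M (tp V) m x) = b V (tcl M (tp V) m x)"
          by (simp add: t_mmap(2)[OF M RT tp_rep[OF V] p m \<tau>] pt_\<tau> V x)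
      qed
      then show "mmap ju (tf M) F a V y = b V y"
        using V y' by (simp add: jm a_def Gamma_simps Rep_simps)
    qed
    ultimately show ?thesis by blast
  qed
  show ?thesis
    unfolding bij_betw_def
  proof
    show "inj_on (mmap ju (tf M) F) (natR (tf M) F)"
      by (rule inj_onI) (rule inj)
    show "mmap ju (tf M) F ` natR (tf M) F = natP (jo (tf M)) (jo F)"
      using into surj by blast
  qed
qed

text \<open>Dually, an equivariant map \<open>B \<rightarrow> N\<close> is determined by its composites with the maps
  \<open>cop N \<phi> : N \<rightarrow> T\<close>, because \<open>w \<circ> cop N \<phi> = \<phi>\<close> and functionals separate the points of \<open>N\<close>.\<close>

lemma h_restrict_bij:
  assumes B: "R B" and F: "lin_fun F"
  shows "bij_betw (mmap ju F (hf B))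
    (natR F (hf B)) (natP (jo F) (jo (hf B)))"
proof -
  interpret B: representation n K B by (rule B)
  note Fs = Vect_functor[OF F, unfolded Rep_simps mem_Collect_eq]
  \<comment> \<open>Elements of h_B(N) are codes; \<open>D N a\<close> is the equivariant map from B
    to N behind \<open>a\<close>.\<close>
  define D where "D N a = dec (Hom B N) a" for N :: "('k, 'v) rep" and a :: 'v
  have fh: "fdvs K (rep_hom n K B N)" if "R N" for N :: "('k, 'v) rep" using rep_hom_fdvs[OF B that] .
  have D_in: "D N a \<in> Hom B N" if "R N" "a \<in> carrier (omap (hf B) N)" for N a
    using that fh by (simp add: D_def h_carrier)
  have D_mm: "D N' (mmap (hf B) N N' u a) = compose (carrier B) u (D N a)"
    if "R N" "R N'" "u \<in> Hom N N'" "a \<in> carrier (omap (hf B) N)" for N N' u a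
    using that D_in[OF that(1,4)] rep_hom_compose[OF B D_in[OF that(1,4)] that(3)]
    by (simp add: h_mmap[OF B] D_def fh)
  have D_eq: "a = a'" if "R N" "a \<in> carrier (omap (hf B) N)" "a' \<in> carrier (omap (hf B) N)"
    "\<And>y. y \<in> carrier B \<Longrightarrow> D N a y = D N a' y" for N a a'
  proof -
    have "D N a = D N a'"
      using that D_in by (intro extensionalityI[of _ "carrier B"]) (auto intro: rep_hom_ext)
    moreover have "enc (Hom B N) (D N a) = a" "enc (Hom B N) (D N a') = a'"
      using that(2,3) fh[OF that(1)] by (simp_all add: D_def h_carrier)
    ultimately show ?thesis by metis
  qed
  have sep: "x = y" if "R N" "x \<in> carrier N" "y \<in> carrier N" "\<And>\<phi>. \<phi> \<in> functionals K N \<Longrightarrow> \<phi> x = \<phi> y"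
    for N :: "('k, 'v) rep" and x y
    using fdvs_separating[OF representation.fdvs[OF that(1)] that(2-4)] .
  \<comment> \<open>Naturality of \<open>a\<close> along \<open>cop N \<phi>\<close>, followed by
    \<open>w\<close>: the values of all functionals on the vectors \<open>D N (a N x) y\<close> are
    read off from the component at T.\<close>
  have key: "\<phi> (D N (a N x) y) = w (D T (a T (mmap F N T (cop N \<phi>) x)) y)"
    if a: "a \<in> natR F (hf B)" and N: "R N" and x: "x \<in> carrier (omap F N)" and \<phi>: "\<phi> \<in> functionals K N"
      and y: "y \<in> carrier B" for a N x \<phi> y
  proof -
    have ax: "a N x \<in> carrier (omap (hf B) N)" using module_hom_in[OF Vect_nat(1)[OF a] x] N by (simp add: Rep_simps)
    have "a T (mmap F N T (cop N \<phi>) x) = mmap (hf B) N T (cop N \<phi>) (a N x)"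
      using Vect_nat(3)[OF a, of N T "cop N \<phi>" x] N RT x cop_arr[OF N \<phi>] by (simp add: Rep_simps)
    then have "D T (a T (mmap F N T (cop N \<phi>) x)) y = cop N \<phi> (D N (a N x) y)"
      using D_mm[OF N RT cop_arr[OF N \<phi>] ax] y by (simp add: compose_def)
    then show ?thesis using w_cop[OF N \<phi> rep_hom_in[OF D_in[OF N ax] y]] by simp
  qed
  have into: "mmap ju F (hf B) a \<in> natP (jo F) (jo (hf B))"
    if a: "a \<in> natR F (hf B)" for a
    unfolding jm by (rule Vect_natI) (use Vect_nat[OF a] in \<open>auto simp: Gamma_simps Rep_simps\<close>)
  have inj: "a = b" if a: "a \<in> natR F (hf B)" and b: "b \<in> natR F (hf B)"
    and eq: "mmap ju F (hf B) a = mmap ju F (hf B) b" for a b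
  proof (rule Vect_nat_eqI[OF a b])
    fix N x assume "N \<in> Ob RepC" and x: "x \<in> carrier (omap F N)"
    then have N: "R N" by (simp add: Rep_simps)
    have abT: "a T = b T" using fun_cong[OF eq, of E] E by (simp add: jm Gamma_simps)
    have ax: "a N x \<in> carrier (omap (hf B) N)" and bx: "b N x \<in> carrier (omap (hf B) N)"
      using module_hom_in[OF Vect_nat(1)[OF a] x] module_hom_in[OF Vect_nat(1)[OF b] x] N by (simp_all add: Rep_simps)
    show "a N x = b N x"
    proof (rule D_eq[OF N ax bx])
      fix y assume y: "y \<in> carrier B"
      show "D N (a N x) y = D N (b N x) y"
        by (rule sep[OF N rep_hom_in[OF D_in[OF N ax] y] rep_hom_in[OF D_in[OF N bx] y]])
          (simp add: key[OF a N x _ y] key[OF b N x _ y] abT)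
    qed
  qed
  have surj: "\<exists>a\<in>natR F (hf B). mmap ju F (hf B) a = b"
    if b: "b \<in> natP (jo F) (jo (hf B))" for b
  proof -
    have bh: "b V \<in> module_hom K (omap F (tp V)) (omap (hf B) (tp V))" if "fdvs K V" for V
      using Vect_nat(1)[OF b, of V] that by (simp add: Gamma_simps)
    have bn: "b W (mmap F (tp V) (tp W) u y) = mmap (hf B) (tp V) (tp W) u (b V y)"
      if "fdvs K V" "fdvs K W" "u \<in> Hom (tp V) (tp W)" "y \<in> carrier (omap F (tp V))" for V W u y
      using Vect_nat(3)[OF b, of V W u y] that by (simp add: Gamma_simps)
    \<comment> \<open>For the sought extension this is forced to be the map behind the image of
      \<open>x\<close>, followed by \<open>cop N \<phi>\<close>.\<close>
    define c where "c N \<phi> x = D T (b E (mmap F N T (cop N \<phi>) x))" for N \<phi> x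
    have Fc: "mmap F N T (cop N \<phi>) \<in> module_hom K (omap F N) (omap F T)" if "R N" "\<phi> \<in> functionals K N" for N \<phi>
      using Fs(2)[OF that(1) RT cop_arr[OF that]] .
    have Dh: "D T \<in> module_hom K (omap (hf B) T) (rep_hom n K B T)"
      unfolding D_def[abs_def] h_carrier by (rule dec_hom[OF fh[OF RT]])
    have c_hom: "c N \<phi> \<in> module_hom K (omap F N) (rep_hom n K B T)" if "R N" "\<phi> \<in> functionals K N" for N \<phi>
      unfolding c_def[abs_def] using module_hom_comp[OF module_hom_comp[OF Fc[OF that] bh[OF E]] Dh] .
    note c_in = module_hom_in[OF c_hom]
    have c_lin: "\<phi> \<in> functionals K N \<Longrightarrow> \<psi> \<in> functionals K N \<Longrightarrow> c N (\<lambda>z. \<phi> z \<oplus>\<^bsub>K\<^esub> \<psi> z) x = c N \<phi> x \<oplus>\<^bsub>rep_hom n K B T\<^esub> c N \<psi> x"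
      "\<phi> \<in> functionals K N \<Longrightarrow> k \<in> carrier K \<Longrightarrow> c N (\<lambda>z. k \<otimes>\<^bsub>K\<^esub> \<phi> z) x = k \<odot>\<^bsub>rep_hom n K B T\<^esub> c N \<phi> x"
      if N: "R N" and x: "x \<in> carrier (omap F N)" for N \<phi> \<psi> x k
      unfolding c_def
      by (simp_all only: cop_add[OF N] cop_smult[OF N] Fs(6)[OF N RT cop_arr[OF N] cop_arr[OF N] x] Fs(7)[OF N RT cop_arr[OF N] _ x]
          module_hom_add[OF bh[OF E] module_hom_in[OF Fc[OF N] x] module_hom_in[OF Fc[OF N] x]]
          module_hom_smult[OF bh[OF E] _ module_hom_in[OF Fc[OF N] x]]
          module_hom_add[OF Dh module_hom_in[OF bh[OF E] module_hom_in[OF Fc[OF N] x]] module_hom_in[OF bh[OF E] module_hom_in[OF Fc[OF N] x]]]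
          module_hom_smult[OF Dh _ module_hom_in[OF bh[OF E] module_hom_in[OF Fc[OF N] x]]])
    have c_cong: "c N \<phi> x = c N \<psi> x" if "R N" "\<psi> \<in> functionals K N" "\<And>z. z \<in> carrier N \<Longrightarrow> \<phi> z = \<psi> z" for N \<phi> \<psi> x
      using cop_cong[OF that] by (simp add: c_def)
    have wh: "w \<in> module_hom K T (scalars K)" using w by (simp add: functionals_def)
    have funD: "\<phi> \<in> functionals K N" if "\<phi> \<in> carrier (hom_space K N (scalars K))" for \<phi> and N :: "('k, 'v) rep"
      using that by (simp add: functionals_def hom_space_carrier)
    \<comment> \<open>For fixed x and y the right-hand side is linear in \<phi>, hence a functional
      on the dual of N, and reflexivity turns it into evaluation at a vector.\<close>
    have ex: "\<exists>z. z \<in> carrier N \<and> (\<forall>\<phi>\<in>functionals K N. \<phi> z = w (c N \<phi> x y))"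
      if N: "R N" and x: "x \<in> carrier (omap F N)" and y: "y \<in> carrier B" for N x y
    proof -
      interpret N: representation n K N by (rule N)
      have cw: "c N \<phi> x y \<in> carrier T" if "\<phi> \<in> functionals K N" for \<phi>
        using rep_hom_in[OF c_in[OF N that x] y] .
      let ?Ds = "hom_space K N (scalars K)"
      have "(\<lambda>\<phi>. w (c N \<phi> x y)) \<in> functionals K ?Ds"
        unfolding functionals_def
      proof (rule module_homI)
        fix \<phi> assume "\<phi> \<in> carrier ?Ds"
        then show "w (c N \<phi> x y) \<in> carrier (scalars K)" using functionals_in[OF w cw[OF funD]] by simp
      next
        fix \<phi> \<psi> assume p: "\<phi> \<in> carrier ?Ds" "\<psi> \<in> carrier ?Ds"
        have s: "(\<lambda>z. \<phi> z \<oplus>\<^bsub>K\<^esub> \<psi> z) \<in> functionals K N"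
          unfolding functionals_def using module_hom_cong[OF N.module _ module_hom_pointwise(2)[OF N.vectorspace scalars_vectorspace, of \<phi> \<psi>]] p
          by (simp add: hom_space_carrier)
        \<comment> \<open>The sum in the dual space is cut off outside the carrier;
          \<open>c_cong\<close> shows that \<open>c\<close> does not notice.\<close>
        have "c N (\<phi> \<oplus>\<^bsub>?Ds\<^esub> \<psi>) x = c N (\<lambda>z. \<phi> z \<oplus>\<^bsub>K\<^esub> \<psi> z) x"
          by (rule c_cong[OF N s]) simp
        then show "w (c N (\<phi> \<oplus>\<^bsub>?Ds\<^esub> \<psi>) x y) = w (c N \<phi> x y) \<oplus>\<^bsub>scalars K\<^esub> w (c N \<psi> x y)"
          using c_lin(1)[OF N x funD[OF p(1)] funD[OF p(2)]] y module_hom_add[OF wh cw[OF funD[OF p(1)]] cw[OF funD[OF p(2)]]]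
          by simp
      next
        fix k \<phi> assume p: "k \<in> carrier K" "\<phi> \<in> carrier ?Ds"
        have s: "(\<lambda>z. k \<otimes>\<^bsub>K\<^esub> \<phi> z) \<in> functionals K N"
          unfolding functionals_def using module_hom_cong[OF N.module _ module_hom_pointwise(3)[OF N.vectorspace scalars_vectorspace, of k \<phi>]] p
          by (simp add: hom_space_carrier)
        have "c N (k \<odot>\<^bsub>?Ds\<^esub> \<phi>) x = c N (\<lambda>z. k \<otimes>\<^bsub>K\<^esub> \<phi> z) x"
          by (rule c_cong[OF N s]) simp
        then show "w (c N (k \<odot>\<^bsub>?Ds\<^esub> \<phi>) x y) = k \<odot>\<^bsub>scalars K\<^esub> w (c N \<phi> x y)"
          using c_lin(2)[OF N x funD[OF p(2)] p(1)] y module_hom_smult[OF wh p(1) cw[OF funD[OF p(2)]]]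
          by simp
      qed
      from fdvs_reflexive[OF N.fdvs this] obtain z where z: "z \<in> carrier N" "\<And>\<phi>. \<phi> \<in> carrier ?Ds \<Longrightarrow> \<phi> z = w (c N \<phi> x y)"
        by blast
      have "\<phi> z = w (c N \<phi> x y)" if \<phi>: "\<phi> \<in> functionals K N" for \<phi>
      proof -
        have "restrict \<phi> (carrier N) \<in> carrier ?Ds"
          using module_hom_restrict[OF N.module] \<phi> by (simp add: functionals_def)
        from z(2)[OF this] show ?thesis
          using z(1) c_cong[OF N \<phi>, of "restrict \<phi> (carrier N)" x] by simp
      qed
      with z(1) show ?thesis by blast
    qed
    then obtain d where d: "\<And>N x y. \<lbrakk>R N; x \<in> carrier (omap F N); y \<in> carrier B\<rbrakk> \<Longrightarrow> d N x y \<in> carrier N"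
      "\<And>N x y \<phi>. \<lbrakk>R N; x \<in> carrier (omap F N); y \<in> carrier B; \<phi> \<in> functionals K N\<rbrakk> \<Longrightarrow> \<phi> (d N x y) = w (c N \<phi> x y)"
      by metis
    define d' where "d' N x = restrict (d N x) (carrier B)" for N x
    have d_hom: "d' N x \<in> Hom B N" if N: "R N" and x: "x \<in> carrier (omap F N)" for N x
    proof -
      interpret N: representation n K N by (rule N)
      have c_hom: "c N \<phi> x \<in> Hom B T" if "\<phi> \<in> functionals K N" for \<phi> using c_in[OF N that x] .
      have add: "d N x (y \<oplus>\<^bsub>B\<^esub> y') = d N x y \<oplus>\<^bsub>N\<^esub> d N x y'" if "y \<in> carrier B" "y' \<in> carrier B" for y y'
      proof (rule sep[OF N])
        fix \<phi> assume \<phi>: "\<phi> \<in> functionals K N"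
        then have ph: "\<phi> \<in> module_hom K N (scalars K)" by (simp add: functionals_def)
        show "\<phi> (d N x (y \<oplus>\<^bsub>B\<^esub> y')) = \<phi> (d N x y \<oplus>\<^bsub>N\<^esub> d N x y')"
          using that by (simp add: module_hom_add[OF ph] d N x \<phi> module_hom_add[OF rep_hom_hom[OF c_hom[OF \<phi>]]]
              module_hom_add[OF wh] rep_hom_in[OF c_hom[OF \<phi>]])
      qed (use that N x d in auto)
      have smult: "d N x (k \<odot>\<^bsub>B\<^esub> y) = k \<odot>\<^bsub>N\<^esub> d N x y" if "k \<in> carrier K" "y \<in> carrier B" for k y
      proof (rule sep[OF N])
        fix \<phi> assume \<phi>: "\<phi> \<in> functionals K N"
        then have ph: "\<phi> \<in> module_hom K N (scalars K)" by (simp add: functionals_def)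
        show "\<phi> (d N x (k \<odot>\<^bsub>B\<^esub> y)) = \<phi> (k \<odot>\<^bsub>N\<^esub> d N x y)"
          using that by (simp add: module_hom_smult[OF ph] d N x \<phi> module_hom_smult[OF rep_hom_hom[OF c_hom[OF \<phi>]]]
              module_hom_smult[OF wh] rep_hom_in[OF c_hom[OF \<phi>]])
      qed (use that N x d in auto)
      have act: "d N x (act B g y) = act N g (d N x y)" if g: "g \<in> G" and y: "y \<in> carrier B" for g y
      proof (rule sep[OF N])
        fix \<phi> assume \<phi>: "\<phi> \<in> functionals K N"
        have \<phi>g: "(\<lambda>z. \<phi> (act N g z)) \<in> functionals K N"
          using module_hom_comp[OF N.act_linear[OF g]] \<phi> by (simp add: functionals_def)
        have wg: "(\<lambda>z. w (act T g z)) \<in> functionals K T"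
          using module_hom_comp[OF T.act_linear[OF g] wh] by (simp add: functionals_def)
        note p = cop_arr[OF RT wg]
        \<comment> \<open>The action of g on N is shifted to T: \<open>cop T\<close> of w after g is
          an endomorphism of T in \<open>Gamma n K\<close>, and preceded by
          \<open>cop N \<phi>\<close> it gives the map belonging to \<phi> after g. Hence the
          naturality of \<open>b\<close> applies.\<close>
        have "compose (carrier N) (cop T (\<lambda>z. w (act T g z))) (cop N \<phi>) = cop N (\<lambda>z. w (act T g (cop N \<phi> z)))"
          by (rule cop_pre[OF N RT wg cop_arr[OF N \<phi>]])
        also have "\<dots> = cop N (\<lambda>z. \<phi> (act N g z))"
          by (rule cop_cong[OF N \<phi>g]) (simp add: rep_hom_act[OF cop_arr[OF N \<phi>] g, symmetric] w_cop N \<phi> g)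
        finally have eq: "cop N (\<lambda>z. \<phi> (act N g z)) = compose (carrier N) (cop T (\<lambda>z. w (act T g z))) (cop N \<phi>)" ..
        have Fx: "mmap F N T (cop N \<phi>) x \<in> carrier (omap F T)" using module_hom_in[OF Fc[OF N \<phi>] x] .
        have bx: "b E (mmap F N T (cop N \<phi>) x) \<in> carrier (omap (hf B) T)" using module_hom_in[OF bh[OF E] Fx] .
        have "c N (\<lambda>z. \<phi> (act N g z)) x = compose (carrier B) (cop T (\<lambda>z. w (act T g z))) (c N \<phi> x)"
          unfolding c_def eq
          by (simp add: Fs(5)[OF N RT RT cop_arr[OF N \<phi>] p x] bn[OF E E p Fx] D_mm[OF RT RT p bx])
        then have "w (c N (\<lambda>z. \<phi> (act N g z)) x y) = w (act T g (c N \<phi> x y))"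
          using y w_cop[OF RT wg rep_hom_in[OF c_hom[OF \<phi>] y]] by (simp add: compose_def)
        then show "\<phi> (d N x (act B g y)) = \<phi> (act N g (d N x y))"
          using d(2)[OF N x y \<phi>g] d(2)[OF N x B.act_closed[OF g y] \<phi>] rep_hom_act[OF c_hom[OF \<phi>] g y] by simp
      qed (use g y N x d in auto)
      show ?thesis
        using add smult act d(1)[OF N x] by (auto simp: rep_hom_carrier d'_def intro!: module_homI)
    qed
    define a where "a = (\<lambda>N\<in>Ob RepC. \<lambda>x\<in>carrier (omap F N). enc (Hom B N) (d' N x) :: 'v)"
    have aD: "D N (a N x) = d' N x" if "R N" "x \<in> carrier (omap F N)" for N x
      using that d_hom[OF that] by (simp add: a_def D_def Rep_simps fh)
    have a_in: "a N x \<in> carrier (omap (hf B) N)" if "R N" "x \<in> carrier (omap F N)" for N x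
      using that d_hom[OF that] by (simp add: a_def h_carrier Rep_simps)
    have a: "a \<in> natR F (hf B)"
    proof (rule Vect_natI)
      show "a \<in> extensional (Ob RepC)" by (simp add: a_def)
      fix N assume "N \<in> Ob RepC"
      then have N: "R N" by (simp add: Rep_simps)
      show "a N \<in> extensional (carrier (omap F N))" using N by (simp add: a_def Rep_simps)
      interpret N: representation n K N by (rule N)
      interpret FN: vectorspace K "omap F N" by (rule fdvs_vs[OF Fs(1)[OF N]])
      have "d' N \<in> module_hom K (omap F N) (rep_hom n K B N)"
      proof (rule module_homI)
        fix x x' assume x: "x \<in> carrier (omap F N)" "x' \<in> carrier (omap F N)"
        have "d N (x \<oplus>\<^bsub>omap F N\<^esub> x') y = d N x y \<oplus>\<^bsub>N\<^esub> d N x' y" if y: "y \<in> carrier B" for y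
        proof (rule sep[OF N])
          fix \<phi> assume \<phi>: "\<phi> \<in> functionals K N"
          then have ph: "\<phi> \<in> module_hom K N (scalars K)" by (simp add: functionals_def)
          show "\<phi> (d N (x \<oplus>\<^bsub>omap F N\<^esub> x') y) = \<phi> (d N x y \<oplus>\<^bsub>N\<^esub> d N x' y)"
            using x y by (simp add: module_hom_add[OF ph] d N \<phi> module_hom_add[OF c_hom[OF N \<phi>]]
                module_hom_add[OF wh] rep_hom_in[OF c_in[OF N \<phi>]])
        qed (use x y N d in auto)
        then show "d' N (x \<oplus>\<^bsub>omap F N\<^esub> x') = d' N x \<oplus>\<^bsub>rep_hom n K B N\<^esub> d' N x'"
          by (auto simp: d'_def intro!: restrict_ext)
      next
        fix k x assume x: "k \<in> carrier K" "x \<in> carrier (omap F N)"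
        have "d N (k \<odot>\<^bsub>omap F N\<^esub> x) y = k \<odot>\<^bsub>N\<^esub> d N x y" if y: "y \<in> carrier B" for y
        proof (rule sep[OF N])
          fix \<phi> assume \<phi>: "\<phi> \<in> functionals K N"
          then have ph: "\<phi> \<in> module_hom K N (scalars K)" by (simp add: functionals_def)
          show "\<phi> (d N (k \<odot>\<^bsub>omap F N\<^esub> x) y) = \<phi> (k \<odot>\<^bsub>N\<^esub> d N x y)"
            using x y by (simp add: module_hom_smult[OF ph] d N \<phi> module_hom_smult[OF c_hom[OF N \<phi>]]
                module_hom_smult[OF wh] rep_hom_in[OF c_in[OF N \<phi>]])
        qed (use x y N d in auto)
        then show "d' N (k \<odot>\<^bsub>omap F N\<^esub> x) = k \<odot>\<^bsub>rep_hom n K B N\<^esub> d' N x"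
          by (auto simp: d'_def intro!: restrict_ext)
      qed (rule d_hom[OF N])
      from module_hom_restrict[OF FN.module_axioms module_hom_comp[OF this enc_hom[OF fh[OF N]]]]
      show "a N \<in> module_hom K (omap F N) (omap (hf B) N)"
        using N by (simp add: a_def Rep_simps h_carrier hom_space_carrier)
    next
      fix X Y u x assume "X \<in> Ob RepC" "Y \<in> Ob RepC" "u \<in> arr RepC X Y" and x: "x \<in> carrier (omap F X)"
      then have X: "R X" and Y: "R Y" and u: "u \<in> Hom X Y" by (simp_all add: Rep_simps)
      have Fx: "mmap F X Y u x \<in> carrier (omap F Y)" using module_hom_in[OF Fs(2)[OF X Y u] x] .
      have mm: "mmap (hf B) X Y u (a X x) \<in> carrier (omap (hf B) Y)"
        using module_hom_in[OF Vect_functor(2)[OF h_functor_linear[OF B], of X Y u]] a_in[OF X x] X Y u by (simp add: Rep_simps)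
      show "a Y (mmap F X Y u x) = mmap (hf B) X Y u (a X x)"
      proof (rule D_eq[OF Y a_in[OF Y Fx] mm])
        fix y assume y: "y \<in> carrier B"
        \<comment> \<open>Naturality is tested by functionals on Y; pulled back along u they become
          functionals on X, and \<open>cop_pre\<close> matches the two maps into T.\<close>
        have "d Y (mmap F X Y u x) y = u (d X x y)"
        proof (rule sep[OF Y d(1)[OF Y Fx y] rep_hom_in[OF u d(1)[OF X x y]]])
          fix \<phi> assume \<phi>: "\<phi> \<in> functionals K Y"
          have \<phi>u: "(\<lambda>z. \<phi> (u z)) \<in> functionals K X"
            using module_hom_comp[OF rep_hom_hom[OF u]] \<phi> by (simp add: functionals_def)
          have "c Y \<phi> (mmap F X Y u x) = c X (\<lambda>z. \<phi> (u z)) x"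
            unfolding c_def using Fs(5)[OF X Y RT u cop_arr[OF Y \<phi>] x] by (simp add: cop_pre[OF X Y \<phi> u])
          then show "\<phi> (d Y (mmap F X Y u x) y) = \<phi> (u (d X x y))"
            by (simp add: d(2)[OF Y Fx y \<phi>] d(2)[OF X x y \<phi>u])
        qed
        then show "D Y (a Y (mmap F X Y u x)) y = D Y (mmap (hf B) X Y u (a X x)) y"
          using y by (simp add: aD Y Fx X x D_mm[OF X Y u a_in[OF X x]] d'_def compose_def)
      qed
    qed
    moreover have "mmap ju F (hf B) a = b"
    proof (rule Vect_nat_eqI[OF into[OF a] b])
      fix V x assume "V \<in> Ob GamC" and "x \<in> carrier (omap (jo F) V)"
      then have V: "fdvs K V" and x: "x \<in> carrier (omap F (tp V))" by (simp_all add: Gamma_simps)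
      note RV = tp_rep[OF V]
      have bx: "b V x \<in> carrier (omap (hf B) (tp V))" using module_hom_in[OF bh[OF V] x] .
      have "a (tp V) x = b V x"
      proof (rule D_eq[OF RV a_in[OF RV x] bx])
        fix y assume y: "y \<in> carrier B"
        have "d (tp V) x y = D (tp V) (b V x) y"
        proof (rule sep[OF RV d(1)[OF RV x y] rep_hom_in[OF D_in[OF RV bx] y]])
          fix \<phi> assume \<phi>: "\<phi> \<in> functionals K (tp V)"
          \<comment> \<open>For a tensor power \<open>cop (tp V) \<phi>\<close> is a morphism from V
            to E, so \<open>b\<close> itself is natural along it.\<close>
          have "c (tp V) \<phi> x = compose (carrier B) (cop (tp V) \<phi>) (D (tp V) (b V x))"
            unfolding c_def by (simp add: bn[OF V E cop_arr[OF RV \<phi>] x] D_mm[OF RV RT cop_arr[OF RV \<phi>] bx])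
          then show "\<phi> (d (tp V) x y) = \<phi> (D (tp V) (b V x) y)"
            using d(2)[OF RV x y \<phi>] y w_cop[OF RV \<phi> rep_hom_in[OF D_in[OF RV bx] y]] by (simp add: compose_def)
        qed
        then show "D (tp V) (a (tp V) x) y = D (tp V) (b V x) y"
          using y by (simp add: aD RV x d'_def)
      qed
      then show "mmap ju F (hf B) a V x = b V x"
        using V by (simp add: jm Gamma_simps)
    qed
    ultimately show ?thesis by blast
  qed
  show ?thesis
    unfolding bij_betw_def
  proof
    show "inj_on (mmap ju F (hf B)) (natR F (hf B))"
      by (rule inj_onI) (rule inj)
    show "mmap ju F (hf B) ` natR F (hf B) = natP (jo F) (jo (hf B))"
      using into surj by blast
  qed
qed

end

section \<open>Commuting triangles of adjoints\<close>

lemma cmp_fctr_simps [simp]: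
  "omap (cmp_fctr G F) X = omap G (omap F X)"
  "mmap (cmp_fctr G F) X Y f = mmap G (omap F X) (omap F Y) (mmap F X Y f)"
  by (simp_all add: cmp_fctr_def)

lemma cmp_fctr_functor:
  assumes "is_functor K A B F" "is_functor K B C G"
  shows "is_functor K A C (cmp_fctr G F)"
proof -
  interpret F: is_functor K A B F by fact
  interpret G: is_functor K B C G by fact
  show ?thesis
    by unfold_locales (simp_all add: F.omap_Ob G.omap_Ob F.mmap_arr G.mmap_arr F.mmap_Id G.mmap_Id F.mmap_Cmp G.mmap_Cmp)
qed

lemma naturally_isomorphic_sym:
  assumes "naturally_isomorphic K C D F G"
  shows "naturally_isomorphic K C D G F"
proof -
  have F: "is_functor K C D F" and G: "is_functor K C D G" using assms by (simp_all add: naturally_isomorphic_def)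
  obtain a where a: "a \<in> nat_trans C D F G" and iso: "\<And>X. X \<in> Ob C \<Longrightarrow> is_iso D (omap F X) (omap G X) (a X)"
    using assms by (auto simp: naturally_isomorphic_def)
  obtain b where b: "b \<in> nat_trans C D G F"
    and inv: "\<forall>X\<in>Ob C. Cmp D (omap F X) (omap G X) (omap F X) (b X) (a X) = Id D (omap F X) \<and>
      Cmp D (omap G X) (omap F X) (omap G X) (a X) (b X) = Id D (omap G X)"
    using inverse_nat_trans[OF F G a iso] by (rule bexE)
  have "is_iso D (omap G X) (omap F X) (b X)" if "X \<in> Ob C" for X
    unfolding is_iso_def using bspec[OF inv that] nat_transD(1)[OF a that] nat_transD(1)[OF b that] by blast
  then show ?thesis
    unfolding naturally_isomorphic_def using F G b by blast
qed

text \<open>Yoneda argument. For X in C, the bijection \<open>ff\<close>, the comparison \<theta>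
  and the adjunction give C(X, t M) \<rightarrow> D(L X, L t M) \<rightarrow> D(L X, c M)
  \<rightarrow> C(X, R c M). The composite is postcomposition with one morphism, which is therefore
  invertible.\<close>

lemma right_adjoint_triangle:
  assumes adj: "adjoint_functors K C D L R" and c: "is_functor K A D c" and t: "is_functor K A C t"
    and th: "naturally_isomorphic K A D (cmp_fctr L t) c"
    and ff: "\<And>X M. \<lbrakk>X \<in> Ob C; M \<in> Ob A\<rbrakk> \<Longrightarrow>
      bij_betw (mmap L X (omap t M)) (arr C X (omap t M)) (arr D (omap L X) (omap L (omap t M)))"
  shows "naturally_isomorphic K A C (cmp_fctr R c) t"
proof -
  interpret L: is_functor K C D L using adj by (simp add: adjoint_functors_def)
  interpret R: is_functor K D C R using adj by (simp add: adjoint_functors_def)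
  interpret c: is_functor K A D c by (rule c)
  interpret t: is_functor K A C t by (rule t)
  obtain \<Phi> where bij: "\<And>X Y. \<lbrakk>X \<in> Ob C; Y \<in> Ob D\<rbrakk> \<Longrightarrow> bij_betw (\<Phi> X Y) (arr D (omap L X) Y) (arr C X (omap R Y))"
    and nat: "\<And>X' X Y Y' f u g. \<lbrakk>X' \<in> Ob C; X \<in> Ob C; Y \<in> Ob D; Y' \<in> Ob D;
        f \<in> arr C X' X; u \<in> arr D (omap L X) Y; g \<in> arr D Y Y'\<rbrakk> \<Longrightarrow>
          \<Phi> X' Y' (Cmp D (omap L X') Y Y' g (Cmp D (omap L X') (omap L X) Y u (mmap L X' X f))) =
          Cmp C X' (omap R Y) (omap R Y') (mmap R Y Y' g) (Cmp C X' X (omap R Y) (\<Phi> X Y u) f)"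
    using adj unfolding adjoint_functors_def by blast
  obtain \<theta> where \<theta>: "\<theta> \<in> nat_trans A D (cmp_fctr L t) c"
    and iso: "\<And>M. M \<in> Ob A \<Longrightarrow> is_iso D (omap L (omap t M)) (omap c M) (\<theta> M)"
    using th by (auto simp: naturally_isomorphic_def)
  note \<theta>D = nat_transD[OF \<theta>, simplified]
  note Co = L.source.Cmp_arr L.source.Id_arr and Do = L.target.Cmp_arr L.target.Id_arr
  note ob = L.omap_Ob R.omap_Ob c.omap_Ob t.omap_Ob
  have \<Phi>in: "\<Phi> X Y u \<in> arr C X (omap R Y)" if "X \<in> Ob C" "Y \<in> Ob D" "u \<in> arr D (omap L X) Y" for X Y u
    using bij[OF that(1,2)] that(3) by (auto simp: bij_betw_def)
  have nat1: "\<Phi> X' Y (Cmp D (omap L X') (omap L X) Y u (mmap L X' X f)) = Cmp C X' X (omap R Y) (\<Phi> X Y u) f"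
    if "X' \<in> Ob C" "X \<in> Ob C" "Y \<in> Ob D" "f \<in> arr C X' X" "u \<in> arr D (omap L X) Y" for X' X Y f u
  proof -
    note x = nat[OF that(1-3) that(3) that(4,5) L.target.Id_arr[OF that(3)]]
    have "Cmp D (omap L X') Y Y (Id D Y) (Cmp D (omap L X') (omap L X) Y u (mmap L X' X f)) =
        Cmp D (omap L X') (omap L X) Y u (mmap L X' X f)"
      using that by (intro L.target.Id_left Do ob L.mmap_arr)
    moreover have "Cmp C X' (omap R Y) (omap R Y) (mmap R Y Y (Id D Y)) (Cmp C X' X (omap R Y) (\<Phi> X Y u) f) =
        Cmp C X' X (omap R Y) (\<Phi> X Y u) f"
      unfolding R.mmap_Id[OF that(3)] using that by (intro L.source.Id_left Co ob \<Phi>in)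
    ultimately show ?thesis using x by simp
  qed
  have nat2: "\<Phi> X Y' (Cmp D (omap L X) Y Y' g u) = Cmp C X (omap R Y) (omap R Y') (mmap R Y Y' g) (\<Phi> X Y u)"
    if "X \<in> Ob C" "Y \<in> Ob D" "Y' \<in> Ob D" "u \<in> arr D (omap L X) Y" "g \<in> arr D Y Y'" for X Y Y' u g
  proof -
    note x = nat[OF that(1,1,2,3) L.source.Id_arr[OF that(1)] that(4,5)]
    have "Cmp D (omap L X) (omap L X) Y u (mmap L X X (Id C X)) = u"
      unfolding L.mmap_Id[OF that(1)] using that by (intro L.target.Id_right ob)
    moreover have "Cmp C X X (omap R Y) (\<Phi> X Y u) (Id C X) = \<Phi> X Y u"
      using that by (intro L.source.Id_right ob \<Phi>in)
    ultimately show ?thesis using x by simp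
  qed
  \<comment> \<open>The image of the identity of t M under the chain of bijections.\<close>
  define \<eta> where "\<eta> = (\<lambda>M\<in>Ob A. \<Phi> (omap t M) (omap c M) (\<theta> M))"
  have \<eta>_arr: "\<eta> M \<in> arr C (omap t M) (omap R (omap c M))" if "M \<in> Ob A" for M
    using that \<theta>D(1)[OF that] by (simp add: \<eta>_def \<Phi>in ob)
  have comp: "Cmp C X (omap t M) (omap R (omap c M)) (\<eta> M) f =
      \<Phi> X (omap c M) (Cmp D (omap L X) (omap L (omap t M)) (omap c M) (\<theta> M) (mmap L X (omap t M) f))"
    if "X \<in> Ob C" "M \<in> Ob A" "f \<in> arr C X (omap t M)" for X M f
    using nat1[of X "omap t M" "omap c M" f "\<theta> M"] that \<theta>D(1)[OF that(2)] by (simp add: \<eta>_def ob)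
  have \<eta>_nat: "\<eta> \<in> nat_trans A C t (cmp_fctr R c)"
  proof (rule nat_transI)
    fix M N f assume M: "M \<in> Ob A" and N: "N \<in> Ob A" and f: "f \<in> arr A M N"
    have "Cmp C (omap t M) (omap t N) (omap R (omap c N)) (\<eta> N) (mmap t M N f) =
        \<Phi> (omap t M) (omap c N) (Cmp D (omap L (omap t M)) (omap c M) (omap c N) (mmap c M N f) (\<theta> M))"
      using comp[OF t.omap_Ob[OF M] N t.mmap_arr[OF M N f]] \<theta>D(3)[OF M N f] by simp
    also have "\<dots> = Cmp C (omap t M) (omap R (omap c M)) (omap R (omap c N)) (mmap R (omap c M) (omap c N) (mmap c M N f)) (\<eta> M)"
      using M N f \<theta>D(1)[OF M] by (simp add: nat2 ob c.mmap_arr \<eta>_def)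
    finally show "Cmp C (omap t M) (omap t N) (omap (cmp_fctr R c) N) (\<eta> N) (mmap t M N f) =
        Cmp C (omap t M) (omap (cmp_fctr R c) M) (omap (cmp_fctr R c) N) (mmap (cmp_fctr R c) M N f) (\<eta> M)" by simp
  qed (auto simp: \<eta>_arr, simp add: \<eta>_def)
  have "is_iso C (omap t M) (omap R (omap c M)) (\<eta> M)" if M: "M \<in> Ob A" for M
  proof -
    obtain \<theta>' where \<theta>': "\<theta>' \<in> arr D (omap c M) (omap L (omap t M))"
      "Cmp D (omap L (omap t M)) (omap c M) (omap L (omap t M)) \<theta>' (\<theta> M) = Id D (omap L (omap t M))"
      "Cmp D (omap c M) (omap L (omap t M)) (omap c M) (\<theta> M) \<theta>' = Id D (omap c M)"
      using iso[OF M] by (auto simp: is_iso_def)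
    note o = ob(4)[OF M] ob(3)[OF M] ob(2)[OF ob(3)[OF M]] ob(1)[OF ob(4)[OF M]]
    have \<theta>b: "bij_betw (\<lambda>v. Cmp D Z (omap L (omap t M)) (omap c M) (\<theta> M) v) (arr D Z (omap L (omap t M))) (arr D Z (omap c M))"
      if Z: "Z \<in> Ob D" for Z
    proof (rule bij_betw_byWitness[where f' = "\<lambda>v. Cmp D Z (omap c M) (omap L (omap t M)) \<theta>' v"])
      show "\<forall>v\<in>arr D Z (omap L (omap t M)). Cmp D Z (omap c M) (omap L (omap t M)) \<theta>' (Cmp D Z (omap L (omap t M)) (omap c M) (\<theta> M) v) = v"
        using Z o \<theta>' \<theta>D(1)[OF M] by (simp add: L.target.Cmp_assoc L.target.Id_left)
      show "\<forall>v\<in>arr D Z (omap c M). Cmp D Z (omap L (omap t M)) (omap c M) (\<theta> M) (Cmp D Z (omap c M) (omap L (omap t M)) \<theta>' v) = v"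
        using Z o \<theta>' \<theta>D(1)[OF M] by (simp add: L.target.Cmp_assoc L.target.Id_left)
    qed (use Z o \<theta>' \<theta>D(1)[OF M] in \<open>auto intro!: Do\<close>)
    have b: "bij_betw (\<lambda>f. Cmp C X (omap t M) (omap R (omap c M)) (\<eta> M) f) (arr C X (omap t M)) (arr C X (omap R (omap c M)))"
      if X: "X \<in> Ob C" for X
    proof -
      have "bij_betw (\<Phi> X (omap c M) \<circ> ((\<lambda>v. Cmp D (omap L X) (omap L (omap t M)) (omap c M) (\<theta> M) v) \<circ> mmap L X (omap t M)))
          (arr C X (omap t M)) (arr C X (omap R (omap c M)))"
        by (rule bij_betw_trans[OF bij_betw_trans[OF ff[OF X M] \<theta>b[OF ob(1)[OF X]]] bij[OF X o(2)]])
      then show ?thesis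
        by (rule bij_betw_cong[THEN iffD1, rotated]) (simp add: comp[OF X M])
    qed
    \<comment> \<open>Surjectivity at X = R c M yields a right inverse of \<eta>; injectivity at X =
      t M shows that it is also a left inverse.\<close>
    have "Id C (omap R (omap c M)) \<in> (\<lambda>f. Cmp C (omap R (omap c M)) (omap t M) (omap R (omap c M)) (\<eta> M) f) `
        arr C (omap R (omap c M)) (omap t M)"
      unfolding bij_betw_imp_surj_on[OF b[OF o(3)]] by (rule L.source.Id_arr[OF o(3)])
    then obtain g where "Id C (omap R (omap c M)) = Cmp C (omap R (omap c M)) (omap t M) (omap R (omap c M)) (\<eta> M) g"
      "g \<in> arr C (omap R (omap c M)) (omap t M)"
      by (rule imageE)
    note g = this(2) this(1)[symmetric]
    have "Cmp C (omap t M) (omap R (omap c M)) (omap t M) g (\<eta> M) = Id C (omap t M)"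
    proof (rule inj_onD[OF bij_betw_imp_inj_on[OF b[OF o(1)]]])
      have "Cmp C (omap t M) (omap t M) (omap R (omap c M)) (\<eta> M) (Cmp C (omap t M) (omap R (omap c M)) (omap t M) g (\<eta> M)) =
          Cmp C (omap t M) (omap R (omap c M)) (omap R (omap c M)) (Cmp C (omap R (omap c M)) (omap t M) (omap R (omap c M)) (\<eta> M) g) (\<eta> M)"
        using o g(1) \<eta>_arr[OF M] by (intro L.source.Cmp_assoc)
      also have "\<dots> = Cmp C (omap t M) (omap t M) (omap R (omap c M)) (\<eta> M) (Id C (omap t M))"
        using o \<eta>_arr[OF M] by (simp add: g(2) L.source.Id_left L.source.Id_right)
      finally show "Cmp C (omap t M) (omap t M) (omap R (omap c M)) (\<eta> M) (Cmp C (omap t M) (omap R (omap c M)) (omap t M) g (\<eta> M)) =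
          Cmp C (omap t M) (omap t M) (omap R (omap c M)) (\<eta> M) (Id C (omap t M))" .
    qed (use o g(1) \<eta>_arr[OF M] in \<open>auto intro!: Co\<close>)
    then show ?thesis unfolding is_iso_def using g \<eta>_arr[OF M] by blast
  qed
  then have "naturally_isomorphic K A C t (cmp_fctr R c)"
    unfolding naturally_isomorphic_def using \<eta>_nat t cmp_fctr_functor[OF c R.is_functor_axioms] by auto
  then show ?thesis by (rule naturally_isomorphic_sym)
qed

text \<open>Dual Yoneda argument, with bijections C(t M, Y) \<rightarrow> D(R t M, R Y)
  \<rightarrow> C(L R t M, Y). The composite is precomposition with the counit at t M, so the counit
  is invertible there. No comparison transformation occurs, since the functor into D is R after t
  itself.\<close>

lemma left_adjoint_triangle:
  assumes adj: "adjoint_functors K D C L R" and t: "is_functor K A C t"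
    and ff: "\<And>Y M. \<lbrakk>Y \<in> Ob C; M \<in> Ob A\<rbrakk> \<Longrightarrow>
      bij_betw (mmap R (omap t M) Y) (arr C (omap t M) Y) (arr D (omap R (omap t M)) (omap R Y))"
  shows "naturally_isomorphic K A C (cmp_fctr L (cmp_fctr R t)) t"
proof -
  interpret L: is_functor K D C L using adj by (simp add: adjoint_functors_def)
  interpret R: is_functor K C D R using adj by (simp add: adjoint_functors_def)
  interpret t: is_functor K A C t by (rule t)
  obtain \<Phi> where bij: "\<And>X Y. \<lbrakk>X \<in> Ob D; Y \<in> Ob C\<rbrakk> \<Longrightarrow> bij_betw (\<Phi> X Y) (arr C (omap L X) Y) (arr D X (omap R Y))"
    and nat: "\<And>X' X Y Y' f u g. \<lbrakk>X' \<in> Ob D; X \<in> Ob D; Y \<in> Ob C; Y' \<in> Ob C;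
        f \<in> arr D X' X; u \<in> arr C (omap L X) Y; g \<in> arr C Y Y'\<rbrakk> \<Longrightarrow>
          \<Phi> X' Y' (Cmp C (omap L X') Y Y' g (Cmp C (omap L X') (omap L X) Y u (mmap L X' X f))) =
          Cmp D X' (omap R Y) (omap R Y') (mmap R Y Y' g) (Cmp D X' X (omap R Y) (\<Phi> X Y u) f)"
    using adj unfolding adjoint_functors_def by blast
  note Do = L.source.Cmp_arr L.source.Id_arr and Co = L.target.Cmp_arr L.target.Id_arr
  note ob = L.omap_Ob R.omap_Ob t.omap_Ob
  have \<Phi>in: "\<Phi> X Y u \<in> arr D X (omap R Y)" if "X \<in> Ob D" "Y \<in> Ob C" "u \<in> arr C (omap L X) Y" for X Y u
    using bij[OF that(1,2)] that(3) by (auto simp: bij_betw_def)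
  have nat1: "\<Phi> X' Y (Cmp C (omap L X') (omap L X) Y u (mmap L X' X f)) = Cmp D X' X (omap R Y) (\<Phi> X Y u) f"
    if "X' \<in> Ob D" "X \<in> Ob D" "Y \<in> Ob C" "f \<in> arr D X' X" "u \<in> arr C (omap L X) Y" for X' X Y f u
  proof -
    note x = nat[OF that(1-3) that(3) that(4,5) L.target.Id_arr[OF that(3)]]
    have "Cmp C (omap L X') Y Y (Id C Y) (Cmp C (omap L X') (omap L X) Y u (mmap L X' X f)) =
        Cmp C (omap L X') (omap L X) Y u (mmap L X' X f)"
      using that by (intro L.target.Id_left Co ob L.mmap_arr)
    moreover have "Cmp D X' (omap R Y) (omap R Y) (mmap R Y Y (Id C Y)) (Cmp D X' X (omap R Y) (\<Phi> X Y u) f) =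
        Cmp D X' X (omap R Y) (\<Phi> X Y u) f"
      unfolding R.mmap_Id[OF that(3)] using that by (intro L.source.Id_left Do ob \<Phi>in)
    ultimately show ?thesis using x by simp
  qed
  have nat2: "\<Phi> X Y' (Cmp C (omap L X) Y Y' g u) = Cmp D X (omap R Y) (omap R Y') (mmap R Y Y' g) (\<Phi> X Y u)"
    if "X \<in> Ob D" "Y \<in> Ob C" "Y' \<in> Ob C" "u \<in> arr C (omap L X) Y" "g \<in> arr C Y Y'" for X Y Y' u g
  proof -
    note x = nat[OF that(1,1,2,3) L.source.Id_arr[OF that(1)] that(4,5)]
    have "Cmp C (omap L X) (omap L X) Y u (mmap L X X (Id D X)) = u"
      unfolding L.mmap_Id[OF that(1)] using that by (intro L.target.Id_right ob)
    moreover have "Cmp D X X (omap R Y) (\<Phi> X Y u) (Id D X) = \<Phi> X Y u"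
      using that by (intro L.source.Id_right ob \<Phi>in)
    ultimately show ?thesis using x by simp
  qed
  let ?c = "\<lambda>M. omap R (omap t M)"
  \<comment> \<open>The component of the counit at t M, recovered as the transpose of an
    identity.\<close>
  define \<eta> where "\<eta> = (\<lambda>M\<in>Ob A. inv_into (arr C (omap L (?c M)) (omap t M)) (\<Phi> (?c M) (omap t M)) (Id D (?c M)))"
  have \<eta>: "\<eta> M \<in> arr C (omap L (?c M)) (omap t M)" "\<Phi> (?c M) (omap t M) (\<eta> M) = Id D (?c M)" if M: "M \<in> Ob A" for M
  proof -
    have "Id D (?c M) \<in> \<Phi> (?c M) (omap t M) ` arr C (omap L (?c M)) (omap t M)"
      using bij[OF ob(2)[OF ob(3)[OF M]] ob(3)[OF M]] L.source.Id_arr[OF ob(2)[OF ob(3)[OF M]]]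
      by (simp add: bij_betw_def)
    then show "\<eta> M \<in> arr C (omap L (?c M)) (omap t M)" "\<Phi> (?c M) (omap t M) (\<eta> M) = Id D (?c M)"
      using M by (simp_all add: \<eta>_def inv_into_into f_inv_into_f)
  qed
  have comp: "\<Phi> (?c M) Y (Cmp C (omap L (?c M)) (omap t M) Y f (\<eta> M)) = mmap R (omap t M) Y f"
    if "M \<in> Ob A" "Y \<in> Ob C" "f \<in> arr C (omap t M) Y" for M Y f
    using that \<eta>[OF that(1)] by (simp add: nat2 ob L.source.Id_right R.mmap_arr)
  have \<eta>_nat: "\<eta> \<in> nat_trans A C (cmp_fctr L (cmp_fctr R t)) t"
  proof (rule nat_transI)
    fix M N f assume M: "M \<in> Ob A" and N: "N \<in> Ob A" and f: "f \<in> arr A M N"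
    note o = ob(3)[OF M] ob(3)[OF N] ob(2)[OF ob(3)[OF M]] ob(2)[OF ob(3)[OF N]]
      ob(1)[OF ob(2)[OF ob(3)[OF M]]] ob(1)[OF ob(2)[OF ob(3)[OF N]]]
    note tf = t.mmap_arr[OF M N f]
    note Rf = R.mmap_arr[OF o(1,2) tf]
    have "Cmp C (omap L (?c M)) (omap L (?c N)) (omap t N) (\<eta> N) (mmap L (?c M) (?c N) (mmap R (omap t M) (omap t N) (mmap t M N f))) =
        Cmp C (omap L (?c M)) (omap t M) (omap t N) (mmap t M N f) (\<eta> M)"
    proof (rule inj_onD[OF bij_betw_imp_inj_on[OF bij[OF o(3,2)]]])
      show "\<Phi> (?c M) (omap t N) (Cmp C (omap L (?c M)) (omap L (?c N)) (omap t N) (\<eta> N) (mmap L (?c M) (?c N) (mmap R (omap t M) (omap t N) (mmap t M N f)))) =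
        \<Phi> (?c M) (omap t N) (Cmp C (omap L (?c M)) (omap t M) (omap t N) (mmap t M N f) (\<eta> M))"
        by (simp add: nat1[OF o(3,4,2) Rf \<eta>(1)[OF N]] \<eta>(2)[OF N] comp[OF M o(2) tf] L.source.Id_left[OF o(3,4) Rf])
    qed (use o tf Rf \<eta>(1)[OF M] \<eta>(1)[OF N] L.mmap_arr[OF o(3,4) Rf] in \<open>auto intro!: Co\<close>)
    then show "Cmp C (omap (cmp_fctr L (cmp_fctr R t)) M) (omap (cmp_fctr L (cmp_fctr R t)) N) (omap t N) (\<eta> N) (mmap (cmp_fctr L (cmp_fctr R t)) M N f) =
        Cmp C (omap (cmp_fctr L (cmp_fctr R t)) M) (omap t M) (omap t N) (mmap t M N f) (\<eta> M)" by simp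
  qed (auto simp: \<eta>, simp add: \<eta>_def)
  have "is_iso C (omap L (?c M)) (omap t M) (\<eta> M)" if M: "M \<in> Ob A" for M
  proof -
    note o = ob(3)[OF M] ob(2)[OF ob(3)[OF M]] ob(1)[OF ob(2)[OF ob(3)[OF M]]]
    have b: "bij_betw (\<lambda>f. Cmp C (omap L (?c M)) (omap t M) Y f (\<eta> M)) (arr C (omap t M) Y) (arr C (omap L (?c M)) Y)"
      if Y: "Y \<in> Ob C" for Y
    proof -
      have "bij_betw (inv_into (arr C (omap L (?c M)) Y) (\<Phi> (?c M) Y) \<circ> mmap R (omap t M) Y) (arr C (omap t M) Y) (arr C (omap L (?c M)) Y)"
        by (rule bij_betw_trans[OF ff[OF Y M] bij_betw_inv_into[OF bij[OF o(2) Y]]])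
      moreover have "(inv_into (arr C (omap L (?c M)) Y) (\<Phi> (?c M) Y) \<circ> mmap R (omap t M) Y) f = Cmp C (omap L (?c M)) (omap t M) Y f (\<eta> M)"
        if f: "f \<in> arr C (omap t M) Y" for f
        using comp[OF M Y f] bij_betw_inv_into_left[OF bij[OF o(2) Y] Co(1)[OF o(3,1) Y \<eta>(1)[OF M] f]] by simp
      ultimately show ?thesis
        by (rule bij_betw_cong[THEN iffD1, rotated])
    qed
    \<comment> \<open>Surjectivity at Y = L R t M gives a left inverse of \<eta>; injectivity at Y =
      t M makes it two-sided.\<close>
    have "Id C (omap L (?c M)) \<in> (\<lambda>f. Cmp C (omap L (?c M)) (omap t M) (omap L (?c M)) f (\<eta> M)) ` arr C (omap t M) (omap L (?c M))"
      unfolding bij_betw_imp_surj_on[OF b[OF o(3)]] by (rule L.target.Id_arr[OF o(3)])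
    then obtain g where "Id C (omap L (?c M)) = Cmp C (omap L (?c M)) (omap t M) (omap L (?c M)) g (\<eta> M)"
      "g \<in> arr C (omap t M) (omap L (?c M))"
      by (rule imageE)
    note g = this(2) this(1)[symmetric]
    have "Cmp C (omap t M) (omap L (?c M)) (omap t M) (\<eta> M) g = Id C (omap t M)"
    proof (rule inj_onD[OF bij_betw_imp_inj_on[OF b[OF o(1)]]])
      have "Cmp C (omap L (?c M)) (omap t M) (omap t M) (Cmp C (omap t M) (omap L (?c M)) (omap t M) (\<eta> M) g) (\<eta> M) =
          Cmp C (omap L (?c M)) (omap L (?c M)) (omap t M) (\<eta> M) (Cmp C (omap L (?c M)) (omap t M) (omap L (?c M)) g (\<eta> M))"
        using o g(1) \<eta>(1)[OF M] by (intro L.target.Cmp_assoc[symmetric])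
      also have "\<dots> = Cmp C (omap L (?c M)) (omap t M) (omap t M) (Id C (omap t M)) (\<eta> M)"
        using o \<eta>(1)[OF M] by (simp add: g(2) L.target.Id_left L.target.Id_right)
      finally show "Cmp C (omap L (?c M)) (omap t M) (omap t M) (Cmp C (omap t M) (omap L (?c M)) (omap t M) (\<eta> M) g) (\<eta> M) =
          Cmp C (omap L (?c M)) (omap t M) (omap t M) (Id C (omap t M)) (\<eta> M)" .
    qed (use o g(1) \<eta>(1)[OF M] in \<open>auto intro!: Co\<close>)
    then show ?thesis unfolding is_iso_def using g \<eta>(1)[OF M] by blast
  qed
  then show ?thesis
    unfolding naturally_isomorphic_def
    using \<eta>_nat t cmp_fctr_functor[OF cmp_fctr_functor[OF t R.is_functor_axioms] L.is_functor_axioms] by auto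
qed

section \<open>The categories of coherent and of polynomial functors\<close>

context coherent_setup
begin

abbreviation CohC :: "('k, ('k, 'v) rep_functor, ('k, 'v) rep_nat) lincat" where "CohC \<equiv> Coh n K"
abbreviation PolC :: "('k, ('k, 'v) poly_functor, ('k, 'v) poly_nat) lincat" where "PolC \<equiv> Pol n K"
abbreviation FunC :: "('k, ('k, 'v) rep_functor, ('k, 'v) rep_nat) lincat" where "FunC \<equiv> functor_cat K RepC VecC"

lemma coherent_linear: "coherent n K F \<Longrightarrow> lin_fun F"
  by (simp add: coherent_def)

lemma Coh_simps:
  "Ob CohC = {F. coherent n K F}" "Id CohC = Id FunC" "Cmp CohC = Cmp FunC"
  "arr CohC F F' = natR F F'"
  by (auto simp: Coh_def full_subcat_def functor_cat_simps coherent_linear)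

lemma Pol_simps:
  "Ob PolC = {F. is_linear_functor K GamC VecC F}"
  "Id PolC = Id (functor_cat K GamC VecC)" "Cmp PolC = Cmp (functor_cat K GamC VecC)"
  "arr PolC F F' = natP F F'"
  by (simp_all add: Pol_def functor_cat_simps)

lemma lincategory_FunC: "lincategory K FunC"
  by (intro lincategory_functor_cat lincategory_RepC lincategory_VecC field_axioms)

lemma lincategory_CohC: "lincategory K CohC"
  unfolding Coh_def by (intro lincategory_full_subcat lincategory_FunC)

lemma lincategory_PolC: "lincategory K PolC"
  unfolding Pol_def by (intro lincategory_functor_cat lincategory_Gamma lincategory_VecC field_axioms)

lemma Fun_Id_apply: "\<lbrakk>X \<in> Ob RepC; x \<in> carrier (omap F X)\<rbrakk> \<Longrightarrow> Id FunC F X x = x"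
  by (simp add: functor_cat_simps Vect_simps)

text \<open>t_*, t_! and c_* all go from representations to a category of functors. Their laws are
  equations between transformations and are reduced here to equations between elements.\<close>

lemma Rep_functor_catI:
  assumes C: "lincategory K C"
    and lin: "\<And>M. R M \<Longrightarrow> is_linear_functor K C VecC (omap F M)"
    and nat: "\<And>M N f. \<lbrakk>R M; R N; f \<in> Hom M N\<rbrakk> \<Longrightarrow> mmap F M N f \<in> nat_trans C VecC (omap F M) (omap F N)"
    and id: "\<And>M V a. \<lbrakk>R M; (\<lambda>x\<in>carrier M. x) \<in> Hom M M; V \<in> Ob C; a \<in> carrier (omap (omap F M) V)\<rbrakk> \<Longrightarrow>
      mmap F M M (\<lambda>x\<in>carrier M. x) V a = a"
    and cmp: "\<And>L M N f g V a. \<lbrakk>R L; R M; R N; f \<in> Hom L M; g \<in> Hom M N; V \<in> Ob C; a \<in> carrier (omap (omap F L) V)\<rbrakk> \<Longrightarrow>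
      mmap F L N (compose (carrier L) g f) V a = mmap F M N g V (mmap F L M f V a)"
  shows "is_functor K RepC (functor_cat K C VecC) F"
proof -
  let ?D = "functor_cat K C VecC"
  interpret D: lincategory K ?D by (intro lincategory_functor_cat C lincategory_VecC field_axioms)
  show ?thesis
  proof (intro is_functor.intro is_functor_axioms.intro D.lincategory_axioms lincategory_RepC)
    fix M assume "M \<in> Ob RepC"
    then have M: "R M" by (simp add: Rep_simps)
    show MO: "omap F M \<in> Ob ?D" by (simp add: functor_cat_simps lin M)
    have i: "(\<lambda>x\<in>carrier M. x) \<in> Hom M M"
      using lincategory.Id_arr[OF lincategory_RepC, of M] M by (simp add: Rep_simps)
    have "mmap F M M (\<lambda>x\<in>carrier M. x) = Id ?D (omap F M)"
      by (rule Vect_nat_eqI[OF nat[OF M M i] D.Id_arr[OF MO, unfolded functor_cat_simps(2)]])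
        (simp add: id[OF M i] functor_cat_simps Vect_simps)
    then show "mmap F M M (Id RepC M) = Id ?D (omap F M)" by (simp add: Rep_simps)
  next
    fix M N f assume "M \<in> Ob RepC" "N \<in> Ob RepC" "f \<in> arr RepC M N"
    then show "mmap F M N f \<in> arr ?D (omap F M) (omap F N)"
      by (simp add: Rep_simps functor_cat_simps nat)
  next
    fix L M N f g assume "L \<in> Ob RepC" "M \<in> Ob RepC" "N \<in> Ob RepC" "f \<in> arr RepC L M" "g \<in> arr RepC M N"
    then have L: "R L" and M: "R M" and N: "R N" and f: "f \<in> Hom L M" and g: "g \<in> Hom M N"
      by (simp_all add: Rep_simps)
    have O: "omap F L \<in> Ob ?D" "omap F M \<in> Ob ?D" "omap F N \<in> Ob ?D" by (simp_all add: functor_cat_simps lin L M N)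
    have "mmap F L N (compose (carrier L) g f) = Cmp ?D (omap F L) (omap F M) (omap F N) (mmap F M N g) (mmap F L M f)"
      by (rule Vect_nat_eqI[OF nat[OF L N rep_hom_compose[OF L f g]]
            D.Cmp_arr[OF O, unfolded functor_cat_simps(2), OF nat[OF L M f] nat[OF M N g]]])
        (simp add: cmp[OF L M N f g] functor_cat_simps Vect_simps compose_eq)
    then show "mmap F L N (Cmp RepC L M N g f) = Cmp ?D (omap F L) (omap F M) (omap F N) (mmap F M N g) (mmap F L M f)"
      by (simp add: Rep_simps)
  qed
qed

lemma Coh_functorI:
  assumes "is_functor K RepC FunC F" "\<And>M. R M \<Longrightarrow> coherent n K (omap F M)"
  shows "is_functor K RepC CohC F"
  using full_subcat_functor[OF assms(1), of "\<lambda>_. True" "coherent n K"] assms(2) by (simp add: Coh_def Rep_simps)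

lemma jo_linear:
  assumes F: "lin_fun F"
  shows "is_linear_functor K GamC VecC (jo F)"
proof -
  note Fs = Vect_functor[OF F, unfolded Rep_simps mem_Collect_eq]
  show ?thesis
    by (rule Vect_functorI[OF lincategory_Gamma field_axioms])
      (simp_all add: Gamma_simps Fs del: rep_hom_simps)
qed

lemma jo_nat: "a \<in> natR F F' \<Longrightarrow> mmap ju F F' a \<in> natP (jo F) (jo F')"
  unfolding jm by (rule Vect_natI) (use Vect_nat[of a RepC K F F'] in \<open>auto simp: Gamma_simps Rep_simps\<close>)

lemma j_functor: "is_functor K CohC PolC ju"
proof (intro is_functor.intro is_functor_axioms.intro lincategory_CohC lincategory_PolC)
  fix F assume F: "F \<in> Ob CohC"
  then show "jo F \<in> Ob PolC" by (simp add: Coh_simps Pol_simps jo_linear coherent_linear)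
  show "mmap ju F F (Id CohC F) = Id PolC (jo F)"
    by (auto simp: Coh_simps Pol_simps jm functor_cat_simps Gamma_simps Rep_simps intro!: restrict_ext)
next
  fix F F' a assume "a \<in> arr CohC F F'"
  then show "mmap ju F F' a \<in> arr PolC (jo F) (jo F')"
    by (simp add: Coh_simps Pol_simps jo_nat)
next
  fix F F' F'' a b
  show "mmap ju F F'' (Cmp CohC F F' F'' b a) =
    Cmp PolC (jo F) (jo F') (jo F'') (mmap ju F' F'' b) (mmap ju F F' a)"
    by (auto simp: Coh_simps Pol_simps jm functor_cat_simps Gamma_simps Rep_simps intro!: restrict_ext)
qed

subsection \<open>Representable functors\<close>

lemma h_trans_nat:
  assumes M: "R M" and M': "R M'" and f: "f \<in> Hom M' M"
  shows "h_trans n K M M' f \<in> natR (hf M) (hf M')"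
  unfolding h_trans_def h_functor_eq
proof (rule copy_nat)
  show "(\<lambda>u. compose (carrier M') u f) \<in> module_hom K (rep_hom n K M X) (rep_hom n K M' X)" if "X \<in> Ob RepC" for X
    using lincategory.Cmp_linear_right[OF lincategory_RepC, of M' M X f] M M' f that by (simp add: Rep_simps)
  show "(\<lambda>u. compose (carrier M) f u) \<in> module_hom K (rep_hom n K M X) (rep_hom n K M Y)"
    if "X \<in> Ob RepC" "Y \<in> Ob RepC" "f \<in> arr RepC X Y" for X Y f
    using that M compose_hom by (simp add: Rep_simps)
  show "compose (carrier M') (compose (carrier M) u x) f = compose (carrier M') u (compose (carrier M') x f)"
    if "X \<in> Ob RepC" "Y \<in> Ob RepC" "u \<in> arr RepC X Y" "x \<in> Hom M X" for X Y u x
    using rep_hom_in[OF f] by (auto simp: compose_def intro!: restrict_ext)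
qed (use M M' in \<open>simp_all add: Rep_simps rep_hom_fdvs\<close>)

lemma h_trans_apply:
  assumes "R M" "R M'" "R N" "u \<in> Hom M N"
  shows "h_trans n K M M' f N (enc (Hom M N) u) =
    (enc (Hom M' N) (compose (carrier M') u f) :: 'v)"
  using assms by (simp add: h_trans_def Rep_simps rep_hom_fdvs)

lemma Id_nat: "lin_fun F \<Longrightarrow> Id FunC F \<in> natR F F"
  using lincategory.Id_arr[OF lincategory_FunC, of F] by (simp add: functor_cat_simps)

text \<open>Presented by the zero map from h_M to h_M followed by the identity.\<close>

lemma coherent_h:
  assumes M: "R M"
  shows "coherent n K (hf M)"
proof -
  note F = h_functor_linear[OF M]
  interpret Z: vectorspace K "Mor FunC (hf M) (hf M)"
    using lincategory.Mor_vs[OF lincategory_FunC, of "hf M" "hf M"] F by (simp add: functor_cat_simps)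
  have z: "\<zero>\<^bsub>Mor FunC (hf M) (hf M)\<^esub> \<in> natR (hf M) (hf M)"
    using Z.M.zero_closed by (simp only: functor_cat_simps)
  show ?thesis
    unfolding coherent_def
  proof (intro conjI F, rule bexI[of _ M], rule bexI[of _ M], rule bexI[OF _ z], rule bexI[OF _ Id_nat[OF F]],
      intro ballI conjI)
    fix X assume X: "X \<in> Ob RepC"
    then interpret h: vectorspace K "omap (hf M) X"
      using Vect_functor(1)[OF F] by (blast intro: fdvs_vs)
    have [simp]: "Id FunC (hf M) X a = a" if "a \<in> carrier (omap (hf M) X)" for a
      using Fun_Id_apply[OF X that] .
    have 0: "\<zero>\<^bsub>Mor FunC (hf M) (hf M)\<^esub> X = (\<lambda>a\<in>carrier (omap (hf M) X). \<zero>\<^bsub>omap (hf M) X\<^esub>)"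
      using X by (simp add: functor_cat_simps Vect_simps)
    show "\<zero>\<^bsub>Mor FunC (hf M) (hf M)\<^esub> X ` carrier (omap (hf M) X) =
        {a \<in> carrier (omap (hf M) X). Id FunC (hf M) X a = \<zero>\<^bsub>omap (hf M) X\<^esub>}"
      unfolding 0 using h.M.zero_closed by auto
    show "Id FunC (hf M) X ` carrier (omap (hf M) X) = carrier (omap (hf M) X)" by auto
  qed (use M in \<open>simp_all add: Rep_simps\<close>)
qed

lemma dual_representation: "R (M :: ('k, 'v) rep) \<Longrightarrow> R (dual n K M)"
  by (simp add: dual_def copy_rep_representation dual_rep_representation)

lemma dual_map_raw:
  assumes M: "R M" and N: "R N" and f: "f \<in> Hom M N"
  shows "(\<lambda>\<phi>. compose (carrier M) \<phi> f) \<in> module_hom K (dual_rep n K N) (dual_rep n K M)"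
    and "\<lbrakk>g \<in> G; \<phi> \<in> carrier (dual_rep n K N)\<rbrakk> \<Longrightarrow>
      compose (carrier M) (act (dual_rep n K N) g \<phi>) f = act (dual_rep n K M) g (compose (carrier M) \<phi> f)"
proof -
  interpret M: representation n K M by (rule M)
  interpret N: representation n K N by (rule N)
  note fx = rep_hom_in[OF f]
  show "(\<lambda>\<phi>. compose (carrier M) \<phi> f) \<in> module_hom K (dual_rep n K N) (dual_rep n K M)"
  proof (rule module_homI)
    fix \<phi> assume "\<phi> \<in> carrier (dual_rep n K N)"
    then have "\<phi> \<in> module_hom K N (scalars K)" by (simp add: hom_space_carrier)
    from module_hom_restrict[OF M.module module_hom_comp[OF rep_hom_hom[OF f] this]]
    show "compose (carrier M) \<phi> f \<in> carrier (dual_rep n K M)" by (simp add: compose_def)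
  qed (auto simp: compose_def fx intro!: restrict_ext)
  show "compose (carrier M) (act (dual_rep n K N) g \<phi>) f = act (dual_rep n K M) g (compose (carrier M) \<phi> f)"
    if "g \<in> G" "\<phi> \<in> carrier (dual_rep n K N)"
    using that by (auto simp: compose_def fx rep_hom_act[OF f] G.inv_closed simp del: sym_group_inv_equality intro!: restrict_ext)
qed

lemma dual_map_arr:
  fixes M N :: "('k, 'v) rep"
  assumes M: "R M" and N: "R N" and f: "f \<in> Hom M N"
  shows "dual_map n K M N f \<in> Hom (dual n K N) (dual n K M)"
  unfolding dual_map_def dual_def
  by (rule copy_map_rep_hom[OF dual_rep_representation[OF N] dual_rep_representation[OF M] dual_map_raw(1)[OF M N f]])
    (rule dual_map_raw(2)[OF M N f])

lemma dual_map_apply: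
  fixes M N :: "('k, 'v) rep"
  assumes "R N" "\<phi> \<in> carrier (dual_rep n K N)"
  shows "dual_map n K M N f (enc (carrier (dual_rep n K N)) \<phi>) = (enc (carrier (dual_rep n K M)) (compose (carrier M) \<phi> f) :: 'v)"
  unfolding dual_map_def using assms by (intro copy_map_enc representation.fdvs[OF dual_rep_representation])

lemma t_lower_star_simps [simp]:
  "omap tl M = hf (dual n K M)"
  "mmap tl M N f = h_trans n K (dual n K M) (dual n K N) (dual_map n K M N f)"
  by (simp_all add: t_lower_star_def)

lemma dual_cases:
  fixes M :: "('k, 'v) rep"
  assumes M: "R M" and a: "a \<in> carrier (dual n K M)"
  obtains \<phi> where "\<phi> \<in> carrier (dual_rep n K M)" "a = enc (carrier (dual_rep n K M)) \<phi>"
  using a unfolding dual_def copy_rep_simps by (rule copy_carrierE)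

text \<open>Dualising reverses arrows and so does passing from M to h_M, which makes the composite
  covariant.\<close>

lemma t_lower_star_functor: "is_functor K RepC CohC tl"
proof (rule Coh_functorI[OF Rep_functor_catI[OF lincategory_RepC]])
  note DR = dual_representation
  fix M :: "('k, 'v) rep" and X a assume M: "R M" and XO: "X \<in> Ob RepC" and a: "a \<in> carrier (omap (omap tl M) X)"
  then have X: "R X" by (simp add: Rep_simps)
  from a obtain u where u: "u \<in> Hom (dual n K M) X" and au: "a = enc (Hom (dual n K M) X) u"
    unfolding t_lower_star_simps h_carrier by (rule copy_carrierE)
  have di: "dual_map n K M M (\<lambda>x\<in>carrier M. x) a = a" if a: "a \<in> carrier (dual n K M)" for a
    using a
  proof (rule dual_cases[OF M])
    fix \<phi> assume \<phi>: "\<phi> \<in> carrier (dual_rep n K M)" and a: "a = enc (carrier (dual_rep n K M)) \<phi>"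
    have "compose (carrier M) \<phi> (\<lambda>x\<in>carrier M. x) = \<phi>"
      using \<phi> by (auto simp: compose_def hom_space_carrier intro!: extensionalityI[of _ "carrier M"])
    then show ?thesis using dual_map_apply[OF M \<phi>] a by simp
  qed
  have "compose (carrier (dual n K M)) u (dual_map n K M M (\<lambda>x\<in>carrier M. x)) = u"
    using rep_hom_ext[OF u] by (auto simp: compose_def di intro!: extensionalityI[of _ "carrier (dual n K M)"])
  then show "mmap tl M M (\<lambda>x\<in>carrier M. x) X a = a"
    using h_trans_apply[OF DR[OF M] DR[OF M] X u] au by simp
next
  note DR = dual_representation
  fix L M N :: "('k, 'v) rep" and f g X a assume L: "R L" and M: "R M" and N: "R N" and f: "f \<in> Hom L M" and g: "g \<in> Hom M N"
    and XO: "X \<in> Ob RepC" and a: "a \<in> carrier (omap (omap tl L) X)"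
  then have X: "R X" by (simp add: Rep_simps)
  from a obtain u where u: "u \<in> Hom (dual n K L) X" and au: "a = enc (Hom (dual n K L) X) u"
    unfolding t_lower_star_simps h_carrier by (rule copy_carrierE)
  have "dual_map n K L N (compose (carrier L) g f) b = dual_map n K L M f (dual_map n K M N g b)" if b: "b \<in> carrier (dual n K N)" for b
    using b
  proof (rule dual_cases[OF N])
    fix \<phi> assume \<phi>: "\<phi> \<in> carrier (dual_rep n K N)" and b: "b = enc (carrier (dual_rep n K N)) \<phi>"
    have p: "compose (carrier M) \<phi> g \<in> carrier (dual_rep n K M)"
      using module_hom_in[OF dual_map_raw(1)[OF M N g] \<phi>] .
    have "compose (carrier L) \<phi> (compose (carrier L) g f) = compose (carrier L) (compose (carrier M) \<phi> g) f"
      using rep_hom_in[OF f] by (auto simp: compose_def intro!: restrict_ext)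
    then show ?thesis by (simp only: b dual_map_apply[OF N \<phi>] dual_map_apply[OF M p])
  qed
  then have "compose (carrier (dual n K N)) u (dual_map n K L N (compose (carrier L) g f)) =
    compose (carrier (dual n K N)) (compose (carrier (dual n K M)) u (dual_map n K L M f)) (dual_map n K M N g)"
    using rep_hom_in[OF dual_map_arr[OF M N g]] by (auto simp: compose_def intro!: restrict_ext)
  then show "mmap tl L N (compose (carrier L) g f) X a = mmap tl M N g X (mmap tl L M f X a)"
    by (simp only: t_lower_star_simps au h_trans_apply[OF DR[OF L] DR[OF N] X u] h_trans_apply[OF DR[OF L] DR[OF M] X u]
        h_trans_apply[OF DR[OF M] DR[OF N] X rep_hom_compose[OF DR[OF M] dual_map_arr[OF L M f] u]])
qed (simp_all add: h_functor_linear h_trans_nat dual_representation dual_map_arr coherent_h)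

subsection \<open>Free representations\<close>

text \<open>The free module on S, taken as a permutation module so that the general facts on
  \<open>perm_rep\<close> apply. The element \<open>gen S s\<close> below is the code of the point
  mass at (s, 1), and its translates are the point masses at all (s, h).\<close>

definition free_raw :: "'s set \<Rightarrow> ('k, 's \<times> (nat \<Rightarrow> nat) \<Rightarrow> 'k) rep" where
  "free_raw S = perm_rep n K (S \<times> G) (\<lambda>g (s, h). (s, g \<cdot> h))"

definition free :: "'s set \<Rightarrow> ('k, 'v) rep" where
  "free S = copy_rep (free_raw S)"

definition delta :: "'s set \<Rightarrow> 's \<Rightarrow> (nat \<Rightarrow> nat) \<Rightarrow> 's \<times> (nat \<Rightarrow> nat) \<Rightarrow> 'k" where
  "delta S s h = (\<lambda>p\<in>S \<times> G. if p = (s, h) then \<one>\<^bsub>K\<^esub> else \<zero>\<^bsub>K\<^esub>)"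

definition gen :: "'s set \<Rightarrow> 's \<Rightarrow> 'v" where
  "gen S s = enc (carrier (free_raw S)) (delta S s \<one>\<^sub>G)"

lemma free_raw_representation: "finite S \<Longrightarrow> R (free_raw S)"
  unfolding free_raw_def
  by (rule perm_rep_representation[OF field_axioms]) (auto simp: sym_group_finite G.m_assoc)

lemma free_representation: "finite S \<Longrightarrow> R (free S)"
  unfolding free_def by (rule copy_rep_representation[OF free_raw_representation])

lemma delta_in: "delta S s h \<in> carrier (free_raw S)"
  by (auto simp: delta_def free_raw_def field_axioms)

lemma gen_in: "gen S s \<in> carrier (free S)"
  by (simp add: gen_def free_def delta_in)

lemma act_delta:
  assumes "s \<in> S" "g \<in> G" "h \<in> G"
  shows "act (free_raw S) g (delta S s h) = delta S s (g \<cdot> h)"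
proof -
  have "iv g \<cdot> k = h \<longleftrightarrow> k = g \<cdot> h" if "k \<in> G" for k
    using assms that by (metis G.inv_solve_left)
  then show ?thesis
    using assms by (auto simp: free_raw_def delta_def field_axioms simp del: sym_group_inv_equality intro!: restrict_ext)
qed

text \<open>Every function is the sum of its values times point masses, and linear maps commute with
  this sum.\<close>

lemma func_space_hom_eq:
  assumes B: "finite B" and f: "f \<in> module_hom K (ring.func_space K B) W" and g: "g \<in> module_hom K (ring.func_space K B) W"
    and W: "module K W" and eq: "\<And>b. b \<in> B \<Longrightarrow> f (\<lambda>p\<in>B. if p = b then \<one>\<^bsub>K\<^esub> else \<zero>\<^bsub>K\<^esub>) = g (\<lambda>p\<in>B. if p = b then \<one>\<^bsub>K\<^esub> else \<zero>\<^bsub>K\<^esub>)"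
    and x: "x \<in> carrier (ring.func_space K B)"
  shows "f x = g x"
proof -
  note fs = func_space_simps[OF field_axioms]
  interpret F: vectorspace K "ring.func_space K B" by (rule func_space_vectorspace) (rule field_axioms)
  interpret S: vectorspace K "scalars K" by (rule scalars_vectorspace)
  interpret W: module K W by (rule W)
  let ?d = "\<lambda>b. \<lambda>p\<in>B. if p = b then \<one>\<^bsub>K\<^esub> else \<zero>\<^bsub>K\<^esub>"
  have xK: "x b \<in> carrier K" if "b \<in> B" for b using x that by (auto simp: fs)
  have d: "?d b \<in> carrier (ring.func_space K B)" for b by (auto simp: fs)
  have sum: "x = (\<Oplus>\<^bsub>ring.func_space K B\<^esub>b\<in>B. x b \<odot>\<^bsub>ring.func_space K B\<^esub> ?d b)" (is "x = ?s")
  proof (rule extensionalityI[of _ B])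
    have "?s \<in> carrier (ring.func_space K B)" using xK d by (intro F.M.finsum_closed) (auto simp del: fs)
    then show "?s \<in> extensional B" by (simp add: fs PiE_def)
    show "x \<in> extensional B" using x by (simp add: fs PiE_def)
    fix b assume b: "b \<in> B"
    have ev: "(\<lambda>f. f b) \<in> module_hom K (ring.func_space K B) (scalars K)"
      by (rule module_homI) (use b in \<open>auto simp: fs\<close>)
    have "?s b = (\<Oplus>\<^bsub>scalars K\<^esub>c\<in>B. (x c \<odot>\<^bsub>ring.func_space K B\<^esub> ?d c) b)"
      using xK d by (intro module_hom_finsum[OF F.module_axioms S.module_axioms ev]) (auto simp del: fs)
    also have "\<dots> = (\<Oplus>\<^bsub>scalars K\<^esub>c\<in>B. if b = c then x c else \<zero>\<^bsub>scalars K\<^esub>)"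
      using xK b by (intro S.M.finsum_cong') (auto simp: fs)
    also have "\<dots> = x b"
      using S.M.finsum_singleton[OF b B, of x] xK by auto
    finally show "x b = ?s b" by simp
  qed
  have *: "h ?s = (\<Oplus>\<^bsub>W\<^esub>b\<in>B. x b \<odot>\<^bsub>W\<^esub> h (?d b))" if h: "h \<in> module_hom K (ring.func_space K B) W" for h
  proof -
    have "h ?s = (\<Oplus>\<^bsub>W\<^esub>b\<in>B. h (x b \<odot>\<^bsub>ring.func_space K B\<^esub> ?d b))"
      using xK d by (intro module_hom_finsum[OF F.module_axioms W h]) (auto simp del: fs)
    also have "\<dots> = (\<Oplus>\<^bsub>W\<^esub>b\<in>B. x b \<odot>\<^bsub>W\<^esub> h (?d b))"
      using xK d module_hom_in[OF h d] by (intro W.M.finsum_cong') (auto simp: module_hom_smult[OF h] simp del: fs)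
    finally show ?thesis .
  qed
  have "f ?s = g ?s"
    unfolding *[OF f] *[OF g] using xK module_hom_in[OF g d] by (intro W.M.finsum_cong') (auto simp: eq)
  then show ?thesis using sum by simp
qed

text \<open>The translates of the generators are the point masses, which span, so equality on
  generators propagates by equivariance and linearity.\<close>

lemma free_hom_unique:
  assumes S: "finite S" and N: "R N" and u: "u \<in> Hom (free S) N" and v: "v \<in> Hom (free S) N"
    and eq: "\<And>s. s \<in> S \<Longrightarrow> u (gen S s) = v (gen S s)"
  shows "u = v"
proof (rule extensionalityI[OF rep_hom_ext[OF u] rep_hom_ext[OF v]])
  interpret N: representation n K N by (rule N)
  interpret F: representation n K "free_raw S" by (rule free_raw_representation[OF S])
  have fs: "module_hom K (free_raw S) N = module_hom K (ring.func_space K (S \<times> G)) N"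
    "carrier (free_raw S) = carrier (ring.func_space K (S \<times> G))"
    by (simp_all add: free_raw_def perm_rep_def)
  have h: "(\<lambda>x. w (enc (carrier (free_raw S)) x)) \<in> module_hom K (free_raw S) N" if "w \<in> Hom (free S) N" for w
    using module_hom_comp[OF enc_hom[OF F.fdvs], of w N] rep_hom_hom[OF that] by (simp add: free_def)
  fix a assume "a \<in> carrier (free S)"
  then obtain x where x: "x \<in> carrier (free_raw S)" "a = enc (carrier (free_raw S)) x"
    unfolding free_def copy_rep_simps by (rule copy_carrierE)
  have "u (enc (carrier (free_raw S)) x) = v (enc (carrier (free_raw S)) x)"
  proof (rule func_space_hom_eq[OF _ h[OF u, unfolded fs(1)] h[OF v, unfolded fs(1)] N.module _ x(1)[unfolded fs(2)]])
    show "finite (S \<times> G)" using S by (simp add: sym_group_finite)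
    fix p assume p: "p \<in> S \<times> G"
    then obtain s k where sk: "p = (s, k)" "s \<in> S" "k \<in> G" by auto
    have "enc (carrier (free_raw S)) (delta S s k) = act (free S) k (gen S s)"
      using act_delta[OF sk(2,3) G.one_closed] sk(3) enc_act[OF F.representation_axioms sk(3) delta_in]
      by (simp add: free_def gen_def)
    then have "u (enc (carrier (free_raw S)) (delta S s k)) = v (enc (carrier (free_raw S)) (delta S s k))"
      using rep_hom_act[OF u sk(3) gen_in, of s] rep_hom_act[OF v sk(3) gen_in, of s] eq[OF sk(2)] by simp
    then show "u (enc (carrier (free_raw S)) (\<lambda>q\<in>S \<times> G. if q = p then \<one>\<^bsub>K\<^esub> else \<zero>\<^bsub>K\<^esub>)) =
        v (enc (carrier (free_raw S)) (\<lambda>q\<in>S \<times> G. if q = p then \<one>\<^bsub>K\<^esub> else \<zero>\<^bsub>K\<^esub>))"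
      by (simp only: sk(1) delta_def)
  qed
  then show "u a = v a" by (simp only: x(2))
qed

text \<open>The coordinate at (s, 1) is the delta function on the orbit of the generator of s and
  vanishes on the orbits of the others. The average built from it and from \<open>x s\<close>
  therefore sends this generator to \<open>x s\<close> and the other generators to 0; the sum over s
  is the required map.\<close>

lemma free_hom_exists:
  assumes S: "finite S" and N: "R N" and x: "\<And>s. s \<in> S \<Longrightarrow> x s \<in> carrier N"
  obtains u where "u \<in> Hom (free S) N" "\<And>s. s \<in> S \<Longrightarrow> u (gen S s) = x s"
proof -
  interpret N: representation n K N by (rule N)
  note RF = free_representation[OF S]
  interpret F: representation n K "free_raw S" by (rule free_raw_representation[OF S])
  interpret TR: two_reps n K "free S" N using RF N by (simp add: two_reps_def)
  interpret H: vectorspace K "rep_hom n K (free S) N" by (rule rep_hom_vectorspace[OF RF N])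
  define \<phi> where "\<phi> s a = dec (carrier (free_raw S)) a (s, \<one>\<^sub>G)" for s and a :: 'v
  have \<phi>: "\<phi> s \<in> functionals K (free S)" if "s \<in> S" for s
  proof -
    have "(\<lambda>f. f (s, \<one>\<^sub>G)) \<in> module_hom K (free_raw S) (scalars K)"
      by (rule module_homI) (use that in \<open>auto simp: free_raw_def field_axioms\<close>)
    from module_hom_comp[OF dec_hom[OF F.fdvs] this] show ?thesis
      by (simp add: functionals_def free_def \<phi>_def[abs_def])
  qed
  have \<phi>gen: "\<phi> s (act (free S) g (gen S s')) = (if s = s' \<and> g = \<one>\<^sub>G then \<one>\<^bsub>K\<^esub> else \<zero>\<^bsub>K\<^esub>)"
    if "s \<in> S" "s' \<in> S" "g \<in> G" for s s' g
  proof -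
    have "act (free S) g (gen S s') = enc (carrier (free_raw S)) (delta S s' g)"
      using act_delta[OF that(2,3) G.one_closed] that(3) enc_act[OF F.representation_axioms that(3) delta_in]
      by (simp add: free_def gen_def)
    then show ?thesis using that delta_in[of S s' g] by (auto simp: \<phi>_def F.fdvs delta_def)
  qed
  define u where "u = (\<Oplus>\<^bsub>rep_hom n K (free S) N\<^esub>s\<in>S. avg n (free S) N (\<phi> s) (x s))"
  have av: "avg n (free S) N (\<phi> s) (x s) \<in> Hom (free S) N" if "s \<in> S" for s
    using that by (intro TR.avg_arr \<phi> x)
  show thesis
  proof (rule that)
    show "u \<in> Hom (free S) N" unfolding u_def using av by (intro H.M.finsum_closed) auto
    fix s assume s: "s \<in> S"
    have ev: "(\<lambda>u. u (gen S s)) \<in> module_hom K (rep_hom n K (free S) N) N"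
      by (rule module_homI) (use gen_in[of S s] in \<open>auto simp: rep_hom_in\<close>)
    have "u (gen S s) = (\<Oplus>\<^bsub>N\<^esub>t\<in>S. avg n (free S) N (\<phi> t) (x t) (gen S s))"
      unfolding u_def using av by (intro module_hom_finsum[OF H.module_axioms N.module ev]) auto
    also have "\<dots> = (\<Oplus>\<^bsub>N\<^esub>t\<in>S. if s = t then x t else \<zero>\<^bsub>N\<^esub>)"
    proof (rule N.M.finsum_cong')
      fix t assume t: "t \<in> S"
      show "avg n (free S) N (\<phi> t) (x t) (gen S s) = (if s = t then x t else \<zero>\<^bsub>N\<^esub>)"
      proof (cases "s = t")
        case True
        then show ?thesis using TR.avg_at[OF \<phi>[OF t] x[OF t] gen_in, of s] \<phi>gen[OF t s] by simp
      next
        case False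
        have "\<phi> t (act (free S) (iv g) (gen S s)) \<odot>\<^bsub>N\<^esub> act N g (x t) = \<zero>\<^bsub>N\<^esub>" if "g \<in> G" for g
          using \<phi>gen[OF t s G.inv_closed[OF that]] False x[OF t] that by (simp del: sym_group_inv_equality)
        then have "avg n (free S) N (\<phi> t) (x t) (gen S s) = (\<Oplus>\<^bsub>N\<^esub>g\<in>G. \<zero>\<^bsub>N\<^esub>)"
          unfolding avg_def restrict_apply'[OF gen_in] by (intro N.M.finsum_cong') auto
        then show ?thesis using False by simp
      qed
    qed (use x in auto)
    also have "\<dots> = x s" using N.M.finsum_singleton[OF s S, of x] x by auto
    finally show "u (gen S s) = x s" .
  qed
qed

end

lemma module_hom_finsum_fun:
  assumes M: "module K M" and N: "module K N" and f: "\<And>i. i \<in> A \<Longrightarrow> f i \<in> module_hom K M N"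
  shows "(\<lambda>x. \<Oplus>\<^bsub>N\<^esub>i\<in>A. f i x) \<in> module_hom K M N"
proof -
  interpret M: module K M by (rule M)
  interpret N: module K N by (rule N)
  have in': "(\<lambda>i. f i x) \<in> A \<rightarrow> carrier N" if "x \<in> carrier M" for x using module_hom_in[OF f that] by auto
  show ?thesis
  proof (rule module_homI)
    fix x assume "x \<in> carrier M" then show "(\<Oplus>\<^bsub>N\<^esub>i\<in>A. f i x) \<in> carrier N" by (intro N.M.finsum_closed in')
  next
    fix x y assume xy: "x \<in> carrier M" "y \<in> carrier M"
    have "(\<Oplus>\<^bsub>N\<^esub>i\<in>A. f i (x \<oplus>\<^bsub>M\<^esub> y)) = (\<Oplus>\<^bsub>N\<^esub>i\<in>A. f i x \<oplus>\<^bsub>N\<^esub> f i y)"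
      using xy module_hom_in[OF f] by (intro N.M.finsum_cong') (auto simp: module_hom_add[OF f])
    also have "\<dots> = (\<Oplus>\<^bsub>N\<^esub>i\<in>A. f i x) \<oplus>\<^bsub>N\<^esub> (\<Oplus>\<^bsub>N\<^esub>i\<in>A. f i y)"
      using xy by (intro N.M.finsum_addf in')
    finally show "(\<Oplus>\<^bsub>N\<^esub>i\<in>A. f i (x \<oplus>\<^bsub>M\<^esub> y)) = (\<Oplus>\<^bsub>N\<^esub>i\<in>A. f i x) \<oplus>\<^bsub>N\<^esub> (\<Oplus>\<^bsub>N\<^esub>i\<in>A. f i y)" .
  next
    fix c x assume cx: "c \<in> carrier K" "x \<in> carrier M"
    have "(\<Oplus>\<^bsub>N\<^esub>i\<in>A. f i (c \<odot>\<^bsub>M\<^esub> x)) = (\<Oplus>\<^bsub>N\<^esub>i\<in>A. c \<odot>\<^bsub>N\<^esub> f i x)"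
      using cx module_hom_in[OF f] by (intro N.M.finsum_cong') (auto simp: module_hom_smult[OF f])
    also have "\<dots> = c \<odot>\<^bsub>N\<^esub> (\<Oplus>\<^bsub>N\<^esub>i\<in>A. f i x)"
      using cx by (intro N.finsum_smult[symmetric] in')
    finally show "(\<Oplus>\<^bsub>N\<^esub>i\<in>A. f i (c \<odot>\<^bsub>M\<^esub> x)) = c \<odot>\<^bsub>N\<^esub> (\<Oplus>\<^bsub>N\<^esub>i\<in>A. f i x)" .
  qed
qed

lemma module_hom_diff:
  assumes M: "module K M" and N: "module K N" and f: "f \<in> module_hom K M N" and g: "g \<in> module_hom K M N"
  shows "(\<lambda>x. f x \<ominus>\<^bsub>N\<^esub> g x) \<in> module_hom K M N"
proof -
  interpret N: module K N by (rule N)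
  show ?thesis
    using module_hom_in[OF f] module_hom_in[OF g] module_hom_add[OF f] module_hom_add[OF g] module_hom_smult[OF f] module_hom_smult[OF g]
    by (intro module_homI) (auto simp: a_minus_def N.M.minus_add N.M.a_ac N.smult_r_distr N.smult_r_minus)
qed

section \<open>Contraction of tensors with functionals\<close>

context coherent_setup
begin

text \<open>Partial evaluation of a tensor at \<phi> in the first factor. It is selected through the
  universal property, which determines it on the tensor product only; off that carrier its values
  are arbitrary.\<close>

definition contract :: "('k, 'x) rep \<Rightarrow> ('k, 'y) rep \<Rightarrow> ('x \<Rightarrow> 'k) \<Rightarrow> (('x \<times> 'y \<Rightarrow> 'k) \<Rightarrow> 'k) \<Rightarrow> 'y" where
  "contract M N \<phi> = (SOME h. h \<in> module_hom K (tensor K M N) N \<and>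
     (\<forall>m\<in>carrier M. \<forall>y\<in>carrier N. h (tens K M N m y) = \<phi> m \<odot>\<^bsub>N\<^esub> y))"

lemma contract:
  assumes M: "fdvs K M" and N: "fdvs K N" and \<phi>: "\<phi> \<in> functionals K M"
  shows "contract M N \<phi> \<in> module_hom K (tensor K M N) N"
    and "\<lbrakk>m \<in> carrier M; y \<in> carrier N\<rbrakk> \<Longrightarrow> contract M N \<phi> (tens K M N m y) = \<phi> m \<odot>\<^bsub>N\<^esub> y"
proof -
  interpret two_spaces K M N using M N by (rule two_spacesI)
  have "\<phi> m \<in> carrier K" if "m \<in> carrier M" for m using functionals_in[OF \<phi> that] .
  then have 1: "(\<lambda>y. \<phi> m \<odot>\<^bsub>N\<^esub> y) \<in> module_hom K N N" if "m \<in> carrier M" for m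
    using that by (intro module_homI) (auto simp: N.smult_r_distr N.smult_assoc1[symmetric] m_comm)
  have 2: "(\<lambda>m. \<phi> m \<odot>\<^bsub>N\<^esub> y) \<in> module_hom K M N" if "y \<in> carrier N" for y
    using that \<phi> functionals_in[OF \<phi>] by (intro module_homI)
      (auto simp: functionals_def module_hom_add module_hom_smult N.smult_l_distr N.smult_assoc1)
  have "\<exists>h. h \<in> module_hom K (tensor K M N) N \<and>
     (\<forall>m\<in>carrier M. \<forall>y\<in>carrier N. h (tens K M N m y) = \<phi> m \<odot>\<^bsub>N\<^esub> y)"
    by (rule tensor_lift[OF N 1 2]) auto
  from someI_ex[OF this] show "contract M N \<phi> \<in> module_hom K (tensor K M N) N"
    "\<lbrakk>m \<in> carrier M; y \<in> carrier N\<rbrakk> \<Longrightarrow> contract M N \<phi> (tens K M N m y) = \<phi> m \<odot>\<^bsub>N\<^esub> y"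
    unfolding contract_def by auto
qed

text \<open>A basis of M turns a tensor into a d-tuple of vectors of N, its contractions with the
  coordinate functionals. \<open>contract_basis\<close> is the converse half of this
  bijection.\<close>

lemma tensor_expansion:
  assumes M: "fdvs K M" and N: "fdvs K N" and dw: "dual_basis K M d z w" and t: "t \<in> carrier (tensor K M N)"
  shows "(\<Oplus>\<^bsub>tensor K M N\<^esub>i\<in>{..<d}. tens K M N (z i) (contract M N (w i) t)) = t"
proof -
  interpret two_spaces K M N using M N by (rule two_spacesI)
  interpret T': vectorspace K "tensor K M N" by (rule tensor_vs)
  have z: "z i \<in> carrier M" and w: "w i \<in> functionals K M" if "i < d" for i
    using that dw by (auto simp: dual_basis_def)
  have h: "(\<lambda>t. \<Oplus>\<^bsub>tensor K M N\<^esub>i\<in>{..<d}. tens K M N (z i) (contract M N (w i) t)) \<in> module_hom K (tensor K M N) (tensor K M N)"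
    by (rule module_hom_finsum_fun[OF T'.module_axioms T'.module_axioms])
      (auto intro!: module_hom_comp[OF contract(1)[OF M N] tens_hom_right] z w)
  show ?thesis
  proof (rule tensor_hom_eq[OF h id_hom T'.module_axioms _ t])
    fix x y assume x: "x \<in> carrier M" and y: "y \<in> carrier N"
    have "(\<Oplus>\<^bsub>tensor K M N\<^esub>i\<in>{..<d}. tens K M N (z i) (contract M N (w i) (tens K M N x y))) =
        (\<Oplus>\<^bsub>tensor K M N\<^esub>i\<in>{..<d}. tens K M N (w i x \<odot>\<^bsub>M\<^esub> z i) y)"
      using z w x y functionals_in[OF w x]
      by (intro T'.M.finsum_cong') (auto simp: contract(2)[OF M N] module_hom_smult[OF tens_hom_right] module_hom_smult[OF tens_hom_left])
    also have "\<dots> = tens K M N (\<Oplus>\<^bsub>M\<^esub>i\<in>{..<d}. w i x \<odot>\<^bsub>M\<^esub> z i) y"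
      using z functionals_in[OF w x]
      by (intro module_hom_finsum[OF M.module_axioms T'.module_axioms tens_hom_left[OF y], symmetric]) auto
    also have "\<dots> = tens K M N x y" using dw x by (simp add: dual_basis_def)
    finally show "(\<Oplus>\<^bsub>tensor K M N\<^esub>i\<in>{..<d}. tens K M N (z i) (contract M N (w i) (tens K M N x y))) = tens K M N x y" .
  qed
qed

lemma contract_expansion:
  assumes M: "fdvs K M" and N: "fdvs K N" and dw: "dual_basis K M d z w" and y: "\<And>i. i < d \<Longrightarrow> y i \<in> carrier N"
    and \<phi>: "\<phi> \<in> functionals K M"
  shows "contract M N \<phi> (\<Oplus>\<^bsub>tensor K M N\<^esub>i\<in>{..<d}. tens K M N (z i) (y i)) = (\<Oplus>\<^bsub>N\<^esub>i\<in>{..<d}. \<phi> (z i) \<odot>\<^bsub>N\<^esub> y i)"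
proof -
  interpret two_spaces K M N using M N by (rule two_spacesI)
  interpret T': vectorspace K "tensor K M N" by (rule tensor_vs)
  have z: "z i \<in> carrier M" if "i < d" for i
    using that dw by (auto simp: dual_basis_def)
  have "contract M N \<phi> (\<Oplus>\<^bsub>tensor K M N\<^esub>i\<in>{..<d}. tens K M N (z i) (y i)) = (\<Oplus>\<^bsub>N\<^esub>i\<in>{..<d}. contract M N \<phi> (tens K M N (z i) (y i)))"
    using y z by (intro module_hom_finsum[OF T'.module_axioms N.module_axioms contract(1)[OF M N \<phi>]]) auto
  also have "\<dots> = (\<Oplus>\<^bsub>N\<^esub>i\<in>{..<d}. \<phi> (z i) \<odot>\<^bsub>N\<^esub> y i)"
    using y z functionals_in[OF \<phi> z] by (intro N.M.finsum_cong') (auto simp: contract(2)[OF M N \<phi>])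
  finally show ?thesis .
qed

lemma contract_basis:
  assumes M: "fdvs K M" and N: "fdvs K N" and dw: "dual_basis K M d z w" and y: "\<And>i. i < d \<Longrightarrow> y i \<in> carrier N" and j: "j < d"
  shows "contract M N (w j) (\<Oplus>\<^bsub>tensor K M N\<^esub>i\<in>{..<d}. tens K M N (z i) (y i)) = y j"
proof -
  interpret N: vectorspace K N using N by (rule fdvs_vs)
  have w: "w j \<in> functionals K M" using dw j by (simp add: dual_basis_def)
  have "(\<Oplus>\<^bsub>N\<^esub>i\<in>{..<d}. w j (z i) \<odot>\<^bsub>N\<^esub> y i) = (\<Oplus>\<^bsub>N\<^esub>i\<in>{..<d}. if j = i then y i else \<zero>\<^bsub>N\<^esub>)"
    using dw y j by (intro N.M.finsum_cong') (auto simp: dual_basis_def)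
  also have "\<dots> = y j" using N.M.finsum_singleton[of j "{..<d}" y] y j by auto
  finally show ?thesis using contract_expansion[OF M N dw y w] by simp
qed

subsection \<open>Coherence of the functors of coinvariants\<close>

text \<open>With a basis \<open>z\<close> of \<open>M\<close> of size \<open>d\<close>, the functors represented by the free modules on \<open>d\<close> and
  on \<open>\<S>\<^sub>n \<times> d\<close> generators are \<open>N \<mapsto> M \<otimes> N\<close> and \<open>N \<mapsto> (M \<otimes> N)\<^sup>n\<^sup>!\<close>, and the presentation is the
  defining one: \<open>(t\<^sub>g) \<mapsto> \<Sum>\<^sub>g (g t\<^sub>g - t\<^sub>g)\<close>.\<close>

lemma coherent_t:
  assumes M: "R M"
  shows "coherent n K (tf M)"
proof -
  interpret M: representation n K M by (rule M)
  obtain d z w where dw: "dual_basis K M d z w" using M.fdvs by (rule fdvs_dual_basis)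
  have z: "z i \<in> carrier M" if "i < d" for i using that dw by (auto simp: dual_basis_def)
  have w: "w i \<in> functionals K M" if "i < d" for i using that dw by (auto simp: dual_basis_def)
  let ?S = "{..<d}" and ?S' = "G \<times> {..<d}"
  let ?F = "free ?S :: ('k, 'v) rep" and ?F' = "free ?S' :: ('k, 'v) rep"
  have S': "finite ?S'" by (simp add: sym_group_finite)
  have F: "R ?F" and F': "R ?F'" using free_representation[of ?S] free_representation[OF S'] by simp_all
  \<comment> \<open>Identifies equivariant maps out of the free module with M \<otimes> N: a map is
    given by the d images of the generators, and these serve as coefficients of a tensor in the
    basis \<open>z\<close>.\<close>
  define Th where "Th N u = (\<Oplus>\<^bsub>tensor K M N\<^esub>i\<in>{..<d}. tens K M N (z i) (u (gen ?S i)))" for N :: "('k, 'v) rep" and u :: "'v \<Rightarrow> 'v"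
  define Th' where "Th' N v g = (\<Oplus>\<^bsub>tensor K M N\<^esub>i\<in>{..<d}. tens K M N (z i) (v (gen ?S' (g, i))))" for N :: "('k, 'v) rep" and v :: "'v \<Rightarrow> 'v" and g
  define rho where "rho N g t = act (tensor_rep K M N) g t \<ominus>\<^bsub>tensor K M N\<^esub> t" for N :: "('k, 'v) rep" and g t
  \<comment> \<open>The image consists of the sums of relations with one arbitrary tensor for each
    group element; as a relation is linear in its tensor, these already exhaust the span of the
    relations.\<close>
  define D where "D N v = (\<Oplus>\<^bsub>tensor K M N\<^esub>g\<in>G. rho N g (Th' N v g))" for N :: "('k, 'v) rep" and v
  note ts = two_spaces_rep[OF M]
  have Tv: "vectorspace K (tensor K M N)" if "R N" for N :: "('k, 'v) rep" using two_spaces.tensor_vs[OF ts[OF that]] .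
  note Tm = vectorspace_module[OF Tv]
  have Nm: "module K N" if "R N" for N :: "('k, 'v) rep" using representation.module[OF that] .
  have Hm: "module K (rep_hom n K ?F N)" "module K (rep_hom n K ?F' N)" if "R N" for N :: "('k, 'v) rep"
    using rep_hom_vectorspace[OF F that] rep_hom_vectorspace[OF F' that] by blast+
  have ev: "(\<lambda>u. u x) \<in> module_hom K (rep_hom n K P N) N" if "x \<in> carrier P" for x and P N :: "('k, 'v) rep"
    by (rule module_homI) (use that in \<open>auto simp: rep_hom_in\<close>)
  have Th: "Th N \<in> module_hom K (rep_hom n K ?F N) (tensor K M N)" if N: "R N" for N
    unfolding Th_def[abs_def]
    by (rule module_hom_finsum_fun[OF Hm(1)[OF N] Tm[OF N]])
      (auto intro!: module_hom_comp[OF ev[OF gen_in] two_spaces.tens_hom_right[OF ts[OF N]]] z)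
  have Th': "(\<lambda>v. Th' N v g) \<in> module_hom K (rep_hom n K ?F' N) (tensor K M N)" if N: "R N" for N g
    unfolding Th'_def
    by (rule module_hom_finsum_fun[OF Hm(2)[OF N] Tm[OF N]])
      (auto intro!: module_hom_comp[OF ev[OF gen_in] two_spaces.tens_hom_right[OF ts[OF N]]] z)
  have rho: "rho N g \<in> module_hom K (tensor K M N) (tensor K M N)" if N: "R N" and g: "g \<in> G" for N g
    unfolding rho_def[abs_def]
    using module_hom_diff[OF Tm[OF N] Tm[OF N] _ id_hom] representation.act_linear[OF tensor_rep_representation[OF M N] g]
    by (simp only: module_hom_tensor_rep)
  have D: "D N \<in> module_hom K (rep_hom n K ?F' N) (tensor K M N)" if N: "R N" for N
    unfolding D_def[abs_def]
    by (rule module_hom_finsum_fun[OF Hm(2)[OF N] Tm[OF N]]) (rule module_hom_comp[OF Th'[OF N] rho[OF N]])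
  have Th_bij: "bij_betw (Th N) (Hom ?F N) (carrier (tensor K M N))" if N: "R N" for N
    unfolding bij_betw_def
  proof
    note Nf = representation.fdvs[OF N]
    show "inj_on (Th N) (Hom ?F N)"
    proof (rule inj_onI)
      fix u v assume u: "u \<in> Hom ?F N" and v: "v \<in> Hom ?F N" and eq: "Th N u = Th N v"
      have "u (gen ?S j) = v (gen ?S j)" if "j < d" for j
      proof -
        have "u (gen ?S j) = contract M N (w j) (Th N u)"
          unfolding Th_def by (rule contract_basis[OF M.fdvs Nf dw rep_hom_in[OF u gen_in] that, symmetric])
        also have "\<dots> = v (gen ?S j)"
          unfolding eq unfolding Th_def by (rule contract_basis[OF M.fdvs Nf dw rep_hom_in[OF v gen_in] that])
        finally show ?thesis .
      qed
      then show "u = v" by (intro free_hom_unique[OF _ N u v]) auto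
    qed
    show "Th N ` Hom ?F N = carrier (tensor K M N)"
    proof (intro equalityI subsetI)
      fix t assume "t \<in> Th N ` Hom ?F N"
      then show "t \<in> carrier (tensor K M N)" using module_hom_in[OF Th[OF N]] by auto
    next
      fix t assume t: "t \<in> carrier (tensor K M N)"
      have c: "contract M N (w i) t \<in> carrier N" if "i \<in> {..<d}" for i
        using module_hom_in[OF contract(1)[OF M.fdvs Nf w] t] that by simp
      obtain u where u: "u \<in> Hom ?F N" "\<And>i. i \<in> {..<d} \<Longrightarrow> u (gen ?S i) = contract M N (w i) t"
        using free_hom_exists[OF finite_lessThan N, of d "\<lambda>i. contract M N (w i) t"] c by blast
      have "Th N u = (\<Oplus>\<^bsub>tensor K M N\<^esub>i\<in>{..<d}. tens K M N (z i) (contract M N (w i) t))"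
        unfolding Th_def
      proof (rule abelian_monoid.finsum_cong')
        show "abelian_monoid (tensor K M N)" using Tm[OF N] by (simp add: module_def abelian_group_def)
        show "(\<lambda>i. tens K M N (z i) (contract M N (w i) t)) \<in> {..<d} \<rightarrow> carrier (tensor K M N)"
          using two_spaces.tens_in[OF ts[OF N] z c] by auto
      qed (simp_all add: u(2))
      also have "\<dots> = t" by (rule tensor_expansion[OF M.fdvs Nf dw t])
      finally show "t \<in> Th N ` Hom ?F N" using u(1) by blast
    qed
  qed
  have D_surj: "\<exists>v\<in>Hom ?F' N. D N v = t"
    if N: "R N" and t: "t \<in> coinv_relations n K (tensor_rep K M N)" for N t
  proof -
    interpret T: representation n K "tensor_rep K M N" by (rule tensor_rep_representation[OF M N])
    interpret TV: vectorspace K "tensor K M N" by (rule Tv[OF N])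
    interpret H: vectorspace K "rep_hom n K ?F' N" by (rule rep_hom_vectorspace[OF F' N])
    note Nf = representation.fdvs[OF N]
    \<comment> \<open>The two records differ only in the action, which subtraction does not
      read.\<close>
    have minus: "x \<ominus>\<^bsub>tensor_rep K M N\<^esub> y = x \<ominus>\<^bsub>tensor K M N\<^esub> y" for x y
      by (simp add: a_minus_def a_inv_def m_inv_def)
    have gens: "{act (tensor_rep K M N) g x \<ominus>\<^bsub>tensor_rep K M N\<^esub> x |g x. g \<in> G \<and> x \<in> carrier (tensor_rep K M N)} \<subseteq>
        carrier (tensor_rep K M N)"
      using T.act_closed by (auto simp del: tensor_rep_simps)
    show ?thesis
    proof (rule span_induct[where P = "\<lambda>t. \<exists>v\<in>Hom ?F' N. D N v = t", OF T.module gens t[unfolded coinv_relations_def]])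
      show "\<exists>v\<in>Hom ?F' N. D N v = \<zero>\<^bsub>tensor_rep K M N\<^esub>"
        using module_hom_zero[OF H.module_axioms TV.module_axioms D[OF N]] H.M.zero_closed by auto
    next
      fix s assume "s \<in> {act (tensor_rep K M N) g x \<ominus>\<^bsub>tensor_rep K M N\<^esub> x |g x. g \<in> G \<and> x \<in> carrier (tensor_rep K M N)}"
      then obtain g x where g: "g \<in> G" and x: "x \<in> carrier (tensor K M N)" and s: "s = rho N g x"
        by (auto simp: rho_def minus)
      have c: "contract M N (w i) x \<in> carrier N" if "i < d" for i
        using module_hom_in[OF contract(1)[OF M.fdvs Nf w] x] that by simp
      interpret NN: representation n K N by (rule N)
      \<comment> \<open>The coefficients of the family of tensors that has \<open>x\<close> in the
        slot of \<open>g\<close> and 0 in the others, so that \<open>D\<close> yields the single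
        relation of \<open>g\<close> and \<open>x\<close>.\<close>
      define y where "y p = (if fst p = g then contract M N (w (snd p)) x else \<zero>\<^bsub>N\<^esub>)" for p
      have yN: "y p \<in> carrier N" if "p \<in> ?S'" for p
        using c that by (auto simp: y_def)
      have "\<exists>v. v \<in> Hom ?F' N \<and> (\<forall>p\<in>?S'. v (gen ?S' p) = y p)"
      proof (rule free_hom_exists[OF S' N])
        show "y p \<in> carrier N" if "p \<in> ?S'" for p using yN that .
        fix u assume "u \<in> Hom ?F' N" and "\<And>p. p \<in> ?S' \<Longrightarrow> u (gen ?S' p) = y p"
        then show "\<exists>v. v \<in> Hom ?F' N \<and> (\<forall>p\<in>?S'. v (gen ?S' p) = y p)"
          by (intro exI[of _ u] conjI ballI)
      qed
      then obtain v where v1: "v \<in> Hom ?F' N" and v2: "\<forall>p\<in>?S'. v (gen ?S' p) = y p"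
        by (elim exE conjE)
      have v: "v (gen ?S' (h, i)) = (if h = g then contract M N (w i) x else \<zero>\<^bsub>N\<^esub>)" if "h \<in> G" "i < d" for h i
        using that bspec[OF v2, of "(h, i)"] by (simp add: y_def)
      have "Th' N v h = (if h = g then x else \<zero>\<^bsub>tensor K M N\<^esub>)" if h: "h \<in> G" for h
      proof (cases "h = g")
        case True
        have "Th' N v h = (\<Oplus>\<^bsub>tensor K M N\<^esub>i\<in>{..<d}. tens K M N (z i) (contract M N (w i) x))"
          unfolding Th'_def using two_spaces.tens_in[OF ts[OF N] z c] h True v
          by (intro TV.M.finsum_cong') auto
        then show ?thesis using True tensor_expansion[OF M.fdvs Nf dw x] by simp
      next
        case False
        have "tens K M N (z i) \<zero>\<^bsub>N\<^esub> = \<zero>\<^bsub>tensor K M N\<^esub>" if "i < d" for i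
          using module_hom_zero[OF NN.module TV.module_axioms two_spaces.tens_hom_right[OF ts[OF N] z[OF that]]] .
        then have "Th' N v h = (\<Oplus>\<^bsub>tensor K M N\<^esub>i\<in>{..<d}. \<zero>\<^bsub>tensor K M N\<^esub>)"
          unfolding Th'_def using h False v by (intro TV.M.finsum_cong') auto
        then show ?thesis using False by simp
      qed
      moreover have "rho N h \<zero>\<^bsub>tensor K M N\<^esub> = \<zero>\<^bsub>tensor K M N\<^esub>" if "h \<in> G" for h
        by (rule module_hom_zero[OF TV.module_axioms TV.module_axioms rho[OF N that]])
      ultimately have "D N v = (\<Oplus>\<^bsub>tensor K M N\<^esub>h\<in>G. if g = h then rho N h x else \<zero>\<^bsub>tensor K M N\<^esub>)"
        unfolding D_def using module_hom_in[OF rho[OF N] x] by (intro TV.M.finsum_cong') auto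
      also have "\<dots> = rho N g x"
        using TV.M.finsum_singleton[OF g sym_group_finite, of "\<lambda>h. rho N h x"] module_hom_in[OF rho[OF N] x] by auto
      finally show "\<exists>v\<in>Hom ?F' N. D N v = s" using v1 s by blast
    next
      fix x y assume "\<exists>v\<in>Hom ?F' N. D N v = x" "\<exists>v\<in>Hom ?F' N. D N v = y"
      then obtain u v where "u \<in> Hom ?F' N" "D N u = x" "v \<in> Hom ?F' N" "D N v = y" by auto
      then show "\<exists>v\<in>Hom ?F' N. D N v = x \<oplus>\<^bsub>tensor_rep K M N\<^esub> y"
        using module_hom_add[OF D[OF N], of u v] H.M.a_closed[of u v] by (intro bexI[of _ "u \<oplus>\<^bsub>rep_hom n K ?F' N\<^esub> v"]) (simp_all only: tensor_rep_simps)
    next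
      fix c x assume c: "c \<in> carrier K" and "\<exists>v\<in>Hom ?F' N. D N v = x"
      then obtain v where "v \<in> Hom ?F' N" "D N v = x" by auto
      then show "\<exists>v\<in>Hom ?F' N. D N v = c \<odot>\<^bsub>tensor_rep K M N\<^esub> x"
        using module_hom_smult[OF D[OF N] c, of v] H.smult_closed[OF c, of v] by (intro bexI[of _ "c \<odot>\<^bsub>rep_hom n K ?F' N\<^esub> v"]) (simp_all only: tensor_rep_simps)
    qed
  qed
  have D_rel: "D N v \<in> coinv_relations n K (tensor_rep K M N)" if N: "R N" and v: "v \<in> Hom ?F' N" for N v
  proof -
    interpret T: representation n K "tensor_rep K M N" by (rule tensor_rep_representation[OF M N])
    have minus: "x \<ominus>\<^bsub>tensor_rep K M N\<^esub> y = x \<ominus>\<^bsub>tensor K M N\<^esub> y" for x y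
      by (simp add: a_minus_def a_inv_def m_inv_def)
    have "finsum (tensor_rep K M N) (\<lambda>g. rho N g (Th' N v g)) G \<in> coinv_relations n K (tensor_rep K M N)"
      using T.relation_in module_hom_in[OF Th'[OF N] v]
      by (intro submodule_finsum[OF T.coinv_relations_submodule]) (auto simp: rho_def minus)
    then show ?thesis
      unfolding D_def by (simp add: finsum_cong_structure[of "tensor_rep K M N" "tensor K M N"])
  qed
  have nat: "tensor_map K M X M Y (\<lambda>x. x) u (Th X v) = Th Y (compose (carrier ?F) u v)"
    if X: "R X" and Y: "R Y" and u: "u \<in> Hom X Y" and v: "v \<in> Hom ?F X" for X Y u v
  proof -
    interpret YV: vectorspace K "tensor K M Y" by (rule Tv[OF Y])
    note tm = tensor_map_hom[OF ts[OF X] ts[OF Y] id_hom rep_hom_hom[OF u]]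
    have vi: "v (gen ?S i) \<in> carrier X" for i using rep_hom_in[OF v gen_in] .
    have "tensor_map K M X M Y (\<lambda>x. x) u (Th X v) = (\<Oplus>\<^bsub>tensor K M Y\<^esub>i\<in>{..<d}. tensor_map K M X M Y (\<lambda>x. x) u (tens K M X (z i) (v (gen ?S i))))"
      unfolding Th_def using two_spaces.tens_in[OF ts[OF X] z vi] by (intro module_hom_finsum[OF Tm[OF X] Tm[OF Y] tm(1)]) auto
    also have "\<dots> = Th Y (compose (carrier ?F) u v)"
      unfolding Th_def using two_spaces.tens_in[OF ts[OF Y] z rep_hom_in[OF u vi]] gen_in[of ?S]
      by (intro YV.M.finsum_cong') (auto simp: tm(2) z vi compose_def)
    finally show ?thesis .
  qed
  have nat': "tensor_map K M X M Y (\<lambda>x. x) u (Th' X v g) = Th' Y (compose (carrier ?F') u v) g"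
    if X: "R X" and Y: "R Y" and u: "u \<in> Hom X Y" and v: "v \<in> Hom ?F' X" for X Y u v g
  proof -
    interpret YV: vectorspace K "tensor K M Y" by (rule Tv[OF Y])
    note tm = tensor_map_hom[OF ts[OF X] ts[OF Y] id_hom rep_hom_hom[OF u]]
    have vi: "v (gen ?S' i) \<in> carrier X" for i using rep_hom_in[OF v gen_in] .
    have "tensor_map K M X M Y (\<lambda>x. x) u (Th' X v g) = (\<Oplus>\<^bsub>tensor K M Y\<^esub>i\<in>{..<d}. tensor_map K M X M Y (\<lambda>x. x) u (tens K M X (z i) (v (gen ?S' (g, i)))))"
      unfolding Th'_def using two_spaces.tens_in[OF ts[OF X] z vi] by (intro module_hom_finsum[OF Tm[OF X] Tm[OF Y] tm(1)]) auto
    also have "\<dots> = Th' Y (compose (carrier ?F') u v) g"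
      unfolding Th'_def using two_spaces.tens_in[OF ts[OF Y] z rep_hom_in[OF u vi]] gen_in[of ?S']
      by (intro YV.M.finsum_cong') (auto simp: tm(2) z vi compose_def)
    finally show ?thesis .
  qed
  have natD: "tensor_map K M X M Y (\<lambda>x. x) u (D X v) = D Y (compose (carrier ?F') u v)"
    if X: "R X" and Y: "R Y" and u: "u \<in> Hom X Y" and v: "v \<in> Hom ?F' X" for X Y u v
  proof -
    interpret YV: vectorspace K "tensor K M Y" by (rule Tv[OF Y])
    note tm = tensor_map_hom[OF ts[OF X] ts[OF Y] id_hom rep_hom_hom[OF u]]
    note Tv' = module_hom_in[OF Th'[OF X] v]
    note uv = rep_hom_compose[OF F' v u]
    have r: "tensor_map K M X M Y (\<lambda>x. x) u (rho X g t) = rho Y g (tensor_map K M X M Y (\<lambda>x. x) u t)" if g: "g \<in> G" and t: "t \<in> carrier (tensor K M X)" for g t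
      unfolding rho_def
      using module_hom_minus[OF Tm[OF X] Tm[OF Y] tm(1) _ t, of "act (tensor_rep K M X) g t"]
        representation.act_closed[OF tensor_rep_representation[OF M X] g, of t] t
        tensor_map_act[OF M M X Y id_hom _ rep_hom_hom[OF u] rep_hom_act[OF u] g t] by simp
    have "tensor_map K M X M Y (\<lambda>x. x) u (D X v) = (\<Oplus>\<^bsub>tensor K M Y\<^esub>g\<in>G. tensor_map K M X M Y (\<lambda>x. x) u (rho X g (Th' X v g)))"
      unfolding D_def using module_hom_in[OF rho[OF X] Tv'] by (intro module_hom_finsum[OF Tm[OF X] Tm[OF Y] tm(1)]) auto
    also have "\<dots> = D Y (compose (carrier ?F') u v)"
      unfolding D_def using module_hom_in[OF rho[OF Y] module_hom_in[OF Th'[OF Y] uv]]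
      by (intro YV.M.finsum_cong') (auto simp: r Tv' nat'[OF X Y u v])
    finally show ?thesis .
  qed
  \<comment> \<open>\<open>Th\<close> is invertible, so the map \<open>D\<close> into M \<otimes> N
    lifts to a map between representable functors.\<close>
  define al where "al N v = inv_into (Hom ?F N) (Th N) (D N v)" for N v
  have al: "al N \<in> module_hom K (rep_hom n K ?F' N) (rep_hom n K ?F N)" if N: "R N" for N
    unfolding al_def[abs_def] using module_hom_comp[OF D[OF N] bij_inv_module_hom[OF Hm(1)[OF N] Th[OF N] Th_bij[OF N]]] .
  have Th_al: "Th N (al N v) = D N v" if N: "R N" and v: "v \<in> Hom ?F' N" for N v
    unfolding al_def using bij_betw_inv_into_right[OF Th_bij[OF N] module_hom_in[OF D[OF N] v]] .
  define be where "be N u = coinv_class n K (tensor_rep K M N) (Th N u)" for N u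
  have be: "be N \<in> module_hom K (rep_hom n K ?F N) (coinvariants n K (tensor_rep K M N))" if N: "R N" for N
    unfolding be_def[abs_def]
    using module_hom_comp[OF Th[OF N]] representation.coinv_class_hom[OF tensor_rep_representation[OF M N]] by simp
  let ?al = "\<lambda>X\<in>Ob RepC. copy_map (rep_hom n K ?F' X) (rep_hom n K ?F X) (al X)"
  let ?be = "\<lambda>X\<in>Ob RepC. copy_map (rep_hom n K ?F X) (coinvariants n K (tensor_rep K M X)) (be X)"
  have al_nat: "?al \<in> natR (hf ?F') (hf ?F)"
    unfolding h_functor_eq
  proof (rule copy_nat)
    fix X Y u v assume "X \<in> Ob RepC" "Y \<in> Ob RepC" "u \<in> arr RepC X Y" and v: "v \<in> Hom ?F' X"
    then have X: "R X" and Y: "R Y" and u: "u \<in> Hom X Y" by (simp_all add: Rep_simps)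
    show "al Y (compose (carrier ?F') u v) = compose (carrier ?F) u (al X v)"
    proof (rule inj_onD[OF bij_betw_imp_inj_on[OF Th_bij[OF Y]]])
      show "Th Y (al Y (compose (carrier ?F') u v)) = Th Y (compose (carrier ?F) u (al X v))"
        using Th_al[OF Y rep_hom_compose[OF F' v u]] nat[OF X Y u module_hom_in[OF al[OF X] v]] natD[OF X Y u v] Th_al[OF X v] by simp
    qed (use module_hom_in[OF al[OF Y] rep_hom_compose[OF F' v u]] rep_hom_compose[OF F module_hom_in[OF al[OF X] v] u] in auto)
  qed (use F F' al compose_hom[OF F'] in \<open>simp_all add: Rep_simps rep_hom_fdvs\<close>)
  have be_nat: "?be \<in> natR (hf ?F) (tf M)"
    unfolding h_functor_eq t_functor_eq
  proof (rule copy_nat)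
    fix X Y u v assume "X \<in> Ob RepC" "Y \<in> Ob RepC" "u \<in> arr RepC X Y" and v: "v \<in> Hom ?F X"
    then have X: "R X" and Y: "R Y" and u: "u \<in> Hom X Y" by (simp_all add: Rep_simps)
    note tm = tensor_map_hom[OF ts[OF X] ts[OF Y] id_hom rep_hom_hom[OF u]]
    have "coinv_map n K (tensor_rep K M Y) (tensor_map K M X M Y (\<lambda>x. x) u) (coinv_class n K (tensor_rep K M X) (Th X v)) =
        coinv_class n K (tensor_rep K M Y) (tensor_map K M X M Y (\<lambda>x. x) u (Th X v))"
      using module_hom_in[OF Th[OF X] v] tm(1) tensor_map_act[OF M M X Y id_hom _ rep_hom_hom[OF u] rep_hom_act[OF u]]
      by (intro coinv_map_class(1)[OF tensor_rep_representation[OF M X] tensor_rep_representation[OF M Y]]) simp_all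
    then show "be Y (compose (carrier ?F) u v) = coinv_map n K (tensor_rep K M Y) (tensor_map K M X M Y (\<lambda>x. x) u) (be X v)"
      by (simp add: be_def nat[OF X Y u v])
  qed (use F be compose_hom[OF F] M in \<open>simp_all add: Rep_simps rep_hom_fdvs tco_fdvs\<close>)
  have be_zero: "?be X (enc (Hom ?F X) u) = \<zero>\<^bsub>omap (tf M) X\<^esub> \<longleftrightarrow> Th X u \<in> coinv_relations n K (tensor_rep K M X)"
    if X: "R X" and u: "u \<in> Hom ?F X" for X u
    using tproj_hom(3)[OF M X module_hom_in[OF Th[OF X] u]] X u rep_hom_fdvs[OF F X]
    by (simp add: Rep_simps be_def tproj_def)
  show ?thesis
    unfolding coherent_def
  proof (intro conjI t_functor_linear[OF M], rule bexI[of _ ?F], rule bexI[of _ ?F'], rule bexI[OF _ al_nat],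
      rule bexI[OF _ be_nat], intro ballI conjI)
    fix X assume "X \<in> Ob RepC"
    then have X: "R X" by (simp add: Rep_simps)
    note fdF = rep_hom_fdvs[OF F X] and fdF' = rep_hom_fdvs[OF F' X]
    have al_enc: "?al X (enc (Hom ?F' X) v) = (enc (Hom ?F X) (al X v) :: 'v)" if "v \<in> Hom ?F' X" for v
      using X that fdF' by (simp add: Rep_simps)
    show "?al X ` carrier (omap (hf ?F') X) = {a \<in> carrier (omap (hf ?F) X). ?be X a = \<zero>\<^bsub>omap (tf M) X\<^esub>}"
    proof (intro equalityI subsetI)
      fix a assume "a \<in> ?al X ` carrier (omap (hf ?F') X)"
      then obtain v where v: "v \<in> Hom ?F' X" and a: "a = ?al X (enc (Hom ?F' X) v)"
        unfolding h_carrier copy_vs_simps by auto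
      have u: "al X v \<in> Hom ?F X" using module_hom_in[OF al[OF X] v] .
      have "?be X a = \<zero>\<^bsub>omap (tf M) X\<^esub>"
        unfolding a al_enc[OF v] be_zero[OF X u] Th_al[OF X v] by (rule D_rel[OF X v])
      moreover have "a \<in> carrier (omap (hf ?F) X)" unfolding a al_enc[OF v] h_carrier using u by simp
      ultimately show "a \<in> {a \<in> carrier (omap (hf ?F) X). ?be X a = \<zero>\<^bsub>omap (tf M) X\<^esub>}" by blast
    next
      fix a assume "a \<in> {a \<in> carrier (omap (hf ?F) X). ?be X a = \<zero>\<^bsub>omap (tf M) X\<^esub>}"
      then have a: "a \<in> carrier (omap (hf ?F) X)" "?be X a = \<zero>\<^bsub>omap (tf M) X\<^esub>" by blast+
      from a(1) obtain u where u: "u \<in> Hom ?F X" and au: "a = enc (Hom ?F X) u"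
        unfolding h_carrier copy_vs_simps by blast
      have "Th X u \<in> coinv_relations n K (tensor_rep K M X)" using a(2) unfolding au be_zero[OF X u] .
      from D_surj[OF X this] obtain v where v: "v \<in> Hom ?F' X" "D X v = Th X u" by blast
      have "al X v = u"
        using inj_onD[OF bij_betw_imp_inj_on[OF Th_bij[OF X]] _ module_hom_in[OF al[OF X] v(1)] u] Th_al[OF X v(1)] v(2) by simp
      then have "a = ?al X (enc (Hom ?F' X) v)" unfolding al_enc[OF v(1)] au by simp
      moreover have "enc (Hom ?F' X) v \<in> carrier (omap (hf ?F') X)" unfolding h_carrier using v(1) by simp
      ultimately show "a \<in> ?al X ` carrier (omap (hf ?F') X)" by blast
    qed
    show "?be X ` carrier (omap (hf ?F) X) = carrier (omap (tf M) X)"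
    proof -
      have "?be X (enc (Hom ?F X) u) = tproj M X (Th X u)" if "u \<in> Hom ?F X" for u
        using X that fdF by (simp add: Rep_simps be_def tproj_def)
      then have "?be X ` carrier (omap (hf ?F) X) = tproj M X ` (Th X ` Hom ?F X)"
        unfolding h_carrier copy_vs_simps image_image by (intro image_cong) auto
      also have "\<dots> = carrier (omap (tf M) X)"
        unfolding bij_betw_imp_surj_on[OF Th_bij[OF X]] by (rule tproj_hom(2)[OF M X])
      finally show ?thesis .
    qed
  qed (use F F' in \<open>simp_all add: Rep_simps\<close>)
qed

lemma t_trans_nat:
  assumes M: "R M" and M': "R M'" and f: "f \<in> Hom M M'"
  shows "t_trans n K M M' f \<in> natR (tf M) (tf M')"
    and "\<lbrakk>R N; m \<in> carrier M; x \<in> carrier N\<rbrakk> \<Longrightarrow> t_trans n K M M' f N (tcl M N m x) = tcl M' N (f m) x"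
proof -
  note tm = t_map[OF M M' _ _ rep_hom_hom[OF f] rep_hom_act[OF f] id_hom]
  have e: "t_trans n K M M' f N = copy_map (coinvariants n K (tensor_rep K M N)) (coinvariants n K (tensor_rep K M' N))
       (coinv_map n K (tensor_rep K M' N) (tensor_map K M N M' N f (\<lambda>x. x)))" if "R N" for N
    using that by (simp add: t_trans_def Rep_simps)
  show v: "t_trans n K M M' f N (tcl M N m x) = tcl M' N (f m) x" if "R N" "m \<in> carrier M" "x \<in> carrier N" for N m x
    unfolding e[OF that(1)] using that by (intro tm(2)) auto
  have h: "t_trans n K M M' f N \<in> module_hom K (omap (tf M) N) (omap (tf M') N)" if "R N" for N
    unfolding e[OF that] t_carrier using that by (intro copy_map_hom tco_fdvs M M' tm(1)) auto
  show "t_trans n K M M' f \<in> natR (tf M) (tf M')"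
  proof (rule Vect_natI)
    fix X assume "X \<in> Ob RepC"
    then have X: "R X" by (simp add: Rep_simps)
    show "t_trans n K M M' f X \<in> module_hom K (omap (tf M) X) (omap (tf M') X)" by (rule h[OF X])
    show "t_trans n K M M' f X \<in> extensional (carrier (omap (tf M) X))" unfolding e[OF X] t_carrier by simp
  next
    show "t_trans n K M M' f \<in> extensional (Ob RepC)" by (simp add: t_trans_def)
    fix X Y u a assume "X \<in> Ob RepC" "Y \<in> Ob RepC" "u \<in> arr RepC X Y" and a: "a \<in> carrier (omap (tf M) X)"
    then have X: "R X" and Y: "R Y" and u: "u \<in> Hom X Y" by (simp_all add: Rep_simps)
    note tu = t_mmap[OF M X Y u] and tu' = t_mmap[OF M' X Y u]
    show "t_trans n K M M' f Y (mmap (tf M) X Y u a) = mmap (tf M') X Y u (t_trans n K M M' f X a)"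
      by (rule tcl_hom_eq[OF M X module_hom_comp[OF tu(1) h[OF Y]] module_hom_comp[OF h[OF X] tu'(1)] vectorspace_module[OF fdvs_vs[OF t_fdvs[OF M' Y]]] _ a])
        (simp add: tu(2) tu'(2) v X Y rep_hom_in[OF u] rep_hom_in[OF f])
  qed
qed

lemma t_lower_shriek_simps [simp]:
  "omap tsh = tf" "mmap tsh M N f = t_trans n K M N f"
  by (simp_all add: t_lower_shriek_def)

lemma t_lower_shriek_functor: "is_functor K RepC CohC tsh"
proof (rule Coh_functorI[OF Rep_functor_catI[OF lincategory_RepC]])
  fix M :: "('k, 'v) rep" and X a assume M: "R M" and i: "(\<lambda>x\<in>carrier M. x) \<in> Hom M M" and XO: "X \<in> Ob RepC" and a: "a \<in> carrier (omap (omap tsh M) X)"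
  then have X: "R X" and a': "a \<in> carrier (omap (tf M) X)" by (simp_all add: Rep_simps)
  note tn = t_trans_nat[OF M M i]
  have "t_trans n K M M (\<lambda>x\<in>carrier M. x) X a = (\<lambda>a. a) a"
    by (rule tcl_hom_eq[OF M X Vect_nat(1)[OF tn(1) XO] id_hom vectorspace_module[OF fdvs_vs[OF t_fdvs[OF M X]]] _ a'])
      (simp add: tn(2) X)
  then show "mmap tsh M M (\<lambda>x\<in>carrier M. x) X a = a" by simp
next
  fix L M N :: "('k, 'v) rep" and f g X a assume L: "R L" and M: "R M" and N: "R N" and f: "f \<in> Hom L M" and g: "g \<in> Hom M N"
    and XO: "X \<in> Ob RepC" and a: "a \<in> carrier (omap (omap tsh L) X)"
  then have X: "R X" and a': "a \<in> carrier (omap (tf L) X)" by (simp_all add: Rep_simps)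
  note fn = t_trans_nat[OF L M f] and gn = t_trans_nat[OF M N g] and gfn = t_trans_nat[OF L N rep_hom_compose[OF L f g]]
  have "t_trans n K L N (compose (carrier L) g f) X a = t_trans n K M N g X (t_trans n K L M f X a)"
    by (rule tcl_hom_eq[OF L X Vect_nat(1)[OF gfn(1) XO] module_hom_comp[OF Vect_nat(1)[OF fn(1) XO] Vect_nat(1)[OF gn(1) XO]]
          vectorspace_module[OF fdvs_vs[OF t_fdvs[OF N X]]] _ a'])
      (simp add: gfn(2) fn(2) gn(2) X compose_eq rep_hom_in[OF f])
  then show "mmap tsh L N (compose (carrier L) g f) X a = mmap tsh M N g X (mmap tsh L M f X a)" by simp
qed (simp_all add: t_functor_linear t_trans_nat coherent_t)

text \<open>An equality and not just an isomorphism: both sides take coinvariants of the same tensor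
  products and use the same codes. This is why the triangle for the left adjoint needs no
  comparison.\<close>

lemma c_lower_shriek_eq:
  "(c_lower_shriek n K :: (('k, 'v) rep, 'v \<Rightarrow> 'v, ('k, 'v) poly_functor, ('k, 'v) poly_nat) fctr) =
    cmp_fctr ju tsh"
  by (auto simp: c_lower_shriek_def cmp_fctr_def j_upper_star_def t_lower_shriek_def t_functor_def t_trans_def
      Gamma_simps Rep_simps fun_eq_iff)

subsection \<open>Invariants\<close>

lemma inv_map:
  assumes "R M" "R M'" "R N" "R N'"
    and f: "f \<in> module_hom K M M'" "\<And>g x. \<lbrakk>g \<in> G; x \<in> carrier M\<rbrakk> \<Longrightarrow> f (act M g x) = act M' g (f x)"
    and u: "u \<in> module_hom K N N'" "\<And>g x. \<lbrakk>g \<in> G; x \<in> carrier N\<rbrakk> \<Longrightarrow> u (act N g x) = act N' g (u x)"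
  shows "tensor_map K M N M' N' f u \<in> module_hom K (invariants n (tensor_rep K M N)) (invariants n (tensor_rep K M' N'))"
proof -
  have ts: "two_spaces K M N" "two_spaces K M' N'" using assms by (simp_all add: two_spacesI representation.fdvs)
  note tm = tensor_map_hom[OF ts f(1) u(1)]
  have "act (tensor_rep K M' N') g (tensor_map K M N M' N' f u t) = tensor_map K M N M' N' f u t"
    if "g \<in> G" "t \<in> carrier (tensor K M N)" "act (tensor_rep K M N) g t = t" for g t
    using tensor_map_act[OF assms(1-4) f u that(1,2)] that(3) by simp
  then show ?thesis
    using module_hom_in[OF tm(1)] module_hom_add[OF tm(1)] module_hom_smult[OF tm(1)]
    by (intro module_homI) (auto simp flip: tensor_rep_simps(5))
qed

lemma inv_fdvs: "\<lbrakk>R M; R N\<rbrakk> \<Longrightarrow> fdvs K (invariants n (tensor_rep K M N))"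
  by (rule representation.invariants_fdvs) (rule tensor_rep_representation)

abbreviation cs :: "(('k, 'v) rep, 'v \<Rightarrow> 'v, ('k, 'v) poly_functor, ('k, 'v) poly_nat) fctr" where
  "cs \<equiv> c_lower_star n K"

abbreviation inv_sp :: "('k, 'v) rep \<Rightarrow> ('k, 'v) module \<Rightarrow> _" where
  "inv_sp M V \<equiv> invariants n (tensor_rep K M (tp V))"

lemma cs_omap: "omap cs M = copy_fctr (inv_sp M) (\<lambda>V W f. tensor_map K M (tp V) M (tp W) (\<lambda>x. x) f)"
  by (simp add: c_lower_star_def copy_fctr_def)

lemma cs_mmap: "mmap cs M N f = (\<lambda>V\<in>Ob GamC. copy_map (inv_sp M V) (inv_sp N V) (tensor_map K M (tp V) N (tp V) f (\<lambda>x. x)))"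
  by (simp add: c_lower_star_def)

lemma two_spaces_tp: "\<lbrakk>R M; fdvs K V\<rbrakk> \<Longrightarrow> two_spaces K M (tp V)"
  by (simp add: two_spaces_rep)

text \<open>Additivity and homogeneity in the morphism are identities on the whole tensor product,
  where they can be tested on pure tensors; restriction to the invariants, which pure tensors need
  not span, comes only afterwards.\<close>

lemma cs_linear:
  assumes M: "R M"
  shows "is_linear_functor K GamC VecC (omap cs M)"
  unfolding cs_omap
proof (rule copy_fctr_linear[OF lincategory_Gamma])
  show "fdvs K (inv_sp M X)" if "X \<in> Ob GamC" for X using that M by (simp add: Gamma_simps inv_fdvs)
  show "tensor_map K M (tp X) M (tp Y) (\<lambda>x. x) u \<in> module_hom K (inv_sp M X) (inv_sp M Y)"
    if "X \<in> Ob GamC" "Y \<in> Ob GamC" "u \<in> arr GamC X Y" for X Y u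
    using that M by (intro inv_map id_hom) (auto simp: Gamma_simps rep_hom_carrier)
  show "tensor_map K M (tp X) M (tp X) (\<lambda>x. x) (Id GamC X) t = t"
    if "X \<in> Ob GamC" "t \<in> carrier (inv_sp M X)" for X t
    using that lincategory.Id_arr[OF lincategory_Gamma, of X]
    by (intro tensor_map_ident[OF two_spaces_tp[OF M]] id_hom) (auto simp: Gamma_simps rep_hom_carrier)
  show "tensor_map K M (tp X) M (tp Z) (\<lambda>x. x) (Cmp GamC X Y Z v u) t =
      tensor_map K M (tp Y) M (tp Z) (\<lambda>x. x) v (tensor_map K M (tp X) M (tp Y) (\<lambda>x. x) u t)"
    if "X \<in> Ob GamC" "Y \<in> Ob GamC" "Z \<in> Ob GamC" "u \<in> arr GamC X Y" "v \<in> arr GamC Y Z" "t \<in> carrier (inv_sp M X)" for X Y Z u v t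
    using that lincategory.Cmp_arr[OF lincategory_Gamma that(1-5)]
    by (intro tensor_map_comp[OF two_spaces_tp[OF M] two_spaces_tp[OF M] two_spaces_tp[OF M]] id_hom)
      (auto simp: Gamma_simps rep_hom_carrier compose_def)
  show "tensor_map K M (tp X) M (tp Y) (\<lambda>x. x) (u \<oplus>\<^bsub>Mor GamC X Y\<^esub> v) t =
      tensor_map K M (tp X) M (tp Y) (\<lambda>x. x) u t \<oplus>\<^bsub>inv_sp M Y\<^esub> tensor_map K M (tp X) M (tp Y) (\<lambda>x. x) v t"
    if XY: "X \<in> Ob GamC" "Y \<in> Ob GamC" and uv: "u \<in> arr GamC X Y" "v \<in> arr GamC X Y" and t: "t \<in> carrier (inv_sp M X)" for X Y u v t
  proof -
    have r: "fdvs K X" "fdvs K Y" "u \<in> Hom (tp X) (tp Y)" "v \<in> Hom (tp X) (tp Y)"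
      using XY uv by (simp_all add: Gamma_simps)
    interpret H: vectorspace K "rep_hom n K (tp X) (tp Y)" by (rule rep_hom_vectorspace) (simp_all add: r)
    note ts = two_spaces_tp[OF M r(1)] two_spaces_tp[OF M r(2)]
    interpret A: two_spaces K M "tp X" by (rule ts(1))
    note TV = two_spaces.tensor_vs[OF ts(1)] two_spaces.tensor_vs[OF ts(2)]
    have s: "u \<oplus>\<^bsub>rep_hom n K (tp X) (tp Y)\<^esub> v \<in> Hom (tp X) (tp Y)" using r by (intro H.M.a_closed)
    note tmu = tensor_map_hom[OF ts id_hom rep_hom_hom[OF r(3)]] and tmv = tensor_map_hom[OF ts id_hom rep_hom_hom[OF r(4)]]
      and tms = tensor_map_hom[OF ts id_hom rep_hom_hom[OF s]]
    have "tensor_map K M (tp X) M (tp Y) (\<lambda>x. x) (u \<oplus>\<^bsub>rep_hom n K (tp X) (tp Y)\<^esub> v) t =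
      (\<lambda>t\<in>carrier (tensor K M (tp X)). tensor_map K M (tp X) M (tp Y) (\<lambda>x. x) u t \<oplus>\<^bsub>tensor K M (tp Y)\<^esub> tensor_map K M (tp X) M (tp Y) (\<lambda>x. x) v t) t"
    proof (rule A.tensor_hom_eq[OF tms(1) module_hom_pointwise(2)[OF TV tmu(1) tmv(1)] vectorspace_module[OF TV(2)]])
      fix m x assume mx: "m \<in> carrier M" "x \<in> carrier (tp X)"
      show "tensor_map K M (tp X) M (tp Y) (\<lambda>x. x) (u \<oplus>\<^bsub>rep_hom n K (tp X) (tp Y)\<^esub> v) (tens K M (tp X) m x) =
        (\<lambda>t\<in>carrier (tensor K M (tp X)). tensor_map K M (tp X) M (tp Y) (\<lambda>x. x) u t \<oplus>\<^bsub>tensor K M (tp Y)\<^esub> tensor_map K M (tp X) M (tp Y) (\<lambda>x. x) v t) (tens K M (tp X) m x)"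
        unfolding tms(2)[OF mx]
        using mx module_hom_add[OF two_spaces.tens_hom_right[OF ts(2) mx(1)] rep_hom_in[OF r(3) mx(2)] rep_hom_in[OF r(4) mx(2)]]
        by (simp add: tmu(2) tmv(2))
    qed (use t in simp)
    then show ?thesis using t by (simp add: Gamma_simps)
  qed
  show "tensor_map K M (tp X) M (tp Y) (\<lambda>x. x) (c \<odot>\<^bsub>Mor GamC X Y\<^esub> u) t =
      c \<odot>\<^bsub>inv_sp M Y\<^esub> tensor_map K M (tp X) M (tp Y) (\<lambda>x. x) u t"
    if XY: "X \<in> Ob GamC" "Y \<in> Ob GamC" and uv: "u \<in> arr GamC X Y" and c: "c \<in> carrier K" and t: "t \<in> carrier (inv_sp M X)" for X Y u c t
  proof -
    have r: "fdvs K X" "fdvs K Y" "u \<in> Hom (tp X) (tp Y)"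
      using XY uv by (simp_all add: Gamma_simps)
    interpret H: vectorspace K "rep_hom n K (tp X) (tp Y)" by (rule rep_hom_vectorspace) (simp_all add: r)
    note ts = two_spaces_tp[OF M r(1)] two_spaces_tp[OF M r(2)]
    interpret A: two_spaces K M "tp X" by (rule ts(1))
    note TV = two_spaces.tensor_vs[OF ts(1)] two_spaces.tensor_vs[OF ts(2)]
    have s: "c \<odot>\<^bsub>rep_hom n K (tp X) (tp Y)\<^esub> u \<in> Hom (tp X) (tp Y)" using r c by (intro H.smult_closed)
    note tmu = tensor_map_hom[OF ts id_hom rep_hom_hom[OF r(3)]] and tms = tensor_map_hom[OF ts id_hom rep_hom_hom[OF s]]
    have "tensor_map K M (tp X) M (tp Y) (\<lambda>x. x) (c \<odot>\<^bsub>rep_hom n K (tp X) (tp Y)\<^esub> u) t =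
      (\<lambda>t\<in>carrier (tensor K M (tp X)). c \<odot>\<^bsub>tensor K M (tp Y)\<^esub> tensor_map K M (tp X) M (tp Y) (\<lambda>x. x) u t) t"
    proof (rule A.tensor_hom_eq[OF tms(1) module_hom_pointwise(3)[OF TV c tmu(1)] vectorspace_module[OF TV(2)]])
      fix m x assume mx: "m \<in> carrier M" "x \<in> carrier (tp X)"
      show "tensor_map K M (tp X) M (tp Y) (\<lambda>x. x) (c \<odot>\<^bsub>rep_hom n K (tp X) (tp Y)\<^esub> u) (tens K M (tp X) m x) =
        (\<lambda>t\<in>carrier (tensor K M (tp X)). c \<odot>\<^bsub>tensor K M (tp Y)\<^esub> tensor_map K M (tp X) M (tp Y) (\<lambda>x. x) u t) (tens K M (tp X) m x)"
        unfolding tms(2)[OF mx]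
        using mx module_hom_smult[OF two_spaces.tens_hom_right[OF ts(2) mx(1)] c rep_hom_in[OF r(3) mx(2)]]
        by (simp add: tmu(2))
    qed (use t in simp)
    then show ?thesis using t by (simp add: Gamma_simps)
  qed
qed

lemma cs_raw_hom:
  assumes "R M" "R N" "f \<in> Hom M N" "fdvs K V"
  shows "tensor_map K M (tp V) N (tp V) f (\<lambda>x. x) \<in> module_hom K (inv_sp M V) (inv_sp N V)"
  using assms by (intro inv_map id_hom) (auto simp: rep_hom_carrier)

lemma cs_nat:
  assumes M: "R M" and N: "R N" and f: "f \<in> Hom M N"
  shows "mmap cs M N f \<in> natP (omap cs M) (omap cs N)"
  unfolding cs_omap cs_mmap
proof (rule copy_nat)
  show "tensor_map K M (tp X) M (tp Y) (\<lambda>x. x) u \<in> module_hom K (inv_sp M X) (inv_sp M Y)"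
    if "X \<in> Ob GamC" "Y \<in> Ob GamC" "u \<in> arr GamC X Y" for X Y u
    using that M by (intro inv_map id_hom) (auto simp: Gamma_simps rep_hom_carrier)
  show "tensor_map K M (tp Y) N (tp Y) f (\<lambda>x. x) (tensor_map K M (tp X) M (tp Y) (\<lambda>x. x) u t) =
      tensor_map K N (tp X) N (tp Y) (\<lambda>x. x) u (tensor_map K M (tp X) N (tp X) f (\<lambda>x. x) t)"
    if "X \<in> Ob GamC" "Y \<in> Ob GamC" "u \<in> arr GamC X Y" and t: "t \<in> carrier (inv_sp M X)" for X Y u t
  proof -
    have r: "fdvs K X" "fdvs K Y" "u \<in> Hom (tp X) (tp Y)" using that by (simp_all add: Gamma_simps)
    note fh = rep_hom_hom[OF f] and uh = rep_hom_hom[OF r(3)]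
    have t': "t \<in> carrier (tensor K M (tp X))" using t by simp
    have "tensor_map K M (tp Y) N (tp Y) f (\<lambda>x. x) (tensor_map K M (tp X) M (tp Y) (\<lambda>x. x) u t) = tensor_map K M (tp X) N (tp Y) f u t"
      by (rule tensor_map_comp[symmetric, OF two_spaces_tp[OF M r(1)] two_spaces_tp[OF M r(2)] two_spaces_tp[OF N r(2)] id_hom fh fh _ uh id_hom uh _ t']) simp_all
    also have "\<dots> = tensor_map K N (tp X) N (tp Y) (\<lambda>x. x) u (tensor_map K M (tp X) N (tp X) f (\<lambda>x. x) t)"
      by (rule tensor_map_comp[OF two_spaces_tp[OF M r(1)] two_spaces_tp[OF N r(1)] two_spaces_tp[OF N r(2)] fh id_hom fh _ id_hom uh uh _ t']) simp_all
    finally show ?thesis .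
  qed
qed (use M N f cs_raw_hom in \<open>simp_all add: Gamma_simps inv_fdvs\<close>)

lemma cs_apply: "\<lbrakk>R M; fdvs K V; t \<in> carrier (inv_sp M V)\<rbrakk> \<Longrightarrow>
    mmap cs M N f V (enc (carrier (inv_sp M V)) t) = (enc (carrier (inv_sp N V)) (tensor_map K M (tp V) N (tp V) f (\<lambda>x. x) t) :: 'v)"
  unfolding cs_mmap using inv_fdvs[of M "tp V"] by (simp add: Gamma_simps del: invariants_simps)

lemma cs_cases:
  assumes "a \<in> carrier (omap (omap cs M) V)"
  obtains t where "t \<in> carrier (inv_sp M V)" "a = enc (carrier (inv_sp M V)) t"
  using assms unfolding cs_omap copy_fctr_simps by (rule copy_carrierE)

lemma Pol_Cmp_apply: "\<lbrakk>V \<in> Ob GamC; x \<in> carrier (omap F V)\<rbrakk> \<Longrightarrow> Cmp PolC F F' F'' b a V x = b V (a V x)"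
  by (simp add: Pol_simps functor_cat_simps Vect_simps compose_def)

lemma Pol_Cmp_nat: "\<lbrakk>F \<in> Ob PolC; F' \<in> Ob PolC; F'' \<in> Ob PolC; a \<in> natP F F'; b \<in> natP F' F''\<rbrakk> \<Longrightarrow>
    Cmp PolC F F' F'' b a \<in> natP F F''"
  using lincategory.Cmp_arr[OF lincategory_PolC, of F F' F'' a b] by (simp only: Pol_simps)

lemma c_lower_star_functor: "is_functor K RepC PolC cs"
  unfolding Pol_def
proof (rule Rep_functor_catI[OF lincategory_Gamma])
  fix M :: "('k, 'v) rep" and V a assume M: "R M" and i: "(\<lambda>x\<in>carrier M. x) \<in> Hom M M" and "V \<in> Ob GamC" and a: "a \<in> carrier (omap (omap cs M) V)"
  then have V: "fdvs K V" by (simp add: Gamma_simps)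
  from a show "mmap cs M M (\<lambda>x\<in>carrier M. x) V a = a"
  proof (rule cs_cases)
    fix t assume t: "t \<in> carrier (inv_sp M V)" and at: "a = enc (carrier (inv_sp M V)) t"
    have "tensor_map K M (tp V) M (tp V) (\<lambda>x\<in>carrier M. x) (\<lambda>x. x) t = t"
      by (rule tensor_map_ident[OF two_spaces_tp[OF M V] rep_hom_hom[OF i] _ id_hom]) (use t in simp_all)
    then show ?thesis using cs_apply[OF M V t] at by simp
  qed
next
  fix L M N :: "('k, 'v) rep" and f g V a assume L: "R L" and M: "R M" and N: "R N" and f: "f \<in> Hom L M" and g: "g \<in> Hom M N"
    and "V \<in> Ob GamC" and a: "a \<in> carrier (omap (omap cs L) V)"
  then have V: "fdvs K V" by (simp add: Gamma_simps)
  from a show "mmap cs L N (compose (carrier L) g f) V a = mmap cs M N g V (mmap cs L M f V a)"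
  proof (rule cs_cases)
    fix t assume t: "t \<in> carrier (inv_sp L V)" and at: "a = enc (carrier (inv_sp L V)) t"
    have "tensor_map K L (tp V) N (tp V) (compose (carrier L) g f) (\<lambda>x. x) t =
        tensor_map K M (tp V) N (tp V) g (\<lambda>x. x) (tensor_map K L (tp V) M (tp V) f (\<lambda>x. x) t)"
      by (rule tensor_map_comp[OF two_spaces_tp[OF L V] two_spaces_tp[OF M V] two_spaces_tp[OF N V] rep_hom_hom[OF f] rep_hom_hom[OF g]
            rep_hom_hom[OF rep_hom_compose[OF L f g]] _ id_hom id_hom id_hom])
        (use t in \<open>simp_all add: compose_eq\<close>)
    then show ?thesis
      unfolding at cs_apply[OF L V t] cs_apply[OF M V module_hom_in[OF cs_raw_hom[OF L M f V] t]] by simp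
  qed
qed (simp_all add: cs_linear cs_nat)

subsection \<open>Invariants as maps out of the dual\<close>

text \<open>\<chi> is tied to the sum only on the carrier of M, because sums in the dual space are
  restricted to that carrier and so differ from the literal pointwise sum.\<close>

lemma contract_add:
  assumes "fdvs K M" "fdvs K N" and \<phi>: "\<phi> \<in> functionals K M" and \<psi>: "\<psi> \<in> functionals K M" and \<chi>: "\<chi> \<in> functionals K M"
    and eq: "\<And>m. m \<in> carrier M \<Longrightarrow> \<chi> m = \<phi> m \<oplus>\<^bsub>K\<^esub> \<psi> m" and t: "t \<in> carrier (tensor K M N)"
  shows "contract M N \<chi> t = contract M N \<phi> t \<oplus>\<^bsub>N\<^esub> contract M N \<psi> t"
proof -
  interpret two_spaces K M N using assms(1,2) by (rule two_spacesI)
  note c = contract[OF assms(1,2) \<phi>] contract[OF assms(1,2) \<psi>] contract[OF assms(1,2) \<chi>]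
  have "contract M N \<chi> t = (\<lambda>t\<in>carrier (tensor K M N). contract M N \<phi> t \<oplus>\<^bsub>N\<^esub> contract M N \<psi> t) t"
    by (rule tensor_hom_eq[OF c(5) module_hom_pointwise(2)[OF tensor_vs N.vectorspace_axioms c(1,3)] N.module_axioms _ t])
      (simp add: c eq N.smult_l_distr functionals_in[OF \<phi>] functionals_in[OF \<psi>])
  with t show ?thesis by simp
qed

lemma contract_smult:
  assumes "fdvs K M" "fdvs K N" and \<phi>: "\<phi> \<in> functionals K M" and \<chi>: "\<chi> \<in> functionals K M" and k: "k \<in> carrier K"
    and eq: "\<And>m. m \<in> carrier M \<Longrightarrow> \<chi> m = k \<otimes>\<^bsub>K\<^esub> \<phi> m" and t: "t \<in> carrier (tensor K M N)"
  shows "contract M N \<chi> t = k \<odot>\<^bsub>N\<^esub> contract M N \<phi> t"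
proof -
  interpret two_spaces K M N using assms(1,2) by (rule two_spacesI)
  note c = contract[OF assms(1,2) \<phi>] contract[OF assms(1,2) \<chi>]
  have "contract M N \<chi> t = (\<lambda>t\<in>carrier (tensor K M N). k \<odot>\<^bsub>N\<^esub> contract M N \<phi> t) t"
    by (rule tensor_hom_eq[OF c(3) module_hom_pointwise(3)[OF tensor_vs N.vectorspace_axioms k c(1)] N.module_axioms _ t])
      (simp add: c eq N.smult_assoc1 k functionals_in[OF \<phi>])
  with t show ?thesis by simp
qed

text \<open>One formula behind three facts: naturality of the contraction in N, naturality in M, and
  its compatibility with the group, where \<open>f\<close> and \<open>u\<close> are the actions of
  an element.\<close>

lemma contract_map:
  assumes fd: "fdvs K M" "fdvs K N" "fdvs K M'" "fdvs K N'" and f: "f \<in> module_hom K M M'" and u: "u \<in> module_hom K N N'"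
    and \<phi>: "\<phi> \<in> functionals K M'" and \<chi>: "\<chi> \<in> functionals K M" and eq: "\<And>m. m \<in> carrier M \<Longrightarrow> \<chi> m = \<phi> (f m)"
    and t: "t \<in> carrier (tensor K M N)"
  shows "contract M' N' \<phi> (tensor_map K M N M' N' f u t) = u (contract M N \<chi> t)"
proof -
  interpret two_spaces K M N using fd(1,2) by (rule two_spacesI)
  note ts = two_spacesI[OF fd(1,2)] two_spacesI[OF fd(3,4)]
  note tm = tensor_map_hom[OF ts f u]
  note c = contract[OF fd(3,4) \<phi>] contract[OF fd(1,2) \<chi>]
  show ?thesis
    by (rule tensor_hom_eq[OF module_hom_comp[OF tm(1) c(1)] module_hom_comp[OF c(3) u] vectorspace_module[OF fdvs_vs[OF fd(4)]] _ t])
      (simp add: tm c eq module_hom_in[OF f] module_hom_in[OF u] module_hom_smult[OF u] functionals_in[OF \<phi>])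
qed

definition inv_to_hom :: "('k, 'v) rep \<Rightarrow> ('k, 'v) rep \<Rightarrow> _ \<Rightarrow> 'v \<Rightarrow> 'v" where
  "inv_to_hom M N t = (\<lambda>a\<in>carrier (dual n K M). contract M N (dec (carrier (dual_rep n K M)) a) t)"

lemma dual_rep_functional: "\<phi> \<in> carrier (dual_rep n K M) \<Longrightarrow> \<phi> \<in> functionals K M"
  by (simp add: functionals_def hom_space_carrier)

lemma dual_fdvs: "R M \<Longrightarrow> fdvs K (dual_rep n K M)"
  by (rule representation.fdvs[OF dual_rep_representation])

lemma inv_to_hom_enc:
  "\<lbrakk>R M; \<phi> \<in> carrier (dual_rep n K M)\<rbrakk> \<Longrightarrow> inv_to_hom M N t (enc (carrier (dual_rep n K M)) \<phi>) = contract M N \<phi> t"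
  unfolding inv_to_hom_def dual_def using dual_fdvs[of M] by (simp del: dual_rep_simps)

lemma contract_act:
  assumes M: "R M" and N: "R N" and g: "g \<in> G" and \<phi>: "\<phi> \<in> carrier (dual_rep n K M)" and t: "t \<in> carrier (tensor K M N)"
  shows "contract M N (act (dual_rep n K M) g \<phi>) (act (tensor_rep K M N) g t) = act N g (contract M N \<phi> t)"
proof -
  interpret M: representation n K M by (rule M)
  interpret N: representation n K N by (rule N)
  have g\<phi>: "act (dual_rep n K M) g \<phi> \<in> carrier (dual_rep n K M)"
    using representation.act_closed[OF dual_rep_representation[OF M] g \<phi>] .
  have "contract M N (act (dual_rep n K M) g \<phi>) (tensor_map K M N M N (act M g) (act N g) t) = act N g (contract M N \<phi> t)"
  proof (rule contract_map[OF M.fdvs N.fdvs M.fdvs N.fdvs M.act_linear[OF g] N.act_linear[OF g] dual_rep_functional[OF g\<phi>] dual_rep_functional[OF \<phi>] _ t])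
    fix m assume m: "m \<in> carrier M"
    have "act M (iv g) (act M g m) = m"
      using M.act_mult[OF G.inv_closed[OF g] g m] M.act_one[OF m] G.l_inv[OF g] by simp
    then show "\<phi> m = act (dual_rep n K M) g \<phi> (act M g m)" using m g by simp
  qed
  then show ?thesis by simp
qed

lemma inv_to_hom_arr:
  assumes M: "R M" and N: "R N" and t: "t \<in> carrier (invariants n (tensor_rep K M N))"
  shows "inv_to_hom M N t \<in> Hom (dual n K M) N"
proof -
  interpret M: representation n K M by (rule M)
  interpret N: representation n K N by (rule N)
  interpret D: representation n K "dual_rep n K M" by (rule dual_rep_representation[OF M])
  note RD = dual_representation[OF M]
  interpret DD: representation n K "dual n K M" by (rule RD)
  have t': "t \<in> carrier (tensor K M N)" and ti: "\<And>g. g \<in> G \<Longrightarrow> act (tensor_rep K M N) g t = t" using t by simp_all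
  note funD = dual_rep_functional
  have lin: "(\<lambda>\<phi>. contract M N \<phi> t) \<in> module_hom K (dual_rep n K M) N"
  proof (rule module_homI)
    fix \<phi> assume "\<phi> \<in> carrier (dual_rep n K M)"
    then show "contract M N \<phi> t \<in> carrier N" using module_hom_in[OF contract(1)[OF M.fdvs N.fdvs] t'] funD by blast
  next
    fix \<phi> \<psi> assume p: "\<phi> \<in> carrier (dual_rep n K M)" "\<psi> \<in> carrier (dual_rep n K M)"
    show "contract M N (\<phi> \<oplus>\<^bsub>dual_rep n K M\<^esub> \<psi>) t = contract M N \<phi> t \<oplus>\<^bsub>N\<^esub> contract M N \<psi> t"
      using p D.M.a_closed[OF p] by (intro contract_add[OF M.fdvs N.fdvs] funD t') auto
  next
    fix k \<phi> assume p: "k \<in> carrier K" "\<phi> \<in> carrier (dual_rep n K M)"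
    show "contract M N (k \<odot>\<^bsub>dual_rep n K M\<^esub> \<phi>) t = k \<odot>\<^bsub>N\<^esub> contract M N \<phi> t"
      using p D.smult_closed[OF p] by (intro contract_smult[OF M.fdvs N.fdvs] funD t') auto
  qed
  have "(\<lambda>a. contract M N (dec (carrier (dual_rep n K M)) a) t) \<in> module_hom K (dual n K M) N"
    using module_hom_comp[OF dec_hom[OF D.fdvs] lin] by (simp add: dual_def)
  from module_hom_restrict[OF DD.module this]
  have 1: "inv_to_hom M N t \<in> module_hom K (dual n K M) N" by (simp add: inv_to_hom_def hom_space_carrier)
  have 2: "inv_to_hom M N t (act (dual n K M) g a) = act N g (inv_to_hom M N t a)" if g: "g \<in> G" and a: "a \<in> carrier (dual n K M)" for g a
    using a
  proof (rule dual_cases[OF M])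
    fix \<phi> assume \<phi>: "\<phi> \<in> carrier (dual_rep n K M)" and a: "a = enc (carrier (dual_rep n K M)) \<phi>"
    have "act (dual n K M) g a = enc (carrier (dual_rep n K M)) (act (dual_rep n K M) g \<phi>)"
      unfolding a dual_def by (rule enc_act[OF D.representation_axioms g \<phi>])
    then show ?thesis
      using contract_act[OF M N g \<phi> t'] ti[OF g] inv_to_hom_enc[OF M \<phi>] inv_to_hom_enc[OF M D.act_closed[OF g \<phi>]] a by simp
  qed
  show ?thesis using 1 2 by (auto simp: rep_hom_carrier inv_to_hom_def)
qed

lemma inv_to_hom_hom:
  assumes M: "R M" and N: "R N"
  shows "inv_to_hom M N \<in> module_hom K (invariants n (tensor_rep K M N)) (rep_hom n K (dual n K M) N)"
proof (rule module_homI)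
  note fd = representation.fdvs[OF M] representation.fdvs[OF N]
  have D: "dec (carrier (dual_rep n K M)) a \<in> functionals K M" if "a \<in> carrier (dual n K M)" for a
    using dec_in[OF dual_fdvs[OF M], of a] that by (intro dual_rep_functional) (simp add: dual_def)
  note c = contract(1)[OF fd D]
  show "inv_to_hom M N t \<in> Hom (dual n K M) N" if "t \<in> carrier (invariants n (tensor_rep K M N))" for t
    by (rule inv_to_hom_arr[OF M N that])
  show "inv_to_hom M N (s \<oplus>\<^bsub>invariants n (tensor_rep K M N)\<^esub> t) = inv_to_hom M N s \<oplus>\<^bsub>rep_hom n K (dual n K M) N\<^esub> inv_to_hom M N t"
    if "s \<in> carrier (invariants n (tensor_rep K M N))" "t \<in> carrier (invariants n (tensor_rep K M N))" for s t
    using that by (auto simp: inv_to_hom_def module_hom_add[OF c] simp del: dual_rep_simps intro!: restrict_ext)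
  show "inv_to_hom M N (k \<odot>\<^bsub>invariants n (tensor_rep K M N)\<^esub> t) = k \<odot>\<^bsub>rep_hom n K (dual n K M) N\<^esub> inv_to_hom M N t"
    if "k \<in> carrier K" "t \<in> carrier (invariants n (tensor_rep K M N))" for k t
    using that by (auto simp: inv_to_hom_def module_hom_smult[OF c] simp del: dual_rep_simps intro!: restrict_ext)
qed

text \<open>Contractions with the dual basis determine a tensor, whence injectivity. The preimage of
  u is the sum of the \<open>z i\<close> tensored with the values of u at the dual basis; its
  contractions are the values of u, and from these it is recognised as invariant.\<close>

lemma inv_to_hom_bij:
  assumes M: "R M" and N: "R N"
  shows "bij_betw (inv_to_hom M N) (carrier (invariants n (tensor_rep K M N))) (Hom (dual n K M) N)"
proof -
  interpret M: representation n K M by (rule M)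
  interpret N: representation n K N by (rule N)
  interpret D: representation n K "dual_rep n K M" by (rule dual_rep_representation[OF M])
  interpret TR: representation n K "tensor_rep K M N" by (rule tensor_rep_representation[OF M N])
  interpret ts: two_spaces K M N by (rule two_spaces_rep[OF M N])
  interpret TV: vectorspace K "tensor K M N" by (rule ts.tensor_vs)
  obtain d z w where dw: "dual_basis K M d z w" using M.fdvs by (rule fdvs_dual_basis)
  have z: "z i \<in> carrier M" if "i < d" for i using that dw by (auto simp: dual_basis_def)
  have w: "w i \<in> functionals K M" if "i < d" for i using that dw by (auto simp: dual_basis_def)
  \<comment> \<open>Restricted so that they lie in the dual space and can be coded.\<close>
  define w' where "w' i = restrict (w i) (carrier M)" for i
  have w'D: "w' i \<in> carrier (dual_rep n K M)" if "i < d" for i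
    using module_hom_restrict[OF M.module] w[OF that] by (simp add: w'_def functionals_def)
  have dw': "dual_basis K M d z w'"
    using dw w'D dual_rep_functional by (auto simp: dual_basis_def w'_def)
  have sep: "s = t" if s: "s \<in> carrier (tensor K M N)" and t: "t \<in> carrier (tensor K M N)"
    and eq: "\<And>\<phi>. \<phi> \<in> carrier (dual_rep n K M) \<Longrightarrow> contract M N \<phi> s = contract M N \<phi> t" for s t
  proof -
    have "s = (\<Oplus>\<^bsub>tensor K M N\<^esub>i\<in>{..<d}. tens K M N (z i) (contract M N (w' i) s))"
      using tensor_expansion[OF M.fdvs N.fdvs dw' s] by simp
    also have "\<dots> = (\<Oplus>\<^bsub>tensor K M N\<^esub>i\<in>{..<d}. tens K M N (z i) (contract M N (w' i) t))"
      using ts.tens_in[OF z module_hom_in[OF contract(1)[OF M.fdvs N.fdvs dual_rep_functional[OF w'D]] t]]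
      by (intro TV.M.finsum_cong') (auto simp del: dual_rep_simps simp: eq[OF w'D])
    also have "\<dots> = t" by (rule tensor_expansion[OF M.fdvs N.fdvs dw' t])
    finally show ?thesis .
  qed
  show ?thesis
    unfolding bij_betw_def
  proof
    show "inj_on (inv_to_hom M N) (carrier (invariants n (tensor_rep K M N)))"
    proof (rule inj_onI)
      fix s t assume s: "s \<in> carrier (invariants n (tensor_rep K M N))" and t: "t \<in> carrier (invariants n (tensor_rep K M N))"
        and eq: "inv_to_hom M N s = inv_to_hom M N t"
      show "s = t"
      proof (rule sep)
        fix \<phi> assume "\<phi> \<in> carrier (dual_rep n K M)"
        then show "contract M N \<phi> s = contract M N \<phi> t"
          using inv_to_hom_enc[OF M, of \<phi> N s] inv_to_hom_enc[OF M, of \<phi> N t] eq by simp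
      qed (use s t in simp_all)
    qed
    show "inv_to_hom M N ` carrier (invariants n (tensor_rep K M N)) = Hom (dual n K M) N"
    proof (intro equalityI subsetI)
      fix u assume "u \<in> inv_to_hom M N ` carrier (invariants n (tensor_rep K M N))"
      then show "u \<in> Hom (dual n K M) N" using inv_to_hom_arr[OF M N] by blast
    next
      fix u assume u: "u \<in> Hom (dual n K M) N"
      let ?e = "enc (carrier (dual_rep n K M)) :: _ \<Rightarrow> 'v"
      have ein: "?e \<phi> \<in> carrier (dual n K M)" if "\<phi> \<in> carrier (dual_rep n K M)" for \<phi>
        using enc_in[OF that] by (simp add: dual_def del: dual_rep_simps)
      have ue: "(\<lambda>\<phi>. u (?e \<phi>)) \<in> module_hom K (dual_rep n K M) N"
        using module_hom_comp[OF enc_hom[OF D.fdvs], of u N] rep_hom_hom[OF u] by (simp add: dual_def)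
      define t where "t = (\<Oplus>\<^bsub>tensor K M N\<^esub>i\<in>{..<d}. tens K M N (z i) (u (?e (w' i))))"
      have y: "u (?e (w' i)) \<in> carrier N" if "i < d" for i using module_hom_in[OF ue w'D[OF that]] .
      have t: "t \<in> carrier (tensor K M N)" unfolding t_def using ts.tens_in[OF z y] by (intro TV.M.finsum_closed) auto
      have ct: "contract M N \<phi> t = u (?e \<phi>)" if \<phi>: "\<phi> \<in> carrier (dual_rep n K M)" for \<phi>
      proof -
        have \<phi>z: "\<phi> (z i) \<in> carrier K" if "i < d" for i using functionals_in[OF dual_rep_functional[OF \<phi>] z[OF that]] .
        have "contract M N \<phi> t = (\<Oplus>\<^bsub>N\<^esub>i\<in>{..<d}. \<phi> (z i) \<odot>\<^bsub>N\<^esub> u (?e (w' i)))"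
          unfolding t_def by (rule contract_expansion[OF M.fdvs N.fdvs dw' y dual_rep_functional[OF \<phi>]])
        also have "\<dots> = (\<Oplus>\<^bsub>N\<^esub>i\<in>{..<d}. u (?e (\<phi> (z i) \<odot>\<^bsub>dual_rep n K M\<^esub> w' i)))"
          using \<phi>z y by (intro N.M.finsum_cong') (auto simp: module_hom_smult[OF ue _ w'D] simp del: dual_rep_simps)
        also have "\<dots> = u (?e (\<Oplus>\<^bsub>dual_rep n K M\<^esub>i\<in>{..<d}. \<phi> (z i) \<odot>\<^bsub>dual_rep n K M\<^esub> w' i))"
          using \<phi>z w'D by (intro module_hom_finsum[OF D.module N.module ue, symmetric]) (auto simp del: dual_rep_simps)
        also have "(\<Oplus>\<^bsub>dual_rep n K M\<^esub>i\<in>{..<d}. \<phi> (z i) \<odot>\<^bsub>dual_rep n K M\<^esub> w' i) = \<phi>"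
          using dual_expansion[OF M.fdvs dw, of \<phi>] \<phi>
            finsum_cong_structure[of "dual_rep n K M" "hom_space K M (scalars K)" "\<lambda>i. \<phi> (z i) \<odot>\<^bsub>dual_rep n K M\<^esub> w' i" "{..<d}"]
          by (simp add: w'_def dual_rep_simps(1-4) del: hom_space_simps dual_rep_simps(5))
        finally show ?thesis .
      qed
      have "act (tensor_rep K M N) g t = t" if g: "g \<in> G" for g
      proof (rule sep)
        have gi: "iv g \<in> G" by (rule G.inv_closed[OF g])
        show "act (tensor_rep K M N) g t \<in> carrier (tensor K M N)" using TR.act_closed[OF g, of t] t by simp
        fix \<phi> assume \<phi>: "\<phi> \<in> carrier (dual_rep n K M)"
        \<comment> \<open>Every functional \<phi> is the translate by g of some \<psi>; this lets
          the equivariance of u cancel the action on the tensor.\<close>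
        define \<psi> where "\<psi> = act (dual_rep n K M) (iv g) \<phi>"
        have \<psi>: "\<psi> \<in> carrier (dual_rep n K M)" unfolding \<psi>_def by (rule D.act_closed[OF gi \<phi>])
        have g\<psi>: "act (dual_rep n K M) g \<psi> = \<phi>"
          unfolding \<psi>_def using D.act_mult[OF g gi \<phi>] D.act_one[OF \<phi>] G.r_inv[OF g] by (simp del: dual_rep_simps)
        have "contract M N \<phi> (act (tensor_rep K M N) g t) = act N g (contract M N \<psi> t)"
          using contract_act[OF M N g \<psi> t] by (simp only: g\<psi>)
        also have "\<dots> = act N g (u (?e \<psi>))" by (simp only: ct[OF \<psi>])
        also have "\<dots> = u (act (dual n K M) g (?e \<psi>))" by (rule rep_hom_act[OF u g ein[OF \<psi>], symmetric])
        also have "act (dual n K M) g (?e \<psi>) = ?e \<phi>"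
          unfolding dual_def using enc_act[OF D.representation_axioms g \<psi>] by (simp only: g\<psi>)
        finally show "contract M N \<phi> (act (tensor_rep K M N) g t) = contract M N \<phi> t" by (simp only: ct[OF \<phi>])
      qed (rule t)
      with t have ti: "t \<in> carrier (invariants n (tensor_rep K M N))" by simp
      have "inv_to_hom M N t a = u a" if a: "a \<in> carrier (dual n K M)" for a
        using a
      proof (rule dual_cases[OF M])
        fix \<phi> assume \<phi>: "\<phi> \<in> carrier (dual_rep n K M)" and a: "a = ?e \<phi>"
        show ?thesis unfolding a inv_to_hom_enc[OF M \<phi>] by (rule ct[OF \<phi>])
      qed
      then have "u = inv_to_hom M N t"
        using rep_hom_ext[OF u] rep_hom_ext[OF inv_to_hom_arr[OF M N ti]] by (intro extensionalityI[of _ "carrier (dual n K M)"]) auto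
      with ti show "u \<in> inv_to_hom M N ` carrier (invariants n (tensor_rep K M N))" by blast
    qed
  qed
qed

lemma jo_hf_eq: "jo (hf B) = copy_fctr (\<lambda>V. rep_hom n K B (tp V)) (\<lambda>V W f u. compose (carrier B) f u)"
  by (simp add: j_upper_star_def h_functor_def copy_fctr_def)

text \<open>There are two naturalities: in V, which makes each \<eta> M a transformation of
  polynomial functors, and in M. Both are instances of \<open>contract_map\<close>, once with a
  morphism of \<open>Gamma n K\<close> in the second factor and once with f in the first.\<close>

lemma j_t_lower_star: "naturally_isomorphic K RepC PolC (cmp_fctr ju tl) cs"
proof (rule naturally_isomorphic_sym)
  note jt = cmp_fctr_functor[OF t_lower_star_functor j_functor]
  define \<eta> where "\<eta> = (\<lambda>M\<in>Ob RepC. \<lambda>V\<in>Ob GamC. copy_map (inv_sp M V) (rep_hom n K (dual n K M) (tp V)) (inv_to_hom M (tp V)) :: 'v \<Rightarrow> 'v)"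
  have e: "\<eta> M = (\<lambda>V\<in>Ob GamC. copy_map (inv_sp M V) (rep_hom n K (dual n K M) (tp V)) (inv_to_hom M (tp V)))" if "R M" for M
    using that by (simp add: \<eta>_def Rep_simps)
  have \<eta>_nat: "\<eta> M \<in> natP (omap cs M) (jo (hf (dual n K M)))" if M: "R M" for M
    unfolding e[OF M] cs_omap jo_hf_eq
  proof (rule copy_nat)
    show "tensor_map K M (tp X) M (tp Y) (\<lambda>x. x) u \<in> module_hom K (inv_sp M X) (inv_sp M Y)"
      if "X \<in> Ob GamC" "Y \<in> Ob GamC" "u \<in> arr GamC X Y" for X Y u
      using that M by (intro inv_map id_hom) (auto simp: Gamma_simps rep_hom_carrier)
    show "inv_to_hom M (tp Y) (tensor_map K M (tp X) M (tp Y) (\<lambda>x. x) u t) = compose (carrier (dual n K M)) u (inv_to_hom M (tp X) t)"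
      if "X \<in> Ob GamC" "Y \<in> Ob GamC" "u \<in> arr GamC X Y" and t: "t \<in> carrier (inv_sp M X)" for X Y u t
    proof -
      have r: "fdvs K X" "fdvs K Y" "u \<in> Hom (tp X) (tp Y)" using that by (simp_all add: Gamma_simps)
      note fd = representation.fdvs[OF M] representation.fdvs[OF tp_rep[OF r(1)]] representation.fdvs[OF tp_rep[OF r(2)]]
      have t': "t \<in> carrier (tensor K M (tp X))" using t by simp
      have "contract M (tp Y) \<phi> (tensor_map K M (tp X) M (tp Y) (\<lambda>x. x) u t) = u (contract M (tp X) \<phi> t)" if "\<phi> \<in> functionals K M" for \<phi>
        by (rule contract_map[OF fd(1,2,1,3) id_hom rep_hom_hom[OF r(3)] that that _ t']) simp
      moreover have "dec (carrier (dual_rep n K M)) a \<in> functionals K M" if "a \<in> carrier (dual n K M)" for a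
        using dec_in[OF dual_fdvs[OF M], of a] that by (intro dual_rep_functional) (simp add: dual_def)
      ultimately show ?thesis by (auto simp: inv_to_hom_def compose_def intro!: restrict_ext)
    qed
  qed (use M inv_to_hom_hom in \<open>simp_all add: Gamma_simps inv_fdvs rep_hom_fdvs dual_representation\<close>)
  have \<eta>_enc: "\<eta> M V (enc (carrier (inv_sp M V)) t) = enc (Hom (dual n K M) (tp V)) (inv_to_hom M (tp V) t)"
    if "R M" "fdvs K V" "t \<in> carrier (inv_sp M V)" for M V t
    unfolding e[OF that(1)] using that inv_fdvs[of M "tp V"] by (simp add: Gamma_simps del: invariants_simps)
  have nat: "\<eta> \<in> nat_trans RepC PolC cs (cmp_fctr ju tl)"
  proof (rule nat_transI)
    fix M N f assume "M \<in> Ob RepC" "N \<in> Ob RepC" "f \<in> arr RepC M N"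
    then have M: "R M" and N: "R N" and f: "f \<in> Hom M N" by (simp_all add: Rep_simps)
    have O: "omap cs M \<in> Ob PolC" "omap cs N \<in> Ob PolC" "jo (hf (dual n K M)) \<in> Ob PolC" "jo (hf (dual n K N)) \<in> Ob PolC"
      by (simp_all add: Pol_simps cs_linear jo_linear h_functor_linear dual_representation M N)
    note DM = dual_representation[OF M] and DN = dual_representation[OF N] and df = dual_map_arr[OF M N f]
    let ?ht = "h_trans n K (dual n K M) (dual n K N) (dual_map n K M N f)"
    note jn = jo_nat[OF h_trans_nat[OF DM DN df]]
    have "Cmp PolC (omap cs M) (omap cs N) (jo (hf (dual n K N))) (\<eta> N) (mmap cs M N f) =
      Cmp PolC (omap cs M) (jo (hf (dual n K M))) (jo (hf (dual n K N))) (mmap ju (hf (dual n K M)) (hf (dual n K N)) ?ht) (\<eta> M)"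
    proof (rule Vect_nat_eqI[OF Pol_Cmp_nat[OF O(1,2,4) cs_nat[OF M N f] \<eta>_nat[OF N]] Pol_Cmp_nat[OF O(1,3,4) \<eta>_nat[OF M] jn]])
      fix V a assume VO: "V \<in> Ob GamC" and a: "a \<in> carrier (omap (omap cs M) V)"
      then have V: "fdvs K V" by (simp add: Gamma_simps)
      note TV = tp_rep[OF V]
      have "\<eta> N V (mmap cs M N f V a) = ?ht (tp V) (\<eta> M V a)"
        using a
      proof (rule cs_cases)
        fix t assume t: "t \<in> carrier (inv_sp M V)" and at: "a = enc (carrier (inv_sp M V)) t"
        note ft = module_hom_in[OF cs_raw_hom[OF M N f V] t]
        have t': "t \<in> carrier (tensor K M (tp V))" using t by simp
        note fd = representation.fdvs[OF M] representation.fdvs[OF TV] representation.fdvs[OF N]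
        have "inv_to_hom N (tp V) (tensor_map K M (tp V) N (tp V) f (\<lambda>x. x) t) b = inv_to_hom M (tp V) t (dual_map n K M N f b)"
          if b: "b \<in> carrier (dual n K N)" for b
          using b
        proof (rule dual_cases[OF N])
          fix \<phi> assume \<phi>: "\<phi> \<in> carrier (dual_rep n K N)" and b: "b = enc (carrier (dual_rep n K N)) \<phi>"
          have \<psi>: "compose (carrier M) \<phi> f \<in> carrier (dual_rep n K M)" using module_hom_in[OF dual_map_raw(1)[OF M N f] \<phi>] .
          have "contract N (tp V) \<phi> (tensor_map K M (tp V) N (tp V) f (\<lambda>x. x) t) = contract M (tp V) (compose (carrier M) \<phi> f) t"
            by (rule contract_map[OF fd(1,2,3,2) rep_hom_hom[OF f] id_hom dual_rep_functional[OF \<phi>] dual_rep_functional[OF \<psi>] _ t'])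
              (simp add: compose_def)
          then show ?thesis
            unfolding b dual_map_apply[OF N \<phi>] inv_to_hom_enc[OF N \<phi>] inv_to_hom_enc[OF M \<psi>] .
        qed
        then have "inv_to_hom N (tp V) (tensor_map K M (tp V) N (tp V) f (\<lambda>x. x) t) =
            compose (carrier (dual n K N)) (inv_to_hom M (tp V) t) (dual_map n K M N f)"
          using rep_hom_ext[OF inv_to_hom_arr[OF N TV ft]] by (intro extensionalityI[of _ "carrier (dual n K N)"]) (auto simp: compose_def)
        then show ?thesis
          unfolding at cs_apply[OF M V t] \<eta>_enc[OF N V ft] \<eta>_enc[OF M V t]
            h_trans_apply[OF DM DN TV inv_to_hom_arr[OF M TV t]] by simp
      qed
      then show "Cmp PolC (omap cs M) (omap cs N) (jo (hf (dual n K N))) (\<eta> N) (mmap cs M N f) V a =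
        Cmp PolC (omap cs M) (jo (hf (dual n K M))) (jo (hf (dual n K N))) (mmap ju (hf (dual n K M)) (hf (dual n K N)) ?ht) (\<eta> M) V a"
        unfolding Pol_Cmp_apply[OF VO a] using VO by (simp add: jm)
    qed
    then show "Cmp PolC (omap cs M) (omap cs N) (omap (cmp_fctr ju tl) N) (\<eta> N) (mmap cs M N f) =
      Cmp PolC (omap cs M) (omap (cmp_fctr ju tl) M) (omap (cmp_fctr ju tl) N)
        (mmap (cmp_fctr ju tl) M N f) (\<eta> M)"
      by simp
  qed (auto simp: Rep_simps Pol_simps(4) \<eta>_nat, simp add: \<eta>_def Rep_simps)
  moreover have "is_iso PolC (omap cs M) (omap (cmp_fctr ju tl) M) (\<eta> M)" if "M \<in> Ob RepC" for M
  proof -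
    have M: "R M" using that by (simp add: Rep_simps)
    have "is_iso (functor_cat K GamC VecC) (omap cs M) (jo (hf (dual n K M))) (\<eta> M)"
    proof (rule functor_cat_isoI[OF _ _ \<eta>_nat[OF M]])
      show "is_functor K GamC VecC (omap cs M)" by (rule is_linear_functor_functor[OF cs_linear[OF M]])
      show "is_functor K GamC VecC (jo (hf (dual n K M)))"
        by (rule is_linear_functor_functor[OF jo_linear[OF h_functor_linear[OF dual_representation[OF M]]]])
      fix V assume VO: "V \<in> Ob GamC"
      then have V: "fdvs K V" by (simp add: Gamma_simps)
      note fd = inv_fdvs[OF M tp_rep[OF V]] rep_hom_fdvs[OF dual_representation[OF M] tp_rep[OF V]]
      have "is_iso VecC (copy_vs (inv_sp M V)) (copy_vs (rep_hom n K (dual n K M) (tp V))) (\<eta> M V)"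
      proof (rule Vect_isoI)
        show "fdvs K (copy_vs (inv_sp M V) :: ('k, 'v) module)" by (rule copy_vs_fdvs[OF fd(1)])
        show "fdvs K (copy_vs (rep_hom n K (dual n K M) (tp V)) :: ('k, 'v) module)" by (rule copy_vs_fdvs[OF fd(2)])
        have ev: "\<eta> M V = copy_map (inv_sp M V) (rep_hom n K (dual n K M) (tp V)) (inv_to_hom M (tp V))"
          using VO by (simp add: e[OF M])
        show "\<eta> M V \<in> carrier (hom_space K (copy_vs (inv_sp M V)) (copy_vs (rep_hom n K (dual n K M) (tp V))))"
          unfolding ev hom_space_carrier using copy_map_hom[OF fd inv_to_hom_hom[OF M tp_rep[OF V]]] by simp
        show "bij_betw (\<eta> M V) (carrier (copy_vs (inv_sp M V))) (carrier (copy_vs (rep_hom n K (dual n K M) (tp V))))"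
          unfolding ev by (rule copy_map_bij[OF fd inv_to_hom_bij[OF M tp_rep[OF V]]])
      qed
      then show "is_iso VecC (omap (omap cs M) V) (omap (jo (hf (dual n K M))) V) (\<eta> M V)"
        by (simp add: cs_omap h_carrier)
    qed
    then show ?thesis by (simp add: Pol_def)
  qed
  ultimately show "naturally_isomorphic K RepC PolC cs (cmp_fctr ju tl)"
    unfolding naturally_isomorphic_def using c_lower_star_functor jt by blast
qed

end

section \<open>The group algebra\<close>

context coherent_setup
begin

declare sym_group_inv_equality [simp del]

abbreviation A :: "('k, 'v) rep" where "A \<equiv> group_alg n K"

lemma regular_representation: "R (regular_rep n K)"
  unfolding regular_rep_def
  by (rule perm_rep_representation[OF field_axioms]) (auto simp: sym_group_finite G.m_assoc)

lemma group_alg_representation: "R A"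
  unfolding group_alg_def by (rule copy_rep_representation[OF regular_representation])

sublocale A: representation n K A by (rule group_alg_representation)

definition point :: "'x set \<Rightarrow> 'x \<Rightarrow> 'x \<Rightarrow> 'k" where
  "point X x = (\<lambda>y\<in>X. if y = x then \<one>\<^bsub>K\<^esub> else \<zero>\<^bsub>K\<^esub>)"

text \<open>A point of X with trivial stabiliser carries the same data as \<tau> and w: a vector and
  a functional that is the delta function on its orbit. Applied to the regular representation and to
  the cosets of the trivial subgroup.\<close>

lemma perm_rep_point:
  assumes M: "R (perm_rep n K X a)" and x: "x \<in> X"
    and X: "\<And>g. g \<in> G \<Longrightarrow> a g x \<in> X" and free: "\<And>g. g \<in> G \<Longrightarrow> a g x = x \<longleftrightarrow> g = \<one>\<^sub>G"
  defines "N \<equiv> copy_rep (perm_rep n K X a) :: ('k, 'v) rep"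
  shows "R N" and "enc (carrier (perm_rep n K X a)) (point X x) \<in> carrier N"
    and "(\<lambda>m. dec (carrier (perm_rep n K X a)) m x) \<in> functionals K N"
    and "g \<in> G \<Longrightarrow> dec (carrier (perm_rep n K X a)) (act N g (enc (carrier (perm_rep n K X a)) (point X x))) x =
      (if g = \<one>\<^sub>G then \<one>\<^bsub>K\<^esub> else \<zero>\<^bsub>K\<^esub>)"
proof -
  let ?M = "perm_rep n K X a"
  interpret M: representation n K ?M by (rule M)
  have p: "point X x \<in> carrier ?M" by (auto simp: point_def field_axioms)
  show "R N" unfolding N_def by (rule copy_rep_representation[OF M])
  show "enc (carrier ?M) (point X x) \<in> carrier N" unfolding N_def copy_rep_simps by (rule enc_in[OF p])
  have "(\<lambda>\<phi>. \<phi> x) \<in> module_hom K ?M (scalars K)"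
    by (rule module_homI) (use x in \<open>auto simp: field_axioms\<close>)
  from module_hom_comp[OF dec_hom[OF M.fdvs] this]
  show "(\<lambda>m. dec (carrier ?M) m x) \<in> functionals K N" by (simp add: functionals_def N_def)
  assume g: "g \<in> G"
  have "dec (carrier ?M) (act N g (enc (carrier ?M) (point X x))) = act ?M g (point X x)"
    unfolding N_def enc_act[OF M g p] by (rule dec_enc[OF M.fdvs M.act_closed[OF g p]])
  moreover have "iv g = \<one>\<^sub>G \<longleftrightarrow> g = \<one>\<^sub>G" using g by (simp add: G.inv_eq_1_iff)
  ultimately show "dec (carrier ?M) (act N g (enc (carrier ?M) (point X x))) x =
      (if g = \<one>\<^sub>G then \<one>\<^bsub>K\<^esub> else \<zero>\<^bsub>K\<^esub>)"
    using x X[OF G.inv_closed[OF g]] free[OF G.inv_closed[OF g]] by (simp add: point_def field_axioms)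
qed

definition unit :: 'v where
  "unit = enc (carrier (regular_rep n K)) (point G \<one>\<^sub>G)"

definition coeff1 :: "'v \<Rightarrow> 'k" where
  "coeff1 a = dec (carrier (regular_rep n K)) a \<one>\<^sub>G"

lemma unit: "unit \<in> carrier A" "coeff1 \<in> functionals K A"
    "g \<in> G \<Longrightarrow> coeff1 (act A g unit) = (if g = \<one>\<^sub>G then \<one>\<^bsub>K\<^esub> else \<zero>\<^bsub>K\<^esub>)"
  using perm_rep_point[OF regular_representation[unfolded regular_rep_def] G.one_closed, folded regular_rep_def group_alg_def]
  by (auto simp: unit_def coeff1_def[abs_def])

text \<open>The coefficient of an element at g is the coefficient at 1 of its translate by
  g^-1.\<close>

lemma coeff1_separating:
  assumes a: "a \<in> carrier A" and b: "b \<in> carrier A" and eq: "\<And>g. g \<in> G \<Longrightarrow> coeff1 (act A g a) = coeff1 (act A g b)"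
  shows "a = b"
proof -
  interpret r: representation n K "regular_rep n K" by (rule regular_representation)
  let ?d = "dec (carrier (regular_rep n K))"
  have d: "?d c \<in> carrier (regular_rep n K)" and ed: "enc (carrier (regular_rep n K)) (?d c) = c" if "c \<in> carrier A" for c
    using that dec_in[OF r.fdvs] enc_dec[OF r.fdvs] by (simp_all add: group_alg_def)
  have val: "coeff1 (act A (iv g) c) = ?d c g" if g: "g \<in> G" and c: "c \<in> carrier A" for g c
  proof -
    note gi = G.inv_closed[OF g]
    have "?d (act A (iv g) c) = act (regular_rep n K) (iv g) (?d c)"
      using enc_act[OF regular_representation gi d[OF c]] dec_enc[OF r.fdvs r.act_closed[OF gi d[OF c]]] ed[OF c]
      by (simp add: group_alg_def)
    then show ?thesis using g by (simp add: coeff1_def regular_rep_def field_axioms)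
  qed
  have "?d a g = ?d b g" if "g \<in> G" for g
    using eq[OF G.inv_closed[OF that]] val[OF that a] val[OF that b] by simp
  then have "?d a = ?d b"
    using d[OF a] d[OF b] by (intro extensionalityI[of _ G]) (auto simp: regular_rep_def field_axioms PiE_def)
  with ed[OF a] ed[OF b] show ?thesis by metis
qed

text \<open>Counterpart of \<open>pt\<close> with the group algebra in place of T. In contrast to
  \<tau>, which need not generate T, the unit generates, so each map out of the group algebra is of
  this form (\<open>A_hom_eq_orb\<close>).\<close>

definition orb :: "('k, 'v) rep \<Rightarrow> 'v \<Rightarrow> 'v \<Rightarrow> 'v" where
  "orb N x = avg n A N coeff1 x"

lemma two_reps_A: "R N \<Longrightarrow> two_reps n K A N"
  using group_alg_representation by (simp add: two_reps_def)

lemma orb_arr: "\<lbrakk>R N; x \<in> carrier N\<rbrakk> \<Longrightarrow> orb N x \<in> Hom A N"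
  unfolding orb_def by (rule two_reps.avg_arr[OF two_reps_A unit(2)])

lemma orb_unit: "\<lbrakk>R N; x \<in> carrier N\<rbrakk> \<Longrightarrow> orb N x unit = x"
  unfolding orb_def by (rule two_reps.avg_at[OF two_reps_A unit(2) _ unit(1,3)])

lemma orb_post: "\<lbrakk>R N; R P; x \<in> carrier N; u \<in> Hom N P\<rbrakk> \<Longrightarrow>
    compose (carrier A) u (orb N x) = orb P (u x)"
  unfolding orb_def by (rule avg_post[OF group_alg_representation _ _ unit(2)])

lemma orb_add: "\<lbrakk>R N; x \<in> carrier N; y \<in> carrier N\<rbrakk> \<Longrightarrow> orb N (x \<oplus>\<^bsub>N\<^esub> y) = orb N x \<oplus>\<^bsub>rep_hom n K A N\<^esub> orb N y"
  unfolding orb_def by (rule two_reps.avg_add[OF two_reps_A unit(2)])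

lemma orb_smult: "\<lbrakk>R N; x \<in> carrier N; c \<in> carrier K\<rbrakk> \<Longrightarrow> orb N (c \<odot>\<^bsub>N\<^esub> x) = c \<odot>\<^bsub>rep_hom n K A N\<^esub> orb N x"
  unfolding orb_def by (rule two_reps.avg_smult[OF two_reps_A unit(2)])

text \<open>By \<open>functional_avg\<close> the map preserves the coefficient at 1, and
  equivariance carries this to all coefficients.\<close>

lemma orb_A_unit: "orb A unit = (\<lambda>a\<in>carrier A. a)"
proof (rule extensionalityI[OF rep_hom_ext[OF orb_arr[OF group_alg_representation unit(1)]]])
  fix a assume a: "a \<in> carrier A"
  note o = orb_arr[OF group_alg_representation unit(1)]
  have c: "coeff1 (orb A unit b) = coeff1 b" if "b \<in> carrier A" for b
    unfolding orb_def
    by (rule two_reps.functional_avg[OF two_reps_A[OF group_alg_representation] unit(2,1) that unit(2,3)])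
  have "orb A unit a = a"
  proof (rule coeff1_separating[OF rep_hom_in[OF o a] a])
    fix g assume g: "g \<in> G"
    show "coeff1 (act A g (orb A unit a)) = coeff1 (act A g a)"
      unfolding rep_hom_act[OF o g a, symmetric] by (rule c[OF A.act_closed[OF g a]])
  qed
  with a show "orb A unit a = (\<lambda>a\<in>carrier A. a) a" by simp
qed simp

lemma A_hom_eq_orb:
  assumes N: "R N" and u: "u \<in> Hom A N"
  shows "u = orb N (u unit)"
proof -
  have "compose (carrier A) u (\<lambda>a\<in>carrier A. a) = u"
    using rep_hom_ext[OF u] by (intro extensionalityI[of _ "carrier A"]) (auto simp: compose_def)
  then show ?thesis using orb_post[OF group_alg_representation N unit(1) u] by (simp add: orb_A_unit)
qed

lemma group_alg_aut_arr: "g \<in> G \<Longrightarrow> group_alg_aut n K g \<in> Hom A A"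
proof -
  assume g: "g \<in> G"
  have *: "iv h \<cdot> (x \<cdot> g) = (iv h \<cdot> x) \<cdot> g"
    if "h \<in> G" "x \<in> G" for h x using that g by (simp add: G.m_assoc)
  show ?thesis
    unfolding group_alg_aut_def group_alg_def
    by (rule copy_map_rep_hom[OF regular_representation regular_representation])
      (use g in \<open>auto simp: regular_rep_def field_axioms * PiE_iff intro!: module_homI restrict_ext\<close>)
qed

text \<open>Left and right multiplication by g^-1 agree on the unit. The identities for the
  automorphisms follow from this, a map out of the group algebra being determined by the image of
  the unit.\<close>

lemma group_alg_aut_unit:
  assumes g: "g \<in> G"
  shows "group_alg_aut n K g unit = act A (iv g) unit"
proof -
  interpret r: representation n K "regular_rep n K" by (rule regular_representation)
  have p: "point G \<one>\<^sub>G \<in> carrier (regular_rep n K)"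
    by (auto simp: point_def regular_rep_def field_axioms)
  have "x \<cdot> g = \<one>\<^sub>G \<longleftrightarrow> g \<cdot> x = \<one>\<^sub>G" if "x \<in> G" for x
    using that g by (metis G.inv_comm)
  then have "(\<lambda>x\<in>G. point G \<one>\<^sub>G (x \<cdot> g)) = act (regular_rep n K) (iv g) (point G \<one>\<^sub>G)"
    using g by (auto simp: regular_rep_def field_axioms point_def intro!: restrict_ext)
  then show ?thesis
    unfolding unit_def group_alg_aut_def group_alg_def copy_map_enc[OF r.fdvs p]
      enc_act[OF regular_representation G.inv_closed[OF g] p] by simp
qed

lemma orb_aut:
  assumes N: "R N" and x: "x \<in> carrier N" and g: "g \<in> G"
  shows "compose (carrier A) (orb N x) (group_alg_aut n K g) = orb N (act N (iv g) x)"
proof -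
  note o = orb_arr[OF N x]
  have "compose (carrier A) (orb N x) (group_alg_aut n K g) unit = act N (iv g) x"
    using rep_hom_act[OF o G.inv_closed[OF g] unit(1)] by (simp add: compose_eq unit(1) group_alg_aut_unit[OF g] orb_unit[OF N x])
  then show ?thesis
    using A_hom_eq_orb[OF N rep_hom_compose[OF group_alg_representation group_alg_aut_arr[OF g] o]] by simp
qed

lemma aut_eq_orb: "g \<in> G \<Longrightarrow> group_alg_aut n K g = orb A (act A (iv g) unit)"
  using A_hom_eq_orb[OF group_alg_representation group_alg_aut_arr] by (simp add: group_alg_aut_unit)

text \<open>The automorphisms are right multiplications by g^-1, so they compose in the order of the
  group elements.\<close>

lemma aut_mult:
  assumes g: "g \<in> G" and h: "h \<in> G"
  shows "group_alg_aut n K (g \<cdot> h) = compose (carrier A) (group_alg_aut n K g) (group_alg_aut n K h)"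
  using orb_aut[OF group_alg_representation A.act_closed[OF G.inv_closed[OF g] unit(1)] h] g h
  by (simp add: aut_eq_orb G.inv_mult_group A.act_mult unit(1))

lemma aut_one: "group_alg_aut n K \<one>\<^sub>G = (\<lambda>a\<in>carrier A. a)"
  using aut_eq_orb[OF G.one_closed] by (simp add: A.act_one unit(1) orb_A_unit)

lemma t_upper_star_simps [simp]:
  "omap tu F = mk_rep (omap F A) (\<lambda>g. mmap F A A (group_alg_aut n K g))"
  "mmap tu F F' \<alpha> = \<alpha> A"
  by (simp_all add: t_upper_star_def)

lemma t_upper_star_representation:
  assumes F: "lin_fun F"
  shows "R (omap tu F)"
proof -
  note Fs = Vect_functor[OF F, unfolded Rep_simps mem_Collect_eq]
  note RA = group_alg_representation
  show ?thesis
    unfolding t_upper_star_simps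
  proof (rule representation_mk_repI)
    show "fdvs K (omap F A)" by (rule Fs(1)[OF RA])
    show "mmap F A A (group_alg_aut n K g) \<in> module_hom K (omap F A) (omap F A)" if "g \<in> G" for g
      by (rule Fs(2)[OF RA RA group_alg_aut_arr[OF that]])
    show "mmap F A A (group_alg_aut n K \<one>\<^sub>G) x = x" if "x \<in> carrier (omap F A)" for x
      using Fs(4)[OF RA that] by (simp add: aut_one)
    show "mmap F A A (group_alg_aut n K (g \<cdot> h)) x = mmap F A A (group_alg_aut n K g) (mmap F A A (group_alg_aut n K h) x)"
      if "g \<in> G" "h \<in> G" "x \<in> carrier (omap F A)" for g h x
      using Fs(5)[OF RA RA RA group_alg_aut_arr[OF that(2)] group_alg_aut_arr[OF that(1)] that(3)] by (simp add: aut_mult that)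
  qed
qed

lemma t_upper_star_functor: "is_functor K CohC RepC tu"
proof (intro is_functor.intro is_functor_axioms.intro lincategory_CohC lincategory_RepC)
  fix F assume "F \<in> Ob CohC"
  then show "omap tu F \<in> Ob RepC"
    using t_upper_star_representation[OF coherent_linear] by (simp add: Coh_simps Rep_simps del: t_upper_star_simps)
  show "mmap tu F F (Id CohC F) = Id RepC (omap tu F)"
    using group_alg_representation by (simp add: Coh_simps functor_cat_simps Rep_simps Vect_simps restrict_def)
next
  fix F F' \<alpha> assume "F \<in> Ob CohC" "F' \<in> Ob CohC" "\<alpha> \<in> arr CohC F F'"
  then have \<alpha>: "\<alpha> \<in> natR F F'" by (simp add: Coh_simps)
  have AO: "A \<in> Ob RepC" using group_alg_representation by (simp add: Rep_simps)
  show "mmap tu F F' \<alpha> \<in> arr RepC (omap tu F) (omap tu F')"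
    using Vect_nat(1,2)[OF \<alpha> AO] Vect_nat(3)[OF \<alpha> AO AO] group_alg_aut_arr
    by (auto simp: Rep_simps rep_hom_carrier module_hom_def)
next
  fix F F' F'' \<alpha> \<beta>
  show "mmap tu F F'' (Cmp CohC F F' F'' \<beta> \<alpha>) =
    Cmp RepC (omap tu F) (omap tu F') (omap tu F'')
      (mmap tu F' F'' \<beta>) (mmap tu F F' \<alpha>)"
    using group_alg_representation by (simp add: Coh_simps functor_cat_simps Rep_simps Vect_simps)
qed

subsection \<open>Vanishing on permutation modules\<close>

lemma young_subgroup_replicate: "young_subgroup n (replicate n 1) = {\<one>\<^sub>G}"
proof (intro equalityI subsetI)
  fix p assume p: "p \<in> young_subgroup n (replicate n 1)"
  have s: "sum_list (replicate i (1::nat)) = i" for i by (simp add: sum_list_replicate)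
  \<comment> \<open>Off by one: the block with index i, counted from 0, is the single place i +
    1.\<close>
  have I: "{i<..1 + i} = {Suc i}" for i by auto
  have "p ` {Suc i} = {Suc i}" if "i < n" for i
    using p that by (simp add: young_subgroup_def s I)
  then have 1: "p j = j" if "j \<in> {1..n}" for j using that by (cases j) auto
  have "p permutes {1..n}" using p by (simp add: young_subgroup_def sym_group_carrier)
  then have "p j = j" for j using 1[of j] permutes_not_in[of p "{1..n}" j] by blast
  then show "p \<in> {\<one>\<^sub>G}" by (simp add: sym_group_one fun_eq_iff)
next
  fix p assume "p \<in> {\<one>\<^sub>G}"
  then show "p \<in> young_subgroup n (replicate n 1)" using G.one_closed by (simp add: young_subgroup_def sym_group_one)
qed

text \<open>The permutation module of the partition \<open>(1, \<dots>, 1)\<close> has the group algebra as a retract.\<close>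

lemma CohY_subset_Coh0: "Ob (CohY n K :: ('k, ('k, 'v) rep_functor, ('k, 'v) rep_nat) lincat) \<subseteq> Ob (Coh0 n K)"
proof
  fix F :: "('k, 'v) rep_functor" assume FY: "F \<in> Ob (CohY n K)"
  then have FC: "F \<in> Ob CohC" by (simp add: CohY_def full_subcat_def)
  then have F: "lin_fun F" by (simp add: Coh_simps coherent_linear)
  note Fs = Vect_functor[OF F, unfolded Rep_simps mem_Collect_eq]
  note RA = group_alg_representation
  let ?\<mu> = "replicate n 1" and ?H = "{\<one>\<^sub>G}"
  define Y where "Y = (young_rep n K ?\<mu> :: ('k, 'v) rep)"
  have "is_partition n ?\<mu>" by (simp add: is_partition_def sum_list_replicate sorted_wrt_iff_nth_less)
  with FY have zero: "carrier (omap F Y) = {\<zero>\<^bsub>omap F Y\<^esub>}" by (simp add: CohY_def full_subcat_def Y_def)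
  let ?X = "lcosets\<^bsub>sym_group n\<^esub> ?H" and ?a = "\<lambda>g A. g <#\<^bsub>sym_group n\<^esub> A"
  have X: "?X = (\<lambda>g. {g}) ` G" by (auto simp: LCOSETS_def l_coset_def)
  have a: "g <#\<^bsub>sym_group n\<^esub> {h} = {g \<cdot> h}" for g h by (simp add: l_coset_def)
  have P: "R (perm_rep n K ?X ?a)"
    by (rule perm_rep_representation[OF field_axioms]) (auto simp: X a sym_group_finite G.m_assoc)
  have H: "?H \<in> ?X" by (simp add: X)
  have aX: "?a g ?H \<in> ?X" if "g \<in> G" for g using that by (simp add: X a)
  have free: "?a g ?H = ?H \<longleftrightarrow> g = \<one>\<^sub>G" if "g \<in> G" for g using that by (simp add: a)
  have Yeq: "Y = copy_rep (perm_rep n K ?X ?a)" by (simp only: Y_def young_rep_def young_subgroup_replicate)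
  note pp = perm_rep_point[OF P H aX free, folded Yeq]
  define y where "y = (enc (carrier (perm_rep n K ?X ?a)) (point ?X ?H) :: 'v)"
  define \<phi> where "\<phi> m = dec (carrier (perm_rep n K ?X ?a)) m ?H" for m :: 'v
  have RY: "R Y" and y: "y \<in> carrier Y" and \<phi>: "\<phi> \<in> functionals K Y"
    and \<phi>y: "\<And>g. g \<in> G \<Longrightarrow> \<phi> (act Y g y) = (if g = \<one>\<^sub>G then \<one>\<^bsub>K\<^esub> else \<zero>\<^bsub>K\<^esub>)"
    using pp by (simp_all add: y_def \<phi>_def[abs_def])
  have YA: "two_reps n K Y A" using RY RA by (simp add: two_reps_def)
  \<comment> \<open>The map from Y to the group algebra that takes the coset of 1 to the unit.
    Preceded by \<open>orb Y y\<close> it fixes the unit and is therefore the identity, which makes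
    F(A) a retract of F(Y) = 0.\<close>
  define r where "r = avg n Y A \<phi> unit"
  have r: "r \<in> Hom Y A" unfolding r_def by (rule two_reps.avg_arr[OF YA \<phi> unit(1)])
  have ry: "r y = unit" unfolding r_def by (rule two_reps.avg_at[OF YA \<phi> unit(1) y \<phi>y])
  note s = orb_arr[OF RY y]
  have id: "compose (carrier A) r (orb Y y) = (\<lambda>a\<in>carrier A. a)"
    using orb_post[OF RY RA y r] by (simp add: ry orb_A_unit)
  have "z = \<zero>\<^bsub>omap F A\<^esub>" if z: "z \<in> carrier (omap F A)" for z
  proof -
    have "z = mmap F Y A r (mmap F A Y (orb Y y) z)"
      using Fs(5)[OF RA RY RA s r z] Fs(4)[OF RA z] by (simp add: id)
    also have "mmap F A Y (orb Y y) z = \<zero>\<^bsub>omap F Y\<^esub>"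
      using module_hom_in[OF Fs(2)[OF RA RY s] z] zero by simp
    also have "mmap F Y A r \<zero>\<^bsub>omap F Y\<^esub> = \<zero>\<^bsub>omap F A\<^esub>"
      using fdvs_vs[OF Fs(1)[OF RY]] fdvs_vs[OF Fs(1)[OF RA]] Fs(2)[OF RY RA r] by (blast intro: module_hom_zero)
    finally show ?thesis .
  qed
  moreover interpret FA: vectorspace K "omap F A" using Fs(1)[OF RA] by (rule fdvs_vs)
  have "\<zero>\<^bsub>omap F A\<^esub> \<in> carrier (omap F A)" by simp
  ultimately have "carrier (omap F A) = {\<zero>\<^bsub>omap F A\<^esub>}" by blast
  with FC show "F \<in> Ob (Coh0 n K)" by (simp add: Coh0_def full_subcat_def)
qed

end

section \<open>Maps out of the tensor power\<close>

lemma module_hom_truncate [simp]: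
  "module_hom K (module.truncate M) N = module_hom K M N" "module_hom K N (module.truncate M) = module_hom K N M"
  by (simp_all add: module_hom_def)

context coherent_setup
begin

declare sym_group_inv_equality [simp del]

abbreviation TF :: "('k, 'v) poly_functor" where "TF \<equiv> T_functor n K"

abbreviation hT :: "('k, 'v) poly_functor \<Rightarrow> ('k, ('k, 'v) poly_nat) rep" where "hT \<equiv> hom_T_rep n K"

abbreviation cu :: "(('k, 'v) poly_functor, ('k, 'v) poly_nat, ('k, 'v) rep, 'v \<Rightarrow> 'v) fctr" where
  "cu \<equiv> c_upper_star n K"

lemma T_functor_simps [simp]: "omap TF V = module.truncate (tp V)" "mmap TF V W f = f"
  by (simp_all add: T_functor_def)

lemma T_functor_Ob: "TF \<in> Ob PolC"
proof -
  have "fdvs K (module.truncate (tp V))" if "fdvs K V" for V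
    by (rule fdvs_cong[OF representation.fdvs[OF tp_rep[OF that]]]) simp_all
  then have "is_linear_functor K GamC VecC TF"
    by (intro Vect_functorI[OF lincategory_Gamma field_axioms])
      (auto simp: Gamma_simps compose_eq rep_hom_hom intro: rep_hom_ext)
  then show ?thesis by (simp add: Pol_simps)
qed

lemma hom_T_simps [simp]:
  "carrier (hT F) = natP TF F" "zero (hT F) = zero (Mor PolC TF F)"
  "add (hT F) = add (Mor PolC TF F)" "smult (hT F) = smult (Mor PolC TF F)"
  "act (hT F) g \<alpha> = (\<lambda>V\<in>Ob GamC. compose (carrier (tp V)) (\<alpha> V) (act (tp V) (iv g)))"
  by (simp_all add: hom_T_rep_def Pol_simps)

lemma Pol_Mor_apply:
  assumes "V \<in> Ob GamC" "x \<in> carrier (omap F V)"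
  shows "(\<alpha> \<oplus>\<^bsub>Mor PolC F F'\<^esub> \<beta>) V x = \<alpha> V x \<oplus>\<^bsub>omap F' V\<^esub> \<beta> V x"
    and "(c \<odot>\<^bsub>Mor PolC F F'\<^esub> \<alpha>) V x = c \<odot>\<^bsub>omap F' V\<^esub> \<alpha> V x"
  using assms by (simp_all add: Pol_def functor_cat_simps Vect_simps)

lemma Pol_Mor_vs: "\<lbrakk>F \<in> Ob PolC; F' \<in> Ob PolC\<rbrakk> \<Longrightarrow> vectorspace K (Mor PolC F F')"
  by (rule lincategory.Mor_vs[OF lincategory_PolC])

lemma Pol_Mor_closed:
  assumes "F \<in> Ob PolC" "F' \<in> Ob PolC" "\<alpha> \<in> natP F F'"
  shows "\<beta> \<in> natP F F' \<Longrightarrow> \<alpha> \<oplus>\<^bsub>Mor PolC F F'\<^esub> \<beta> \<in> natP F F'"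
    and "c \<in> carrier K \<Longrightarrow> c \<odot>\<^bsub>Mor PolC F F'\<^esub> \<alpha> \<in> natP F F'"
proof -
  interpret V: vectorspace K "Mor PolC F F'" using assms(1,2) by (rule Pol_Mor_vs)
  show "\<beta> \<in> natP F F' \<Longrightarrow> \<alpha> \<oplus>\<^bsub>Mor PolC F F'\<^esub> \<beta> \<in> natP F F'"
    "c \<in> carrier K \<Longrightarrow> c \<odot>\<^bsub>Mor PolC F F'\<^esub> \<alpha> \<in> natP F F'"
    using V.M.a_closed[of \<alpha> \<beta>] V.smult_closed[of c \<alpha>] assms(3) by (simp_all only: Pol_simps)
qed

text \<open>Precomposition with a place permutation preserves naturality because the morphisms of
  \<open>Gamma n K\<close> commute with place permutations.\<close>

lemma hom_T_act_nat:
  assumes F: "F \<in> Ob PolC" and g: "g \<in> G" and \<alpha>: "\<alpha> \<in> natP TF F"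
  shows "act (hT F) g \<alpha> \<in> natP TF F"
    and "\<lbrakk>V \<in> Ob GamC; x \<in> carrier (tp V)\<rbrakk> \<Longrightarrow> act (hT F) g \<alpha> V x = \<alpha> V (act (tp V) (iv g) x)"
proof -
  note gi = G.inv_closed[OF g]
  show val: "act (hT F) g \<alpha> V x = \<alpha> V (act (tp V) (iv g) x)"
    if "V \<in> Ob GamC" "x \<in> carrier (tp V)" for V x
    using that by (simp add: compose_eq)
  show "act (hT F) g \<alpha> \<in> natP TF F"
  proof (rule Vect_natI)
    fix V assume V: "V \<in> Ob GamC"
    then interpret t: representation n K "tp V" by (simp add: Gamma_simps)
    show "act (hT F) g \<alpha> V \<in> module_hom K (omap TF V) (omap F V)"
      using module_hom_cong[OF t.module _ module_hom_comp[OF t.act_linear[OF gi]], of "act (hT F) g \<alpha> V" "\<alpha> V" "omap F V"]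
        Vect_nat(1)[OF \<alpha> V] val[OF V] by simp
    show "act (hT F) g \<alpha> V \<in> extensional (carrier (omap TF V))" using V by simp
  next
    fix V W u x assume V: "V \<in> Ob GamC" and W: "W \<in> Ob GamC" and u: "u \<in> arr GamC V W" and x: "x \<in> carrier (omap TF V)"
    then have RV: "R (tp V)" and u': "u \<in> Hom (tp V) (tp W)" and x': "x \<in> carrier (tp V)"
      by (simp_all add: Gamma_simps)
    show "act (hT F) g \<alpha> W (mmap TF V W u x) = mmap F V W u (act (hT F) g \<alpha> V x)"
      using Vect_nat(3)[OF \<alpha> V W u, of "act (tp V) (iv g) x"] representation.act_closed[OF RV gi x']
      by (simp only: val[OF V x'] val[OF W rep_hom_in[OF u' x']] T_functor_simps rep_hom_act[OF u' gi x'] module_truncate_simps)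
  qed simp
qed

end

context special
begin

text \<open>Since every \<open>x\<close> is the image of \<open>\<tau>\<close> under a morphism of \<open>\<Gamma>\<^sup>n\<V>\<close>, a transformation out of
  \<open>T\<^sup>n\<close> is determined by the image of \<open>\<tau>\<close>.\<close>

lemma T_nat_eq:
  assumes "\<alpha> \<in> natP TF F" "fdvs K V" "x \<in> carrier (tp V)"
  shows "\<alpha> V x = mmap F E V (pt (tp V) x) (\<alpha> E \<tau>)"
  using Vect_nat(3)[OF assms(1), of E V "pt (tp V) x" \<tau>] assms(2,3) E \<tau>
  by (simp add: Gamma_simps pt_arr pt_\<tau>)

text \<open>Evaluation at \<tau> embeds Hom(T^n, F) into F(E), so it is finite-dimensional although
  transformations range over all objects. This makes coding injective on it and
  \<open>copy_rep\<close> a faithful copy.\<close>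

lemma hom_T_representation:
  assumes F: "F \<in> Ob PolC"
  shows "R (hT F)"
proof -
  have Fl: "is_linear_functor K GamC VecC F" using F by (simp add: Pol_simps)
  have EO: "E \<in> Ob GamC" using E by (simp add: Gamma_simps)
  interpret V: vectorspace K "Mor PolC TF F" by (rule Pol_Mor_vs[OF T_functor_Ob F])
  have hom: "(\<lambda>\<alpha>. \<alpha> E \<tau>) \<in> module_hom K (Mor PolC TF F) (omap F E)"
    using Vect_nat(1)[of _ GamC K TF F, OF _ EO] \<tau>
    by (intro module_homI) (auto simp: Pol_simps(4) Pol_Mor_apply[OF EO] intro: module_hom_in)
  have fd: "fdvs K (Mor PolC TF F)"
  proof (rule fdvs_of_injection[OF V.vectorspace_axioms Vect_functor(1)[OF Fl EO] hom])
    show "inj_on (\<lambda>\<alpha>. \<alpha> E \<tau>) (arr PolC TF F)"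
      unfolding Pol_simps
    proof (rule inj_onI)
      fix \<alpha> \<beta> assume \<alpha>: "\<alpha> \<in> natP TF F" and \<beta>: "\<beta> \<in> natP TF F" and eq: "\<alpha> E \<tau> = \<beta> E \<tau>"
      show "\<alpha> = \<beta>"
        by (rule Vect_nat_eqI[OF \<alpha> \<beta>]) (simp add: T_nat_eq[OF \<alpha>] T_nat_eq[OF \<beta>] eq Gamma_simps)
    qed
  qed
  note an = hom_T_act_nat[OF F]
  note cl = Pol_Mor_closed[OF T_functor_Ob F]
  show ?thesis
  proof (rule representation.intro)
    show "fdvs K (hT F)" unfolding hom_T_rep_def fdvs_mk_rep by (rule fd)
    show "act (hT F) g \<in> module_hom K (hT F) (hT F)" if g: "g \<in> G" for g
    proof (rule module_homI)
      fix \<alpha> \<beta> assume "\<alpha> \<in> carrier (hT F)" "\<beta> \<in> carrier (hT F)"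
      then have \<alpha>: "\<alpha> \<in> natP TF F" and \<beta>: "\<beta> \<in> natP TF F" by simp_all
      show "act (hT F) g (\<alpha> \<oplus>\<^bsub>hT F\<^esub> \<beta>) = act (hT F) g \<alpha> \<oplus>\<^bsub>hT F\<^esub> act (hT F) g \<beta>"
        unfolding hom_T_simps(3)
      proof (rule Vect_nat_eqI[OF an(1)[OF g cl(1)[OF \<alpha> \<beta>]] cl(1)[OF an(1)[OF g \<alpha>] an(1)[OF g \<beta>]]])
        fix V x assume V: "V \<in> Ob GamC" and "x \<in> carrier (omap TF V)"
        then have x: "x \<in> carrier (tp V)" and gx: "act (tp V) (iv g) x \<in> carrier (tp V)"
          using representation.act_closed[OF tp_rep G.inv_closed[OF g]] by (simp_all add: Gamma_simps)
        show "act (hT F) g (\<alpha> \<oplus>\<^bsub>Mor PolC TF F\<^esub> \<beta>) V x = (act (hT F) g \<alpha> \<oplus>\<^bsub>Mor PolC TF F\<^esub> act (hT F) g \<beta>) V x"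
          using x gx by (simp add: an(2)[OF g cl(1)[OF \<alpha> \<beta>] V x] an(2)[OF g \<alpha> V x] an(2)[OF g \<beta> V x] Pol_Mor_apply[OF V] del: hom_T_simps(5))
      qed
    next
      fix c \<alpha> assume c: "c \<in> carrier K" and "\<alpha> \<in> carrier (hT F)"
      then have \<alpha>: "\<alpha> \<in> natP TF F" by simp
      show "act (hT F) g (c \<odot>\<^bsub>hT F\<^esub> \<alpha>) = c \<odot>\<^bsub>hT F\<^esub> act (hT F) g \<alpha>"
        unfolding hom_T_simps(4)
      proof (rule Vect_nat_eqI[OF an(1)[OF g cl(2)[OF \<alpha> c]] cl(2)[OF an(1)[OF g \<alpha>] c]])
        fix V x assume V: "V \<in> Ob GamC" and "x \<in> carrier (omap TF V)"
        then have x: "x \<in> carrier (tp V)" and gx: "act (tp V) (iv g) x \<in> carrier (tp V)"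
          using representation.act_closed[OF tp_rep G.inv_closed[OF g]] by (simp_all add: Gamma_simps)
        show "act (hT F) g (c \<odot>\<^bsub>Mor PolC TF F\<^esub> \<alpha>) V x = (c \<odot>\<^bsub>Mor PolC TF F\<^esub> act (hT F) g \<alpha>) V x"
          using x gx by (simp add: an(2)[OF g cl(2)[OF \<alpha> c] V x] an(2)[OF g \<alpha> V x] Pol_Mor_apply[OF V] del: hom_T_simps(5))
      qed
    qed (use an(1)[OF g] in \<open>simp del: hom_T_simps(5)\<close>)
  next
    fix \<alpha> assume "\<alpha> \<in> carrier (hT F)"
    then have \<alpha>: "\<alpha> \<in> natP TF F" by simp
    show "act (hT F) \<one>\<^sub>G \<alpha> = \<alpha>"
      by (rule Vect_nat_eqI[OF an(1)[OF G.one_closed \<alpha>] \<alpha>])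
        (simp add: an(2)[OF G.one_closed \<alpha>] representation.act_one[OF tp_rep] Gamma_simps del: hom_T_simps(5))
  next
    fix g h \<alpha> assume g: "g \<in> G" and h: "h \<in> G" and "\<alpha> \<in> carrier (hT F)"
    then have \<alpha>: "\<alpha> \<in> natP TF F" by simp
    have gh: "g \<cdot> h \<in> G" using g h by simp
    show "act (hT F) (g \<cdot> h) \<alpha> = act (hT F) g (act (hT F) h \<alpha>)"
    proof (rule Vect_nat_eqI[OF an(1)[OF gh \<alpha>] an(1)[OF g an(1)[OF h \<alpha>]]])
      fix V x assume V: "V \<in> Ob GamC" and "x \<in> carrier (omap TF V)"
      then have x: "x \<in> carrier (tp V)" and gx: "act (tp V) (iv g) x \<in> carrier (tp V)"
        and t: "R (tp V)"
        using representation.act_closed[OF tp_rep G.inv_closed[OF g]] by (simp_all add: Gamma_simps)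
      show "act (hT F) (g \<cdot> h) \<alpha> V x = act (hT F) g (act (hT F) h \<alpha>) V x"
        using representation.act_mult[OF t G.inv_closed[OF h] G.inv_closed[OF g] x] G.inv_mult_group[OF g h]
        by (simp add: an(2)[OF gh \<alpha> V x] an(2)[OF g an(1)[OF h \<alpha>] V x] an(2)[OF h \<alpha> V gx] del: hom_T_simps(5))
    qed
  qed
qed

lemma c_upper_star_simps [simp]:
  "omap cu F = copy_rep (hT F)"
  "mmap cu F F' \<beta> = copy_map (hT F) (hT F') (\<lambda>\<alpha>. Cmp PolC TF F F' \<beta> \<alpha>)"
  by (simp_all add: c_upper_star_def)

lemma cu_apply: "\<lbrakk>F \<in> Ob PolC; \<alpha> \<in> carrier (hT F)\<rbrakk> \<Longrightarrow>
    mmap cu F F' \<beta> (enc (carrier (hT F)) \<alpha>) = (enc (carrier (hT F')) (Cmp PolC TF F F' \<beta> \<alpha>) :: 'v)"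
  unfolding c_upper_star_simps by (rule copy_map_enc[OF representation.fdvs[OF hom_T_representation]])

lemma T_Cmp_apply: "\<lbrakk>V \<in> Ob GamC; x \<in> carrier (tp V)\<rbrakk> \<Longrightarrow> Cmp PolC TF F F' \<beta> \<alpha> V x = \<beta> V (\<alpha> V x)"
  by (rule Pol_Cmp_apply) simp_all

lemma c_upper_star_functor: "is_functor K PolC RepC cu"
proof (intro is_functor.intro is_functor_axioms.intro lincategory_PolC lincategory_RepC)
  fix F assume F: "F \<in> Ob PolC"
  note fd = representation.fdvs[OF hom_T_representation[OF F]]
  show "omap cu F \<in> Ob RepC" by (simp add: Rep_simps copy_rep_representation hom_T_representation F)
  show "mmap cu F F (Id PolC F) = Id RepC (omap cu F)"
  proof (rule extensionalityI[of _ "carrier (copy_vs (hT F))"])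
    fix a assume "a \<in> carrier (copy_vs (hT F) :: ('k, 'v) module)"
    then show "mmap cu F F (Id PolC F) a = Id RepC (omap cu F) a"
    proof (rule copy_carrierE)
      fix \<alpha> assume \<alpha>: "\<alpha> \<in> carrier (hT F)" and a: "a = enc (carrier (hT F)) \<alpha>"
      have "Cmp PolC TF F F (Id PolC F) \<alpha> = \<alpha>"
        using lincategory.Id_left[OF lincategory_PolC T_functor_Ob F, of \<alpha>] \<alpha> by (simp add: Pol_simps(4))
      then show ?thesis unfolding a cu_apply[OF F \<alpha>] using enc_in[OF \<alpha>] by (simp add: Rep_simps del: hom_T_simps)
    qed
  qed (simp_all add: Rep_simps)
next
  fix F F' \<beta> assume F: "F \<in> Ob PolC" and F': "F' \<in> Ob PolC" and \<beta>: "\<beta> \<in> arr PolC F F'"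
  have \<beta>n: "\<beta> \<in> natP F F'" using \<beta> by (simp add: Pol_simps)
  show "mmap cu F F' \<beta> \<in> arr RepC (omap cu F) (omap cu F')"
    unfolding c_upper_star_simps Rep_simps
  proof (rule copy_map_rep_hom[OF hom_T_representation[OF F] hom_T_representation[OF F']])
    show "(\<lambda>\<alpha>. Cmp PolC TF F F' \<beta> \<alpha>) \<in> module_hom K (hT F) (hT F')"
      using lincategory.Cmp_linear_left[OF lincategory_PolC T_functor_Ob F F' \<beta>]
      by (simp add: module_hom_def Pol_simps(4))
    fix g \<alpha> assume g: "g \<in> G" and "\<alpha> \<in> carrier (hT F)"
    then have \<alpha>: "\<alpha> \<in> natP TF F" by simp
    note \<beta>\<alpha> = Pol_Cmp_nat[OF T_functor_Ob F F' \<alpha> \<beta>n]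
    show "Cmp PolC TF F F' \<beta> (act (hT F) g \<alpha>) = act (hT F') g (Cmp PolC TF F F' \<beta> \<alpha>)"
    proof (rule Vect_nat_eqI[OF Pol_Cmp_nat[OF T_functor_Ob F F' hom_T_act_nat(1)[OF F g \<alpha>] \<beta>n] hom_T_act_nat(1)[OF F' g \<beta>\<alpha>]])
      fix V x assume V: "V \<in> Ob GamC" and "x \<in> carrier (omap TF V)"
      then have x: "x \<in> carrier (tp V)" and gx: "act (tp V) (iv g) x \<in> carrier (tp V)"
        using representation.act_closed[OF tp_rep G.inv_closed[OF g]] by (simp_all add: Gamma_simps)
      show "Cmp PolC TF F F' \<beta> (act (hT F) g \<alpha>) V x = act (hT F') g (Cmp PolC TF F F' \<beta> \<alpha>) V x"
        by (simp only: T_Cmp_apply[OF V x] T_Cmp_apply[OF V gx] hom_T_act_nat(2)[OF F g \<alpha> V x] hom_T_act_nat(2)[OF F' g \<beta>\<alpha> V x])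
    qed
  qed
next
  fix F F' F'' \<beta> \<gamma> assume F: "F \<in> Ob PolC" and F': "F' \<in> Ob PolC" and F'': "F'' \<in> Ob PolC"
    and \<beta>: "\<beta> \<in> arr PolC F F'" and \<gamma>: "\<gamma> \<in> arr PolC F' F''"
  show "mmap cu F F'' (Cmp PolC F F' F'' \<gamma> \<beta>) = Cmp RepC (omap cu F) (omap cu F') (omap cu F'') (mmap cu F' F'' \<gamma>) (mmap cu F F' \<beta>)"
  proof (rule extensionalityI[of _ "carrier (copy_vs (hT F))"])
    fix a assume aF: "a \<in> carrier (copy_vs (hT F) :: ('k, 'v) module)"
    then show "mmap cu F F'' (Cmp PolC F F' F'' \<gamma> \<beta>) a =
      Cmp RepC (omap cu F) (omap cu F') (omap cu F'') (mmap cu F' F'' \<gamma>) (mmap cu F F' \<beta>) a"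
    proof (rule copy_carrierE)
      fix \<alpha> assume \<alpha>: "\<alpha> \<in> carrier (hT F)" and a: "a = enc (carrier (hT F)) \<alpha>"
      then have \<alpha>': "\<alpha> \<in> arr PolC TF F" by (simp add: Pol_simps(4))
      have \<beta>\<alpha>: "Cmp PolC TF F F' \<beta> \<alpha> \<in> carrier (hT F')"
        using lincategory.Cmp_arr[OF lincategory_PolC T_functor_Ob F F' \<alpha>' \<beta>] by (simp add: Pol_simps(4))
      have "Cmp RepC (omap cu F) (omap cu F') (omap cu F'') (mmap cu F' F'' \<gamma>) (mmap cu F F' \<beta>) a =
          mmap cu F' F'' \<gamma> (mmap cu F F' \<beta> a)"
        using aF by (simp add: Rep_simps compose_eq)
      also have "\<dots> = enc (carrier (hT F'')) (Cmp PolC TF F' F'' \<gamma> (Cmp PolC TF F F' \<beta> \<alpha>))"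
        unfolding a cu_apply[OF F \<alpha>] cu_apply[OF F' \<beta>\<alpha>] ..
      also have "\<dots> = mmap cu F F'' (Cmp PolC F F' F'' \<gamma> \<beta>) a"
        unfolding a cu_apply[OF F \<alpha>] lincategory.Cmp_assoc[OF lincategory_PolC T_functor_Ob F F' F'' \<alpha>' \<beta> \<gamma>] ..
      finally show ?thesis by (rule sym)
    qed
  qed (simp_all add: Rep_simps)
qed

subsection \<open>Evaluation at the group algebra\<close>

definition ev_nat :: "('k, 'v) rep_functor \<Rightarrow> 'v \<Rightarrow> ('k, 'v) poly_nat" where
  "ev_nat F y = (\<lambda>V\<in>Ob GamC. \<lambda>x\<in>carrier (tp V). mmap F A (tp V) (orb (tp V) x) y)"

lemma ev_nat_apply: "\<lbrakk>fdvs K V; x \<in> carrier (tp V)\<rbrakk> \<Longrightarrow> ev_nat F y V x = mmap F A (tp V) (orb (tp V) x) y"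
  by (simp add: ev_nat_def Gamma_simps)

lemma ev_nat_in:
  assumes F: "lin_fun F" and y: "y \<in> carrier (omap F A)"
  shows "ev_nat F y \<in> natP TF (jo F)"
proof -
  note Fs = Vect_functor[OF F, unfolded Rep_simps mem_Collect_eq]
  note RA = group_alg_representation
  show ?thesis
  proof (rule Vect_natI)
    fix V assume VO: "V \<in> Ob GamC"
    then have V: "fdvs K V" by (simp add: Gamma_simps)
    note t = tp_rep[OF V]
    interpret t: representation n K "tp V" by (rule t)
    note o = orb_arr[OF t]
    have "ev_nat F y V \<in> module_hom K (tp V) (omap F (tp V))"
      by (rule module_homI) (simp_all add: ev_nat_apply[OF V] orb_add[OF t] orb_smult[OF t] Fs(6)[OF RA t o o y] Fs(7)[OF RA t o _ y]
        module_hom_in[OF Fs(2)[OF RA t o] y] del: rep_hom_simps)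
    then show "ev_nat F y V \<in> module_hom K (omap TF V) (omap (jo F) V)" by simp
    show "ev_nat F y V \<in> extensional (carrier (omap TF V))" using VO by (simp add: ev_nat_def)
  next
    fix V W u x assume "V \<in> Ob GamC" "W \<in> Ob GamC" "u \<in> arr GamC V W" "x \<in> carrier (omap TF V)"
    then have V: "fdvs K V" and W: "fdvs K W" and u: "u \<in> Hom (tp V) (tp W)" and x: "x \<in> carrier (tp V)"
      by (simp_all add: Gamma_simps)
    show "ev_nat F y W (mmap TF V W u x) = mmap (jo F) V W u (ev_nat F y V x)"
      using Fs(5)[OF RA tp_rep[OF V] tp_rep[OF W] orb_arr[OF tp_rep[OF V] x] u y]
      by (simp add: ev_nat_apply[OF V x] ev_nat_apply[OF W rep_hom_in[OF u x]] orb_post[OF tp_rep[OF V] tp_rep[OF W] x u])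
  qed (simp add: ev_nat_def)
qed

lemma ev_nat_hom:
  assumes F: "lin_fun F"
  shows "ev_nat F \<in> module_hom K (omap F A) (hT (jo F))"
proof (rule module_homI)
  note Fs = Vect_functor[OF F, unfolded Rep_simps mem_Collect_eq]
  note RA = group_alg_representation
  have JO: "jo F \<in> Ob PolC" by (simp add: Pol_simps jo_linear[OF F])
  interpret FA: vectorspace K "omap F A" using Fs(1)[OF RA] by (rule fdvs_vs)
  note cl = Pol_Mor_closed[OF T_functor_Ob JO]
  show "ev_nat F y \<in> carrier (hT (jo F))" if "y \<in> carrier (omap F A)" for y using ev_nat_in[OF F that] by simp
  show "ev_nat F (y \<oplus>\<^bsub>omap F A\<^esub> z) = ev_nat F y \<oplus>\<^bsub>hT (jo F)\<^esub> ev_nat F z"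
    if y: "y \<in> carrier (omap F A)" and z: "z \<in> carrier (omap F A)" for y z
    unfolding hom_T_simps(3)
  proof (rule Vect_nat_eqI[OF ev_nat_in[OF F] cl(1)[OF ev_nat_in[OF F y] ev_nat_in[OF F z]]])
    fix V x assume VO: "V \<in> Ob GamC" and x: "x \<in> carrier (omap TF V)"
    then have V: "fdvs K V" and x': "x \<in> carrier (tp V)" by (simp_all add: Gamma_simps)
    show "ev_nat F (y \<oplus>\<^bsub>omap F A\<^esub> z) V x = (ev_nat F y \<oplus>\<^bsub>Mor PolC TF (jo F)\<^esub> ev_nat F z) V x"
      using module_hom_add[OF Fs(2)[OF RA tp_rep[OF V] orb_arr[OF tp_rep[OF V] x']] y z]
      by (simp add: Pol_Mor_apply[OF VO x] ev_nat_apply[OF V x'])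
  qed (use y z in simp)
  show "ev_nat F (c \<odot>\<^bsub>omap F A\<^esub> y) = c \<odot>\<^bsub>hT (jo F)\<^esub> ev_nat F y"
    if c: "c \<in> carrier K" and y: "y \<in> carrier (omap F A)" for c y
    unfolding hom_T_simps(4)
  proof (rule Vect_nat_eqI[OF ev_nat_in[OF F] cl(2)[OF ev_nat_in[OF F y] c]])
    fix V x assume VO: "V \<in> Ob GamC" and x: "x \<in> carrier (omap TF V)"
    then have V: "fdvs K V" and x': "x \<in> carrier (tp V)" by (simp_all add: Gamma_simps)
    show "ev_nat F (c \<odot>\<^bsub>omap F A\<^esub> y) V x = (c \<odot>\<^bsub>Mor PolC TF (jo F)\<^esub> ev_nat F y) V x"
      using module_hom_smult[OF Fs(2)[OF RA tp_rep[OF V] orb_arr[OF tp_rep[OF V] x']] c y]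
      by (simp add: Pol_Mor_apply[OF VO x] ev_nat_apply[OF V x'])
  qed (use c y in simp)
qed

text \<open>The group acts on f(K[S_n]) through right multiplication by g^-1 and on transformations
  through the place permutation of g^-1. By \<open>orb_aut\<close> both amount to replacing the
  vector x in \<open>orb\<close> by g^-1 x.\<close>

lemma ev_nat_act:
  assumes F: "lin_fun F" and g: "g \<in> G" and y: "y \<in> carrier (omap F A)"
  shows "ev_nat F (mmap F A A (group_alg_aut n K g) y) = act (hT (jo F)) g (ev_nat F y)"
proof -
  note Fs = Vect_functor[OF F, unfolded Rep_simps mem_Collect_eq]
  note RA = group_alg_representation
  note aut = group_alg_aut_arr[OF g]
  have JO: "jo F \<in> Ob PolC" by (simp add: Pol_simps jo_linear[OF F])
  show ?thesis
  proof (rule Vect_nat_eqI[OF ev_nat_in[OF F module_hom_in[OF Fs(2)[OF RA RA aut] y]] hom_T_act_nat(1)[OF JO g ev_nat_in[OF F y]]])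
    fix V x assume VO: "V \<in> Ob GamC" and "x \<in> carrier (omap TF V)"
    then have V: "fdvs K V" and x: "x \<in> carrier (tp V)" by (simp_all add: Gamma_simps)
    note t = tp_rep[OF V]
    have gx: "act (tp V) (iv g) x \<in> carrier (tp V)"
      by (rule representation.act_closed[OF t G.inv_closed[OF g] x])
    show "ev_nat F (mmap F A A (group_alg_aut n K g) y) V x = act (hT (jo F)) g (ev_nat F y) V x"
      unfolding hom_T_act_nat(2)[OF JO g ev_nat_in[OF F y] VO x] ev_nat_apply[OF V x] ev_nat_apply[OF V gx]
        orb_aut[OF t x g, symmetric]
      by (rule Fs(5)[OF RA RA t aut orb_arr[OF t x] y, symmetric])
  qed
qed

text \<open>With r the map from T to the group algebra taking \<tau> to the unit, the inverse sends
  \<alpha> to f(r) applied to the value of \<alpha> at \<tau>. One composite is the identity since r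
  retracts the orbit map of \<tau>; for the other, \<alpha> is natural along r followed by the orbit
  map of x, a map between tensor powers.\<close>

lemma ev_nat_bij:
  assumes F: "lin_fun F"
  shows "bij_betw (ev_nat F) (carrier (omap F A)) (carrier (hT (jo F)))"
proof -
  note Fs = Vect_functor[OF F, unfolded Rep_simps mem_Collect_eq]
  note RA = group_alg_representation
  define r where "r = pt A unit"
  have r: "r \<in> Hom T A" and r\<tau>: "r \<tau> = unit"
    using pt_arr[OF RA unit(1)] pt_\<tau>[OF RA unit(1)] by (simp_all add: r_def)
  show ?thesis
  proof (rule bij_betw_byWitness[where f' = "\<lambda>\<alpha>. mmap F T A r (\<alpha> E \<tau>)"])
    show "\<forall>y\<in>carrier (omap F A). mmap F T A r (ev_nat F y E \<tau>) = y"
    proof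
      fix y assume y: "y \<in> carrier (omap F A)"
      note o = orb_arr[OF RT \<tau>]
      have "compose (carrier A) r (orb T \<tau>) = (\<lambda>a\<in>carrier A. a)"
        using orb_post[OF RT RA \<tau> r] by (simp add: r\<tau> orb_A_unit)
      then show "mmap F T A r (ev_nat F y E \<tau>) = y"
        using Fs(5)[OF RA RT RA o r y] Fs(4)[OF RA y] by (simp add: ev_nat_apply[OF E \<tau>])
    qed
    show "\<forall>\<alpha>\<in>carrier (hT (jo F)). ev_nat F (mmap F T A r (\<alpha> E \<tau>)) = \<alpha>"
    proof
      fix \<alpha> assume "\<alpha> \<in> carrier (hT (jo F))"
      then have \<alpha>: "\<alpha> \<in> natP TF (jo F)" by simp
      have \<alpha>E: "\<alpha> E \<tau> \<in> carrier (omap F T)"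
        using module_hom_in[OF Vect_nat(1)[OF \<alpha>, of E], of \<tau>] E \<tau> by (simp add: Gamma_simps)
      note y = module_hom_in[OF Fs(2)[OF RT RA r] \<alpha>E]
      show "ev_nat F (mmap F T A r (\<alpha> E \<tau>)) = \<alpha>"
      proof (rule Vect_nat_eqI[OF ev_nat_in[OF F y] \<alpha>])
        fix V x assume "V \<in> Ob GamC" "x \<in> carrier (omap TF V)"
        then have V: "fdvs K V" and x: "x \<in> carrier (tp V)" by (simp_all add: Gamma_simps)
        note t = tp_rep[OF V] and o = orb_arr[OF tp_rep[OF V] x]
        have "ev_nat F (mmap F T A r (\<alpha> E \<tau>)) V x = mmap F T (tp V) (compose (carrier T) (orb (tp V) x) r) (\<alpha> E \<tau>)"
          unfolding ev_nat_apply[OF V x] by (rule Fs(5)[OF RT RA t r o \<alpha>E, symmetric])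
        also have "\<dots> = \<alpha> V (compose (carrier T) (orb (tp V) x) r \<tau>)"
          using Vect_nat(3)[OF \<alpha>, of E V "compose (carrier T) (orb (tp V) x) r" \<tau>] rep_hom_compose[OF RT r o] V E \<tau>
          by (simp add: Gamma_simps)
        also have "\<dots> = \<alpha> V x" using \<tau> by (simp add: compose_eq r\<tau> orb_unit[OF t x])
        finally show "ev_nat F (mmap F T A r (\<alpha> E \<tau>)) V x = \<alpha> V x" .
      qed
    qed
    show "ev_nat F ` carrier (omap F A) \<subseteq> carrier (hT (jo F))" using ev_nat_in[OF F] by auto
    show "(\<lambda>\<alpha>. mmap F T A r (\<alpha> E \<tau>)) ` carrier (hT (jo F)) \<subseteq> carrier (omap F A)"
    proof (rule image_subsetI)
      fix \<alpha> assume "\<alpha> \<in> carrier (hT (jo F))"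
      then have \<alpha>: "\<alpha> \<in> natP TF (jo F)" by simp
      have "\<alpha> E \<tau> \<in> carrier (omap F T)"
        using module_hom_in[OF Vect_nat(1)[OF \<alpha>, of E], of \<tau>] E \<tau> by (simp add: Gamma_simps)
      then show "mmap F T A r (\<alpha> E \<tau>) \<in> carrier (omap F A)" by (rule module_hom_in[OF Fs(2)[OF RT RA r]])
    qed
  qed
qed

text \<open>Built in the direction from t^* to the composite of j^* and c^*, where
  \<open>ev_nat\<close> gives a formula, and reversed by symmetry.\<close>

lemma c_j_upper_star: "naturally_isomorphic K CohC RepC (cmp_fctr cu ju) tu"
proof (rule naturally_isomorphic_sym)
  note cj = cmp_fctr_functor[OF j_functor c_upper_star_functor]
  have AO: "A \<in> Ob RepC" using group_alg_representation by (simp add: Rep_simps)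
  define \<theta> where "\<theta> = (\<lambda>F\<in>Ob CohC. \<lambda>y\<in>carrier (omap F A). enc (carrier (hT (jo F))) (ev_nat F y) :: 'v)"
  have \<theta>: "\<theta> F y = enc (carrier (hT (jo F))) (ev_nat F y)" if "F \<in> Ob CohC" "y \<in> carrier (omap F A)" for F y
    using that by (simp add: \<theta>_def)
  have iso: "is_iso RepC (omap tu F) (omap cu (jo F)) (\<theta> F)" if FO: "F \<in> Ob CohC" for F
  proof -
    have F: "lin_fun F" using FO by (simp add: Coh_simps coherent_linear)
    have JO: "jo F \<in> Ob PolC" by (simp add: Pol_simps jo_linear[OF F])
    note H = hom_T_representation[OF JO] and tF = t_upper_star_representation[OF F]
    interpret H: representation n K "hT (jo F)" by (rule H)
    interpret tF: representation n K "omap tu F" by (rule tF)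
    have FA: "module K (omap F A)" using fdvs_vs[OF Vect_functor(1)[OF F AO]] by blast
    have hom: "\<theta> F \<in> module_hom K (omap F A) (copy_vs (hT (jo F)))"
      by (rule module_hom_cong[OF FA \<theta>[OF FO] module_hom_comp[OF ev_nat_hom[OF F] enc_hom[OF H.fdvs]]])
    show ?thesis
    proof (rule Rep_isoI[OF tF])
      show "R (omap cu (jo F))" by (simp add: copy_rep_representation[OF H])
      have "\<theta> F (mmap F A A (group_alg_aut n K g) y) = act (copy_rep (hT (jo F))) g (\<theta> F y)"
        if g: "g \<in> G" and y: "y \<in> carrier (omap F A)" for g y
      proof -
        have gy: "mmap F A A (group_alg_aut n K g) y \<in> carrier (omap F A)" using tF.act_closed[OF g, of y] y by simp
        have e: "ev_nat F y \<in> carrier (hT (jo F))" using ev_nat_in[OF F y] by simp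
        show ?thesis unfolding \<theta>[OF FO y] \<theta>[OF FO gy] enc_act[OF H g e] ev_nat_act[OF F g y] ..
      qed
      then show "\<theta> F \<in> Hom (omap tu F) (omap cu (jo F))"
        using hom FO by (auto simp: rep_hom_carrier \<theta>_def module_hom_def)
      have "bij_betw (enc (carrier (hT (jo F))) \<circ> ev_nat F) (carrier (omap F A)) (carrier (copy_vs (hT (jo F)) :: ('k, 'v) module))"
        by (rule bij_betw_trans[OF ev_nat_bij[OF F] enc_bij[OF H.fdvs]])
      then have "bij_betw (\<theta> F) (carrier (omap F A)) (carrier (copy_vs (hT (jo F)) :: ('k, 'v) module))"
        by (rule bij_betw_cong[THEN iffD1, rotated]) (simp add: \<theta>[OF FO])
      then show "bij_betw (\<theta> F) (carrier (omap tu F)) (carrier (omap cu (jo F)))" by simp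
    qed
  qed
  have nat: "\<theta> \<in> nat_trans CohC RepC tu (cmp_fctr cu ju)"
  proof (rule nat_transI)
    show "\<theta> F \<in> arr RepC (omap tu F) (omap (cmp_fctr cu ju) F)" if "F \<in> Ob CohC" for F
      using iso[OF that] by (simp add: is_iso_def)
    show "\<theta> \<in> extensional (Ob CohC)" by (simp add: \<theta>_def)
    fix F F' \<alpha> assume FO: "F \<in> Ob CohC" and FO': "F' \<in> Ob CohC" and \<alpha>: "\<alpha> \<in> arr CohC F F'"
    then have F: "lin_fun F" and F': "lin_fun F'" and \<alpha>n: "\<alpha> \<in> natR F F'"
      by (simp_all add: Coh_simps coherent_linear)
    have JO: "jo F \<in> Ob PolC" "jo F' \<in> Ob PolC" by (simp_all add: Pol_simps jo_linear F F')
    let ?j\<alpha> = "mmap ju F F' \<alpha>"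
    have "\<theta> F' (\<alpha> A y) = mmap cu (jo F) (jo F') ?j\<alpha> (\<theta> F y)" if y: "y \<in> carrier (omap F A)" for y
    proof -
      have \<alpha>y: "\<alpha> A y \<in> carrier (omap F' A)" by (rule module_hom_in[OF Vect_nat(1)[OF \<alpha>n AO] y])
      have e: "ev_nat F y \<in> carrier (hT (jo F))" using ev_nat_in[OF F y] by simp
      have "ev_nat F' (\<alpha> A y) = Cmp PolC TF (jo F) (jo F') ?j\<alpha> (ev_nat F y)"
      proof (rule Vect_nat_eqI[OF ev_nat_in[OF F' \<alpha>y] Pol_Cmp_nat[OF T_functor_Ob JO ev_nat_in[OF F y] jo_nat[OF \<alpha>n]]])
        fix V x assume VO: "V \<in> Ob GamC" and "x \<in> carrier (omap TF V)"
        then have V: "fdvs K V" and x: "x \<in> carrier (tp V)" by (simp_all add: Gamma_simps)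
        show "ev_nat F' (\<alpha> A y) V x = Cmp PolC TF (jo F) (jo F') ?j\<alpha> (ev_nat F y) V x"
          unfolding T_Cmp_apply[OF VO x] ev_nat_apply[OF V x]
          using Vect_nat(3)[OF \<alpha>n AO, of "tp V" "orb (tp V) x" y] orb_arr[OF tp_rep[OF V] x] y V VO
          by (simp add: Rep_simps jm)
      qed
      then show ?thesis unfolding \<theta>[OF FO y] \<theta>[OF FO' \<alpha>y] cu_apply[OF JO(1) e] by simp
    qed
    then have "compose (carrier (omap F A)) (\<theta> F') (\<alpha> A) = compose (carrier (omap F A)) (mmap cu (jo F) (jo F') ?j\<alpha>) (\<theta> F)"
      by (auto simp: compose_def intro!: restrict_ext)
    then show "Cmp RepC (omap tu F) (omap tu F') (omap (cmp_fctr cu ju) F')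
        (\<theta> F') (mmap tu F F' \<alpha>) =
      Cmp RepC (omap tu F) (omap (cmp_fctr cu ju) F) (omap (cmp_fctr cu ju) F')
        (mmap (cmp_fctr cu ju) F F' \<alpha>) (\<theta> F)"
      by (simp add: Rep_simps del: c_upper_star_simps)
  qed
  show "naturally_isomorphic K CohC RepC tu (cmp_fctr cu ju)"
    unfolding naturally_isomorphic_def cmp_fctr_simps using t_upper_star_functor cj nat iso by blast
qed

end

section \<open>Inclusions\<close>

lemma incl_simps [simp]: "omap incl X = X" "mmap incl X Y f = f"
  by (simp_all add: incl_def)

lemma cmp_fctr_incl [simp]: "cmp_fctr incl F = F" "cmp_fctr F incl = F"
  by (simp_all add: cmp_fctr_def incl_def)

lemma incl_functor: "lincategory K C \<Longrightarrow> is_functor K C C incl"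
  by (simp add: is_functor_def is_functor_axioms_def)

lemma naturally_isomorphic_refl:
  assumes F: "is_functor K C D F"
  shows "naturally_isomorphic K C D F F"
proof -
  interpret F: is_functor K C D F by (rule F)
  have "(\<lambda>X\<in>Ob C. Id D (omap F X)) \<in> nat_trans C D F F"
    by (rule nat_transI) (auto simp: F.target.Id_arr F.omap_Ob F.target.Id_left F.target.Id_right F.mmap_arr)
  moreover have "is_iso D (omap F X) (omap F X) (Id D (omap F X))" if "X \<in> Ob C" for X
    unfolding is_iso_def using F.target.Id_arr[OF F.omap_Ob[OF that]] F.target.Id_left[OF F.omap_Ob[OF that] F.omap_Ob[OF that]] by blast
  ultimately show ?thesis
    unfolding naturally_isomorphic_def using F by (intro conjI bexI[of _ "\<lambda>X\<in>Ob C. Id D (omap F X)"]) auto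
qed

section \<open>Assembling the triangles and the inclusions\<close>

context special
begin

lemma j_lower_star_triangle:
  assumes adj: "adjoint_functors K CohC PolC ju j_lower_star"
  shows "triangle_commutes K RepC PolC CohC cs j_lower_star tl"
proof -
  have "naturally_isomorphic K RepC CohC (cmp_fctr j_lower_star cs) tl"
    by (rule right_adjoint_triangle[OF adj c_lower_star_functor t_lower_star_functor j_t_lower_star])
      (simp add: Coh_simps Pol_simps(4) Rep_simps h_restrict_bij coherent_linear dual_representation)
  then show ?thesis
    using adj c_lower_star_functor by (simp add: triangle_commutes_def adjoint_functors_def)
qed

lemma j_lower_shriek_triangle:
  assumes adj: "adjoint_functors K PolC CohC j_lower_shriek ju"
  shows "triangle_commutes K RepC PolC CohC (c_lower_shriek n K) j_lower_shriek tsh"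
proof -
  have "naturally_isomorphic K RepC CohC (cmp_fctr j_lower_shriek (c_lower_shriek n K)) tsh"
    unfolding c_lower_shriek_eq
    by (rule left_adjoint_triangle[OF adj t_lower_shriek_functor])
      (simp add: Coh_simps Pol_simps(4) Rep_simps t_lower_shriek_def t_restrict_bij coherent_linear)
  then show ?thesis
    using adj cmp_fctr_functor[OF t_lower_shriek_functor j_functor]
    by (simp add: triangle_commutes_def adjoint_functors_def c_lower_shriek_eq)
qed

text \<open>Hom(T^n, j^* f) is in bijection with f(K[S_n]), which is a single point, and a vector
  space with one point is zero.\<close>

lemma j_Coh0_Pol0: "is_functor K (Coh0 n K) (Pol0 n K) (ju :: (('k, 'v) rep_functor, ('k, 'v) rep_nat, _, _) fctr)"
  unfolding Coh0_def Pol0_def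
proof (rule full_subcat_functor[OF j_functor])
  fix F :: "('k, 'v) rep_functor"
  assume FO: "F \<in> Ob CohC" and z: "carrier (omap tu F) = {\<zero>\<^bsub>omap tu F\<^esub>}"
  have F: "lin_fun F" using FO by (simp add: Coh_simps coherent_linear)
  have JO: "jo F \<in> Ob PolC" by (simp add: Pol_simps jo_linear[OF F])
  interpret H: representation n K "hT (jo F)" by (rule hom_T_representation[OF JO])
  interpret C: vectorspace K "copy_vs (hT (jo F)) :: ('k, 'v) module" by (rule fdvs_vs[OF copy_vs_fdvs[OF H.fdvs]])
  have "bij_betw (enc (carrier (hT (jo F))) \<circ> ev_nat F) (carrier (omap F A)) (carrier (copy_vs (hT (jo F)) :: ('k, 'v) module))"
    by (rule bij_betw_trans[OF ev_nat_bij[OF F] enc_bij[OF H.fdvs]])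
  with z have "\<exists>a. carrier (copy_vs (hT (jo F)) :: ('k, 'v) module) = {a}"
    by (auto simp: bij_betw_def)
  with C.M.zero_closed show "carrier (omap cu (jo F)) = {\<zero>\<^bsub>omap cu (jo F)\<^esub>}"
    unfolding c_upper_star_simps copy_rep_simps by fastforce
qed

end

text \<open>The adjoints are quantified because adjointness determines them only up to isomorphism;
  the two triangles are asserted for every functor adjoint to j^* on the relevant side. The last
  conjunct is the square formed by j^* , its restriction and the two inclusions.\<close>

theorem proposition3p2p16:
  fixes K :: "('k, 'z) ring_scheme" and n :: nat and e :: "'k list \<Rightarrow> 'v"
  assumes "field K" and "\<exists>p::nat. p > 0 \<and> [p] \<cdot>\<^bsub>K\<^esub> \<one>\<^bsub>K\<^esub> = \<zero>\<^bsub>K\<^esub>"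
    and universe: "inj e"
    and "n > 0"
  shows
    "(\<forall>j_lower_star :: (('k, 'v) poly_functor, ('k, 'v) poly_nat,
          ('k, 'v) rep_functor, ('k, 'v) rep_nat) fctr.
        adjoint_functors K (Coh n K) (Pol n K) (j_upper_star n K) j_lower_star \<longrightarrow>
        triangle_commutes K (Rep n K) (Pol n K) (Coh n K)
          (c_lower_star n K) j_lower_star (t_lower_star n K)) \<and>
     (\<forall>j_lower_shriek :: (('k, 'v) poly_functor, ('k, 'v) poly_nat,
          ('k, 'v) rep_functor, ('k, 'v) rep_nat) fctr.
        adjoint_functors K (Pol n K) (Coh n K) j_lower_shriek (j_upper_star n K) \<longrightarrow>
        triangle_commutes K (Rep n K) (Pol n K) (Coh n K)
          (c_lower_shriek n K) j_lower_shriek (t_lower_shriek n K)) \<and>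
     triangle_commutes K (Coh n K :: ('k, ('k, 'v) rep_functor, ('k, 'v) rep_nat) lincat)
       (Pol n K) (Rep n K) (j_upper_star n K) (c_upper_star n K) (t_upper_star n K) \<and>
     Ob (CohY n K :: ('k, ('k, 'v) rep_functor, ('k, 'v) rep_nat) lincat) \<subseteq> Ob (Coh0 n K) \<and>
     triangle_commutes K (CohY n K :: ('k, ('k, 'v) rep_functor, ('k, 'v) rep_nat) lincat)
       (Coh0 n K) (Coh n K) incl incl incl \<and>
     is_functor K (Coh0 n K :: ('k, ('k, 'v) rep_functor, ('k, 'v) rep_nat) lincat)
       (Pol0 n K) (j_upper_star n K) \<and>
     is_functor K (Pol0 n K :: ('k, ('k, 'v) poly_functor, ('k, 'v) poly_nat) lincat)
       (Pol n K) incl \<and>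
     is_functor K (Coh0 n K :: ('k, ('k, 'v) rep_functor, ('k, 'v) rep_nat) lincat)
       (Coh n K) incl \<and>
     naturally_isomorphic K (Coh0 n K :: ('k, ('k, 'v) rep_functor, ('k, 'v) rep_nat) lincat)
       (Pol n K) (cmp_fctr incl (j_upper_star n K)) (cmp_fctr (j_upper_star n K) incl)"
proof -
  interpret coherent_setup K e n
    using assms by (simp add: coherent_setup_def universe_def universe_axioms_def coherent_setup_axioms_def)
  \<comment> \<open>The data of K^n are fixed here; the triangles and inclusions are statements of
    the locale \<open>special\<close> that do not mention them.\<close>
  obtain E \<tau> w where "fdvs K (E :: ('k, 'v) module)" "\<tau> \<in> carrier (tp E)" "w \<in> functionals K (tp E)"
    "\<And>g. g \<in> G \<Longrightarrow> w (act (tp E) g \<tau>) = (if g = \<one>\<^bsub>sym_group n\<^esub> then \<one>\<^bsub>K\<^esub> else \<zero>\<^bsub>K\<^esub>)"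
    using special_vector by blast
  then interpret special K e n E \<tau> w by unfold_locales
  \<comment> \<open>A category is its own full subcategory for the predicate True, so inclusions are
    instances of restricting a functor to full subcategories.\<close>
  have Coh0: "is_functor K (Coh0 n K) CohC incl"
    unfolding Coh0_def using full_subcat_functor[OF incl_functor[OF lincategory_CohC], where Q = "\<lambda>_. True"] by simp
  have CohY: "is_functor K (CohY n K) CohC incl"
    unfolding CohY_def using full_subcat_functor[OF incl_functor[OF lincategory_CohC], where Q = "\<lambda>_. True"] by simp
  have Pol0: "is_functor K (Pol0 n K) PolC incl"
    unfolding Pol0_def using full_subcat_functor[OF incl_functor[OF lincategory_PolC], where Q = "\<lambda>_. True"] by simp
  have Y0: "is_functor K (CohY n K) (Coh0 n K) (incl :: (('k, 'v) rep_functor, ('k, 'v) rep_nat, _, _) fctr)"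
    using CohY_subset_Coh0 unfolding CohY_def Coh0_def
    by (intro full_subcat_functor[OF incl_functor[OF lincategory_CohC]]) (auto simp del: t_upper_star_simps)
  show ?thesis
    using j_lower_star_triangle j_lower_shriek_triangle c_j_upper_star j_functor c_upper_star_functor
      CohY_subset_Coh0 Y0 Coh0 CohY Pol0 j_Coh0_Pol0 cmp_fctr_functor[OF Coh0 j_functor]
    by (auto simp: triangle_commutes_def naturally_isomorphic_refl)
qed

end
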